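(* Let $C$ be a category with finite limits and let $(T,\mu,\epsilon)$ be a cartesian monad on $C$. Then the 2-functor $IAlg_T:\mathbf{CAlg}_T\to Cat$, which assigns to a categorical $T$-algebra its category of internal $T$-algebras, is representable. The representing categorical $T$-algebra $\mathbf H^T$ has the characteristic property that its simplicial nerve (a simplicial object in $Alg_T$) coincides with the two-sided bar construction $B_\star(T,T,1)$, i.e. with the cotriple resolution of the terminal $T$-algebra.
   Context: A monad $(T,\mu,\epsilon)$ on a category with pullbacks is cartesian if $T$ preserves pullbacks and all naturality squares of $\mu$ and $\epsilon$ are pullbacks. Such a $T$ extends levelwise to a 2-monad on the 2-category $\mathbf{Cat}(C)$ of internal categories in $C$; its strict algebras are called categorical $T$-algebras and $\mathbf{CAlg}_T$ denotes the 2-category of categorical $T$-algebras, strict morphisms and $T$-algebra transformations (equivalently, the 2-category of internal categories in the category $Alg_T$ of $T$-algebras). For categorical $T$-algebras $(A,\alpha)$, $(B,\beta)$ a lax morphism $(f,\phi):A\to B$ is an internal functor $f:A\to B$ with an internal natural transformation $\phi:\beta\circ T(f)\Rightarrow f\circ\alpha$ such that $\phi*\epsilon_A=\mathrm{id}_f$ and $\phi*\mu_A=(\phi*T\alpha)\circ(\beta*T\phi)$. A transformation $(f,\phi)\Rightarrow(g,\psi)$ is an internal natural transformation $\tau:f\Rightarrow g$ with $\psi\circ(\beta*T\tau)=(\tau*\alpha)\circ\phi$. The terminal internal category $1$ is a categorical $T$-algebra; an internal $T$-algebra in $A$ is a lax morphism $1\to A$, and $IAlg_T(A)$ is the category of these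 and their transformations. $B_\star(T,T,1)$ is the simplicial $T$-algebra with $B_k=T^{k+1}(1)$, faces induced by $\mu$ and by $T(1)\to1$, degeneracies induced by $\epsilon$; the convention is that in the category $\mathbf H^T$ the source map $T^2(1)\to T(1)$ is $\mu_1$ and the target map is $T(!)$. *)

theory Defs
  imports Main
begin

section \<open>Categories, functors, finite limits\<close>

record ('o, 'a) cat =
  Obj :: "'o set"
  Arr :: "'a set"
  Dom :: "'a \<Rightarrow> 'o"
  Cod :: "'a \<Rightarrow> 'o"
  Ident :: "'o \<Rightarrow> 'a"
  Comp :: "'a \<Rightarrow> 'a \<Rightarrow> 'a"  (infixr "\<cdot>\<index>" 75)

definition hom :: "('o, 'a, 'm) cat_scheme \<Rightarrow> 'o \<Rightarrow> 'o \<Rightarrow> 'a set" where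
  "hom C X Y = {f \<in> Arr C. Dom C f = X \<and> Cod C f = Y}"

locale category =
  fixes C :: "('o, 'a, 'm) cat_scheme" (structure)
  assumes dom_obj: "f \<in> Arr C \<Longrightarrow> Dom C f \<in> Obj C"
    and cod_obj: "f \<in> Arr C \<Longrightarrow> Cod C f \<in> Obj C"
    and ident_hom: "X \<in> Obj C \<Longrightarrow> Ident C X \<in> hom C X X"
    and comp_hom: "\<lbrakk>f \<in> hom C X Y; g \<in> hom C Y Z\<rbrakk> \<Longrightarrow> g \<cdot> f \<in> hom C X Z"
    and comp_assoc:
      "\<lbrakk>f \<in> hom C X Y; g \<in> hom C Y Z; h \<in> hom C Z W\<rbrakk> \<Longrightarrow> (h \<cdot> g) \<cdot> f = h \<cdot> (g \<cdot> f)"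
    and ident_left: "f \<in> hom C X Y \<Longrightarrow> Ident C Y \<cdot> f = f"
    and ident_right: "f \<in> hom C X Y \<Longrightarrow> f \<cdot> Ident C X = f"

record ('o, 'a, 'p, 'b) func =
  FO :: "'o \<Rightarrow> 'p"
  FA :: "'a \<Rightarrow> 'b"

definition is_functor ::
  "('o, 'a, 'm) cat_scheme \<Rightarrow> ('p, 'b, 'n) cat_scheme \<Rightarrow> ('o, 'a, 'p, 'b, 'k) func_scheme \<Rightarrow> bool" where
  "is_functor C D F \<longleftrightarrow>
     (\<forall>X\<in>Obj C. FO F X \<in> Obj D) \<and>
     (\<forall>f\<in>Arr C. FA F f \<in> hom D (FO F (Dom C f)) (FO F (Cod C f))) \<and>
     (\<forall>X\<in>Obj C. FA F (Ident C X) = Ident D (FO F X)) \<and>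
     (\<forall>f\<in>Arr C. \<forall>g\<in>Arr C. Dom C g = Cod C f \<longrightarrow>
        FA F (g \<cdot>\<^bsub>C\<^esub> f) = FA F g \<cdot>\<^bsub>D\<^esub> FA F f)"

definition is_nat_trans ::
  "('o, 'a, 'm) cat_scheme \<Rightarrow> ('p, 'b, 'n) cat_scheme \<Rightarrow> ('o, 'a, 'p, 'b, 'k) func_scheme
     \<Rightarrow> ('o, 'a, 'p, 'b, 'l) func_scheme \<Rightarrow> ('o \<Rightarrow> 'b) \<Rightarrow> bool" where
  "is_nat_trans C D F G \<eta> \<longleftrightarrow>
     (\<forall>X\<in>Obj C. \<eta> X \<in> hom D (FO F X) (FO G X)) \<and>
     (\<forall>f\<in>Arr C. FA G f \<cdot>\<^bsub>D\<^esub> \<eta> (Dom C f) = \<eta> (Cod C f) \<cdot>\<^bsub>D\<^esub> FA F f)"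

definition is_cone ::
  "('j, 'k) cat \<Rightarrow> ('o, 'a, 'm) cat_scheme \<Rightarrow> ('j, 'k, 'o, 'a) func \<Rightarrow> 'o \<Rightarrow> ('j \<Rightarrow> 'a) \<Rightarrow> bool" where
  "is_cone J C D L \<pi> \<longleftrightarrow>
     L \<in> Obj C \<and>
     (\<forall>j\<in>Obj J. \<pi> j \<in> hom C L (FO D j)) \<and>
     (\<forall>a\<in>Arr J. FA D a \<cdot>\<^bsub>C\<^esub> \<pi> (Dom J a) = \<pi> (Cod J a))"

definition is_limit ::
  "('j, 'k) cat \<Rightarrow> ('o, 'a, 'm) cat_scheme \<Rightarrow> ('j, 'k, 'o, 'a) func \<Rightarrow> 'o \<Rightarrow> ('j \<Rightarrow> 'a) \<Rightarrow> bool" where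
  "is_limit J C D L \<pi> \<longleftrightarrow>
     is_cone J C D L \<pi> \<and>
     (\<forall>M \<rho>. is_cone J C D M \<rho> \<longrightarrow>
        (\<exists>!h. h \<in> hom C M L \<and> (\<forall>j\<in>Obj J. \<pi> j \<cdot>\<^bsub>C\<^esub> h = \<rho> j)))"

text \<open>Every finite category is isomorphic to one whose objects and arrows are natural numbers.\<close>

definition has_finite_limits :: "('o, 'a, 'm) cat_scheme \<Rightarrow> bool" where
  "has_finite_limits C \<longleftrightarrow>
     (\<forall>(J :: (nat, nat) cat) D.
        category J \<and> finite (Obj J) \<and> finite (Arr J) \<and> is_functor J C D
          \<longrightarrow> (\<exists>L \<pi>. is_limit J C D L \<pi>))"

definition is_terminal :: "('o, 'a, 'm) cat_scheme \<Rightarrow> 'o \<Rightarrow> bool" where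
  "is_terminal C X \<longleftrightarrow> X \<in> Obj C \<and> (\<forall>Y\<in>Obj C. \<exists>!f. f \<in> hom C Y X)"

text \<open>\<open>is_pullback C f g p q\<close>: the square \<open>f \<cdot> p = g \<cdot> q\<close> is a pullback.\<close>

definition is_pullback :: "('o, 'a, 'm) cat_scheme \<Rightarrow> 'a \<Rightarrow> 'a \<Rightarrow> 'a \<Rightarrow> 'a \<Rightarrow> bool" where
  "is_pullback C f g p q \<longleftrightarrow>
     f \<in> Arr C \<and> g \<in> Arr C \<and> p \<in> Arr C \<and> q \<in> Arr C \<and>
     Cod C f = Cod C g \<and> Dom C p = Dom C q \<and> Cod C p = Dom C f \<and> Cod C q = Dom C g \<and>
     f \<cdot>\<^bsub>C\<^esub> p = g \<cdot>\<^bsub>C\<^esub> q \<and>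
     (\<forall>Z. \<forall>x\<in>hom C Z (Dom C f). \<forall>y\<in>hom C Z (Dom C g).
        f \<cdot>\<^bsub>C\<^esub> x = g \<cdot>\<^bsub>C\<^esub> y \<longrightarrow>
        (\<exists>!h. h \<in> hom C Z (Dom C p) \<and> p \<cdot>\<^bsub>C\<^esub> h = x \<and> q \<cdot>\<^bsub>C\<^esub> h = y))"


section \<open>Cartesian monads and their algebras\<close>

record ('o, 'a) monad = "('o, 'a, 'o, 'a) func" +
  Mu :: "'o \<Rightarrow> 'a"
  Eps :: "'o \<Rightarrow> 'a"

definition is_monad :: "('o, 'a, 'm) cat_scheme \<Rightarrow> ('o, 'a) monad \<Rightarrow> bool" where
  "is_monad C T \<longleftrightarrow>
     is_functor C C T \<and>
     is_nat_trans C C \<lparr>FO = FO T \<circ> FO T, FA = FA T \<circ> FA T\<rparr> T (Mu T) \<and>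
     is_nat_trans C C \<lparr>FO = id, FA = id\<rparr> T (Eps T) \<and>
     (\<forall>X\<in>Obj C.
        Mu T X \<cdot>\<^bsub>C\<^esub> FA T (Mu T X) = Mu T X \<cdot>\<^bsub>C\<^esub> Mu T (FO T X) \<and>
        Mu T X \<cdot>\<^bsub>C\<^esub> FA T (Eps T X) = Ident C (FO T X) \<and>
        Mu T X \<cdot>\<^bsub>C\<^esub> Eps T (FO T X) = Ident C (FO T X))"

definition is_cartesian_monad :: "('o, 'a, 'm) cat_scheme \<Rightarrow> ('o, 'a) monad \<Rightarrow> bool" where
  "is_cartesian_monad C T \<longleftrightarrow>
     is_monad C T \<and>
     (\<forall>f g p q. is_pullback C f g p q \<longrightarrow> is_pullback C (FA T f) (FA T g) (FA T p) (FA T q)) \<and>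
     (\<forall>f\<in>Arr C. is_pullback C (FA T f) (Mu T (Cod C f)) (Mu T (Dom C f)) (FA T (FA T f))) \<and>
     (\<forall>f\<in>Arr C. is_pullback C (FA T f) (Eps T (Cod C f)) (Eps T (Dom C f)) f)"

text \<open>An arrow of the category of algebras records its domain and codomain algebras.\<close>

type_synonym ('o, 'a) alg = "'o \<times> 'a"
type_synonym ('o, 'a) alg_arr = "('o, 'a) alg \<times> ('o, 'a) alg \<times> 'a"

definition Alg ::
  "('o, 'a, 'm) cat_scheme \<Rightarrow> ('o, 'a) monad \<Rightarrow> (('o, 'a) alg, ('o, 'a) alg_arr) cat" where
  "Alg C T = (let
      Ob = {(X, \<xi>). X \<in> Obj C \<and> \<xi> \<in> hom C (FO T X) X \<and>
              \<xi> \<cdot>\<^bsub>C\<^esub> FA T \<xi> = \<xi> \<cdot>\<^bsub>C\<^esub> Mu T X \<and> \<xi> \<cdot>\<^bsub>C\<^esub> Eps T X = Ident C X}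
    in \<lparr>Obj = Ob,
        Arr = {(x, y, f). x \<in> Ob \<and> y \<in> Ob \<and> f \<in> hom C (fst x) (fst y) \<and>
                 f \<cdot>\<^bsub>C\<^esub> snd x = snd y \<cdot>\<^bsub>C\<^esub> FA T f},
        Dom = (\<lambda>(x, y, f). x),
        Cod = (\<lambda>(x, y, f). y),
        Ident = (\<lambda>x. (x, x, Ident C (fst x))),
        Comp = (\<lambda>(y, z, g) (x, y', f). (x, z, g \<cdot>\<^bsub>C\<^esub> f))\<rparr>)"


section \<open>Strict 2-categories and 2-functors to Cat\<close>

record ('o, 'f, 't) cat2 = "('o, 'f) cat" +
  Cell2 :: "'t set"
  Dom2 :: "'t \<Rightarrow> 'f"
  Cod2 :: "'t \<Rightarrow> 'f"
  Id2 :: "'f \<Rightarrow> 't"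
  VComp :: "'t \<Rightarrow> 't \<Rightarrow> 't"  (infixr "\<bullet>\<index>" 70)
  HComp :: "'t \<Rightarrow> 't \<Rightarrow> 't"  (infixr "\<star>\<index>" 75)

definition cell :: "('o, 'f, 't) cat2 \<Rightarrow> 'f \<Rightarrow> 'f \<Rightarrow> 't set" where
  "cell K f g = {\<theta> \<in> Cell2 K. Dom2 K \<theta> = f \<and> Cod2 K \<theta> = g}"

definition hom_cat :: "('o, 'f, 't) cat2 \<Rightarrow> 'o \<Rightarrow> 'o \<Rightarrow> ('f, 't) cat" where
  "hom_cat K A B =
     \<lparr>Obj = hom K A B,
      Arr = {\<theta> \<in> Cell2 K. Dom2 K \<theta> \<in> hom K A B \<and> Cod2 K \<theta> \<in> hom K A B},
      Dom = Dom2 K, Cod = Cod2 K, Ident = Id2 K, Comp = VComp K\<rparr>"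

locale two_category = category K
  for K :: "('o, 'f, 't) cat2" (structure) +
  assumes cell2_parallel:
      "\<theta> \<in> Cell2 K \<Longrightarrow> \<exists>A B. Dom2 K \<theta> \<in> hom K A B \<and> Cod2 K \<theta> \<in> hom K A B"
    and hom_category: "\<lbrakk>A \<in> Obj K; B \<in> Obj K\<rbrakk> \<Longrightarrow> category (hom_cat K A B)"
    and hcomp_cell:
      "\<lbrakk>f \<in> hom K A B; g \<in> hom K B D; \<tau> \<in> cell K f f'; \<sigma> \<in> cell K g g'\<rbrakk>
         \<Longrightarrow> \<sigma> \<star> \<tau> \<in> cell K (g \<cdot> f) (g' \<cdot> f')"
    and hcomp_id2:
      "\<lbrakk>f \<in> hom K A B; g \<in> hom K B D\<rbrakk> \<Longrightarrow> Id2 K g \<star> Id2 K f = Id2 K (g \<cdot> f)"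
    and interchange:
      "\<lbrakk>f \<in> hom K A B; g \<in> hom K B D; \<tau> \<in> cell K f f'; \<tau>' \<in> cell K f' f'';
        \<sigma> \<in> cell K g g'; \<sigma>' \<in> cell K g' g''\<rbrakk>
         \<Longrightarrow> (\<sigma>' \<bullet> \<sigma>) \<star> (\<tau>' \<bullet> \<tau>) = (\<sigma>' \<star> \<tau>') \<bullet> (\<sigma> \<star> \<tau>)"
    and hcomp_assoc:
      "\<lbrakk>f \<in> hom K A B; g \<in> hom K B D; h \<in> hom K D E;
        \<tau> \<in> cell K f f'; \<sigma> \<in> cell K g g'; \<rho> \<in> cell K h h'\<rbrakk>
         \<Longrightarrow> (\<rho> \<star> \<sigma>) \<star> \<tau> = \<rho> \<star> (\<sigma> \<star> \<tau>)"
    and hcomp_unit_left: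
      "\<lbrakk>f \<in> hom K A B; \<tau> \<in> cell K f f'\<rbrakk> \<Longrightarrow> Id2 K (Ident K B) \<star> \<tau> = \<tau>"
    and hcomp_unit_right:
      "\<lbrakk>f \<in> hom K A B; \<tau> \<in> cell K f f'\<rbrakk> \<Longrightarrow> \<tau> \<star> Id2 K (Ident K A) = \<tau>"

record ('o, 'f, 't, 'x, 'y) cat_valued =
  P0 :: "'o \<Rightarrow> ('x, 'y) cat"
  P1 :: "'f \<Rightarrow> ('x, 'y, 'x, 'y) func"
  P2 :: "'t \<Rightarrow> 'x \<Rightarrow> 'y"

text \<open>Functors and transformations between the values are compared on their carriers only.\<close>

definition is_two_functor_to_Cat ::
  "('o, 'f, 't) cat2 \<Rightarrow> ('o, 'f, 't, 'x, 'y) cat_valued \<Rightarrow> bool" where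
  "is_two_functor_to_Cat K P \<longleftrightarrow>
     (\<forall>A\<in>Obj K. category (P0 P A)) \<and>
     (\<forall>f\<in>Arr K. is_functor (P0 P (Dom K f)) (P0 P (Cod K f)) (P1 P f)) \<and>
     (\<forall>\<theta>\<in>Cell2 K. is_nat_trans (P0 P (Dom K (Dom2 K \<theta>))) (P0 P (Cod K (Dom2 K \<theta>)))
                    (P1 P (Dom2 K \<theta>)) (P1 P (Cod2 K \<theta>)) (P2 P \<theta>)) \<and>
     (\<forall>A\<in>Obj K.
        (\<forall>x\<in>Obj (P0 P A). FO (P1 P (Ident K A)) x = x) \<and>
        (\<forall>u\<in>Arr (P0 P A). FA (P1 P (Ident K A)) u = u)) \<and>
     (\<forall>f\<in>Arr K. \<forall>g\<in>Arr K. Dom K g = Cod K f \<longrightarrow>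
        (\<forall>x\<in>Obj (P0 P (Dom K f)). FO (P1 P (g \<cdot>\<^bsub>K\<^esub> f)) x = FO (P1 P g) (FO (P1 P f) x)) \<and>
        (\<forall>u\<in>Arr (P0 P (Dom K f)). FA (P1 P (g \<cdot>\<^bsub>K\<^esub> f)) u = FA (P1 P g) (FA (P1 P f) u))) \<and>
     (\<forall>f\<in>Arr K. \<forall>x\<in>Obj (P0 P (Dom K f)).
        P2 P (Id2 K f) x = Ident (P0 P (Cod K f)) (FO (P1 P f) x)) \<and>
     (\<forall>\<theta>\<in>Cell2 K. \<forall>\<theta>'\<in>Cell2 K. Dom2 K \<theta>' = Cod2 K \<theta> \<longrightarrow>
        (\<forall>x\<in>Obj (P0 P (Dom K (Dom2 K \<theta>))).
           P2 P (\<theta>' \<bullet>\<^bsub>K\<^esub> \<theta>) x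
             = P2 P \<theta>' x \<cdot>\<^bsub>P0 P (Cod K (Dom2 K \<theta>))\<^esub> P2 P \<theta> x)) \<and>
     (\<forall>\<tau>\<in>Cell2 K. \<forall>\<sigma>\<in>Cell2 K. Dom K (Dom2 K \<sigma>) = Cod K (Dom2 K \<tau>) \<longrightarrow>
        (\<forall>x\<in>Obj (P0 P (Dom K (Dom2 K \<tau>))).
           P2 P (\<sigma> \<star>\<^bsub>K\<^esub> \<tau>) x
             = P2 P \<sigma> (FO (P1 P (Cod2 K \<tau>)) x)
                 \<cdot>\<^bsub>P0 P (Cod K (Dom2 K \<sigma>))\<^esub> FA (P1 P (Dom2 K \<sigma>)) (P2 P \<tau> x)))"

definition hom_two_functor :: "('o, 'f, 't) cat2 \<Rightarrow> 'o \<Rightarrow> ('o, 'f, 't, 'f, 't) cat_valued" where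
  "hom_two_functor K H =
     \<lparr>P0 = hom_cat K H,
      P1 = (\<lambda>f. \<lparr>FO = (\<lambda>h. f \<cdot>\<^bsub>K\<^esub> h), FA = (\<lambda>\<theta>. Id2 K f \<star>\<^bsub>K\<^esub> \<theta>)\<rparr>),
      P2 = (\<lambda>\<theta> h. \<theta> \<star>\<^bsub>K\<^esub> Id2 K h)\<rparr>"

definition is_two_nat_iso ::
  "('o, 'f, 't) cat2 \<Rightarrow> ('o, 'f, 't, 'x, 'y) cat_valued \<Rightarrow> ('o, 'f, 't, 'z, 'w) cat_valued
     \<Rightarrow> ('o \<Rightarrow> ('x, 'y, 'z, 'w) func) \<Rightarrow> bool" where
  "is_two_nat_iso K P Q \<Phi> \<longleftrightarrow>
     (\<forall>A\<in>Obj K. is_functor (P0 P A) (P0 Q A) (\<Phi> A) \<and>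
        bij_betw (FO (\<Phi> A)) (Obj (P0 P A)) (Obj (P0 Q A)) \<and>
        bij_betw (FA (\<Phi> A)) (Arr (P0 P A)) (Arr (P0 Q A))) \<and>
     (\<forall>f\<in>Arr K.
        (\<forall>x\<in>Obj (P0 P (Dom K f)).
           FO (P1 Q f) (FO (\<Phi> (Dom K f)) x) = FO (\<Phi> (Cod K f)) (FO (P1 P f) x)) \<and>
        (\<forall>u\<in>Arr (P0 P (Dom K f)).
           FA (P1 Q f) (FA (\<Phi> (Dom K f)) u) = FA (\<Phi> (Cod K f)) (FA (P1 P f) u))) \<and>
     (\<forall>\<theta>\<in>Cell2 K. \<forall>x\<in>Obj (P0 P (Dom K (Dom2 K \<theta>))).
        P2 Q \<theta> (FO (\<Phi> (Dom K (Dom2 K \<theta>))) x)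
          = FA (\<Phi> (Cod K (Dom2 K \<theta>))) (P2 P \<theta> x))"

definition represents ::
  "('o, 'f, 't) cat2 \<Rightarrow> ('o, 'f, 't, 'x, 'y) cat_valued \<Rightarrow> 'o \<Rightarrow> bool" where
  "represents K P H \<longleftrightarrow> H \<in> Obj K \<and> (\<exists>\<Phi>. is_two_nat_iso K (hom_two_functor K H) P \<Phi>)"

definition representable :: "('o, 'f, 't) cat2 \<Rightarrow> ('o, 'f, 't, 'x, 'y) cat_valued \<Rightarrow> bool" where
  "representable K P \<longleftrightarrow> (\<exists>H. represents K P H)"


section \<open>Strict algebras and lax morphisms for a 2-monad\<close>

record ('o, 'f, 't) monad2 =
  M0 :: "'o \<Rightarrow> 'o"
  M1 :: "'f \<Rightarrow> 'f"
  M2 :: "'t \<Rightarrow> 't"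
  Mu2 :: "'o \<Rightarrow> 'f"
  Eps2 :: "'o \<Rightarrow> 'f"

definition strict_algs :: "('o, 'f, 't) cat2 \<Rightarrow> ('o, 'f, 't) monad2 \<Rightarrow> ('o \<times> 'f) set" where
  "strict_algs K M = {(A, \<alpha>). A \<in> Obj K \<and> \<alpha> \<in> hom K (M0 M A) A \<and>
     \<alpha> \<cdot>\<^bsub>K\<^esub> M1 M \<alpha> = \<alpha> \<cdot>\<^bsub>K\<^esub> Mu2 M A \<and> \<alpha> \<cdot>\<^bsub>K\<^esub> Eps2 M A = Ident K A}"

text \<open>Strict algebras, strict morphisms and algebra transformations; cells of dimension 1 and 2
  record their domain and codomain algebras.\<close>

definition Alg2 :: "('o, 'f, 't) cat2 \<Rightarrow> ('o, 'f, 't) monad2 \<Rightarrow>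
    ('o \<times> 'f, ('o \<times> 'f) \<times> ('o \<times> 'f) \<times> 'f, ('o \<times> 'f) \<times> ('o \<times> 'f) \<times> 't) cat2" where
  "Alg2 K M = (let
      Ob = strict_algs K M;
      Mor = {(x, y, f). x \<in> Ob \<and> y \<in> Ob \<and> f \<in> hom K (fst x) (fst y) \<and>
               f \<cdot>\<^bsub>K\<^esub> snd x = snd y \<cdot>\<^bsub>K\<^esub> M1 M f}
    in \<lparr>Obj = Ob,
        Arr = Mor,
        Dom = (\<lambda>(x, y, f). x),
        Cod = (\<lambda>(x, y, f). y),
        Ident = (\<lambda>x. (x, x, Ident K (fst x))),
        Comp = (\<lambda>(y, z, g) (x, y', f). (x, z, g \<cdot>\<^bsub>K\<^esub> f)),
        Cell2 = {(x, y, \<theta>). \<theta> \<in> Cell2 K \<and>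
                   (x, y, Dom2 K \<theta>) \<in> Mor \<and> (x, y, Cod2 K \<theta>) \<in> Mor \<and>
                   \<theta> \<star>\<^bsub>K\<^esub> Id2 K (snd x) = Id2 K (snd y) \<star>\<^bsub>K\<^esub> M2 M \<theta>},
        Dom2 = (\<lambda>(x, y, \<theta>). (x, y, Dom2 K \<theta>)),
        Cod2 = (\<lambda>(x, y, \<theta>). (x, y, Cod2 K \<theta>)),
        Id2 = (\<lambda>(x, y, f). (x, y, Id2 K f)),
        VComp = (\<lambda>(x, y, \<theta>') (x', y', \<theta>). (x, y, \<theta>' \<bullet>\<^bsub>K\<^esub> \<theta>)),
        HComp = (\<lambda>(y, z, \<sigma>) (x, y', \<tau>). (x, z, \<sigma> \<star>\<^bsub>K\<^esub> \<tau>))\<rparr>)"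

definition lax_mors ::
  "('o, 'f, 't) cat2 \<Rightarrow> ('o, 'f, 't) monad2 \<Rightarrow> 'o \<times> 'f \<Rightarrow> 'o \<times> 'f \<Rightarrow> ('f \<times> 't) set" where
  "lax_mors K M = (\<lambda>(A, \<alpha>) (B, \<beta>). {(f, \<phi>).
     f \<in> hom K A B \<and>
     \<phi> \<in> cell K (\<beta> \<cdot>\<^bsub>K\<^esub> M1 M f) (f \<cdot>\<^bsub>K\<^esub> \<alpha>) \<and>
     \<phi> \<star>\<^bsub>K\<^esub> Id2 K (Eps2 M A) = Id2 K f \<and>
     \<phi> \<star>\<^bsub>K\<^esub> Id2 K (Mu2 M A)
       = (\<phi> \<star>\<^bsub>K\<^esub> Id2 K (M1 M \<alpha>)) \<bullet>\<^bsub>K\<^esub> (Id2 K \<beta> \<star>\<^bsub>K\<^esub> M2 M \<phi>)})"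

type_synonym ('f, 't) lax = "'f \<times> 't"
type_synonym ('f, 't) lax_trans = "('f, 't) lax \<times> ('f, 't) lax \<times> 't"

definition lax_cat ::
  "('o, 'f, 't) cat2 \<Rightarrow> ('o, 'f, 't) monad2 \<Rightarrow> 'o \<times> 'f \<Rightarrow> 'o \<times> 'f
     \<Rightarrow> (('f, 't) lax, ('f, 't) lax_trans) cat" where
  "lax_cat K M x y =
     \<lparr>Obj = lax_mors K M x y,
      Arr = {(u, v, \<tau>). u \<in> lax_mors K M x y \<and> v \<in> lax_mors K M x y \<and>
               \<tau> \<in> cell K (fst u) (fst v) \<and>
               snd v \<bullet>\<^bsub>K\<^esub> (Id2 K (snd y) \<star>\<^bsub>K\<^esub> M2 M \<tau>)
                 = (\<tau> \<star>\<^bsub>K\<^esub> Id2 K (snd x)) \<bullet>\<^bsub>K\<^esub> snd u},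
      Dom = (\<lambda>(u, v, \<tau>). u),
      Cod = (\<lambda>(u, v, \<tau>). v),
      Ident = (\<lambda>u. (u, u, Id2 K (fst u))),
      Comp = (\<lambda>(v, w, \<sigma>) (u, v', \<tau>). (u, w, \<sigma> \<bullet>\<^bsub>K\<^esub> \<tau>))\<rparr>"

text \<open>The 2-functor of lax morphisms out of \<open>x\<close>, acting by postcomposition with strict morphisms
  and by whiskering with algebra transformations.\<close>

definition lax_post :: "('o, 'f, 't) cat2 \<Rightarrow> 'f \<Rightarrow> ('f, 't) lax \<Rightarrow> ('f, 't) lax" where
  "lax_post K h = (\<lambda>(f, \<phi>). (h \<cdot>\<^bsub>K\<^esub> f, Id2 K h \<star>\<^bsub>K\<^esub> \<phi>))"

definition lax_two_functor ::
  "('o, 'f, 't) cat2 \<Rightarrow> ('o, 'f, 't) monad2 \<Rightarrow> 'o \<times> 'f \<Rightarrow>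
     ('o \<times> 'f, ('o \<times> 'f) \<times> ('o \<times> 'f) \<times> 'f, ('o \<times> 'f) \<times> ('o \<times> 'f) \<times> 't,
      ('f, 't) lax, ('f, 't) lax_trans) cat_valued" where
  "lax_two_functor K M x =
     \<lparr>P0 = lax_cat K M x,
      P1 = (\<lambda>(y, z, h).
              \<lparr>FO = lax_post K h,
               FA = (\<lambda>(u, v, \<tau>). (lax_post K h u, lax_post K h v, Id2 K h \<star>\<^bsub>K\<^esub> \<tau>))\<rparr>),
      P2 = (\<lambda>(y, z, \<theta>) u.
              (lax_post K (Dom2 K \<theta>) u, lax_post K (Cod2 K \<theta>) u,
               \<theta> \<star>\<^bsub>K\<^esub> Id2 K (fst u)))\<rparr>"


section \<open>Internal categories\<close>

text \<open>The object \<open>O2\<close> of composable pairs, a pullback of \<open>tgt\<close> and \<open>src\<close>, belongs to the data of an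
  internal category, so that a pullback preserving functor can be applied levelwise without
  choosing pullbacks.  \<open>pr1\<close> projects to the arrow that is applied first.\<close>

record ('o, 'a) icat =
  O0 :: 'o
  O1 :: 'o
  O2 :: 'o
  src :: 'a
  tgt :: 'a
  idn :: 'a
  pr1 :: 'a
  pr2 :: 'a
  cmp :: 'a

text \<open>\<open>icomp E A y x\<close> is the composite ``\<open>y\<close> after \<open>x\<close>'' of generalized elements
  \<open>x, y : Z \<rightarrow> O1 A\<close> with \<open>tgt \<cdot> x = src \<cdot> y\<close>.\<close>

definition ipair :: "('o, 'a, 'm) cat_scheme \<Rightarrow> ('o, 'a) icat \<Rightarrow> 'a \<Rightarrow> 'a \<Rightarrow> 'a" where
  "ipair E A x y = (THE h. h \<in> hom E (Dom E x) (O2 A) \<and>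
     pr1 A \<cdot>\<^bsub>E\<^esub> h = x \<and> pr2 A \<cdot>\<^bsub>E\<^esub> h = y)"

definition icomp :: "('o, 'a, 'm) cat_scheme \<Rightarrow> ('o, 'a) icat \<Rightarrow> 'a \<Rightarrow> 'a \<Rightarrow> 'a" where
  "icomp E A y x = cmp A \<cdot>\<^bsub>E\<^esub> ipair E A x y"

text \<open>Unitality and associativity are quantified over generalized elements; the universal ones
  are the identity of \<open>O1\<close> and the three projections from the object of composable triples.\<close>

definition is_icat :: "('o, 'a, 'm) cat_scheme \<Rightarrow> ('o, 'a) icat \<Rightarrow> bool" where
  "is_icat E A \<longleftrightarrow>
     O0 A \<in> Obj E \<and> O1 A \<in> Obj E \<and> O2 A \<in> Obj E \<and>
     src A \<in> hom E (O1 A) (O0 A) \<and> tgt A \<in> hom E (O1 A) (O0 A) \<and>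
     idn A \<in> hom E (O0 A) (O1 A) \<and>
     pr1 A \<in> hom E (O2 A) (O1 A) \<and> pr2 A \<in> hom E (O2 A) (O1 A) \<and>
     cmp A \<in> hom E (O2 A) (O1 A) \<and>
     is_pullback E (tgt A) (src A) (pr1 A) (pr2 A) \<and>
     src A \<cdot>\<^bsub>E\<^esub> idn A = Ident E (O0 A) \<and> tgt A \<cdot>\<^bsub>E\<^esub> idn A = Ident E (O0 A) \<and>
     src A \<cdot>\<^bsub>E\<^esub> cmp A = src A \<cdot>\<^bsub>E\<^esub> pr1 A \<and>
     tgt A \<cdot>\<^bsub>E\<^esub> cmp A = tgt A \<cdot>\<^bsub>E\<^esub> pr2 A \<and>
     (\<forall>Z. \<forall>x\<in>hom E Z (O1 A).
        icomp E A x (idn A \<cdot>\<^bsub>E\<^esub> (src A \<cdot>\<^bsub>E\<^esub> x)) = x \<and>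
        icomp E A (idn A \<cdot>\<^bsub>E\<^esub> (tgt A \<cdot>\<^bsub>E\<^esub> x)) x = x) \<and>
     (\<forall>Z. \<forall>x\<in>hom E Z (O1 A). \<forall>y\<in>hom E Z (O1 A). \<forall>z\<in>hom E Z (O1 A).
        tgt A \<cdot>\<^bsub>E\<^esub> x = src A \<cdot>\<^bsub>E\<^esub> y \<and> tgt A \<cdot>\<^bsub>E\<^esub> y = src A \<cdot>\<^bsub>E\<^esub> z \<longrightarrow>
        icomp E A z (icomp E A y x) = icomp E A (icomp E A z y) x)"

text \<open>The component \<open>F2\<close> is uniquely determined by \<open>F1\<close>.\<close>

record ('o, 'a) ifun =
  IDom :: "('o, 'a) icat"
  ICod :: "('o, 'a) icat"
  F0 :: 'a
  F1 :: 'a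
  F2 :: 'a

definition is_ifun :: "('o, 'a, 'm) cat_scheme \<Rightarrow> ('o, 'a) ifun \<Rightarrow> bool" where
  "is_ifun E f \<longleftrightarrow> (let A = IDom f; B = ICod f in
     is_icat E A \<and> is_icat E B \<and>
     F0 f \<in> hom E (O0 A) (O0 B) \<and> F1 f \<in> hom E (O1 A) (O1 B) \<and> F2 f \<in> hom E (O2 A) (O2 B) \<and>
     src B \<cdot>\<^bsub>E\<^esub> F1 f = F0 f \<cdot>\<^bsub>E\<^esub> src A \<and>
     tgt B \<cdot>\<^bsub>E\<^esub> F1 f = F0 f \<cdot>\<^bsub>E\<^esub> tgt A \<and>
     F1 f \<cdot>\<^bsub>E\<^esub> idn A = idn B \<cdot>\<^bsub>E\<^esub> F0 f \<and>
     pr1 B \<cdot>\<^bsub>E\<^esub> F2 f = F1 f \<cdot>\<^bsub>E\<^esub> pr1 A \<and>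
     pr2 B \<cdot>\<^bsub>E\<^esub> F2 f = F1 f \<cdot>\<^bsub>E\<^esub> pr2 A \<and>
     F1 f \<cdot>\<^bsub>E\<^esub> cmp A = cmp B \<cdot>\<^bsub>E\<^esub> F2 f)"

record ('o, 'a) itrans =
  TDom :: "('o, 'a) ifun"
  TCod :: "('o, 'a) ifun"
  TMap :: 'a

definition is_itrans :: "('o, 'a, 'm) cat_scheme \<Rightarrow> ('o, 'a) itrans \<Rightarrow> bool" where
  "is_itrans E \<tau> \<longleftrightarrow> (let f = TDom \<tau>; g = TCod \<tau>; A = IDom f; B = ICod f in
     is_ifun E f \<and> is_ifun E g \<and> IDom g = A \<and> ICod g = B \<and>
     TMap \<tau> \<in> hom E (O0 A) (O1 B) \<and>
     src B \<cdot>\<^bsub>E\<^esub> TMap \<tau> = F0 f \<and> tgt B \<cdot>\<^bsub>E\<^esub> TMap \<tau> = F0 g \<and>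
     icomp E B (F1 g) (TMap \<tau> \<cdot>\<^bsub>E\<^esub> src A) = icomp E B (TMap \<tau> \<cdot>\<^bsub>E\<^esub> tgt A) (F1 f))"

definition icomp1 :: "('o, 'a, 'm) cat_scheme \<Rightarrow> ('o, 'a) ifun \<Rightarrow> ('o, 'a) ifun \<Rightarrow> ('o, 'a) ifun" where
  "icomp1 E g f = \<lparr>IDom = IDom f, ICod = ICod g,
     F0 = F0 g \<cdot>\<^bsub>E\<^esub> F0 f, F1 = F1 g \<cdot>\<^bsub>E\<^esub> F1 f, F2 = F2 g \<cdot>\<^bsub>E\<^esub> F2 f\<rparr>"

definition ICat ::
  "('o, 'a, 'm) cat_scheme \<Rightarrow> (('o, 'a) icat, ('o, 'a) ifun, ('o, 'a) itrans) cat2" where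
  "ICat E =
     \<lparr>Obj = {A. is_icat E A},
      Arr = {f. is_ifun E f},
      Dom = IDom,
      Cod = ICod,
      Ident = (\<lambda>A. \<lparr>IDom = A, ICod = A,
                 F0 = Ident E (O0 A), F1 = Ident E (O1 A), F2 = Ident E (O2 A)\<rparr>),
      Comp = icomp1 E,
      Cell2 = {\<tau>. is_itrans E \<tau>},
      Dom2 = TDom,
      Cod2 = TCod,
      Id2 = (\<lambda>f. \<lparr>TDom = f, TCod = f, TMap = idn (ICod f) \<cdot>\<^bsub>E\<^esub> F0 f\<rparr>),
      VComp = (\<lambda>\<sigma> \<tau>. \<lparr>TDom = TDom \<tau>, TCod = TCod \<sigma>,
                 TMap = icomp E (ICod (TDom \<tau>)) (TMap \<sigma>) (TMap \<tau>)\<rparr>),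
      HComp = (\<lambda>\<sigma> \<tau>. \<lparr>TDom = icomp1 E (TDom \<sigma>) (TDom \<tau>), TCod = icomp1 E (TCod \<sigma>) (TCod \<tau>),
                 TMap = icomp E (ICod (TDom \<sigma>))
                          (F1 (TCod \<sigma>) \<cdot>\<^bsub>E\<^esub> TMap \<tau>) (TMap \<sigma> \<cdot>\<^bsub>E\<^esub> F0 (TDom \<tau>))\<rparr>)\<rparr>"

definition lift_icat :: "('o, 'a) monad \<Rightarrow> ('o, 'a) icat \<Rightarrow> ('o, 'a) icat" where
  "lift_icat T A = \<lparr>O0 = FO T (O0 A), O1 = FO T (O1 A), O2 = FO T (O2 A),
     src = FA T (src A), tgt = FA T (tgt A), idn = FA T (idn A),
     pr1 = FA T (pr1 A), pr2 = FA T (pr2 A), cmp = FA T (cmp A)\<rparr>"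

definition lift_ifun :: "('o, 'a) monad \<Rightarrow> ('o, 'a) ifun \<Rightarrow> ('o, 'a) ifun" where
  "lift_ifun T f = \<lparr>IDom = lift_icat T (IDom f), ICod = lift_icat T (ICod f),
     F0 = FA T (F0 f), F1 = FA T (F1 f), F2 = FA T (F2 f)\<rparr>"

definition lift_monad ::
  "('o, 'a) monad \<Rightarrow> (('o, 'a) icat, ('o, 'a) ifun, ('o, 'a) itrans) monad2" where
  "lift_monad T =
     \<lparr>M0 = lift_icat T,
      M1 = lift_ifun T,
      M2 = (\<lambda>\<tau>. \<lparr>TDom = lift_ifun T (TDom \<tau>), TCod = lift_ifun T (TCod \<tau>), TMap = FA T (TMap \<tau>)\<rparr>),
      Mu2 = (\<lambda>A. \<lparr>IDom = lift_icat T (lift_icat T A), ICod = lift_icat T A,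
               F0 = Mu T (O0 A), F1 = Mu T (O1 A), F2 = Mu T (O2 A)\<rparr>),
      Eps2 = (\<lambda>A. \<lparr>IDom = A, ICod = lift_icat T A,
               F0 = Eps T (O0 A), F1 = Eps T (O1 A), F2 = Eps T (O2 A)\<rparr>)\<rparr>"


section \<open>Categorical algebras and internal algebras\<close>

type_synonym ('o, 'a) calg = "('o, 'a) icat \<times> ('o, 'a) ifun"
type_synonym ('o, 'a) calg_mor = "('o, 'a) calg \<times> ('o, 'a) calg \<times> ('o, 'a) ifun"
type_synonym ('o, 'a) calg_trans = "('o, 'a) calg \<times> ('o, 'a) calg \<times> ('o, 'a) itrans"
type_synonym ('o, 'a) ialg = "(('o, 'a) ifun, ('o, 'a) itrans) lax"
type_synonym ('o, 'a) ialg_mor = "(('o, 'a) ifun, ('o, 'a) itrans) lax_trans"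

definition CAlg ::
  "('o, 'a, 'm) cat_scheme \<Rightarrow> ('o, 'a) monad
     \<Rightarrow> (('o, 'a) calg, ('o, 'a) calg_mor, ('o, 'a) calg_trans) cat2" where
  "CAlg C T = Alg2 (ICat C) (lift_monad T)"

definition bang :: "('o, 'a, 'm) cat_scheme \<Rightarrow> 'o \<Rightarrow> 'o \<Rightarrow> 'a" where
  "bang C one X = (THE f. f \<in> hom C X one)"

text \<open>Throughout, \<open>one\<close> is a terminal object; the terminal internal category is the discrete one
  on it, with its unique action.\<close>

definition one_icat :: "('o, 'a, 'm) cat_scheme \<Rightarrow> 'o \<Rightarrow> ('o, 'a) icat" where
  "one_icat C one = (let i = Ident C one in
     \<lparr>O0 = one, O1 = one, O2 = one, src = i, tgt = i, idn = i, pr1 = i, pr2 = i, cmp = i\<rparr>)"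

definition one_calg ::
  "('o, 'a, 'm) cat_scheme \<Rightarrow> ('o, 'a) monad \<Rightarrow> 'o \<Rightarrow> ('o, 'a) calg" where
  "one_calg C T one = (let b = bang C one (FO T one) in
     (one_icat C one,
      \<lparr>IDom = lift_icat T (one_icat C one), ICod = one_icat C one, F0 = b, F1 = b, F2 = b\<rparr>))"

definition IAlg ::
  "('o, 'a, 'm) cat_scheme \<Rightarrow> ('o, 'a) monad \<Rightarrow> 'o
     \<Rightarrow> (('o, 'a) calg, ('o, 'a) calg_mor, ('o, 'a) calg_trans, ('o, 'a) ialg, ('o, 'a) ialg_mor)
          cat_valued" where
  "IAlg C T one = lax_two_functor (ICat C) (lift_monad T) (one_calg C T one)"

text \<open>A categorical algebra viewed as an internal category in the category of algebras.\<close>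

definition calg_icat :: "('o, 'a) calg \<Rightarrow> (('o, 'a) alg, ('o, 'a) alg_arr) icat" where
  "calg_icat = (\<lambda>(A, \<alpha>). let x0 = (O0 A, F0 \<alpha>); x1 = (O1 A, F1 \<alpha>); x2 = (O2 A, F2 \<alpha>) in
     \<lparr>O0 = x0, O1 = x1, O2 = x2,
      src = (x1, x0, src A), tgt = (x1, x0, tgt A), idn = (x0, x1, idn A),
      pr1 = (x2, x1, pr1 A), pr2 = (x2, x1, pr2 A), cmp = (x2, x1, cmp A)\<rparr>)"


section \<open>Simplicial objects, nerves, bar construction\<close>

text \<open>\<open>Face X n i : X\<^sub>n\<^sub>+\<^sub>1 \<rightarrow> X\<^sub>n\<close> for \<open>i \<le> n + 1\<close>, and
  \<open>Degen X n i : X\<^sub>n \<rightarrow> X\<^sub>n\<^sub>+\<^sub>1\<close> for \<open>i \<le> n\<close>.\<close>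

record ('o, 'a) simp_obj =
  SOb :: "nat \<Rightarrow> 'o"
  Face :: "nat \<Rightarrow> nat \<Rightarrow> 'a"
  Degen :: "nat \<Rightarrow> nat \<Rightarrow> 'a"

definition is_simplicial :: "('o, 'a, 'm) cat_scheme \<Rightarrow> ('o, 'a) simp_obj \<Rightarrow> bool" where
  "is_simplicial E X \<longleftrightarrow>
     (\<forall>n. SOb X n \<in> Obj E) \<and>
     (\<forall>n. \<forall>i\<le>Suc n. Face X n i \<in> hom E (SOb X (Suc n)) (SOb X n)) \<and>
     (\<forall>n. \<forall>i\<le>n. Degen X n i \<in> hom E (SOb X n) (SOb X (Suc n))) \<and>
     (\<forall>n i j. i < j \<and> j \<le> n + 2 \<longrightarrow>
        Face X n i \<cdot>\<^bsub>E\<^esub> Face X (Suc n) j = Face X n (j - 1) \<cdot>\<^bsub>E\<^esub> Face X (Suc n) i) \<and>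
     (\<forall>n i j. i \<le> j \<and> j \<le> n \<longrightarrow>
        Degen X (Suc n) i \<cdot>\<^bsub>E\<^esub> Degen X n j = Degen X (Suc n) (Suc j) \<cdot>\<^bsub>E\<^esub> Degen X n i) \<and>
     (\<forall>n i j. j \<le> n \<and> (i = j \<or> i = Suc j) \<longrightarrow>
        Face X n i \<cdot>\<^bsub>E\<^esub> Degen X n j = Ident E (SOb X n)) \<and>
     (\<forall>n i j. i < j \<and> j \<le> Suc n \<longrightarrow>
        Face X (Suc n) i \<cdot>\<^bsub>E\<^esub> Degen X (Suc n) j = Degen X n (j - 1) \<cdot>\<^bsub>E\<^esub> Face X n i) \<and>
     (\<forall>n i j. Suc j < i \<and> i \<le> n + 2 \<longrightarrow>
        Face X (Suc n) i \<cdot>\<^bsub>E\<^esub> Degen X (Suc n) j = Degen X n j \<cdot>\<^bsub>E\<^esub> Face X n (i - 1))"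

definition is_iso :: "('o, 'a, 'm) cat_scheme \<Rightarrow> 'o \<Rightarrow> 'o \<Rightarrow> 'a \<Rightarrow> bool" where
  "is_iso E X Y f \<longleftrightarrow> f \<in> hom E X Y \<and>
     (\<exists>g\<in>hom E Y X. g \<cdot>\<^bsub>E\<^esub> f = Ident E X \<and> f \<cdot>\<^bsub>E\<^esub> g = Ident E Y)"

definition simplicial_isomorphic ::
  "('o, 'a, 'm) cat_scheme \<Rightarrow> ('o, 'a) simp_obj \<Rightarrow> ('o, 'a) simp_obj \<Rightarrow> bool" where
  "simplicial_isomorphic E X Y \<longleftrightarrow>
     is_simplicial E X \<and> is_simplicial E Y \<and>
     (\<exists>\<eta>. (\<forall>n. is_iso E (SOb X n) (SOb Y n) (\<eta> n)) \<and>
          (\<forall>n. \<forall>i\<le>Suc n. Face Y n i \<cdot>\<^bsub>E\<^esub> \<eta> (Suc n) = \<eta> n \<cdot>\<^bsub>E\<^esub> Face X n i) \<and>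
          (\<forall>n. \<forall>i\<le>n. Degen Y n i \<cdot>\<^bsub>E\<^esub> \<eta> n = \<eta> (Suc n) \<cdot>\<^bsub>E\<^esub> Degen X n i))"

definition simplicial_eq :: "('o, 'a) simp_obj \<Rightarrow> ('o, 'a) simp_obj \<Rightarrow> bool" where
  "simplicial_eq X Y \<longleftrightarrow>
     (\<forall>n. SOb X n = SOb Y n) \<and>
     (\<forall>n. \<forall>i\<le>Suc n. Face X n i = Face Y n i) \<and>
     (\<forall>n. \<forall>i\<le>n. Degen X n i = Degen Y n i)"

text \<open>A chain \<open>x\<^sub>0 \<leftarrow> x\<^sub>1 \<leftarrow> \<dots> \<leftarrow> x\<^sub>n\<close> of \<open>Z\<close>-indexed generalized
  elements: vertices \<open>v i\<close> for \<open>i \<le> n\<close> and arrows \<open>e i\<close> from vertex \<open>i + 1\<close> to vertex \<open>i\<close>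
  for \<open>i < n\<close>.\<close>

definition is_chain ::
  "('o, 'a, 'm) cat_scheme \<Rightarrow> ('o, 'a) icat \<Rightarrow> nat \<Rightarrow> 'o \<Rightarrow> (nat \<Rightarrow> 'a) \<Rightarrow> (nat \<Rightarrow> 'a) \<Rightarrow> bool" where
  "is_chain E A n Z v e \<longleftrightarrow>
     Z \<in> Obj E \<and>
     (\<forall>i\<le>n. v i \<in> hom E Z (O0 A)) \<and>
     (\<forall>i<n. e i \<in> hom E Z (O1 A) \<and>
        src A \<cdot>\<^bsub>E\<^esub> e i = v (Suc i) \<and> tgt A \<cdot>\<^bsub>E\<^esub> e i = v i)"

text \<open>\<open>X\<close> is a nerve of \<open>A\<close>: \<open>X\<^sub>n\<close> is the object of \<open>n\<close>-chains, i.e. a limit of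
  the zigzag \<open>A\<^sub>0 \<leftarrow> A\<^sub>1 \<rightarrow> A\<^sub>0 \<leftarrow> \<dots> \<rightarrow> A\<^sub>0\<close> (determined up to unique
  isomorphism); faces omit a vertex, composing or dropping arrows, and degeneracies insert an
  identity.  Chains are indexed against the direction of the arrows, so that \<open>d\<^sub>0\<close> of a 1-simplex
  is its source and \<open>d\<^sub>1\<close> its target; this is the convention under which the first face of the bar
  construction, given by the multiplication, is the source map.\<close>

definition is_nerve ::
  "('o, 'a, 'm) cat_scheme \<Rightarrow> ('o, 'a) icat \<Rightarrow> ('o, 'a) simp_obj \<Rightarrow> bool" where
  "is_nerve E A X \<longleftrightarrow> is_simplicial E X \<and>
     (\<exists>v e.
        (\<forall>n. is_chain E A n (SOb X n) (v n) (e n)) \<and>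
        (\<forall>n Z w g. is_chain E A n Z w g \<longrightarrow>
           (\<exists>!h. h \<in> hom E Z (SOb X n) \<and>
              (\<forall>i\<le>n. v n i \<cdot>\<^bsub>E\<^esub> h = w i) \<and> (\<forall>i<n. e n i \<cdot>\<^bsub>E\<^esub> h = g i))) \<and>
        (\<forall>n. \<forall>j\<le>Suc n.
           (\<forall>i\<le>n. v n i \<cdot>\<^bsub>E\<^esub> Face X n j = v (Suc n) (if i < j then i else Suc i)) \<and>
           (\<forall>i<n. e n i \<cdot>\<^bsub>E\<^esub> Face X n j =
              (if Suc i < j then e (Suc n) i
               else if Suc i = j then icomp E A (e (Suc n) i) (e (Suc n) (Suc i))
               else e (Suc n) (Suc i)))) \<and>
        (\<forall>n. \<forall>j\<le>n.
           (\<forall>i\<le>Suc n. v (Suc n) i \<cdot>\<^bsub>E\<^esub> Degen X n j = v n (if i \<le> j then i else i - 1)) \<and>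
           (\<forall>i<Suc n. e (Suc n) i \<cdot>\<^bsub>E\<^esub> Degen X n j =
              (if i < j then e n i
               else if i = j then idn A \<cdot>\<^bsub>E\<^esub> v n j
               else e n (i - 1)))))"

text \<open>The two-sided bar construction \<open>B\<^sub>\<star>(T, T, 1)\<close>, with \<open>T\<^sup>n\<^sup>+\<^sup>1(1)\<close> in degree \<open>n\<close>.\<close>

definition bar ::
  "('o, 'a, 'm) cat_scheme \<Rightarrow> ('o, 'a) monad \<Rightarrow> 'o \<Rightarrow> (('o, 'a) alg, ('o, 'a) alg_arr) simp_obj" where
  "bar C T one = (let
      P = (\<lambda>k. (FO T ^^ k) one);
      B = (\<lambda>n. (P (Suc n), Mu T (P n)))
    in \<lparr>SOb = B,
        Face = (\<lambda>n i. (B (Suc n), B n,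
                  if i \<le> n then (FA T ^^ i) (Mu T (P (n - i)))
                  else (FA T ^^ Suc n) (bang C one (FO T one)))),
        Degen = (\<lambda>n i. (B n, B (Suc n), (FA T ^^ Suc i) (Eps T (P (n - i)))))\<rparr>)"

record ('o, 'a) cotriple = "('o, 'a, 'o, 'a) func" +
  Counit :: "'o \<Rightarrow> 'a"
  Comult :: "'o \<Rightarrow> 'a"

definition cotriple_resolution :: "('o, 'a) cotriple \<Rightarrow> 'o \<Rightarrow> ('o, 'a) simp_obj" where
  "cotriple_resolution G x =
     \<lparr>SOb = (\<lambda>n. (FO G ^^ Suc n) x),
      Face = (\<lambda>n i. (FA G ^^ i) (Counit G ((FO G ^^ (Suc n - i)) x))),
      Degen = (\<lambda>n i. (FA G ^^ i) (Comult G ((FO G ^^ (n - i)) x)))\<rparr>"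

text \<open>The cotriple of the free-forgetful adjunction of \<open>T\<close>.\<close>

definition alg_cotriple :: "('o, 'a) monad \<Rightarrow> (('o, 'a) alg, ('o, 'a) alg_arr) cotriple" where
  "alg_cotriple T = (let free = (\<lambda>X. (FO T X, Mu T X)) in
     \<lparr>FO = (\<lambda>(X, \<xi>). free X),
      FA = (\<lambda>((X, \<xi>), (Y, \<upsilon>), f). (free X, free Y, FA T f)),
      Counit = (\<lambda>(X, \<xi>). (free X, (X, \<xi>), \<xi>)),
      Comult = (\<lambda>(X, \<xi>). (free X, free (FO T X), FA T (Eps T X)))\<rparr>)"

definition one_alg :: "('o, 'a, 'm) cat_scheme \<Rightarrow> ('o, 'a) monad \<Rightarrow> 'o \<Rightarrow> ('o, 'a) alg" where
  "one_alg C T one = (one, bang C one (FO T one))"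

end

theory Submission
  imports Defs
begin

text \<open>
  Write \<open>\<mu>\<close>, \<open>\<epsilon>\<close> for the multiplication and unit of \<open>T\<close>, \<open>!\<close> for maps to the terminal object, and
  \<open>\<alpha>\<^sub>0\<close>, \<open>\<alpha>\<^sub>1\<close> for the action of \<open>T\<close> on the objects and arrows of a categorical algebra \<open>A\<close>.

  An internal algebra in \<open>A\<close> amounts to a global object \<open>a : 1 \<rightarrow> A\<^sub>0\<close> and a map \<open>p : T(1) \<rightarrow> A\<^sub>1\<close> with
  source \<open>\<alpha>\<^sub>0 \<cdot> T(a)\<close> and target \<open>a \<cdot> !\<close>, subject to a unit law \<open>p \<cdot> \<epsilon> = id(a)\<close> and a multiplication law
  expressing \<open>p \<cdot> \<mu>\<close> as a composite in \<open>A\<close> (\<open>lax_one_iff\<close>).  A map from an object \<open>X\<close> to an algebra is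
  the same as an algebra map out of the free algebra \<open>T(X)\<close>, so \<open>a\<close> and \<open>p\<close> correspond to algebra maps \<open>T(1) \<rightarrow> A\<^sub>0\<close> and
  \<open>T(T(1)) \<rightarrow> A\<^sub>1\<close>.  The conditions on \<open>a\<close> and \<open>p\<close> then say exactly that these two maps form a functor out of
  an internal category \<open>H\<^sup>T\<close> in algebras with objects \<open>T(1)\<close>, arrows \<open>T(T(1))\<close>, source \<open>\<mu>\<close>, target
  \<open>T(!)\<close>, identities \<open>T(\<epsilon>)\<close> and composable pairs \<open>T(T(T(1)))\<close> composed by \<open>T(\<mu>)\<close>.
  Cartesianness enters here: the naturality square of \<open>\<mu>\<close> at \<open>! : T(1) \<rightarrow> 1\<close> is a pullback, which makes
  \<open>T\<^sup>3(1)\<close> the object of composable pairs, and the next such square makes \<open>T\<^sup>4(1)\<close> the object of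
  composable triples, where associativity of composition is \<open>T\<close> applied to associativity of \<open>\<mu>\<close>
  (\<open>HT_icat\<close>).  The pair \<open>(\<epsilon>\<^sub>1, \<epsilon>\<^bsub>T(1)\<^esub>)\<close> is an internal algebra \<open>gen\<close> in \<open>H\<^sup>T\<close>, and
  by the Yoneda argument of \<open>represents_by_universal_element\<close> it suffices to see that every internal algebra,
  and every morphism between internal algebras, is the image of \<open>gen\<close> under a unique strict morphism or cell
  (\<open>HT_mor_determined\<close>, \<open>HT_mor_exists\<close>, \<open>HT_cell_determined\<close>, \<open>HT_cell_exists\<close>).

  That the 2-category of categorical algebras and the 2-functor of internal algebras exist is a formal
  matter.  Internal categories form a 2-category, all of whose laws are equations between composites of
  generalized elements; a pullback preserving monad acts on it; and strict algebras and lax morphisms for a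
  2-monad on any 2-category have the required structure.

  The nerve of \<open>H\<^sup>T\<close> is the bar construction (\<open>bar_nerve\<close>).  In degree \<open>n + 1\<close> a chain consists of its
  first edge and a chain of length \<open>n\<close>, and the naturality square of \<open>\<mu>\<close> at \<open>! : T\<^sup>n(1) \<rightarrow> 1\<close> exhibits
  \<open>T\<^sup>n\<^sup>+\<^sup>2(1)\<close> as the object of such pairs.  Since the faces and degeneracies of positive index are \<open>T\<close> applied
  to those of one degree lower (or to \<open>! : T(1) \<rightarrow> 1\<close>), all identities reduce to index 0.

  Finally, representing objects are unique up to isomorphism, and a nerve determines its internal category up to
  isomorphism: objects and arrows are recovered in degrees 0 and 1, composition from the inner face of a
  2-simplex (\<open>nerve_determines_precat\<close>).  Hence both being a representing object and having the bar
  construction as nerve are equivalent to being isomorphic to \<open>H\<^sup>T\<close> (\<open>represents_iff_nerve\<close>).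
\<close>


section \<open>Calculating in a category\<close>

context category
begin

lemma hom_iff: "f \<in> hom C X Y \<longleftrightarrow> f \<in> Arr C \<and> Dom C f = X \<and> Cod C f = Y"
  by (auto simp: hom_def)

lemma comp_arr:
  assumes "f \<in> Arr C" "g \<in> Arr C" "Dom C g = Cod C f"
  shows "g \<cdot> f \<in> Arr C" "Dom C (g \<cdot> f) = Dom C f" "Cod C (g \<cdot> f) = Cod C g"
  using comp_hom[of f "Dom C f" "Cod C f" g "Cod C g"] assms by (auto simp: hom_iff)

lemma assoc:
  assumes "f \<in> Arr C" "g \<in> Arr C" "h \<in> Arr C" "Dom C g = Cod C f" "Dom C h = Cod C g"
  shows "(h \<cdot> g) \<cdot> f = h \<cdot> (g \<cdot> f)"
  using comp_assoc[of f "Dom C f" "Cod C f" g "Cod C g" h "Cod C h"] assms by (auto simp: hom_iff)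

lemma ident_arr:
  assumes "X \<in> Obj C"
  shows "Ident C X \<in> Arr C" "Dom C (Ident C X) = X" "Cod C (Ident C X) = X"
  using ident_hom[OF assms] by (auto simp: hom_iff)

lemma ident_comp: "f \<in> Arr C \<Longrightarrow> Cod C f = X \<Longrightarrow> Ident C X \<cdot> f = f"
  using ident_left[of f "Dom C f" X] by (auto simp: hom_iff)

lemma comp_ident: "f \<in> Arr C \<Longrightarrow> Dom C f = X \<Longrightarrow> f \<cdot> Ident C X = f"
  using ident_right[of f X "Cod C f"] by (auto simp: hom_iff)

text \<open>Rewriting with typing facts in the form of \<open>Arr\<close>, \<open>Dom\<close>, \<open>Cod\<close> lets the simplifier
  discharge all composability conditions by evaluation and normalize composites to the right.\<close>

lemmas cat_simps = dom_obj cod_obj comp_arr assoc ident_arr ident_comp comp_ident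

declare cat_simps [simp]

text \<open>Applies an equation \<open>g \<cdot> f = k\<close> inside a composite that is normalized to the right.\<close>

lemma reassoc:
  assumes "g \<cdot> f = k" "f \<in> Arr C" "g \<in> Arr C" "Dom C g = Cod C f" "x \<in> Arr C" "Cod C x = Dom C f"
  shows "g \<cdot> (f \<cdot> x) = k \<cdot> x"
  using assms assoc[of x f g] by simp

lemma pullbackI:
  assumes "f \<in> Arr C" "g \<in> Arr C" "p \<in> Arr C" "q \<in> Arr C"
    and "Cod C f = Cod C g" "Dom C p = Dom C q" "Cod C p = Dom C f" "Cod C q = Dom C g"
    and "f \<cdot> p = g \<cdot> q"
    and "\<And>x y. x \<in> Arr C \<Longrightarrow> y \<in> Arr C \<Longrightarrow> Cod C x = Dom C f \<Longrightarrow> Cod C y = Dom C g \<Longrightarrow>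
           Dom C x = Dom C y \<Longrightarrow> f \<cdot> x = g \<cdot> y \<Longrightarrow>
           \<exists>h. h \<in> Arr C \<and> Dom C h = Dom C x \<and> Cod C h = Dom C p \<and> p \<cdot> h = x \<and> q \<cdot> h = y"
    and "\<And>h k. h \<in> Arr C \<Longrightarrow> k \<in> Arr C \<Longrightarrow> Dom C h = Dom C k \<Longrightarrow> Cod C h = Dom C p \<Longrightarrow>
           Cod C k = Dom C p \<Longrightarrow> p \<cdot> h = p \<cdot> k \<Longrightarrow> q \<cdot> h = q \<cdot> k \<Longrightarrow> h = k"
  shows "is_pullback C f g p q"
  unfolding is_pullback_def
proof (intro conjI allI ballI impI)
  fix Z x y
  assume x: "x \<in> hom C Z (Dom C f)" and y: "y \<in> hom C Z (Dom C g)" and eq: "f \<cdot> x = g \<cdot> y"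
  obtain h where "h \<in> Arr C \<and> Dom C h = Dom C x \<and> Cod C h = Dom C p \<and> p \<cdot> h = x \<and> q \<cdot> h = y"
    using assms(10)[of x y] x y eq by (auto simp: hom_iff)
  then show "\<exists>!h. h \<in> hom C Z (Dom C p) \<and> p \<cdot> h = x \<and> q \<cdot> h = y"
    using x assms(11) by (intro ex1I[of _ h]) (auto simp: hom_iff)
qed (use assms in auto)

lemma pullback_lift:
  assumes "is_pullback C f g p q" "x \<in> Arr C" "y \<in> Arr C" "Cod C x = Dom C f" "Cod C y = Dom C g"
    "Dom C x = Dom C y" "f \<cdot> x = g \<cdot> y"
  obtains h where "h \<in> Arr C" "Dom C h = Dom C x" "Cod C h = Dom C p" "p \<cdot> h = x" "q \<cdot> h = y"
proof -
  have "x \<in> hom C (Dom C x) (Dom C f)" "y \<in> hom C (Dom C x) (Dom C g)"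
    using assms by (auto simp: hom_iff)
  then have "\<exists>!h. h \<in> hom C (Dom C x) (Dom C p) \<and> p \<cdot> h = x \<and> q \<cdot> h = y"
    using assms(1,7) unfolding is_pullback_def by blast
  then show ?thesis using that by (auto simp: hom_iff)
qed

lemma pullback_ext:
  assumes "is_pullback C f g p q" "h \<in> Arr C" "k \<in> Arr C" "Cod C h = Dom C p" "Cod C k = Dom C p"
    "Dom C h = Dom C k" "p \<cdot> h = p \<cdot> k" "q \<cdot> h = q \<cdot> k"
  shows "h = k"
proof -
  have pb: "f \<in> Arr C" "g \<in> Arr C" "p \<in> Arr C" "q \<in> Arr C" "Cod C p = Dom C f"
    "Cod C q = Dom C g" "Dom C p = Dom C q" "Cod C f = Cod C g" "f \<cdot> p = g \<cdot> q"
    using assms(1) unfolding is_pullback_def by auto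
  have "p \<cdot> h \<in> hom C (Dom C h) (Dom C f)" "q \<cdot> h \<in> hom C (Dom C h) (Dom C g)"
    using pb assms by (auto simp: hom_iff)
  moreover have "f \<cdot> (p \<cdot> h) = g \<cdot> (q \<cdot> h)"
    using pb assms by (metis assoc)
  ultimately have "\<exists>!l. l \<in> hom C (Dom C h) (Dom C p) \<and> p \<cdot> l = p \<cdot> h \<and> q \<cdot> l = q \<cdot> h"
    using assms(1) unfolding is_pullback_def by blast
  then show ?thesis using assms by (auto simp: hom_iff)
qed

end


section \<open>Generalized elements of internal categories\<close>

context category
begin

text \<open>The axioms of an internal category other than the unit and associativity laws: enough for
  composites of generalized elements to make sense.\<close>

definition is_precat :: "('o, 'a) icat \<Rightarrow> bool" where
  "is_precat A \<longleftrightarrow>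
     O0 A \<in> Obj C \<and> O1 A \<in> Obj C \<and> O2 A \<in> Obj C \<and>
     src A \<in> hom C (O1 A) (O0 A) \<and> tgt A \<in> hom C (O1 A) (O0 A) \<and>
     idn A \<in> hom C (O0 A) (O1 A) \<and>
     pr1 A \<in> hom C (O2 A) (O1 A) \<and> pr2 A \<in> hom C (O2 A) (O1 A) \<and>
     cmp A \<in> hom C (O2 A) (O1 A) \<and>
     is_pullback C (tgt A) (src A) (pr1 A) (pr2 A) \<and>
     src A \<cdot> idn A = Ident C (O0 A) \<and> tgt A \<cdot> idn A = Ident C (O0 A) \<and>
     src A \<cdot> cmp A = src A \<cdot> pr1 A \<and> tgt A \<cdot> cmp A = tgt A \<cdot> pr2 A"

lemma icat_precat [simp]: "is_icat C A \<Longrightarrow> is_precat A"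
  unfolding is_icat_def is_precat_def by (elim conjE, intro conjI)

lemma icat_typ:
  assumes "is_precat A"
  shows "O0 A \<in> Obj C" "O1 A \<in> Obj C" "O2 A \<in> Obj C"
    "src A \<in> Arr C" "tgt A \<in> Arr C" "idn A \<in> Arr C" "pr1 A \<in> Arr C" "pr2 A \<in> Arr C" "cmp A \<in> Arr C"
    "Dom C (src A) = O1 A" "Dom C (tgt A) = O1 A" "Dom C (idn A) = O0 A"
    "Dom C (pr1 A) = O2 A" "Dom C (pr2 A) = O2 A" "Dom C (cmp A) = O2 A"
    "Cod C (src A) = O0 A" "Cod C (tgt A) = O0 A" "Cod C (idn A) = O1 A"
    "Cod C (pr1 A) = O1 A" "Cod C (pr2 A) = O1 A" "Cod C (cmp A) = O1 A"
  using assms unfolding is_precat_def by (auto simp: hom_iff)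

declare icat_typ [simp]

lemma icat_pullback: "is_precat A \<Longrightarrow> is_pullback C (tgt A) (src A) (pr1 A) (pr2 A)"
  unfolding is_precat_def by auto

lemma icat_eq:
  assumes "is_precat A"
  shows "tgt A \<cdot> pr1 A = src A \<cdot> pr2 A"
    "src A \<cdot> idn A = Ident C (O0 A)" "tgt A \<cdot> idn A = Ident C (O0 A)"
    "src A \<cdot> cmp A = src A \<cdot> pr1 A" "tgt A \<cdot> cmp A = tgt A \<cdot> pr2 A"
  using assms unfolding is_precat_def is_pullback_def by auto

lemma icat_src_idn: "is_precat A \<Longrightarrow> x \<in> Arr C \<Longrightarrow> Cod C x = O0 A \<Longrightarrow> src A \<cdot> (idn A \<cdot> x) = x"
  using reassoc[OF icat_eq(2), of A x] by simp

lemma icat_tgt_idn: "is_precat A \<Longrightarrow> x \<in> Arr C \<Longrightarrow> Cod C x = O0 A \<Longrightarrow> tgt A \<cdot> (idn A \<cdot> x) = x"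
  using reassoc[OF icat_eq(3), of A x] by simp

declare icat_eq(2,3) [simp] icat_src_idn [simp] icat_tgt_idn [simp]

lemma composable_dom:
  assumes "is_precat A" "x \<in> Arr C" "y \<in> Arr C" "Cod C x = O1 A" "Cod C y = O1 A"
    "tgt A \<cdot> x = src A \<cdot> y"
  shows "Dom C y = Dom C x"
  using assms comp_arr(2)[of x "tgt A"] comp_arr(2)[of y "src A"] by simp

lemma ipair:
  assumes "is_precat A" "x \<in> Arr C" "y \<in> Arr C" "Cod C x = O1 A" "Cod C y = O1 A"
    "tgt A \<cdot> x = src A \<cdot> y"
  shows "ipair C A x y \<in> Arr C" "Dom C (ipair C A x y) = Dom C x" "Cod C (ipair C A x y) = O2 A"
    "pr1 A \<cdot> ipair C A x y = x" "pr2 A \<cdot> ipair C A x y = y"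
proof -
  have d: "Dom C x = Dom C y"
    using composable_dom[OF assms] by simp
  obtain h where h: "h \<in> Arr C" "Dom C h = Dom C x" "Cod C h = O2 A" "pr1 A \<cdot> h = x" "pr2 A \<cdot> h = y"
    using pullback_lift[OF icat_pullback[OF assms(1)], of x y] assms d by auto
  then have "\<exists>!h. h \<in> hom C (Dom C x) (O2 A) \<and> pr1 A \<cdot> h = x \<and> pr2 A \<cdot> h = y"
    using pullback_ext[OF icat_pullback[OF assms(1)]] assms(1)
    by (intro ex1I[of _ h]) (auto simp: hom_iff)
  from theI'[OF this]
  show "ipair C A x y \<in> Arr C" "Dom C (ipair C A x y) = Dom C x" "Cod C (ipair C A x y) = O2 A"
    "pr1 A \<cdot> ipair C A x y = x" "pr2 A \<cdot> ipair C A x y = y"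
    unfolding ipair_def by (auto simp: hom_iff)
qed

lemma ipair_ext:
  assumes "is_precat A" "h \<in> Arr C" "k \<in> Arr C" "Cod C h = O2 A" "Cod C k = O2 A"
    "Dom C h = Dom C k" "pr1 A \<cdot> h = pr1 A \<cdot> k" "pr2 A \<cdot> h = pr2 A \<cdot> k"
  shows "h = k"
  using pullback_ext[OF icat_pullback[OF assms(1)]] assms by auto

lemma ipair_eqI:
  assumes "is_precat A" "h \<in> Arr C" "Cod C h = O2 A" "pr1 A \<cdot> h = x" "pr2 A \<cdot> h = y"
  shows "ipair C A x y = h"
proof -
  have xy: "x \<in> Arr C" "y \<in> Arr C" "Cod C x = O1 A" "Cod C y = O1 A" "Dom C x = Dom C h"
    using assms by auto
  have "tgt A \<cdot> x = src A \<cdot> y"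
    using assms(1-3) icat_eq(1)[OF assms(1)] reassoc[OF icat_eq(1), of A h]
    unfolding assms(4,5)[symmetric] by simp
  note p = ipair[OF assms(1) xy(1-4) this]
  show ?thesis
    using p assms xy(5) by - (rule ipair_ext[OF assms(1)]; simp)
qed

lemma icomp:
  assumes "is_precat A" "x \<in> Arr C" "y \<in> Arr C" "Cod C x = O1 A" "Cod C y = O1 A"
    "tgt A \<cdot> x = src A \<cdot> y"
  shows "icomp C A y x \<in> Arr C" "Dom C (icomp C A y x) = Dom C x" "Cod C (icomp C A y x) = O1 A"
    "src A \<cdot> icomp C A y x = src A \<cdot> x" "tgt A \<cdot> icomp C A y x = tgt A \<cdot> y"
proof -
  note p = ipair[OF assms]
  show "icomp C A y x \<in> Arr C" "Dom C (icomp C A y x) = Dom C x" "Cod C (icomp C A y x) = O1 A"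
    unfolding icomp_def using p assms(1) by auto
  show "src A \<cdot> icomp C A y x = src A \<cdot> x"
    unfolding icomp_def using p assms(1) reassoc[OF icat_eq(4)[OF assms(1)], of "ipair C A x y"] by simp
  show "tgt A \<cdot> icomp C A y x = tgt A \<cdot> y"
    unfolding icomp_def using p assms(1) reassoc[OF icat_eq(5)[OF assms(1)], of "ipair C A x y"] by simp
qed

lemma icomp_comp:
  assumes "is_precat A" "x \<in> Arr C" "y \<in> Arr C" "Cod C x = O1 A" "Cod C y = O1 A"
    "tgt A \<cdot> x = src A \<cdot> y" "h \<in> Arr C" "Cod C h = Dom C x"
  shows "icomp C A y x \<cdot> h = icomp C A (y \<cdot> h) (x \<cdot> h)"
proof -
  note p = ipair[OF assms(1-6)]
  have "ipair C A (x \<cdot> h) (y \<cdot> h) = ipair C A x y \<cdot> h"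
    using p assms reassoc[OF p(4)] reassoc[OF p(5)] by (intro ipair_eqI) auto
  then show ?thesis
    unfolding icomp_def using p assms by simp
qed

lemma icomp_idn:
  assumes "is_icat C A" "x \<in> Arr C" "Cod C x = O1 A"
  shows "src A \<cdot> x = s \<Longrightarrow> icomp C A x (idn A \<cdot> s) = x"
    and "tgt A \<cdot> x = t \<Longrightarrow> icomp C A (idn A \<cdot> t) x = x"
proof -
  have x: "x \<in> hom C (Dom C x) (O1 A)"
    using assms by (simp add: hom_iff)
  have "\<forall>Z. \<forall>x\<in>hom C Z (O1 A). icomp C A x (idn A \<cdot> (src A \<cdot> x)) = x \<and>
      icomp C A (idn A \<cdot> (tgt A \<cdot> x)) x = x"
    using assms(1) unfolding is_icat_def by (elim conjE)
  note unit = bspec[OF spec[OF this] x]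
  show "icomp C A x (idn A \<cdot> s) = x" if "src A \<cdot> x = s"
    using conjunct1[OF unit] unfolding that .
  show "icomp C A (idn A \<cdot> t) x = x" if "tgt A \<cdot> x = t"
    using conjunct2[OF unit] unfolding that .
qed

lemma icomp_assoc:
  assumes "is_icat C A" "x \<in> Arr C" "y \<in> Arr C" "z \<in> Arr C"
    "Cod C x = O1 A" "Cod C y = O1 A" "Cod C z = O1 A"
    "tgt A \<cdot> x = src A \<cdot> y" "tgt A \<cdot> y = src A \<cdot> z"
  shows "icomp C A (icomp C A z y) x = icomp C A z (icomp C A y x)"
proof -
  have "Dom C y = Dom C x" "Dom C z = Dom C x"
    using composable_dom[of A x y] composable_dom[of A y z] assms by auto
  then have elts: "x \<in> hom C (Dom C x) (O1 A)" "y \<in> hom C (Dom C x) (O1 A)" "z \<in> hom C (Dom C x) (O1 A)"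
    using assms by (auto simp: hom_iff)
  have "\<forall>Z. \<forall>x\<in>hom C Z (O1 A). \<forall>y\<in>hom C Z (O1 A). \<forall>z\<in>hom C Z (O1 A).
      tgt A \<cdot> x = src A \<cdot> y \<and> tgt A \<cdot> y = src A \<cdot> z \<longrightarrow>
      icomp C A z (icomp C A y x) = icomp C A (icomp C A z y) x"
    using assms(1) unfolding is_icat_def by (elim conjE)
  from bspec[OF bspec[OF bspec[OF spec[OF this] elts(1)] elts(2)] elts(3)]
  show ?thesis
    using assms(8,9) by metis
qed

declare icomp [simp] icomp_assoc [simp] icomp_idn [simp]

lemma ifun_icat: "is_ifun C f \<Longrightarrow> IDom f = A \<Longrightarrow> is_icat C A"
  "is_ifun C f \<Longrightarrow> ICod f = B \<Longrightarrow> is_icat C B"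
  unfolding is_ifun_def Let_def by auto

lemma ifun_typ:
  assumes "is_ifun C f"
  shows "is_icat C (IDom f)" "is_icat C (ICod f)"
    "F0 f \<in> Arr C" "F1 f \<in> Arr C" "F2 f \<in> Arr C"
    "Dom C (F0 f) = O0 (IDom f)" "Dom C (F1 f) = O1 (IDom f)" "Dom C (F2 f) = O2 (IDom f)"
    "Cod C (F0 f) = O0 (ICod f)" "Cod C (F1 f) = O1 (ICod f)" "Cod C (F2 f) = O2 (ICod f)"
  using assms unfolding is_ifun_def Let_def by (auto simp: hom_iff)

declare ifun_typ [simp]

lemma ifun_eq:
  assumes "is_ifun C f" "IDom f = A" "ICod f = B"
  shows "src B \<cdot> F1 f = F0 f \<cdot> src A" "tgt B \<cdot> F1 f = F0 f \<cdot> tgt A"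
    "F1 f \<cdot> idn A = idn B \<cdot> F0 f"
    "pr1 B \<cdot> F2 f = F1 f \<cdot> pr1 A" "pr2 B \<cdot> F2 f = F1 f \<cdot> pr2 A"
    "F1 f \<cdot> cmp A = cmp B \<cdot> F2 f"
  using assms unfolding is_ifun_def Let_def by auto

lemma ifun_src: "is_ifun C f \<Longrightarrow> ICod f = B \<Longrightarrow> src B \<cdot> F1 f = F0 f \<cdot> src (IDom f)"
  and ifun_tgt: "is_ifun C f \<Longrightarrow> ICod f = B \<Longrightarrow> tgt B \<cdot> F1 f = F0 f \<cdot> tgt (IDom f)"
  and ifun_idn: "is_ifun C f \<Longrightarrow> IDom f = A \<Longrightarrow> F1 f \<cdot> idn A = idn (ICod f) \<cdot> F0 f"
  by (auto simp: ifun_eq)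

lemma ifun_src_elt: "is_ifun C f \<Longrightarrow> ICod f = B \<Longrightarrow> x \<in> Arr C \<Longrightarrow> Cod C x = O1 (IDom f) \<Longrightarrow>
    src B \<cdot> (F1 f \<cdot> x) = F0 f \<cdot> (src (IDom f) \<cdot> x)"
  using reassoc[OF ifun_src, of f B x] by auto

lemma ifun_tgt_elt: "is_ifun C f \<Longrightarrow> ICod f = B \<Longrightarrow> x \<in> Arr C \<Longrightarrow> Cod C x = O1 (IDom f) \<Longrightarrow>
    tgt B \<cdot> (F1 f \<cdot> x) = F0 f \<cdot> (tgt (IDom f) \<cdot> x)"
  using reassoc[OF ifun_tgt, of f B x] by auto

lemma ifun_idn_elt: "is_ifun C f \<Longrightarrow> IDom f = A \<Longrightarrow> x \<in> Arr C \<Longrightarrow> Cod C x = O0 A \<Longrightarrow>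
    F1 f \<cdot> (idn A \<cdot> x) = idn (ICod f) \<cdot> (F0 f \<cdot> x)"
  using reassoc[OF ifun_idn, of f A x] by auto

declare ifun_src [simp] ifun_tgt [simp] ifun_idn [simp]
  ifun_src_elt [simp] ifun_tgt_elt [simp] ifun_idn_elt [simp]

lemma ifun_F2:
  assumes "is_ifun C f"
  shows "F2 f = ipair C (ICod f) (F1 f \<cdot> pr1 (IDom f)) (F1 f \<cdot> pr2 (IDom f))"
  using assms by (intro ipair_eqI[symmetric]) (auto simp: ifun_eq)

text \<open>Functoriality can be tested on generalized elements, because the action \<open>F2\<close> on composable pairs
  commutes with pairing.\<close>

lemma ifun_icomp:
  assumes "is_ifun C f" "IDom f = A" "x \<in> Arr C" "y \<in> Arr C" "Cod C x = O1 A" "Cod C y = O1 A"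
    "tgt A \<cdot> x = src A \<cdot> y"
  shows "F1 f \<cdot> icomp C A y x = icomp C (ICod f) (F1 f \<cdot> y) (F1 f \<cdot> x)"
proof -
  have A: "is_icat C A" "is_icat C (ICod f)"
    using assms by auto
  note p = ipair[OF icat_precat[OF A(1)] assms(3-7)]
  have "ipair C (ICod f) (F1 f \<cdot> x) (F1 f \<cdot> y) = F2 f \<cdot> ipair C A x y"
    using p assms A
      reassoc[OF ifun_eq(4)[OF assms(1,2)], of "ICod f" "ipair C A x y"]
      reassoc[OF ifun_eq(5)[OF assms(1,2)], of "ICod f" "ipair C A x y"]
    by (intro ipair_eqI) auto
  then show ?thesis
    unfolding icomp_def
    using p assms A reassoc[OF ifun_eq(6)[OF assms(1,2)], of "ICod f" "ipair C A x y"] by simp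
qed

text \<open>Conversely, preservation of composition of the two projections makes a graph map a functor;
  its action on composable pairs is forced.\<close>

lemma ifunI:
  assumes "is_icat C A" "is_icat C B"
    and "f0 \<in> Arr C" "f1 \<in> Arr C" "Dom C f0 = O0 A" "Cod C f0 = O0 B" "Dom C f1 = O1 A" "Cod C f1 = O1 B"
    and "src B \<cdot> f1 = f0 \<cdot> src A" "tgt B \<cdot> f1 = f0 \<cdot> tgt A" "f1 \<cdot> idn A = idn B \<cdot> f0"
    and "f1 \<cdot> cmp A = icomp C B (f1 \<cdot> pr2 A) (f1 \<cdot> pr1 A)"
    and "f2 = ipair C B (f1 \<cdot> pr1 A) (f1 \<cdot> pr2 A)"
  shows "is_ifun C \<lparr>IDom = A, ICod = B, F0 = f0, F1 = f1, F2 = f2\<rparr>"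
proof -
  have "tgt B \<cdot> (f1 \<cdot> pr1 A) = f0 \<cdot> (tgt A \<cdot> pr1 A)" "src B \<cdot> (f1 \<cdot> pr2 A) = f0 \<cdot> (src A \<cdot> pr2 A)"
    using assms(1-8) reassoc[OF assms(9), of "pr2 A"] reassoc[OF assms(10), of "pr1 A"] by auto
  then have "tgt B \<cdot> (f1 \<cdot> pr1 A) = src B \<cdot> (f1 \<cdot> pr2 A)"
    by (simp only: icat_eq(1)[OF icat_precat[OF assms(1)]])
  moreover have "f1 \<cdot> pr1 A \<in> Arr C" "f1 \<cdot> pr2 A \<in> Arr C" "Cod C (f1 \<cdot> pr1 A) = O1 B"
      "Cod C (f1 \<cdot> pr2 A) = O1 B"
    using assms(1-8) by auto
  ultimately have p: "f2 \<in> Arr C" "Dom C f2 = O2 A" "Cod C f2 = O2 B"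
      "pr1 B \<cdot> f2 = f1 \<cdot> pr1 A" "pr2 B \<cdot> f2 = f1 \<cdot> pr2 A"
    using ipair[OF icat_precat[OF assms(2)], of "f1 \<cdot> pr1 A" "f1 \<cdot> pr2 A"] assms(1-8) unfolding assms(13) by simp_all
  have "f1 \<cdot> cmp A = cmp B \<cdot> f2"
    unfolding assms(12,13) icomp_def ..
  then show ?thesis
    unfolding is_ifun_def Let_def
    using assms(1-11) p by (simp add: hom_iff)
qed

lemma ifun_eqI:
  assumes "is_ifun C f" "is_ifun C g" "IDom f = IDom g" "ICod f = ICod g" "F0 f = F0 g" "F1 f = F1 g"
  shows "f = g"
  using assms ifun_F2[of f] ifun_F2[of g] by (cases f, cases g) simp

lemma itrans_typ:
  assumes "is_itrans C \<tau>"
  shows "is_ifun C (TDom \<tau>)" "is_ifun C (TCod \<tau>)" "IDom (TCod \<tau>) = IDom (TDom \<tau>)"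
    "ICod (TCod \<tau>) = ICod (TDom \<tau>)" "TMap \<tau> \<in> Arr C" "Dom C (TMap \<tau>) = O0 (IDom (TDom \<tau>))"
    "Cod C (TMap \<tau>) = O1 (ICod (TDom \<tau>))"
    "src (ICod (TDom \<tau>)) \<cdot> TMap \<tau> = F0 (TDom \<tau>)" "tgt (ICod (TDom \<tau>)) \<cdot> TMap \<tau> = F0 (TCod \<tau>)"
  using assms unfolding is_itrans_def Let_def by (auto simp: hom_iff)

end


section \<open>Internal categories form a 2-category\<close>

context category
begin

abbreviation Tr :: "('o, 'a) ifun \<Rightarrow> ('o, 'a) ifun \<Rightarrow> 'a \<Rightarrow> ('o, 'a) itrans" where
  "Tr f g t \<equiv> \<lparr>TDom = f, TCod = g, TMap = t\<rparr>"

text \<open>The typing facts of a transformation, expressed through names \<open>A\<close>, \<open>B\<close> of its domain and codomain: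
  used as rewrite rules, they let the simplifier decide composability.\<close>

lemma tr:
  assumes "is_itrans C (Tr f g t)" "IDom f = A" "ICod f = B"
  shows "is_ifun C f" "is_ifun C g" "IDom f = A" "ICod f = B" "IDom g = A" "ICod g = B"
    "is_icat C A" "is_icat C B" "t \<in> Arr C" "Dom C t = O0 A" "Cod C t = O1 B"
    "src B \<cdot> t = F0 f" "tgt B \<cdot> t = F0 g"
    "\<And>x. x \<in> Arr C \<Longrightarrow> Cod C x = O0 A \<Longrightarrow> src B \<cdot> (t \<cdot> x) = F0 f \<cdot> x"
    "\<And>x. x \<in> Arr C \<Longrightarrow> Cod C x = O0 A \<Longrightarrow> tgt B \<cdot> (t \<cdot> x) = F0 g \<cdot> x"
proof -
  show *: "is_ifun C f" "is_ifun C g" "IDom f = A" "ICod f = B" "IDom g = A" "ICod g = B"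
    "is_icat C A" "is_icat C B" "t \<in> Arr C" "Dom C t = O0 A" "Cod C t = O1 B"
    "src B \<cdot> t = F0 f" "tgt B \<cdot> t = F0 g"
    using itrans_typ[OF assms(1)] assms(2,3) ifun_icat by simp_all
  show "\<And>x. x \<in> Arr C \<Longrightarrow> Cod C x = O0 A \<Longrightarrow> src B \<cdot> (t \<cdot> x) = F0 f \<cdot> x"
    "\<And>x. x \<in> Arr C \<Longrightarrow> Cod C x = O0 A \<Longrightarrow> tgt B \<cdot> (t \<cdot> x) = F0 g \<cdot> x"
    using reassoc[OF *(12)] reassoc[OF *(13)] * by auto
qed

lemma tr_nat0:
  assumes "is_itrans C (Tr f g t)" "IDom f = A" "ICod f = B"
  shows "icomp C B (F1 g) (t \<cdot> src A) = icomp C B (t \<cdot> tgt A) (F1 f)"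
  using assms unfolding is_itrans_def Let_def by simp

lemma tr_nat:
  assumes "is_itrans C (Tr f g t)" "IDom f = A" "ICod f = B" "e \<in> Arr C" "Cod C e = O1 A"
  shows "icomp C B (F1 g \<cdot> e) (t \<cdot> (src A \<cdot> e)) = icomp C B (t \<cdot> (tgt A \<cdot> e)) (F1 f \<cdot> e)"
proof -
  note t = tr[OF assms(1-3)]
  have "icomp C B (F1 g) (t \<cdot> src A) \<cdot> e = icomp C B (t \<cdot> tgt A) (F1 f) \<cdot> e"
    using tr_nat0[OF assms(1-3)] by simp
  then show ?thesis
    using assms(4,5) by (simp add: icomp_comp t)
qed

lemma trI:
  assumes "is_ifun C f" "is_ifun C g" "IDom f = A" "ICod f = B" "IDom g = A" "ICod g = B"
    "t \<in> Arr C" "Dom C t = O0 A" "Cod C t = O1 B"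
    "src B \<cdot> t = F0 f" "tgt B \<cdot> t = F0 g"
    "icomp C B (F1 g) (t \<cdot> src A) = icomp C B (t \<cdot> tgt A) (F1 f)"
  shows "is_itrans C (Tr f g t)"
  using assms unfolding is_itrans_def Let_def by (simp add: hom_iff)

lemma icomp1_simps [simp]:
  "IDom (icomp1 C g f) = IDom f" "ICod (icomp1 C g f) = ICod g" "F0 (icomp1 C g f) = F0 g \<cdot> F0 f"
  "F1 (icomp1 C g f) = F1 g \<cdot> F1 f" "F2 (icomp1 C g f) = F2 g \<cdot> F2 f"
  by (auto simp: icomp1_def)

lemma ifun_comp:
  assumes "is_ifun C f" "is_ifun C g" "IDom g = ICod f"
  shows "is_ifun C (icomp1 C g f)"
proof -
  note gf = assms
  have "is_ifun C \<lparr>IDom = IDom f, ICod = ICod g, F0 = F0 g \<cdot> F0 f, F1 = F1 g \<cdot> F1 f, F2 = F2 g \<cdot> F2 f\<rparr>"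
    unfolding is_ifun_def Let_def
    using assms by (simp add: hom_iff ifun_eq[OF assms(1) refl refl]
      reassoc[OF ifun_eq(4)[OF assms(2,3) refl]] reassoc[OF ifun_eq(5)[OF assms(2,3) refl]]
      reassoc[OF ifun_eq(6)[OF assms(2,3) refl]])
  then show ?thesis by (simp add: icomp1_def)
qed

lemma id_itrans:
  assumes "is_ifun C f" "ICod f = B"
  shows "is_itrans C (Tr f f (idn B \<cdot> F0 f))"
  using assms by (intro trI) auto

lemma vcomp_itrans:
  assumes "is_itrans C (Tr f g s)" "is_itrans C (Tr g h t)" "ICod f = B"
  shows "is_itrans C (Tr f h (icomp C B t s))"
proof -
  define A where "A = IDom f"
  note s = tr[OF assms(1) A_def[symmetric] assms(3)]
  note t = tr[OF assms(2) s(5,6)]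
  note st = s t
  have "icomp C B (F1 h) (icomp C B t s \<cdot> src A) = icomp C B (icomp C B (F1 h) (t \<cdot> src A)) (s \<cdot> src A)"
    by (simp add: icomp_comp st)
  also have "\<dots> = icomp C B (icomp C B (t \<cdot> tgt A) (F1 g)) (s \<cdot> src A)"
    unfolding tr_nat0[OF assms(2) s(5,6)] ..
  also have "\<dots> = icomp C B (t \<cdot> tgt A) (icomp C B (F1 g) (s \<cdot> src A))"
    by (simp add: st)
  also have "\<dots> = icomp C B (t \<cdot> tgt A) (icomp C B (s \<cdot> tgt A) (F1 f))"
    unfolding tr_nat0[OF assms(1) s(3,4)] ..
  also have "\<dots> = icomp C B (icomp C B t s \<cdot> tgt A) (F1 f)"
    by (simp add: icomp_comp st)
  finally show ?thesis
    by (intro trI[of _ _ A B]) (simp_all add: st)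
qed

text \<open>Naturality of \<open>s\<close> at the components of \<open>t\<close>: the two ways of reading a horizontal composite.\<close>

lemma hcomp_swap:
  assumes "is_itrans C (Tr f f' t)" "is_itrans C (Tr g g' s)" "IDom g = ICod f" "ICod g = D"
  shows "icomp C D (F1 g' \<cdot> t) (s \<cdot> F0 f) = icomp C D (s \<cdot> F0 f') (F1 g \<cdot> t)"
  using tr_nat[OF assms(2,3,4), of t] tr[OF assms(1) refl refl] by simp

text \<open>Naturality is checked by moving an arrow of the domain first past \<open>t\<close>, inside \<open>g'\<close>, and then past \<open>s\<close>.\<close>

lemma hcomp_itrans:
  assumes "is_itrans C (Tr f f' t)" "is_itrans C (Tr g g' s)" "IDom g = ICod f" "ICod g = D"
  shows "is_itrans C (Tr (icomp1 C g f) (icomp1 C g' f') (icomp C D (F1 g' \<cdot> t) (s \<cdot> F0 f)))"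
proof -
  define A B where AB: "A = IDom f" "B = ICod f"
  note t = tr[OF assms(1) AB[symmetric]]
  have g: "IDom g = B" using assms(3) AB by simp
  note s = tr[OF assms(2) g assms(4)]
  note ts = t s
  let ?x = "icomp C D (F1 g' \<cdot> t) (s \<cdot> F0 f)"
  have nt: "icomp C B (F1 f') (t \<cdot> src A) = icomp C B (t \<cdot> tgt A) (F1 f)"
    by (rule tr_nat0[OF assms(1) t(3,4)])
  have "icomp C D (F1 g' \<cdot> F1 f') (?x \<cdot> src A)
      = icomp C D (icomp C D (F1 g' \<cdot> F1 f') (F1 g' \<cdot> (t \<cdot> src A))) (s \<cdot> (F0 f \<cdot> src A))"
    by (simp add: icomp_comp ts)
  also have "\<dots> = icomp C D (F1 g' \<cdot> icomp C B (F1 f') (t \<cdot> src A)) (s \<cdot> (F0 f \<cdot> src A))"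
    by (simp add: ifun_icomp ts)
  also have "\<dots> = icomp C D (F1 g' \<cdot> (t \<cdot> tgt A)) (icomp C D (F1 g' \<cdot> F1 f) (s \<cdot> (src B \<cdot> F1 f)))"
    unfolding nt by (simp add: ifun_icomp ts)
  also have "icomp C D (F1 g' \<cdot> F1 f) (s \<cdot> (src B \<cdot> F1 f)) = icomp C D (s \<cdot> (F0 f \<cdot> tgt A)) (F1 g \<cdot> F1 f)"
    using tr_nat[OF assms(2) s(3,4), of "F1 f"] by (simp add: ts)
  also have "icomp C D (F1 g' \<cdot> (t \<cdot> tgt A)) (icomp C D (s \<cdot> (F0 f \<cdot> tgt A)) (F1 g \<cdot> F1 f))
      = icomp C D (?x \<cdot> tgt A) (F1 g \<cdot> F1 f)"
    by (simp add: icomp_comp ts)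
  finally show ?thesis
    by (intro trI[of _ _ A D]) (simp_all add: ts ifun_comp)
qed

end

lemma ICat_simps [simp]:
  "Obj (ICat E) = {A. is_icat E A}" "Arr (ICat E) = {f. is_ifun E f}"
  "Dom (ICat E) = IDom" "Cod (ICat E) = ICod" "Comp (ICat E) = icomp1 E"
  "Ident (ICat E) A = \<lparr>IDom = A, ICod = A, F0 = Ident E (O0 A), F1 = Ident E (O1 A), F2 = Ident E (O2 A)\<rparr>"
  "Cell2 (ICat E) = {\<tau>. is_itrans E \<tau>}" "Dom2 (ICat E) = TDom" "Cod2 (ICat E) = TCod"
  "Id2 (ICat E) f = \<lparr>TDom = f, TCod = f, TMap = idn (ICod f) \<cdot>\<^bsub>E\<^esub> F0 f\<rparr>"
  "VComp (ICat E) \<sigma> \<tau> = \<lparr>TDom = TDom \<tau>, TCod = TCod \<sigma>, TMap = icomp E (ICod (TDom \<tau>)) (TMap \<sigma>) (TMap \<tau>)\<rparr>"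
  "HComp (ICat E) \<sigma> \<tau> = \<lparr>TDom = icomp1 E (TDom \<sigma>) (TDom \<tau>), TCod = icomp1 E (TCod \<sigma>) (TCod \<tau>),
     TMap = icomp E (ICod (TDom \<sigma>)) (F1 (TCod \<sigma>) \<cdot>\<^bsub>E\<^esub> TMap \<tau>) (TMap \<sigma> \<cdot>\<^bsub>E\<^esub> F0 (TDom \<tau>))\<rparr>"
  by (simp_all add: ICat_def)

context category
begin

lemma ident_ifun:
  assumes "is_icat C A"
  shows "is_ifun C \<lparr>IDom = A, ICod = A, F0 = Ident C (O0 A), F1 = Ident C (O1 A), F2 = Ident C (O2 A)\<rparr>"
  unfolding is_ifun_def Let_def using assms by (simp add: hom_iff)

lemma ICat_category: "category (ICat C)"
proof
  fix f assume "f \<in> Arr (ICat C)"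
  then show "Dom (ICat C) f \<in> Obj (ICat C)" "Cod (ICat C) f \<in> Obj (ICat C)"
    by auto
next
  fix A assume "A \<in> Obj (ICat C)"
  then show "Ident (ICat C) A \<in> hom (ICat C) A A"
    using ident_ifun[of A] by (simp add: hom_def)
next
  fix f X Y g Z assume "f \<in> hom (ICat C) X Y" "g \<in> hom (ICat C) Y Z"
  then show "g \<cdot>\<^bsub>ICat C\<^esub> f \<in> hom (ICat C) X Z"
    using ifun_comp by (simp add: hom_def)
next
  fix f X Y g Z h W assume "f \<in> hom (ICat C) X Y" "g \<in> hom (ICat C) Y Z" "h \<in> hom (ICat C) Z W"
  then show "(h \<cdot>\<^bsub>ICat C\<^esub> g) \<cdot>\<^bsub>ICat C\<^esub> f = h \<cdot>\<^bsub>ICat C\<^esub> (g \<cdot>\<^bsub>ICat C\<^esub> f)"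
    by (auto simp add: hom_def icomp1_def)
next
  fix f X Y assume "f \<in> hom (ICat C) X Y"
  then show "Ident (ICat C) Y \<cdot>\<^bsub>ICat C\<^esub> f = f" "f \<cdot>\<^bsub>ICat C\<^esub> Ident (ICat C) X = f"
    by (auto simp add: hom_def icomp1_def intro!: ifun.equality)
qed

lemma cell_ICat: "\<tau> \<in> cell (ICat C) f g \<longleftrightarrow> \<tau> = Tr f g (TMap \<tau>) \<and> is_itrans C (Tr f g (TMap \<tau>))"
  by (cases \<tau>) (auto simp: cell_def)

lemma cell_ICatE:
  assumes "\<tau> \<in> cell (ICat C) f g"
  obtains t where "\<tau> = Tr f g t" "is_itrans C (Tr f g t)"
  using assms cell_ICat by blast

lemma ICat_hom_category:
  shows "category (hom_cat (ICat C) A B)"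
proof -
  let ?H = "hom_cat (ICat C) A B"
  have hom: "\<tau> \<in> hom ?H f g \<longleftrightarrow> \<tau> \<in> cell (ICat C) f g \<and> IDom f = A \<and> ICod f = B" for \<tau> f g
    using itrans_typ[of \<tau>] by (auto simp: hom_def cell_def hom_cat_def)
  show ?thesis
  proof
    fix \<tau> assume "\<tau> \<in> Arr ?H"
    then show "Dom ?H \<tau> \<in> Obj ?H" "Cod ?H \<tau> \<in> Obj ?H"
      by (auto simp: hom_cat_def)
  next
    fix f assume "f \<in> Obj ?H"
    then show "Ident ?H f \<in> hom ?H f f"
      using id_itrans[OF _ refl] by (auto simp: hom_cat_def hom_def)
  next
    fix \<tau> f g \<sigma> h assume *: "\<tau> \<in> hom ?H f g" "\<sigma> \<in> hom ?H g h"
    then obtain s t where "\<tau> = Tr f g t" "is_itrans C (Tr f g t)" "\<sigma> = Tr g h s" "is_itrans C (Tr g h s)"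
      using hom by (metis cell_ICatE)
    then show "\<sigma> \<cdot>\<^bsub>?H\<^esub> \<tau> \<in> hom ?H f h"
      unfolding hom using * vcomp_itrans[of f g t h s B]
      by (auto simp: cell_ICat hom) (auto simp: hom_cat_def)
  next
    fix \<tau> f g \<sigma> h \<rho> k assume *: "\<tau> \<in> hom ?H f g" "\<sigma> \<in> hom ?H g h" "\<rho> \<in> hom ?H h k"
    then obtain s t r where "\<tau> = Tr f g t" "\<sigma> = Tr g h s" "\<rho> = Tr h k r"
      and trs: "is_itrans C (Tr f g t)" "is_itrans C (Tr g h s)" "is_itrans C (Tr h k r)"
      using hom by (metis cell_ICatE)
    moreover have "IDom f = A" "ICod f = B"
      using * hom by auto
    note t = tr[OF trs(1) this]
    note s = tr[OF trs(2) t(5,6)]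
    note r = tr[OF trs(3) s(5,6)]
    ultimately show "(\<rho> \<cdot>\<^bsub>?H\<^esub> \<sigma>) \<cdot>\<^bsub>?H\<^esub> \<tau> = \<rho> \<cdot>\<^bsub>?H\<^esub> (\<sigma> \<cdot>\<^bsub>?H\<^esub> \<tau>)"
      by (simp add: hom_cat_def t s r)
  next
    fix \<tau> f g assume *: "\<tau> \<in> hom ?H f g"
    then obtain t where "\<tau> = Tr f g t" and t: "is_itrans C (Tr f g t)"
      using hom by (metis cell_ICatE)
    moreover have "IDom f = A" "ICod f = B"
      using * hom by auto
    note t = tr[OF t this]
    ultimately show "Ident ?H g \<cdot>\<^bsub>?H\<^esub> \<tau> = \<tau>" "\<tau> \<cdot>\<^bsub>?H\<^esub> Ident ?H f = \<tau>"
      by (simp_all add: hom_cat_def t)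
  qed
qed

text \<open>Among the equations, interchange rests on naturality, through \<open>hcomp_swap\<close>; the others hold for
  composites of generalized elements and their images under internal functors.\<close>

theorem ICat_two_category: "two_category (ICat C)"
proof (intro two_category.intro two_category_axioms.intro)
  show "category (ICat C)" by (rule ICat_category)
next
  fix \<theta> assume "\<theta> \<in> Cell2 (ICat C)"
  then show "\<exists>A B. Dom2 (ICat C) \<theta> \<in> hom (ICat C) A B \<and> Cod2 (ICat C) \<theta> \<in> hom (ICat C) A B"
    using itrans_typ[of \<theta>] by (auto simp: hom_def)
next
  fix A B assume "A \<in> Obj (ICat C)" "B \<in> Obj (ICat C)"
  show "category (hom_cat (ICat C) A B)"
    by (rule ICat_hom_category)
next
  fix f A B g D \<tau> f' \<sigma> g'
  assume *: "f \<in> hom (ICat C) A B" "g \<in> hom (ICat C) B D" "\<tau> \<in> cell (ICat C) f f'" "\<sigma> \<in> cell (ICat C) g g'"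
  obtain t where t: "\<tau> = Tr f f' t" "is_itrans C (Tr f f' t)" using *(3) by (rule cell_ICatE)
  obtain s where s: "\<sigma> = Tr g g' s" "is_itrans C (Tr g g' s)" using *(4) by (rule cell_ICatE)
  show "\<sigma> \<star>\<^bsub>ICat C\<^esub> \<tau> \<in> cell (ICat C) (g \<cdot>\<^bsub>ICat C\<^esub> f) (g' \<cdot>\<^bsub>ICat C\<^esub> f')"
    using hcomp_itrans[OF t(2) s(2), of D] *(1,2) by (simp add: cell_ICat t(1) s(1) hom_def)
next
  fix f A B g D
  assume "f \<in> hom (ICat C) A B" "g \<in> hom (ICat C) B D"
  then show "Id2 (ICat C) g \<star>\<^bsub>ICat C\<^esub> Id2 (ICat C) f = Id2 (ICat C) (g \<cdot>\<^bsub>ICat C\<^esub> f)"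
    by (auto simp: hom_def)
next
  fix f A B g D \<tau> f' \<tau>' f'' \<sigma> g' \<sigma>' g''
  assume *: "f \<in> hom (ICat C) A B" "g \<in> hom (ICat C) B D"
    "\<tau> \<in> cell (ICat C) f f'" "\<tau>' \<in> cell (ICat C) f' f''"
    "\<sigma> \<in> cell (ICat C) g g'" "\<sigma>' \<in> cell (ICat C) g' g''"
  obtain t where t: "\<tau> = Tr f f' t" "is_itrans C (Tr f f' t)" using *(3) by (rule cell_ICatE)
  obtain t' where t': "\<tau>' = Tr f' f'' t'" "is_itrans C (Tr f' f'' t')" using *(4) by (rule cell_ICatE)
  obtain s where s: "\<sigma> = Tr g g' s" "is_itrans C (Tr g g' s)" using *(5) by (rule cell_ICatE)
  obtain s' where s': "\<sigma>' = Tr g' g'' s'" "is_itrans C (Tr g' g'' s')" using *(6) by (rule cell_ICatE)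
  have fg: "IDom f = A" "ICod f = B" "IDom g = B" "ICod g = D"
    using *(1,2) by (auto simp: hom_def)
  note tt = tr[OF t(2) fg(1,2)] and ss = tr[OF s(2) fg(3,4)]
  note trs = tt ss tr[OF t'(2) tt(5,6)] tr[OF s'(2) ss(5,6)]
  let ?c = "icomp C D"
  have "?c (F1 g'' \<cdot> icomp C B t' t) (?c s' s \<cdot> F0 f)
      = ?c (F1 g'' \<cdot> t') (?c (?c (F1 g'' \<cdot> t) (s' \<cdot> F0 f)) (s \<cdot> F0 f))"
    by (simp add: ifun_icomp icomp_comp trs)
  also have "?c (F1 g'' \<cdot> t) (s' \<cdot> F0 f) = ?c (s' \<cdot> F0 f') (F1 g' \<cdot> t)"
    using hcomp_swap[OF t(2) s'(2), of D] by (simp add: trs)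
  also have "?c (F1 g'' \<cdot> t') (?c (?c (s' \<cdot> F0 f') (F1 g' \<cdot> t)) (s \<cdot> F0 f))
      = ?c (?c (F1 g'' \<cdot> t') (s' \<cdot> F0 f')) (?c (F1 g' \<cdot> t) (s \<cdot> F0 f))"
    by (simp add: trs)
  finally show "(\<sigma>' \<bullet>\<^bsub>ICat C\<^esub> \<sigma>) \<star>\<^bsub>ICat C\<^esub> (\<tau>' \<bullet>\<^bsub>ICat C\<^esub> \<tau>)
      = (\<sigma>' \<star>\<^bsub>ICat C\<^esub> \<tau>') \<bullet>\<^bsub>ICat C\<^esub> (\<sigma> \<star>\<^bsub>ICat C\<^esub> \<tau>)"
    by (simp add: t t' s s' trs)
next
  fix f A B g D h E \<tau> f' \<sigma> g' \<rho> h'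
  assume *: "f \<in> hom (ICat C) A B" "g \<in> hom (ICat C) B D" "h \<in> hom (ICat C) D E"
    "\<tau> \<in> cell (ICat C) f f'" "\<sigma> \<in> cell (ICat C) g g'" "\<rho> \<in> cell (ICat C) h h'"
  obtain t where t: "\<tau> = Tr f f' t" "is_itrans C (Tr f f' t)" using *(4) by (rule cell_ICatE)
  obtain s where s: "\<sigma> = Tr g g' s" "is_itrans C (Tr g g' s)" using *(5) by (rule cell_ICatE)
  obtain r where r: "\<rho> = Tr h h' r" "is_itrans C (Tr h h' r)" using *(6) by (rule cell_ICatE)
  have fg: "IDom f = A" "ICod f = B" "IDom g = B" "ICod g = D" "IDom h = D" "ICod h = E"
    using *(1-3) by (auto simp: hom_def)
  show "(\<rho> \<star>\<^bsub>ICat C\<^esub> \<sigma>) \<star>\<^bsub>ICat C\<^esub> \<tau> = \<rho> \<star>\<^bsub>ICat C\<^esub> (\<sigma> \<star>\<^bsub>ICat C\<^esub> \<tau>)"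
    using tr[OF t(2) fg(1,2)] tr[OF s(2) fg(3,4)] tr[OF r(2) fg(5,6)]
    by (simp add: t(1) s(1) r(1) ifun_icomp icomp_comp icomp1_def)
next
  fix f A B \<tau> f'
  assume *: "f \<in> hom (ICat C) A B" "\<tau> \<in> cell (ICat C) f f'"
  obtain t where t: "\<tau> = Tr f f' t" "is_itrans C (Tr f f' t)" using *(2) by (rule cell_ICatE)
  show "Id2 (ICat C) (Ident (ICat C) B) \<star>\<^bsub>ICat C\<^esub> \<tau> = \<tau>" "\<tau> \<star>\<^bsub>ICat C\<^esub> Id2 (ICat C) (Ident (ICat C) A) = \<tau>"
    using *(1) tr[OF t(2), of A B] by (auto simp: t(1) hom_def icomp1_def intro!: ifun.equality)
qed

end


section \<open>Calculating in a 2-category\<close>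

context two_category
begin

lemma cell_typ:
  assumes "\<theta> \<in> Cell2 K"
  shows "Dom2 K \<theta> \<in> Arr K" "Cod2 K \<theta> \<in> Arr K" "Dom K (Cod2 K \<theta>) = Dom K (Dom2 K \<theta>)"
    "Cod K (Cod2 K \<theta>) = Cod K (Dom2 K \<theta>)"
  using cell2_parallel[OF assms] by (auto simp: hom_iff)

declare cell_typ [simp]

lemma cell_iff: "\<theta> \<in> cell K f g \<longleftrightarrow> \<theta> \<in> Cell2 K \<and> Dom2 K \<theta> = f \<and> Cod2 K \<theta> = g"
  by (auto simp: cell_def)

lemma hom_cat_category: "\<theta> \<in> Cell2 K \<Longrightarrow> category (hom_cat K (Dom K (Dom2 K \<theta>)) (Cod K (Dom2 K \<theta>)))"
  by (rule hom_category) auto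

lemma id2_typ:
  assumes "f \<in> Arr K"
  shows "Id2 K f \<in> Cell2 K" "Dom2 K (Id2 K f) = f" "Cod2 K (Id2 K f) = f"
proof -
  have "category (hom_cat K (Dom K f) (Cod K f))"
    using assms by (intro hom_category) auto
  then have "Id2 K f \<in> hom (hom_cat K (Dom K f) (Cod K f)) f f"
    using category.ident_hom[of "hom_cat K (Dom K f) (Cod K f)" f] assms
    by (simp add: hom_cat_def hom_iff)
  then show "Id2 K f \<in> Cell2 K" "Dom2 K (Id2 K f) = f" "Cod2 K (Id2 K f) = f"
    by (auto simp: hom_def hom_cat_def)
qed

lemma vcomp_typ:
  assumes "\<sigma> \<in> Cell2 K" "\<tau> \<in> Cell2 K" "Dom2 K \<sigma> = Cod2 K \<tau>"
  shows "\<sigma> \<bullet> \<tau> \<in> Cell2 K" "Dom2 K (\<sigma> \<bullet> \<tau>) = Dom2 K \<tau>" "Cod2 K (\<sigma> \<bullet> \<tau>) = Cod2 K \<sigma>"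
proof -
  let ?H = "hom_cat K (Dom K (Dom2 K \<tau>)) (Cod K (Dom2 K \<tau>))"
  have "\<sigma> \<bullet> \<tau> \<in> hom ?H (Dom2 K \<tau>) (Cod2 K \<sigma>)"
    using category.comp_hom[OF hom_cat_category[OF assms(2)], of \<tau> "Dom2 K \<tau>" "Cod2 K \<tau>" \<sigma> "Cod2 K \<sigma>"]
      assms cell_typ[OF assms(1)] cell_typ[OF assms(2)]
    by (simp add: hom_cat_def hom_def)
  then show "\<sigma> \<bullet> \<tau> \<in> Cell2 K" "Dom2 K (\<sigma> \<bullet> \<tau>) = Dom2 K \<tau>" "Cod2 K (\<sigma> \<bullet> \<tau>) = Cod2 K \<sigma>"
    by (auto simp: hom_def hom_cat_def)
qed

lemma vcomp_assoc:
  assumes "\<rho> \<in> Cell2 K" "\<sigma> \<in> Cell2 K" "\<tau> \<in> Cell2 K" "Dom2 K \<rho> = Cod2 K \<sigma>" "Dom2 K \<sigma> = Cod2 K \<tau>"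
  shows "(\<rho> \<bullet> \<sigma>) \<bullet> \<tau> = \<rho> \<bullet> (\<sigma> \<bullet> \<tau>)"
  using category.comp_assoc[OF hom_cat_category[OF assms(3)],
      of \<tau> "Dom2 K \<tau>" "Cod2 K \<tau>" \<sigma> "Cod2 K \<sigma>" \<rho> "Cod2 K \<rho>"]
    assms cell_typ[OF assms(1)] cell_typ[OF assms(2)] cell_typ[OF assms(3)]
  by (simp add: hom_cat_def hom_def)

lemma vcomp_id2:
  assumes "\<tau> \<in> Cell2 K"
  shows "Cod2 K \<tau> = f \<Longrightarrow> Id2 K f \<bullet> \<tau> = \<tau>" "Dom2 K \<tau> = f \<Longrightarrow> \<tau> \<bullet> Id2 K f = \<tau>"
  using category.ident_left[OF hom_cat_category[OF assms], of \<tau> "Dom2 K \<tau>" "Cod2 K \<tau>"]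
    category.ident_right[OF hom_cat_category[OF assms], of \<tau> "Dom2 K \<tau>" "Cod2 K \<tau>"]
    assms cell_typ[OF assms]
  by (auto simp add: hom_cat_def hom_def)

lemma hcomp_typ:
  assumes "\<sigma> \<in> Cell2 K" "\<tau> \<in> Cell2 K" "Dom K (Dom2 K \<sigma>) = Cod K (Dom2 K \<tau>)"
  shows "\<sigma> \<star> \<tau> \<in> Cell2 K" "Dom2 K (\<sigma> \<star> \<tau>) = Dom2 K \<sigma> \<cdot> Dom2 K \<tau>" "Cod2 K (\<sigma> \<star> \<tau>) = Cod2 K \<sigma> \<cdot> Cod2 K \<tau>"
  using hcomp_cell[of "Dom2 K \<tau>" "Dom K (Dom2 K \<tau>)" "Cod K (Dom2 K \<tau>)" "Dom2 K \<sigma>" "Cod K (Dom2 K \<sigma>)"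
      \<tau> "Cod2 K \<tau>" \<sigma> "Cod2 K \<sigma>"] assms
  by (auto simp: hom_iff cell_iff)

lemma hcomp_id2s:
  "f \<in> Arr K \<Longrightarrow> g \<in> Arr K \<Longrightarrow> Dom K g = Cod K f \<Longrightarrow> Id2 K g \<star> Id2 K f = Id2 K (g \<cdot> f)"
  using hcomp_id2[of f "Dom K f" "Cod K f" g "Cod K g"] by (auto simp: hom_iff)

lemma hassoc:
  assumes "\<rho> \<in> Cell2 K" "\<sigma> \<in> Cell2 K" "\<tau> \<in> Cell2 K" "Dom K (Dom2 K \<sigma>) = Cod K (Dom2 K \<tau>)"
    "Dom K (Dom2 K \<rho>) = Cod K (Dom2 K \<sigma>)"
  shows "(\<rho> \<star> \<sigma>) \<star> \<tau> = \<rho> \<star> (\<sigma> \<star> \<tau>)"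
  using hcomp_assoc[of "Dom2 K \<tau>" "Dom K (Dom2 K \<tau>)" "Cod K (Dom2 K \<tau>)" "Dom2 K \<sigma>" "Cod K (Dom2 K \<sigma>)"
      "Dom2 K \<rho>" "Cod K (Dom2 K \<rho>)" \<tau> "Cod2 K \<tau>" \<sigma> "Cod2 K \<sigma>" \<rho> "Cod2 K \<rho>"] assms
  by (auto simp: hom_iff cell_iff)

lemma hcomp_ident:
  assumes "\<tau> \<in> Cell2 K"
  shows "Cod K (Dom2 K \<tau>) = B \<Longrightarrow> Id2 K (Ident K B) \<star> \<tau> = \<tau>"
    "Dom K (Dom2 K \<tau>) = A \<Longrightarrow> \<tau> \<star> Id2 K (Ident K A) = \<tau>"
  using hcomp_unit_left[of "Dom2 K \<tau>" "Dom K (Dom2 K \<tau>)" "Cod K (Dom2 K \<tau>)" \<tau> "Cod2 K \<tau>"]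
    hcomp_unit_right[of "Dom2 K \<tau>" "Dom K (Dom2 K \<tau>)" "Cod K (Dom2 K \<tau>)" \<tau> "Cod2 K \<tau>"] assms
  by (auto simp: hom_iff cell_iff)

lemma middle_four:
  assumes "\<sigma> \<in> Cell2 K" "\<sigma>' \<in> Cell2 K" "\<tau> \<in> Cell2 K" "\<tau>' \<in> Cell2 K"
    "Dom2 K \<tau>' = Cod2 K \<tau>" "Dom2 K \<sigma>' = Cod2 K \<sigma>" "Dom K (Dom2 K \<sigma>) = Cod K (Dom2 K \<tau>)"
  shows "(\<sigma>' \<star> \<tau>') \<bullet> (\<sigma> \<star> \<tau>) = (\<sigma>' \<bullet> \<sigma>) \<star> (\<tau>' \<bullet> \<tau>)"
  using interchange[of "Dom2 K \<tau>" "Dom K (Dom2 K \<tau>)" "Cod K (Dom2 K \<tau>)" "Dom2 K \<sigma>" "Cod K (Dom2 K \<sigma>)"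
      \<tau> "Cod2 K \<tau>" \<tau>' "Cod2 K \<tau>'" \<sigma> "Cod2 K \<sigma>" \<sigma>' "Cod2 K \<sigma>'"] assms
  by (auto simp: hom_iff cell_iff)

lemmas cell_simps = id2_typ vcomp_typ vcomp_assoc vcomp_id2 hcomp_typ hcomp_id2s hassoc hcomp_ident

declare cell_simps [simp]

lemma whisker_id2:
  "f \<in> Arr K \<Longrightarrow> g \<in> Arr K \<Longrightarrow> \<tau> \<in> Cell2 K \<Longrightarrow> Dom K g = Cod K f \<Longrightarrow> Dom K f = Cod K (Dom2 K \<tau>) \<Longrightarrow>
    Id2 K g \<star> (Id2 K f \<star> \<tau>) = Id2 K (g \<cdot> f) \<star> \<tau>"
  using hassoc[of "Id2 K g" "Id2 K f" \<tau>] by simp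

lemma whisker_left:
  assumes "h \<in> Arr K" "\<sigma> \<in> Cell2 K" "\<tau> \<in> Cell2 K" "Dom2 K \<sigma> = Cod2 K \<tau>" "Dom K h = Cod K (Dom2 K \<tau>)"
  shows "Id2 K h \<star> (\<sigma> \<bullet> \<tau>) = (Id2 K h \<star> \<sigma>) \<bullet> (Id2 K h \<star> \<tau>)"
  using middle_four[of "Id2 K h" "Id2 K h" \<tau> \<sigma>] assms by simp

lemma whisker_right:
  assumes "h \<in> Arr K" "\<sigma> \<in> Cell2 K" "\<tau> \<in> Cell2 K" "Dom2 K \<sigma> = Cod2 K \<tau>" "Dom K (Dom2 K \<tau>) = Cod K h"
  shows "(\<sigma> \<bullet> \<tau>) \<star> Id2 K h = (\<sigma> \<star> Id2 K h) \<bullet> (\<tau> \<star> Id2 K h)"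
  using middle_four[of \<tau> \<sigma> "Id2 K h" "Id2 K h"] assms by simp

text \<open>Interchange of whiskerings: the origin of all naturality squares of induced transformations.\<close>

lemma whisker_exchange:
  assumes "\<sigma> \<in> Cell2 K" "\<tau> \<in> Cell2 K" "Dom K (Dom2 K \<sigma>) = Cod K (Dom2 K \<tau>)"
  shows "(\<sigma> \<star> Id2 K (Cod2 K \<tau>)) \<bullet> (Id2 K (Dom2 K \<sigma>) \<star> \<tau>) = \<sigma> \<star> \<tau>"
    and "(Id2 K (Cod2 K \<sigma>) \<star> \<tau>) \<bullet> (\<sigma> \<star> Id2 K (Dom2 K \<tau>)) = \<sigma> \<star> \<tau>"
  using middle_four[of "Id2 K (Dom2 K \<sigma>)" \<sigma> \<tau> "Id2 K (Cod2 K \<tau>)"]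
    middle_four[of \<sigma> "Id2 K (Cod2 K \<sigma>)" "Id2 K (Dom2 K \<tau>)" \<tau>] assms by simp_all

end


section \<open>Strict algebras for a 2-monad and lax morphisms between them\<close>

text \<open>A strict 2-functor with typed 1-cells as multiplication and unit: the setting in which strict algebras
  form a 2-category and the lax morphisms out of a fixed algebra are 2-functorial in their target.\<close>

locale two_endofunctor = two_category K for K :: "('o, 'f, 't) cat2" (structure) +
  fixes M :: "('o, 'f, 't) monad2"
  assumes M0_obj: "A \<in> Obj K \<Longrightarrow> M0 M A \<in> Obj K"
    and M1_hom: "f \<in> hom K A B \<Longrightarrow> M1 M f \<in> hom K (M0 M A) (M0 M B)"
    and M1_ident: "A \<in> Obj K \<Longrightarrow> M1 M (Ident K A) = Ident K (M0 M A)"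
    and M1_comp: "\<lbrakk>f \<in> hom K A B; g \<in> hom K B D\<rbrakk> \<Longrightarrow> M1 M (g \<cdot> f) = M1 M g \<cdot> M1 M f"
    and M2_cell: "\<tau> \<in> cell K f g \<Longrightarrow> M2 M \<tau> \<in> cell K (M1 M f) (M1 M g)"
    and M2_id2: "f \<in> Arr K \<Longrightarrow> M2 M (Id2 K f) = Id2 K (M1 M f)"
    and M2_vcomp: "\<lbrakk>\<tau> \<in> cell K f g; \<sigma> \<in> cell K g h\<rbrakk> \<Longrightarrow> M2 M (\<sigma> \<bullet> \<tau>) = M2 M \<sigma> \<bullet> M2 M \<tau>"
    and M2_hcomp: "\<lbrakk>f \<in> hom K A B; g \<in> hom K B D; \<tau> \<in> cell K f f'; \<sigma> \<in> cell K g g'\<rbrakk>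
           \<Longrightarrow> M2 M (\<sigma> \<star> \<tau>) = M2 M \<sigma> \<star> M2 M \<tau>"
    and Mu2_hom: "A \<in> Obj K \<Longrightarrow> Mu2 M A \<in> hom K (M0 M (M0 M A)) (M0 M A)"
    and Eps2_hom: "A \<in> Obj K \<Longrightarrow> Eps2 M A \<in> hom K A (M0 M A)"
begin

lemma M_typ:
  "f \<in> Arr K \<Longrightarrow> M1 M f \<in> Arr K"
  "f \<in> Arr K \<Longrightarrow> Dom K (M1 M f) = M0 M (Dom K f)"
  "f \<in> Arr K \<Longrightarrow> Cod K (M1 M f) = M0 M (Cod K f)"
  "\<lbrakk>f \<in> Arr K; g \<in> Arr K; Dom K g = Cod K f\<rbrakk> \<Longrightarrow> M1 M (g \<cdot> f) = M1 M g \<cdot> M1 M f"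
  "\<tau> \<in> Cell2 K \<Longrightarrow> M2 M \<tau> \<in> Cell2 K"
  "\<tau> \<in> Cell2 K \<Longrightarrow> Dom2 K (M2 M \<tau>) = M1 M (Dom2 K \<tau>)"
  "\<tau> \<in> Cell2 K \<Longrightarrow> Cod2 K (M2 M \<tau>) = M1 M (Cod2 K \<tau>)"
  "\<lbrakk>\<sigma> \<in> Cell2 K; \<tau> \<in> Cell2 K; Dom2 K \<sigma> = Cod2 K \<tau>\<rbrakk> \<Longrightarrow> M2 M (\<sigma> \<bullet> \<tau>) = M2 M \<sigma> \<bullet> M2 M \<tau>"
  "\<lbrakk>\<sigma> \<in> Cell2 K; \<tau> \<in> Cell2 K; Dom K (Dom2 K \<sigma>) = Cod K (Dom2 K \<tau>)\<rbrakk> \<Longrightarrow>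
     M2 M (\<sigma> \<star> \<tau>) = M2 M \<sigma> \<star> M2 M \<tau>"
  "A \<in> Obj K \<Longrightarrow> Mu2 M A \<in> Arr K" "A \<in> Obj K \<Longrightarrow> Dom K (Mu2 M A) = M0 M (M0 M A)"
  "A \<in> Obj K \<Longrightarrow> Cod K (Mu2 M A) = M0 M A"
  "A \<in> Obj K \<Longrightarrow> Eps2 M A \<in> Arr K" "A \<in> Obj K \<Longrightarrow> Dom K (Eps2 M A) = A"
  "A \<in> Obj K \<Longrightarrow> Cod K (Eps2 M A) = M0 M A"
  using M1_hom[of f "Dom K f" "Cod K f"] M2_cell[of \<tau> "Dom2 K \<tau>" "Cod2 K \<tau>"] Mu2_hom[of A] Eps2_hom[of A]
    M1_comp[of f "Dom K f" "Cod K f" g "Cod K g"]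
    M2_vcomp[of \<tau> "Dom2 K \<tau>" "Cod2 K \<tau>" \<sigma> "Cod2 K \<sigma>"]
    M2_hcomp[of "Dom2 K \<tau>" "Dom K (Dom2 K \<tau>)" "Cod K (Dom2 K \<tau>)" "Dom2 K \<sigma>" "Cod K (Dom2 K \<sigma>)"
      \<tau> "Cod2 K \<tau>" \<sigma> "Cod2 K \<sigma>"]
  by (auto simp: hom_iff cell_iff)

declare M_typ [simp] M0_obj [simp] M1_ident [simp] M2_id2 [simp]

lemma Alg2_simps:
  "Obj (Alg2 K M) = strict_algs K M"
  "Dom (Alg2 K M) (x, y, f) = x" "Cod (Alg2 K M) (x, y, f) = y"
  "Ident (Alg2 K M) x = (x, x, Ident K (fst x))"
  "Comp (Alg2 K M) (y, z, g) (x, y', f) = (x, z, g \<cdot> f)"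
  "Dom2 (Alg2 K M) (x, y, \<theta>) = (x, y, Dom2 K \<theta>)" "Cod2 (Alg2 K M) (x, y, \<theta>) = (x, y, Cod2 K \<theta>)"
  "Id2 (Alg2 K M) (x, y, f) = (x, y, Id2 K f)"
  "VComp (Alg2 K M) (x, y, \<theta>') (x', y', \<theta>) = (x, y, \<theta>' \<bullet> \<theta>)"
  "HComp (Alg2 K M) (y, z, \<sigma>) (x, y', \<tau>) = (x, z, \<sigma> \<star> \<tau>)"
  by (simp_all add: Alg2_def Let_def)

declare Alg2_simps [simp]

lemma strict_alg_typ:
  assumes "x \<in> strict_algs K M"
  shows "fst x \<in> Obj K" "snd x \<in> Arr K" "Dom K (snd x) = M0 M (fst x)" "Cod K (snd x) = fst x"
  using assms by (auto simp: strict_algs_def hom_iff)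

declare strict_alg_typ [simp]

lemma Alg2_arr: "(x, y, f) \<in> Arr (Alg2 K M) \<longleftrightarrow> x \<in> strict_algs K M \<and> y \<in> strict_algs K M \<and>
    f \<in> Arr K \<and> Dom K f = fst x \<and> Cod K f = fst y \<and> f \<cdot> snd x = snd y \<cdot> M1 M f"
  by (auto simp: Alg2_def Let_def hom_iff)

lemma Alg2_cell: "(x, y, \<theta>) \<in> Cell2 (Alg2 K M) \<longleftrightarrow> \<theta> \<in> Cell2 K \<and>
    (x, y, Dom2 K \<theta>) \<in> Arr (Alg2 K M) \<and> (x, y, Cod2 K \<theta>) \<in> Arr (Alg2 K M) \<and>
    \<theta> \<star> Id2 K (snd x) = Id2 K (snd y) \<star> M2 M \<theta>"
  by (auto simp: Alg2_def Let_def)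

lemma Alg2_hom: "u \<in> hom (Alg2 K M) x y \<longleftrightarrow> u = (x, y, snd (snd u)) \<and> (x, y, snd (snd u)) \<in> Arr (Alg2 K M)"
  by (cases u) (auto simp: hom_def)

lemma Alg2_homE:
  assumes "u \<in> hom (Alg2 K M) x y"
  obtains f where "u = (x, y, f)" "(x, y, f) \<in> Arr (Alg2 K M)"
  using assms Alg2_hom by blast

lemma Alg2_cellE:
  assumes "w \<in> cell (Alg2 K M) (x, y, f) v"
  obtains \<theta> where "w = (x, y, \<theta>)" "(x, y, \<theta>) \<in> Cell2 (Alg2 K M)" "v = (x, y, Cod2 K \<theta>)" "Dom2 K \<theta> = f"
  using assms by (cases w) (auto simp: cell_def)

lemma reassocK:
  assumes "g \<cdot> f = k \<cdot> l" "f \<in> Arr K" "g \<in> Arr K" "Dom K g = Cod K f" "x \<in> Arr K" "Cod K x = Dom K f"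
    "k \<in> Arr K" "l \<in> Arr K" "Dom K k = Cod K l" "Dom K l = Dom K f"
  shows "g \<cdot> (f \<cdot> x) = k \<cdot> (l \<cdot> x)"
  using assms assoc[of x f g] assoc[of x l k] by simp

lemma Alg2_arr_comp:
  assumes "(x, y, f) \<in> Arr (Alg2 K M)" "(y, z, g) \<in> Arr (Alg2 K M)"
  shows "(x, z, g \<cdot> f) \<in> Arr (Alg2 K M)"
  using assms reassocK[of g "snd y" "snd z" "M1 M g" "M1 M f"] by (simp add: Alg2_arr)

lemma Alg2_category: "category (Alg2 K M)"
proof
  fix f assume "f \<in> Arr (Alg2 K M)"
  then show "Dom (Alg2 K M) f \<in> Obj (Alg2 K M)" "Cod (Alg2 K M) f \<in> Obj (Alg2 K M)"
    by (cases f; auto simp: Alg2_arr)+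
next
  fix x assume "x \<in> Obj (Alg2 K M)"
  then show "Ident (Alg2 K M) x \<in> hom (Alg2 K M) x x"
    by (simp add: Alg2_hom Alg2_arr)
next
  fix f X Y g Z assume f: "f \<in> hom (Alg2 K M) X Y" and g: "g \<in> hom (Alg2 K M) Y Z"
  obtain f' where "f = (X, Y, f')" "(X, Y, f') \<in> Arr (Alg2 K M)" by (rule Alg2_homE[OF f])
  moreover obtain g' where "g = (Y, Z, g')" "(Y, Z, g') \<in> Arr (Alg2 K M)" by (rule Alg2_homE[OF g])
  ultimately show "g \<cdot>\<^bsub>Alg2 K M\<^esub> f \<in> hom (Alg2 K M) X Z"
    using Alg2_arr_comp by (simp add: Alg2_hom)
next
  fix f X Y g Z h W
  assume f: "f \<in> hom (Alg2 K M) X Y" and g: "g \<in> hom (Alg2 K M) Y Z" and h: "h \<in> hom (Alg2 K M) Z W"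
  obtain f' where "f = (X, Y, f')" "(X, Y, f') \<in> Arr (Alg2 K M)" by (rule Alg2_homE[OF f])
  moreover obtain g' where "g = (Y, Z, g')" "(Y, Z, g') \<in> Arr (Alg2 K M)" by (rule Alg2_homE[OF g])
  moreover obtain h' where "h = (Z, W, h')" "(Z, W, h') \<in> Arr (Alg2 K M)" by (rule Alg2_homE[OF h])
  ultimately show "(h \<cdot>\<^bsub>Alg2 K M\<^esub> g) \<cdot>\<^bsub>Alg2 K M\<^esub> f = h \<cdot>\<^bsub>Alg2 K M\<^esub> (g \<cdot>\<^bsub>Alg2 K M\<^esub> f)"
    by (simp add: Alg2_arr)
next
  fix f X Y assume f: "f \<in> hom (Alg2 K M) X Y"
  obtain f' where "f = (X, Y, f')" "(X, Y, f') \<in> Arr (Alg2 K M)" by (rule Alg2_homE[OF f])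
  then show "Ident (Alg2 K M) Y \<cdot>\<^bsub>Alg2 K M\<^esub> f = f" "f \<cdot>\<^bsub>Alg2 K M\<^esub> Ident (Alg2 K M) X = f"
    by (simp_all add: Alg2_arr)
qed

lemma Alg2_vcomp:
  assumes "(x, y, \<theta>) \<in> Cell2 (Alg2 K M)" "(x, y, \<theta>') \<in> Cell2 (Alg2 K M)" "Dom2 K \<theta>' = Cod2 K \<theta>"
  shows "(x, y, \<theta>' \<bullet> \<theta>) \<in> Cell2 (Alg2 K M)"
  using assms by (simp add: Alg2_cell Alg2_arr whisker_left whisker_right)

lemma Alg2_id2:
  assumes "(x, y, f) \<in> Arr (Alg2 K M)"
  shows "(x, y, Id2 K f) \<in> Cell2 (Alg2 K M)"
  using assms by (simp add: Alg2_cell Alg2_arr)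

text \<open>The condition on an algebra cell is stable under horizontal composition because the structure cells
  of the middle algebra can be passed from one factor to the other.\<close>

lemma Alg2_hcomp:
  assumes "(x, y, \<tau>) \<in> Cell2 (Alg2 K M)" "(y, z, \<sigma>) \<in> Cell2 (Alg2 K M)"
  shows "(x, z, \<sigma> \<star> \<tau>) \<in> Cell2 (Alg2 K M)"
proof -
  note a = assms[unfolded Alg2_cell Alg2_arr]
  have "(\<sigma> \<star> \<tau>) \<star> Id2 K (snd x) = \<sigma> \<star> (Id2 K (snd y) \<star> M2 M \<tau>)"
    using a by simp
  also have "\<dots> = (\<sigma> \<star> Id2 K (snd y)) \<star> M2 M \<tau>"
    using a by (intro hassoc[symmetric]) auto
  also have "\<dots> = Id2 K (snd z) \<star> M2 M (\<sigma> \<star> \<tau>)"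
    using a by simp
  finally show ?thesis
    using a Alg2_arr_comp[of x y "Dom2 K \<tau>" z "Dom2 K \<sigma>"] Alg2_arr_comp[of x y "Cod2 K \<tau>" z "Cod2 K \<sigma>"]
    by (simp add: Alg2_cell Alg2_arr)
qed

lemma Alg2_hom_category: "category (hom_cat (Alg2 K M) x y)"
proof -
  let ?H = "hom_cat (Alg2 K M) x y"
  have arr: "w \<in> Arr ?H \<longleftrightarrow> w = (x, y, snd (snd w)) \<and> (x, y, snd (snd w)) \<in> Cell2 (Alg2 K M)" for w
    by (cases w) (auto simp: hom_cat_def Alg2_hom Alg2_cell)
  have hom: "w \<in> hom ?H u v \<longleftrightarrow> (\<exists>\<theta>. w = (x, y, \<theta>) \<and> (x, y, \<theta>) \<in> Cell2 (Alg2 K M) \<and>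
      u = (x, y, Dom2 K \<theta>) \<and> v = (x, y, Cod2 K \<theta>))" for w u v
    unfolding hom_def mem_Collect_eq arr by (cases w) (auto simp: hom_cat_def)
  have simps: "Comp ?H = VComp (Alg2 K M)" "Ident ?H = Id2 (Alg2 K M)" "Dom ?H = Dom2 (Alg2 K M)"
      "Cod ?H = Cod2 (Alg2 K M)" "Obj ?H = hom (Alg2 K M) x y"
    by (auto simp: hom_cat_def)
  show ?thesis
  proof
    fix w assume "w \<in> Arr ?H"
    then show "Dom ?H w \<in> Obj ?H" "Cod ?H w \<in> Obj ?H"
      unfolding arr by (cases w; auto simp: simps Alg2_hom Alg2_cell)+
  next
    fix u assume "u \<in> Obj ?H"
    then show "Ident ?H u \<in> hom ?H u u"
      unfolding hom using Alg2_id2[of x y] by (cases u) (auto simp: simps Alg2_hom Alg2_arr)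
  next
    fix w u v w' v' assume "w \<in> hom ?H u v" "w' \<in> hom ?H v v'"
    then show "w' \<cdot>\<^bsub>?H\<^esub> w \<in> hom ?H u v'"
      unfolding hom using Alg2_vcomp by (fastforce simp: simps Alg2_cell)
  next
    fix w u v w' v' w'' v'' assume "w \<in> hom ?H u v" "w' \<in> hom ?H v v'" "w'' \<in> hom ?H v' v''"
    then show "(w'' \<cdot>\<^bsub>?H\<^esub> w') \<cdot>\<^bsub>?H\<^esub> w = w'' \<cdot>\<^bsub>?H\<^esub> (w' \<cdot>\<^bsub>?H\<^esub> w)"
      unfolding hom by (auto simp: simps Alg2_cell)
  next
    fix w u v assume "w \<in> hom ?H u v"
    then show "Ident ?H v \<cdot>\<^bsub>?H\<^esub> w = w" "w \<cdot>\<^bsub>?H\<^esub> Ident ?H u = w"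
      unfolding hom by (auto simp: simps Alg2_cell)
  qed
qed

theorem Alg2_two_category: "two_category (Alg2 K M)"
proof (intro two_category.intro two_category_axioms.intro)
  show "category (Alg2 K M)" by (rule Alg2_category)
next
  fix w assume "w \<in> Cell2 (Alg2 K M)"
  then show "\<exists>x y. Dom2 (Alg2 K M) w \<in> hom (Alg2 K M) x y \<and> Cod2 (Alg2 K M) w \<in> hom (Alg2 K M) x y"
    by (cases w) (auto simp: Alg2_cell Alg2_hom)
next
  fix x y show "category (hom_cat (Alg2 K M) x y)" by (rule Alg2_hom_category)
next
  fix f x y g z \<tau> f' \<sigma> g'
  assume *: "f \<in> hom (Alg2 K M) x y" "g \<in> hom (Alg2 K M) y z"
    "\<tau> \<in> cell (Alg2 K M) f f'" "\<sigma> \<in> cell (Alg2 K M) g g'"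
  then obtain f1 g1 t s where "f = (x, y, f1)" "g = (y, z, g1)"
      "\<tau> = (x, y, t)" "(x, y, t) \<in> Cell2 (Alg2 K M)" "f' = (x, y, Cod2 K t)" "Dom2 K t = f1"
      "\<sigma> = (y, z, s)" "(y, z, s) \<in> Cell2 (Alg2 K M)" "g' = (y, z, Cod2 K s)" "Dom2 K s = g1"
    by (metis Alg2_homE Alg2_cellE)
  then show "\<sigma> \<star>\<^bsub>Alg2 K M\<^esub> \<tau> \<in> cell (Alg2 K M) (g \<cdot>\<^bsub>Alg2 K M\<^esub> f) (g' \<cdot>\<^bsub>Alg2 K M\<^esub> f')"
    using Alg2_hcomp[of x y t z s] by (auto simp: cell_def Alg2_cell Alg2_arr)
next
  fix f x y g z
  assume *: "f \<in> hom (Alg2 K M) x y" "g \<in> hom (Alg2 K M) y z"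
  then obtain f1 g1 where "f = (x, y, f1)" "g = (y, z, g1)" "(x, y, f1) \<in> Arr (Alg2 K M)"
      "(y, z, g1) \<in> Arr (Alg2 K M)"
    by (metis Alg2_homE)
  then show "Id2 (Alg2 K M) g \<star>\<^bsub>Alg2 K M\<^esub> Id2 (Alg2 K M) f = Id2 (Alg2 K M) (g \<cdot>\<^bsub>Alg2 K M\<^esub> f)"
    by (simp add: Alg2_arr)
next
  fix f x y g z \<tau> f' \<tau>' f'' \<sigma> g' \<sigma>' g''
  assume *: "f \<in> hom (Alg2 K M) x y" "g \<in> hom (Alg2 K M) y z"
    "\<tau> \<in> cell (Alg2 K M) f f'" "\<tau>' \<in> cell (Alg2 K M) f' f''"
    "\<sigma> \<in> cell (Alg2 K M) g g'" "\<sigma>' \<in> cell (Alg2 K M) g' g''"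
  obtain f1 where f: "f = (x, y, f1)" using *(1) by (rule Alg2_homE)
  obtain g1 where g: "g = (y, z, g1)" using *(2) by (rule Alg2_homE)
  obtain t where t: "\<tau> = (x, y, t)" "(x, y, t) \<in> Cell2 (Alg2 K M)" "f' = (x, y, Cod2 K t)" "Dom2 K t = f1"
    using *(3) unfolding f by (rule Alg2_cellE)
  obtain t' where t': "\<tau>' = (x, y, t')" "(x, y, t') \<in> Cell2 (Alg2 K M)" "Dom2 K t' = Cod2 K t"
    using *(4) unfolding t(3) by (rule Alg2_cellE)
  obtain s where s: "\<sigma> = (y, z, s)" "(y, z, s) \<in> Cell2 (Alg2 K M)" "g' = (y, z, Cod2 K s)" "Dom2 K s = g1"
    using *(5) unfolding g by (rule Alg2_cellE)
  obtain s' where s': "\<sigma>' = (y, z, s')" "(y, z, s') \<in> Cell2 (Alg2 K M)" "Dom2 K s' = Cod2 K s"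
    using *(6) unfolding s(3) by (rule Alg2_cellE)
  show "(\<sigma>' \<bullet>\<^bsub>Alg2 K M\<^esub> \<sigma>) \<star>\<^bsub>Alg2 K M\<^esub> (\<tau>' \<bullet>\<^bsub>Alg2 K M\<^esub> \<tau>)
      = (\<sigma>' \<star>\<^bsub>Alg2 K M\<^esub> \<tau>') \<bullet>\<^bsub>Alg2 K M\<^esub> (\<sigma> \<star>\<^bsub>Alg2 K M\<^esub> \<tau>)"
    using t(2) t'(2,3) s(2) s'(2,3) middle_four[of s s' t t']
    by (simp add: t(1) t'(1) s(1) s'(1) Alg2_cell Alg2_arr)
next
  fix f x y g z h w \<tau> f' \<sigma> g' \<rho> h'
  assume *: "f \<in> hom (Alg2 K M) x y" "g \<in> hom (Alg2 K M) y z" "h \<in> hom (Alg2 K M) z w"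
    "\<tau> \<in> cell (Alg2 K M) f f'" "\<sigma> \<in> cell (Alg2 K M) g g'" "\<rho> \<in> cell (Alg2 K M) h h'"
  obtain f1 where f: "f = (x, y, f1)" using *(1) by (rule Alg2_homE)
  obtain g1 where g: "g = (y, z, g1)" using *(2) by (rule Alg2_homE)
  obtain h1 where h: "h = (z, w, h1)" using *(3) by (rule Alg2_homE)
  obtain t where t: "\<tau> = (x, y, t)" "(x, y, t) \<in> Cell2 (Alg2 K M)" using *(4) unfolding f by (rule Alg2_cellE)
  obtain s where s: "\<sigma> = (y, z, s)" "(y, z, s) \<in> Cell2 (Alg2 K M)" using *(5) unfolding g by (rule Alg2_cellE)
  obtain r where r: "\<rho> = (z, w, r)" "(z, w, r) \<in> Cell2 (Alg2 K M)" using *(6) unfolding h by (rule Alg2_cellE)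
  show "(\<rho> \<star>\<^bsub>Alg2 K M\<^esub> \<sigma>) \<star>\<^bsub>Alg2 K M\<^esub> \<tau> = \<rho> \<star>\<^bsub>Alg2 K M\<^esub> (\<sigma> \<star>\<^bsub>Alg2 K M\<^esub> \<tau>)"
    using t s r by (simp add: Alg2_cell Alg2_arr)
next
  fix f x y \<tau> f'
  assume *: "f \<in> hom (Alg2 K M) x y" "\<tau> \<in> cell (Alg2 K M) f f'"
  obtain f1 where f: "f = (x, y, f1)" using *(1) by (rule Alg2_homE)
  obtain t where t: "\<tau> = (x, y, t)" "(x, y, t) \<in> Cell2 (Alg2 K M)" using *(2) unfolding f by (rule Alg2_cellE)
  show "Id2 (Alg2 K M) (Ident (Alg2 K M) y) \<star>\<^bsub>Alg2 K M\<^esub> \<tau> = \<tau>"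
      "\<tau> \<star>\<^bsub>Alg2 K M\<^esub> Id2 (Alg2 K M) (Ident (Alg2 K M) x) = \<tau>"
    using t by (auto simp: Alg2_cell Alg2_arr)
qed


lemma lax_mors_iff:
  "(f, \<phi>) \<in> lax_mors K M x y \<longleftrightarrow>
     f \<in> Arr K \<and> Dom K f = fst x \<and> Cod K f = fst y \<and>
     \<phi> \<in> Cell2 K \<and> Dom2 K \<phi> = snd y \<cdot> M1 M f \<and> Cod2 K \<phi> = f \<cdot> snd x \<and>
     \<phi> \<star> Id2 K (Eps2 M (fst x)) = Id2 K f \<and>
     \<phi> \<star> Id2 K (Mu2 M (fst x)) = (\<phi> \<star> Id2 K (M1 M (snd x))) \<bullet> (Id2 K (snd y) \<star> M2 M \<phi>)"
  by (cases x, cases y) (auto simp: lax_mors_def hom_iff cell_iff)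

lemma lax_cat_simps:
  "Obj (lax_cat K M x y) = lax_mors K M x y"
  "Dom (lax_cat K M x y) (u, v, \<tau>) = u" "Cod (lax_cat K M x y) (u, v, \<tau>) = v"
  "Ident (lax_cat K M x y) u = (u, u, Id2 K (fst u))"
  "Comp (lax_cat K M x y) (v, w, \<sigma>) (u, v', \<tau>) = (u, w, \<sigma> \<bullet> \<tau>)"
  by (simp_all add: lax_cat_def)

declare lax_cat_simps [simp]

lemma lax_arr_iff:
  "(u, v, \<tau>) \<in> Arr (lax_cat K M x y) \<longleftrightarrow> u \<in> lax_mors K M x y \<and> v \<in> lax_mors K M x y \<and>
     \<tau> \<in> Cell2 K \<and> Dom2 K \<tau> = fst u \<and> Cod2 K \<tau> = fst v \<and>
     snd v \<bullet> (Id2 K (snd y) \<star> M2 M \<tau>) = (\<tau> \<star> Id2 K (snd x)) \<bullet> snd u"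
  by (auto simp: lax_cat_def cell_iff)

lemma lax_hom_iff: "w \<in> hom (lax_cat K M x y) u v \<longleftrightarrow>
    w = (u, v, snd (snd w)) \<and> (u, v, snd (snd w)) \<in> Arr (lax_cat K M x y)"
  by (cases w) (auto simp: hom_def)

lemma lax_homE:
  assumes "w \<in> hom (lax_cat K M x y) u v"
  obtains \<tau> where "w = (u, v, \<tau>)" "(u, v, \<tau>) \<in> Arr (lax_cat K M x y)"
  using assms lax_hom_iff by blast

lemma lax_mor_typ:
  assumes "(f, \<phi>) \<in> lax_mors K M x y"
  shows "f \<in> Arr K" "Dom K f = fst x" "Cod K f = fst y" "\<phi> \<in> Cell2 K"
    "Dom2 K \<phi> = snd y \<cdot> M1 M f" "Cod2 K \<phi> = f \<cdot> snd x"
  using assms by (auto simp: lax_mors_iff)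

lemma lax_arr_typ:
  assumes "((f, \<phi>), (g, \<psi>), \<tau>) \<in> Arr (lax_cat K M x y)"
  shows "(f, \<phi>) \<in> lax_mors K M x y" "(g, \<psi>) \<in> lax_mors K M x y"
    "\<tau> \<in> Cell2 K" "Dom2 K \<tau> = f" "Cod2 K \<tau> = g"
    "\<psi> \<bullet> (Id2 K (snd y) \<star> M2 M \<tau>) = (\<tau> \<star> Id2 K (snd x)) \<bullet> \<phi>"
  using assms by (auto simp: lax_arr_iff)

text \<open>Pasting of the two defining squares.\<close>

lemma lax_comp:
  assumes "x \<in> strict_algs K M" "y \<in> strict_algs K M"
    and "(u, v, \<tau>) \<in> Arr (lax_cat K M x y)" "(v, w, \<sigma>) \<in> Arr (lax_cat K M x y)"
  shows "(u, w, \<sigma> \<bullet> \<tau>) \<in> Arr (lax_cat K M x y)"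
proof -
  obtain f \<phi> g \<psi> h \<chi> where uvw: "u = (f, \<phi>)" "v = (g, \<psi>)" "w = (h, \<chi>)"
    by (metis surj_pair)
  note t = lax_arr_typ[OF assms(3)[unfolded uvw]] and r = lax_arr_typ[OF assms(4)[unfolded uvw]]
  note ty = t(3-5) r(3-5) lax_mor_typ[OF t(1)] lax_mor_typ[OF t(2)] lax_mor_typ[OF r(2)] assms(1,2)
  let ?\<beta> = "Id2 K (snd y)" and ?\<alpha> = "Id2 K (snd x)"
  have "\<chi> \<bullet> (?\<beta> \<star> M2 M (\<sigma> \<bullet> \<tau>)) = (\<chi> \<bullet> (?\<beta> \<star> M2 M \<sigma>)) \<bullet> (?\<beta> \<star> M2 M \<tau>)"
    using ty by (simp add: whisker_left)
  also have "\<dots> = ((\<sigma> \<star> ?\<alpha>) \<bullet> \<psi>) \<bullet> (?\<beta> \<star> M2 M \<tau>)"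
    by (simp only: r(6))
  also have "\<dots> = (\<sigma> \<star> ?\<alpha>) \<bullet> (\<psi> \<bullet> (?\<beta> \<star> M2 M \<tau>))"
    using ty by (intro vcomp_assoc) simp_all
  also have "\<dots> = (\<sigma> \<star> ?\<alpha>) \<bullet> ((\<tau> \<star> ?\<alpha>) \<bullet> \<phi>)"
    by (simp only: t(6))
  also have "\<dots> = ((\<sigma> \<bullet> \<tau>) \<star> ?\<alpha>) \<bullet> \<phi>"
    using ty by (simp add: whisker_right)
  finally show ?thesis
    using ty t(1) r(2) by (simp add: uvw lax_arr_iff)
qed

lemma lax_category:
  assumes "x \<in> strict_algs K M" "y \<in> strict_algs K M"
  shows "category (lax_cat K M x y)"
proof
  fix w assume "w \<in> Arr (lax_cat K M x y)"
  then show "Dom (lax_cat K M x y) w \<in> Obj (lax_cat K M x y)" "Cod (lax_cat K M x y) w \<in> Obj (lax_cat K M x y)"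
    by (cases w; auto simp: lax_arr_iff)+
next
  fix u assume u: "u \<in> Obj (lax_cat K M x y)"
  obtain f \<phi> where "u = (f, \<phi>)" by (cases u)
  then show "Ident (lax_cat K M x y) u \<in> hom (lax_cat K M x y) u u"
    using u assms by (simp add: lax_hom_iff lax_arr_iff lax_mors_iff)
next
  fix a u v b w assume a: "a \<in> hom (lax_cat K M x y) u v" and b: "b \<in> hom (lax_cat K M x y) v w"
  obtain \<tau> where "a = (u, v, \<tau>)" "(u, v, \<tau>) \<in> Arr (lax_cat K M x y)" by (rule lax_homE[OF a])
  moreover obtain \<sigma> where "b = (v, w, \<sigma>)" "(v, w, \<sigma>) \<in> Arr (lax_cat K M x y)" by (rule lax_homE[OF b])
  ultimately show "b \<cdot>\<^bsub>lax_cat K M x y\<^esub> a \<in> hom (lax_cat K M x y) u w"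
    using lax_comp[OF assms, of u v \<tau> w \<sigma>] by (simp add: lax_hom_iff)
next
  fix a u v b w c z
  assume a: "a \<in> hom (lax_cat K M x y) u v" and b: "b \<in> hom (lax_cat K M x y) v w"
    and c: "c \<in> hom (lax_cat K M x y) w z"
  obtain \<tau> where "a = (u, v, \<tau>)" "(u, v, \<tau>) \<in> Arr (lax_cat K M x y)" by (rule lax_homE[OF a])
  moreover obtain \<sigma> where "b = (v, w, \<sigma>)" "(v, w, \<sigma>) \<in> Arr (lax_cat K M x y)" by (rule lax_homE[OF b])
  moreover obtain \<rho> where "c = (w, z, \<rho>)" "(w, z, \<rho>) \<in> Arr (lax_cat K M x y)" by (rule lax_homE[OF c])
  ultimately show "(c \<cdot>\<^bsub>lax_cat K M x y\<^esub> b) \<cdot>\<^bsub>lax_cat K M x y\<^esub> a = c \<cdot>\<^bsub>lax_cat K M x y\<^esub> (b \<cdot>\<^bsub>lax_cat K M x y\<^esub> a)"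
    by (simp add: lax_arr_iff)
next
  fix a u v assume a: "a \<in> hom (lax_cat K M x y) u v"
  obtain \<tau> where "a = (u, v, \<tau>)" "(u, v, \<tau>) \<in> Arr (lax_cat K M x y)" by (rule lax_homE[OF a])
  then show "Ident (lax_cat K M x y) v \<cdot>\<^bsub>lax_cat K M x y\<^esub> a = a" "a \<cdot>\<^bsub>lax_cat K M x y\<^esub> Ident (lax_cat K M x y) u = a"
    by (simp_all add: lax_arr_iff)
qed

text \<open>Postcomposition with a strict morphism: strictness moves \<open>h\<close> past the structure map of the
  codomain, so the two laws of a lax morphism are simply whiskered by \<open>h\<close>.\<close>

lemma lax_post_mor:
  assumes "x \<in> strict_algs K M" "(y, z, h) \<in> Arr (Alg2 K M)" "u \<in> lax_mors K M x y"
  shows "lax_post K h u \<in> lax_mors K M x z"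
proof -
  obtain f \<phi> where u: "u = (f, \<phi>)" by (cases u)
  note a = assms[unfolded u Alg2_arr lax_mors_iff]
  have x: "fst x \<in> Obj K" using assms(1) by simp
  have hy: "h \<cdot> (snd y \<cdot> k) = snd z \<cdot> (M1 M h \<cdot> k)" if "k \<in> Arr K" "Cod K k = M0 M (fst y)" for k
    using a that by (intro reassocK) auto
  have "Id2 K h \<star> (\<phi> \<star> Id2 K (Mu2 M (fst x)))
      = (Id2 K h \<star> (\<phi> \<star> Id2 K (M1 M (snd x)))) \<bullet> (Id2 K h \<star> (Id2 K (snd y) \<star> M2 M \<phi>))"
    using a x by (simp add: whisker_left)
  also have "Id2 K h \<star> (Id2 K (snd y) \<star> M2 M \<phi>) = Id2 K (h \<cdot> snd y) \<star> M2 M \<phi>"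
    using a by (simp add: whisker_id2)
  also have "\<dots> = Id2 K (snd z) \<star> M2 M (Id2 K h \<star> \<phi>)"
    using a by (simp add: whisker_id2)
  finally show ?thesis
    using a x by (simp add: u lax_post_def lax_mors_iff hy)
qed

lemma lax_post_simps [simp]:
  "fst (lax_post K h u) = h \<cdot> fst u" "snd (lax_post K h u) = Id2 K h \<star> snd u"
  by (cases u; simp add: lax_post_def)+

lemma lax_post_arr:
  assumes "x \<in> strict_algs K M" "(y, z, h) \<in> Arr (Alg2 K M)" "(u, v, \<tau>) \<in> Arr (lax_cat K M x y)"
  shows "(lax_post K h u, lax_post K h v, Id2 K h \<star> \<tau>) \<in> Arr (lax_cat K M x z)"
proof -
  obtain f \<phi> g \<psi> where uv: "u = (f, \<phi>)" "v = (g, \<psi>)"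
    by (metis surj_pair)
  note t = lax_arr_typ[OF assms(3)[unfolded uv]]
  note ty = t(3-5) lax_mor_typ[OF t(1)] lax_mor_typ[OF t(2)] assms(1) assms(2)[unfolded Alg2_arr]
  have "(Id2 K h \<star> \<psi>) \<bullet> (Id2 K (snd z) \<star> M2 M (Id2 K h \<star> \<tau>))
      = (Id2 K h \<star> \<psi>) \<bullet> (Id2 K (h \<cdot> snd y) \<star> M2 M \<tau>)"
    using ty by (simp add: whisker_id2)
  also have "\<dots> = Id2 K h \<star> (\<psi> \<bullet> (Id2 K (snd y) \<star> M2 M \<tau>))"
    using ty by (simp add: whisker_id2 whisker_left)
  also have "\<dots> = Id2 K h \<star> ((\<tau> \<star> Id2 K (snd x)) \<bullet> \<phi>)"
    by (simp only: t(6))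
  also have "\<dots> = ((Id2 K h \<star> \<tau>) \<star> Id2 K (snd x)) \<bullet> (Id2 K h \<star> \<phi>)"
    using ty by (simp add: whisker_left)
  finally show ?thesis
    using ty lax_post_mor[OF assms(1,2)] t(1,2) by (simp add: uv lax_arr_iff)
qed

text \<open>The algebra condition on \<open>\<theta>\<close> turns the square to be checked into the interchange square of \<open>\<theta>\<close> with \<open>\<phi>\<close>.\<close>

lemma lax_whisker_arr:
  assumes "x \<in> strict_algs K M" "(y, z, \<theta>) \<in> Cell2 (Alg2 K M)" "u \<in> lax_mors K M x y"
  shows "(lax_post K (Dom2 K \<theta>) u, lax_post K (Cod2 K \<theta>) u, \<theta> \<star> Id2 K (fst u)) \<in> Arr (lax_cat K M x z)"
proof -
  obtain f \<phi> where u: "u = (f, \<phi>)" by (cases u)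
  note arr = assms(2)[unfolded Alg2_cell, THEN conjunct2, THEN conjunct1]
    assms(2)[unfolded Alg2_cell, THEN conjunct2, THEN conjunct2, THEN conjunct1]
  have t: "\<theta> \<in> Cell2 K" "\<theta> \<star> Id2 K (snd y) = Id2 K (snd z) \<star> M2 M \<theta>"
    using assms(2) unfolding Alg2_cell by auto
  note ty = lax_mor_typ[OF assms(3)[unfolded u]] t(1) assms(1) arr[unfolded Alg2_arr]
  let ?h = "Dom2 K \<theta>" and ?k = "Cod2 K \<theta>"
  have ex: "Dom K (Dom2 K \<theta>) = Cod K (Dom2 K \<phi>)"
    using ty by simp
  have "Id2 K (snd z) \<star> M2 M (\<theta> \<star> Id2 K f) = (Id2 K (snd z) \<star> M2 M \<theta>) \<star> Id2 K (M1 M f)"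
    using ty by simp
  also have "\<dots> = (\<theta> \<star> Id2 K (snd y)) \<star> Id2 K (M1 M f)"
    by (simp only: t(2))
  also have "\<dots> = \<theta> \<star> Id2 K (Dom2 K \<phi>)"
    using ty by simp
  finally have "(Id2 K ?k \<star> \<phi>) \<bullet> (Id2 K (snd z) \<star> M2 M (\<theta> \<star> Id2 K f))
      = (Id2 K ?k \<star> \<phi>) \<bullet> (\<theta> \<star> Id2 K (Dom2 K \<phi>))"
    by simp
  also have "\<dots> = (\<theta> \<star> Id2 K (Cod2 K \<phi>)) \<bullet> (Id2 K ?h \<star> \<phi>)"
    by (simp only: whisker_exchange[OF t(1) ty(4) ex])
  also have "\<dots> = ((\<theta> \<star> Id2 K f) \<star> Id2 K (snd x)) \<bullet> (Id2 K ?h \<star> \<phi>)"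
    using ty by simp
  finally show ?thesis
    using ty lax_post_mor[OF assms(1) arr(1) assms(3)] lax_post_mor[OF assms(1) arr(2) assms(3)]
    by (simp add: u lax_arr_iff)
qed

lemma lax_two_functor_simps [simp]:
  "P0 (lax_two_functor K M x) = lax_cat K M x"
  "FO (P1 (lax_two_functor K M x) (y, z, h)) = lax_post K h"
  "FA (P1 (lax_two_functor K M x) (y, z, h)) (u, v, \<tau>) = (lax_post K h u, lax_post K h v, Id2 K h \<star> \<tau>)"
  "P2 (lax_two_functor K M x) (y, z, \<theta>) u =
     (lax_post K (Dom2 K \<theta>) u, lax_post K (Cod2 K \<theta>) u, \<theta> \<star> Id2 K (fst u))"
  by (simp_all add: lax_two_functor_def)

lemma lax_post_ident: "x \<in> strict_algs K M \<Longrightarrow> y \<in> strict_algs K M \<Longrightarrow> u \<in> lax_mors K M x y \<Longrightarrow>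
    lax_post K (Ident K (fst y)) u = u"
  by (cases u) (auto simp: lax_post_def lax_mors_iff)

lemma lax_post_comp: "x \<in> strict_algs K M \<Longrightarrow> (y, z, h) \<in> Arr (Alg2 K M) \<Longrightarrow> (z, w, k) \<in> Arr (Alg2 K M) \<Longrightarrow>
    u \<in> lax_mors K M x y \<Longrightarrow> lax_post K (k \<cdot> h) u = lax_post K k (lax_post K h u)"
  by (cases u) (simp add: lax_post_def lax_mors_iff Alg2_arr whisker_id2)

theorem lax_two_functor:
  assumes x: "x \<in> strict_algs K M"
  shows "is_two_functor_to_Cat (Alg2 K M) (lax_two_functor K M x)"
proof -
  let ?P = "lax_two_functor K M x" and ?S = "Alg2 K M"
  show ?thesis
    unfolding is_two_functor_to_Cat_def
  proof (intro conjI ballI impI)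
    fix y assume "y \<in> Obj ?S"
    then show "category (P0 ?P y)"
      using lax_category[OF x] by simp
  next
    fix h assume "h \<in> Arr ?S"
    then obtain y z h1 where h: "h = (y, z, h1)" "(y, z, h1) \<in> Arr ?S"
      by (cases h) auto
    then have h': "h1 \<in> Arr K" "Dom K h1 = fst y"
      by (auto simp: Alg2_arr)
    show "is_functor (P0 ?P (Dom ?S h))
        (P0 ?P (Cod ?S h)) (P1 ?P h)"
      unfolding is_functor_def
    proof (intro conjI ballI impI)
      fix u assume "u \<in> Obj (P0 ?P (Dom ?S h))"
      then show "FO (P1 ?P h) u \<in> Obj (P0 ?P (Cod ?S h))"
        "FA (P1 ?P h) (Ident (P0 ?P (Dom ?S h)) u)
         = Ident (P0 ?P (Cod ?S h)) (FO (P1 ?P h) u)"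
        using lax_post_mor[OF x h(2)] h' by (cases u; simp add: h(1) lax_mors_iff)+
    next
      fix w assume "w \<in> Arr (P0 ?P (Dom ?S h))"
      then show "FA (P1 ?P h) w \<in> hom (P0 ?P (Cod ?S h))
          (FO (P1 ?P h) (Dom (P0 ?P (Dom ?S h)) w))
          (FO (P1 ?P h) (Cod (P0 ?P (Dom ?S h)) w))"
        using lax_post_arr[OF x h(2)] by (cases w) (simp add: h(1) lax_hom_iff)
    next
      fix w w'
      assume *: "w \<in> Arr (P0 ?P (Dom ?S h))"
        "w' \<in> Arr (P0 ?P (Dom ?S h))"
        "Dom (P0 ?P (Dom ?S h)) w' = Cod (P0 ?P (Dom ?S h)) w"
      obtain u v \<tau> where w: "w = (u, v, \<tau>)" by (cases w) auto
      obtain v' r \<sigma> where w': "w' = (v', r, \<sigma>)" by (cases w') auto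
      obtain f \<phi> g \<psi> k \<chi> where "u = (f, \<phi>)" "v = (g, \<psi>)" "r = (k, \<chi>)"
        by (metis surj_pair)
      then show "FA (P1 ?P h) (w' \<cdot>\<^bsub>P0 ?P (Dom ?S h)\<^esub> w)
         = FA (P1 ?P h) w' \<cdot>\<^bsub>P0 ?P (Cod ?S h)\<^esub>
           FA (P1 ?P h) w"
        using * h' by (auto simp: w w' h(1) lax_arr_iff lax_mors_iff whisker_left)
    qed
  next
    fix \<theta> assume "\<theta> \<in> Cell2 ?S"
    then obtain y z t where t: "\<theta> = (y, z, t)" "(y, z, t) \<in> Cell2 ?S"
      by (cases \<theta>) auto
    note t' = t(2)[unfolded Alg2_cell Alg2_arr]
    show "is_nat_trans (P0 ?P (Dom ?S (Dom2 ?S \<theta>)))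
        (P0 ?P (Cod ?S (Dom2 ?S \<theta>)))
        (P1 ?P (Dom2 ?S \<theta>)) (P1 ?P (Cod2 ?S \<theta>))
        (P2 ?P \<theta>)"
      unfolding is_nat_trans_def
    proof (intro conjI ballI)
      fix u assume "u \<in> Obj (P0 ?P (Dom ?S (Dom2 ?S \<theta>)))"
      then show "P2 ?P \<theta> u \<in> hom (P0 ?P (Cod ?S (Dom2 ?S \<theta>)))
          (FO (P1 ?P (Dom2 ?S \<theta>)) u) (FO (P1 ?P (Cod2 ?S \<theta>)) u)"
        using lax_whisker_arr[OF x t(2)] by (simp add: t(1) lax_hom_iff)
    next
      fix w assume w: "w \<in> Arr (P0 ?P (Dom ?S (Dom2 ?S \<theta>)))"
      then obtain f \<phi> g \<psi> \<tau> where *: "w = ((f, \<phi>), (g, \<psi>), \<tau>)"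
        by (metis surj_pair)
      show "FA (P1 ?P (Cod2 ?S \<theta>)) w
          \<cdot>\<^bsub>P0 ?P (Cod ?S (Dom2 ?S \<theta>))\<^esub>
          P2 ?P \<theta> (Dom (P0 ?P (Dom ?S (Dom2 ?S \<theta>))) w)
        = P2 ?P \<theta> (Cod (P0 ?P (Dom ?S (Dom2 ?S \<theta>))) w)
          \<cdot>\<^bsub>P0 ?P (Cod ?S (Dom2 ?S \<theta>))\<^esub>
          FA (P1 ?P (Dom2 ?S \<theta>)) w"
        using w t' whisker_exchange[of t \<tau>] by (simp add: * t(1) lax_arr_iff lax_mors_iff)
    qed
  next
    fix y u assume "y \<in> Obj ?S" "u \<in> Obj (P0 ?P y)"
    then show "FO (P1 ?P (Ident ?S y)) u = u"
      using x lax_post_ident by simp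
  next
    fix y w assume "y \<in> Obj ?S" "w \<in> Arr (P0 ?P y)"
    then show "FA (P1 ?P (Ident ?S y)) w = w"
      using x by (cases w) (auto simp: lax_arr_iff lax_mors_iff lax_post_ident)
  next
    fix h k u assume *: "h \<in> Arr ?S" "k \<in> Arr ?S" "Dom ?S k = Cod ?S h"
      "u \<in> Obj (P0 ?P (Dom ?S h))"
    then show "FO (P1 ?P (k \<cdot>\<^bsub>?S\<^esub> h)) u
        = FO (P1 ?P k) (FO (P1 ?P h) u)"
      using lax_post_comp[OF x] by (cases h; cases k) simp
  next
    fix h k w assume *: "h \<in> Arr ?S" "k \<in> Arr ?S" "Dom ?S k = Cod ?S h"
      "w \<in> Arr (P0 ?P (Dom ?S h))"
    then show "FA (P1 ?P (k \<cdot>\<^bsub>?S\<^esub> h)) w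
        = FA (P1 ?P k) (FA (P1 ?P h) w)"
      using lax_post_comp[OF x] by (cases h; cases k; cases w)
        (auto simp: lax_arr_iff lax_mors_iff Alg2_arr whisker_id2)
  next
    fix h u assume "h \<in> Arr ?S" "u \<in> Obj (P0 ?P (Dom ?S h))"
    then show "P2 ?P (Id2 ?S h) u
        = Ident (P0 ?P (Cod ?S h)) (FO (P1 ?P h) u)"
      by (cases h; cases u) (simp add: Alg2_arr lax_mors_iff)
  next
    fix \<theta> \<theta>' u assume "\<theta> \<in> Cell2 ?S" "\<theta>' \<in> Cell2 ?S" "Dom2 ?S \<theta>' = Cod2 ?S \<theta>"
      "u \<in> Obj (P0 ?P (Dom ?S (Dom2 ?S \<theta>)))"
    then show "P2 ?P (\<theta>' \<bullet>\<^bsub>?S\<^esub> \<theta>) u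
        = P2 ?P \<theta>' u \<cdot>\<^bsub>P0 ?P (Cod ?S (Dom2 ?S \<theta>))\<^esub>
          P2 ?P \<theta> u"
      by (cases \<theta>; cases \<theta>'; cases u) (auto simp: Alg2_cell Alg2_arr lax_mors_iff whisker_right)
  next
    fix \<tau> \<sigma> u assume \<tau>: "\<tau> \<in> Cell2 ?S" and \<sigma>: "\<sigma> \<in> Cell2 ?S"
      and ts: "Dom ?S (Dom2 ?S \<sigma>) = Cod ?S (Dom2 ?S \<tau>)"
      and u: "u \<in> Obj (P0 ?P (Dom ?S (Dom2 ?S \<tau>)))"
    obtain y z t where t: "\<tau> = (y, z, t)" by (cases \<tau>) auto
    with ts obtain w s where s: "\<sigma> = (z, w, s)" by (cases \<sigma>) auto
    obtain f \<phi> where uf: "u = (f, \<phi>)" by (cases u)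
    note a = \<tau>[unfolded t Alg2_cell] \<sigma>[unfolded s Alg2_cell]
    have "lax_post K (Dom2 K s \<cdot> Dom2 K t) u = lax_post K (Dom2 K s) (lax_post K (Dom2 K t) u)"
      "lax_post K (Cod2 K s \<cdot> Cod2 K t) u = lax_post K (Cod2 K s) (lax_post K (Cod2 K t) u)"
      using a u lax_post_comp[OF x, of y z _ w _ u] by (simp_all add: t)
    moreover have "(s \<star> t) \<star> Id2 K f = (s \<star> Id2 K (Cod2 K t \<cdot> f)) \<bullet> (Id2 K (Dom2 K s) \<star> (t \<star> Id2 K f))"
      using a u whisker_exchange(1)[of s "t \<star> Id2 K f"] by (simp add: t uf Alg2_arr lax_mors_iff)
    ultimately show "P2 ?P (\<sigma> \<star>\<^bsub>?S\<^esub> \<tau>) u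
        = P2 ?P \<sigma> (FO (P1 ?P (Cod2 ?S \<tau>)) u)
          \<cdot>\<^bsub>P0 ?P (Cod ?S (Dom2 ?S \<sigma>))\<^esub>
          FA (P1 ?P (Dom2 ?S \<sigma>)) (P2 ?P \<tau> u)"
      using a by (simp add: t s uf Alg2_arr)
  qed
qed

end


section \<open>Pullbacks from finite limits\<close>

text \<open>The shape of a cospan: arrows 0, 1, 2 are the identities, 3 and 4 point from the objects
  0 and 1 to the object 2.\<close>

definition cospan_shape :: "(nat, nat) cat" where
  "cospan_shape = \<lparr>Obj = {0, 1, 2}, Arr = {0, 1, 2, 3, 4},
     Dom = (\<lambda>a. if a = 3 then 0 else if a = 4 then 1 else a),
     Cod = (\<lambda>a. if a \<ge> 3 then 2 else a),
     Ident = id,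
     Comp = (\<lambda>b a. if b < 3 then a else b)\<rparr>"

lemma cospan_shape_category: "category cospan_shape"
proof
  show "\<lbrakk>f \<in> hom cospan_shape X Y; g \<in> hom cospan_shape Y Z\<rbrakk> \<Longrightarrow> g \<cdot>\<^bsub>cospan_shape\<^esub> f \<in> hom cospan_shape X Z"
    for f X Y g Z
    by (auto simp: hom_def cospan_shape_def split: if_splits)
  show "\<lbrakk>f \<in> hom cospan_shape X Y; g \<in> hom cospan_shape Y Z; h \<in> hom cospan_shape Z W\<rbrakk>
      \<Longrightarrow> (h \<cdot>\<^bsub>cospan_shape\<^esub> g) \<cdot>\<^bsub>cospan_shape\<^esub> f = h \<cdot>\<^bsub>cospan_shape\<^esub> (g \<cdot>\<^bsub>cospan_shape\<^esub> f)"
    for f X Y g Z h W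
    by (auto simp: hom_def cospan_shape_def split: if_splits)
qed (auto simp: hom_def cospan_shape_def split: if_splits)

context category
begin

lemma pullback_exists:
  assumes "has_finite_limits C" "f \<in> Arr C" "g \<in> Arr C" "Cod C f = Cod C g"
  obtains p q where "is_pullback C f g p q"
proof -
  let ?ob = "\<lambda>j::nat. if j = 0 then Dom C f else if j = 1 then Dom C g else Cod C f"
  let ?D = "\<lparr>FO = ?ob, FA = \<lambda>a::nat. if a = 3 then f else if a = 4 then g else Ident C (?ob a)\<rparr>"
  have "is_functor cospan_shape C ?D"
    unfolding is_functor_def using assms(2-4) by (auto simp: cospan_shape_def hom_iff)
  moreover have "finite (Obj cospan_shape)" "finite (Arr cospan_shape)"
    by (auto simp: cospan_shape_def)
  ultimately obtain L \<pi> where lim: "is_limit cospan_shape C ?D L \<pi>"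
    using assms(1) cospan_shape_category unfolding has_finite_limits_def by blast
  have cone: "is_cone cospan_shape C ?D M (\<lambda>j. if j = 0 then x else if j = 1 then y else f \<cdot> x)"
    if "x \<in> Arr C" "y \<in> Arr C" "Dom C x = M" "Dom C y = M" "Cod C x = Dom C f" "Cod C y = Dom C g"
      "f \<cdot> x = g \<cdot> y" for M x y
    unfolding is_cone_def using that assms(2-4) by (auto simp: cospan_shape_def hom_iff)
  have \<pi>: "\<pi> 0 \<in> Arr C" "\<pi> 1 \<in> Arr C" "Dom C (\<pi> 0) = L" "Dom C (\<pi> 1) = L" "Cod C (\<pi> 0) = Dom C f"
    "Cod C (\<pi> 1) = Dom C g" "f \<cdot> \<pi> 0 = \<pi> 2" "g \<cdot> \<pi> 1 = \<pi> 2" "\<pi> 2 \<in> Arr C"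
    using lim unfolding is_limit_def is_cone_def by (auto simp: cospan_shape_def hom_iff)
  have univ: "\<exists>!h. h \<in> hom C M L \<and> (\<forall>j\<in>Obj cospan_shape. \<pi> j \<cdot> h = \<rho> j)"
    if "is_cone cospan_shape C ?D M \<rho>" for M \<rho>
    using lim that unfolding is_limit_def by blast
  have "is_pullback C f g (\<pi> 0) (\<pi> 1)"
  proof (rule pullbackI)
    fix x y
    assume xy: "x \<in> Arr C" "y \<in> Arr C" "Cod C x = Dom C f" "Cod C y = Dom C g" "Dom C x = Dom C y"
      "f \<cdot> x = g \<cdot> y"
    from ex1_implies_ex[OF univ[OF cone[OF xy(1,2) refl xy(5)[symmetric] xy(3,4,6)]]]
    obtain h where h: "h \<in> hom C (Dom C x) L" "\<forall>j\<in>Obj cospan_shape. \<pi> j \<cdot> h =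
        (if j = 0 then x else if j = 1 then y else f \<cdot> x)"
      by (elim exE conjE)
    have "\<pi> 0 \<cdot> h = x" "\<pi> 1 \<cdot> h = y"
      using bspec[OF h(2), of 0] bspec[OF h(2), of 1] by (simp_all add: cospan_shape_def)
    then show "\<exists>h. h \<in> Arr C \<and> Dom C h = Dom C x \<and> Cod C h = Dom C (\<pi> 0) \<and> \<pi> 0 \<cdot> h = x \<and> \<pi> 1 \<cdot> h = y"
      using \<pi>(3) h(1) by (intro exI[of _ h]) (simp add: hom_iff)
  next
    fix h k
    assume hk: "h \<in> Arr C" "k \<in> Arr C" "Dom C h = Dom C k" "Cod C h = Dom C (\<pi> 0)" "Cod C k = Dom C (\<pi> 0)"
      "\<pi> 0 \<cdot> h = \<pi> 0 \<cdot> k" "\<pi> 1 \<cdot> h = \<pi> 1 \<cdot> k"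
    have leg: "f \<cdot> (\<pi> 0 \<cdot> h) = \<pi> 2 \<cdot> h" "g \<cdot> (\<pi> 1 \<cdot> h) = \<pi> 2 \<cdot> h" "f \<cdot> (\<pi> 0 \<cdot> k) = \<pi> 2 \<cdot> k"
      using hk(1-5) \<pi> assms(2,3) reassoc[OF \<pi>(7)] reassoc[OF \<pi>(8)] by simp_all
    then have 2: "\<pi> 2 \<cdot> k = \<pi> 2 \<cdot> h"
      using hk(6) by simp
    have "is_cone cospan_shape C ?D (Dom C h) (\<lambda>j. if j = 0 then \<pi> 0 \<cdot> h else if j = 1 then \<pi> 1 \<cdot> h else f \<cdot> (\<pi> 0 \<cdot> h))"
      using hk \<pi>(1-6) leg by (intro cone) simp_all
    from univ[OF this] show "h = k"
    proof (rule ex1E)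
      fix l
      assume l: "\<forall>h'. h' \<in> hom C (Dom C h) L \<and> (\<forall>j\<in>Obj cospan_shape. \<pi> j \<cdot> h' =
          (if j = 0 then \<pi> 0 \<cdot> h else if j = 1 then \<pi> 1 \<cdot> h else f \<cdot> (\<pi> 0 \<cdot> h))) \<longrightarrow> h' = l"
      have "h = l"
        using hk(1-5) \<pi>(3) leg by (intro l[rule_format]) (auto simp: hom_iff cospan_shape_def)
      moreover have "k = l"
        using hk \<pi>(3) leg 2 by (intro l[rule_format]) (auto simp: hom_iff cospan_shape_def)
      ultimately show ?thesis by simp
    qed
  qed (use \<pi> assms in auto)
  then show ?thesis by (rule that)
qed

end


section \<open>A cartesian monad acts on internal categories\<close>

locale cartesian_monad = category C for C :: "('o, 'a, 'm) cat_scheme" (structure) +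
  fixes T :: "('o, 'a) monad"
  assumes finite_limits: "has_finite_limits C"
    and cartesian: "is_cartesian_monad C T"
begin

lemma T_typ:
  "X \<in> Obj C \<Longrightarrow> FO T X \<in> Obj C"
  "f \<in> Arr C \<Longrightarrow> FA T f \<in> Arr C"
  "f \<in> Arr C \<Longrightarrow> Dom C (FA T f) = FO T (Dom C f)"
  "f \<in> Arr C \<Longrightarrow> Cod C (FA T f) = FO T (Cod C f)"
  "X \<in> Obj C \<Longrightarrow> FA T (Ident C X) = Ident C (FO T X)"
  "\<lbrakk>f \<in> Arr C; g \<in> Arr C; Dom C g = Cod C f\<rbrakk> \<Longrightarrow> FA T (g \<cdot> f) = FA T g \<cdot> FA T f"
  using cartesian unfolding is_cartesian_monad_def is_monad_def is_functor_def
  by (auto simp: hom_iff)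

lemma Mu_typ:
  "X \<in> Obj C \<Longrightarrow> Mu T X \<in> Arr C" "X \<in> Obj C \<Longrightarrow> Dom C (Mu T X) = FO T (FO T X)"
  "X \<in> Obj C \<Longrightarrow> Cod C (Mu T X) = FO T X"
  "X \<in> Obj C \<Longrightarrow> Eps T X \<in> Arr C" "X \<in> Obj C \<Longrightarrow> Dom C (Eps T X) = X"
  "X \<in> Obj C \<Longrightarrow> Cod C (Eps T X) = FO T X"
  using cartesian unfolding is_cartesian_monad_def is_monad_def is_nat_trans_def
  by (auto simp: hom_iff)

declare T_typ [simp] Mu_typ [simp]

lemma Mu_nat: "f \<in> Arr C \<Longrightarrow> Dom C f = X \<Longrightarrow> Cod C f = Y \<Longrightarrow> Mu T Y \<cdot> FA T (FA T f) = FA T f \<cdot> Mu T X"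
  using cartesian unfolding is_cartesian_monad_def is_monad_def is_nat_trans_def by auto

lemma Eps_nat: "f \<in> Arr C \<Longrightarrow> Dom C f = X \<Longrightarrow> Cod C f = Y \<Longrightarrow> Eps T Y \<cdot> f = FA T f \<cdot> Eps T X"
  using cartesian unfolding is_cartesian_monad_def is_monad_def is_nat_trans_def by auto

lemma Mu_assoc: "X \<in> Obj C \<Longrightarrow> Mu T X \<cdot> FA T (Mu T X) = Mu T X \<cdot> Mu T (FO T X)"
  and Mu_unit: "X \<in> Obj C \<Longrightarrow> Mu T X \<cdot> FA T (Eps T X) = Ident C (FO T X)"
    "X \<in> Obj C \<Longrightarrow> Mu T X \<cdot> Eps T (FO T X) = Ident C (FO T X)"
  using cartesian unfolding is_cartesian_monad_def is_monad_def by auto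

lemma T_pullback: "is_pullback C f g p q \<Longrightarrow> is_pullback C (FA T f) (FA T g) (FA T p) (FA T q)"
  using cartesian unfolding is_cartesian_monad_def by blast

lemma Mu_pullback: "f \<in> Arr C \<Longrightarrow> is_pullback C (FA T f) (Mu T (Cod C f)) (Mu T (Dom C f)) (FA T (FA T f))"
  using cartesian unfolding is_cartesian_monad_def by blast

lemma lift_icat_simps [simp]:
  "O0 (lift_icat T A) = FO T (O0 A)" "O1 (lift_icat T A) = FO T (O1 A)" "O2 (lift_icat T A) = FO T (O2 A)"
  "src (lift_icat T A) = FA T (src A)" "tgt (lift_icat T A) = FA T (tgt A)" "idn (lift_icat T A) = FA T (idn A)"
  "pr1 (lift_icat T A) = FA T (pr1 A)" "pr2 (lift_icat T A) = FA T (pr2 A)" "cmp (lift_icat T A) = FA T (cmp A)"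
  by (simp_all add: lift_icat_def)

lemma T_eq:
  assumes "g \<cdot> f = k \<cdot> l" "f \<in> Arr C" "g \<in> Arr C" "k \<in> Arr C" "l \<in> Arr C"
    "Dom C g = Cod C f" "Dom C k = Cod C l"
  shows "FA T g \<cdot> FA T f = FA T k \<cdot> FA T l"
  using assms T_typ(6)[of f g] T_typ(6)[of l k] by simp

lemma T_comp: "g \<cdot> f = k \<Longrightarrow> f \<in> Arr C \<Longrightarrow> g \<in> Arr C \<Longrightarrow> Dom C g = Cod C f \<Longrightarrow> FA T g \<cdot> FA T f = FA T k"
  using T_typ(6)[of f g] by simp

lemma icomp_comp3:
  assumes "is_precat B" "x \<in> Arr C" "y \<in> Arr C" "z \<in> Arr C" "Cod C x = O1 B" "Cod C y = O1 B" "Cod C z = O1 B"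
    "tgt B \<cdot> x = src B \<cdot> y" "tgt B \<cdot> y = src B \<cdot> z" "h \<in> Arr C" "Cod C h = Dom C x"
  shows "icomp C B z (icomp C B y x) \<cdot> h = icomp C B (z \<cdot> h) (icomp C B (y \<cdot> h) (x \<cdot> h))"
    and "icomp C B (icomp C B z y) x \<cdot> h = icomp C B (icomp C B (z \<cdot> h) (y \<cdot> h)) (x \<cdot> h)"
  using assms composable_dom[OF assms(1,2,3,5,6,8)] by (simp_all add: icomp_comp)

lemma lift_precat:
  assumes "is_icat C A"
  shows "is_precat (lift_icat T A)"
  unfolding is_precat_def
  using assms T_pullback[OF icat_pullback[of A]]
    T_eq[OF icat_eq(4)[of A]] T_eq[OF icat_eq(5)[of A]]
    T_typ(6)[of "idn A" "src A"] T_typ(6)[of "idn A" "tgt A"]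
  by (simp add: hom_iff)

lemma lift_ipair:
  assumes "is_icat C A" "x \<in> Arr C" "y \<in> Arr C" "Cod C x = O1 A" "Cod C y = O1 A" "tgt A \<cdot> x = src A \<cdot> y"
  shows "ipair C (lift_icat T A) (FA T x) (FA T y) = FA T (ipair C A x y)"
proof -
  note p = ipair[OF icat_precat[OF assms(1)] assms(2-6)]
  have "FA T (pr1 A) \<cdot> FA T (ipair C A x y) = FA T x" "FA T (pr2 A) \<cdot> FA T (ipair C A x y) = FA T y"
    using p assms(1) T_typ(6)[of "ipair C A x y" "pr1 A"] T_typ(6)[of "ipair C A x y" "pr2 A"] by simp_all
  then show ?thesis
    using p assms(1) by (intro ipair_eqI lift_precat) simp_all
qed

lemma lift_icomp:
  assumes "is_icat C A" "x \<in> Arr C" "y \<in> Arr C" "Cod C x = O1 A" "Cod C y = O1 A" "tgt A \<cdot> x = src A \<cdot> y"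
  shows "FA T (icomp C A y x) = icomp C (lift_icat T A) (FA T y) (FA T x)"
  unfolding icomp_def lift_ipair[OF assms]
  using ipair[OF icat_precat[OF assms(1)] assms(2-6)] assms(1) by simp

text \<open>The laws hold in the image of \<open>T\<close> for the universal generalized elements. For associativity
  these are the projections of the object of composable triples, a pullback preserved by \<open>T\<close>.\<close>

lemma lift_icat:
  assumes A: "is_icat C A"
  shows "is_icat C (lift_icat T A)"
proof -
  let ?TA = "lift_icat T A"
  note pre = lift_precat[OF A]
  have unit: "icomp C ?TA x (idn ?TA \<cdot> (src ?TA \<cdot> x)) = x" "icomp C ?TA (idn ?TA \<cdot> (tgt ?TA \<cdot> x)) x = x"
    if x: "x \<in> hom C Z (O1 ?TA)" for Z x
  proof -
    have x': "x \<in> Arr C" "Cod C x = FO T (O1 A)"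
      using x by (auto simp: hom_iff)
    let ?i = "Ident C (O1 A)"
    have "icomp C ?TA (FA T ?i) (FA T (idn A \<cdot> src A)) = FA T (icomp C A ?i (idn A \<cdot> src A))"
      using A by (intro lift_icomp[symmetric]) simp_all
    also have "icomp C A ?i (idn A \<cdot> src A) = ?i"
      using A by simp
    finally have "icomp C ?TA (FA T ?i) (FA T (idn A \<cdot> src A)) \<cdot> x = x"
      using A x' by simp
    moreover have "FA T (tgt A) \<cdot> (FA T (idn A) \<cdot> FA T (src A)) = FA T (src A)"
      "FA T (tgt A \<cdot> (idn A \<cdot> tgt A)) = FA T (tgt A)"
      using A pre icat_tgt_idn[of ?TA "FA T (src A)"] by simp_all
    ultimately show "icomp C ?TA x (idn ?TA \<cdot> (src ?TA \<cdot> x)) = x"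
      using A pre x' by (simp add: icomp_comp)
    have "icomp C ?TA (FA T (idn A \<cdot> tgt A)) (FA T ?i) = FA T (icomp C A (idn A \<cdot> tgt A) ?i)"
      using A by (intro lift_icomp[symmetric]) simp_all
    also have "icomp C A (idn A \<cdot> tgt A) ?i = ?i"
      using A by simp
    finally have "icomp C ?TA (FA T (idn A \<cdot> tgt A)) (FA T ?i) \<cdot> x = x"
      using A x' by simp
    moreover have "FA T (src A) \<cdot> (FA T (idn A) \<cdot> FA T (tgt A)) = FA T (tgt A)"
      using A pre icat_src_idn[of ?TA "FA T (tgt A)"] by simp
    ultimately show "icomp C ?TA (idn ?TA \<cdot> (tgt ?TA \<cdot> x)) x = x"
      using A pre x' by (simp add: icomp_comp)
  qed
  have assoc: "icomp C ?TA z (icomp C ?TA y x) = icomp C ?TA (icomp C ?TA z y) x"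
    if "x \<in> hom C Z (O1 ?TA)" "y \<in> hom C Z (O1 ?TA)" "z \<in> hom C Z (O1 ?TA)"
      "tgt ?TA \<cdot> x = src ?TA \<cdot> y" "tgt ?TA \<cdot> y = src ?TA \<cdot> z" for Z x y z
  proof -
    have xyz: "x \<in> Arr C" "y \<in> Arr C" "z \<in> Arr C" "Cod C x = O1 ?TA" "Cod C y = O1 ?TA" "Cod C z = O1 ?TA"
      "Dom C x = Z" "Dom C y = Z" "Dom C z = Z"
      using that(1-3) by (auto simp: hom_iff)
    obtain p q where pb: "is_pullback C (tgt A \<cdot> pr2 A) (src A) p q"
      using pullback_exists[OF finite_limits, of "tgt A \<cdot> pr2 A" "src A"] A by auto
    then have pq: "p \<in> Arr C" "q \<in> Arr C" "Cod C p = O2 A" "Cod C q = O1 A" "Dom C q = Dom C p"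
      "tgt A \<cdot> (pr2 A \<cdot> p) = src A \<cdot> q"
      unfolding is_pullback_def using A by auto
    note yz = that(5)
    note xy = ipair[OF pre xyz(1,2,4,5) that(4)]
    obtain h where h: "h \<in> Arr C" "Dom C h = Z" "Cod C h = FO T (Dom C p)"
      "FA T p \<cdot> h = ipair C ?TA x y" "FA T q \<cdot> h = z"
    proof (rule pullback_lift[OF T_pullback[OF pb], of "ipair C ?TA x y" z])
      have "FA T (tgt A) \<cdot> (FA T (pr2 A) \<cdot> ipair C ?TA x y) = FA T (tgt A) \<cdot> y"
        using xy(5) by simp
      then show "FA T (tgt A \<cdot> pr2 A) \<cdot> ipair C ?TA x y = FA T (src A) \<cdot> z"
        using A xy xyz yz by simp
    qed (use A xy xyz pq in auto)
    let ?a = "pr1 A \<cdot> p" and ?b = "pr2 A \<cdot> p"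
    have ab: "tgt A \<cdot> ?a = src A \<cdot> ?b"
      using A pq reassoc[OF icat_eq(1)[OF icat_precat[OF A]]] by simp
    have ab': "FA T (tgt A) \<cdot> FA T ?a = FA T (src A) \<cdot> FA T ?b"
      using A pq by (intro T_eq[OF ab]) simp_all
    have bq: "FA T (tgt A) \<cdot> FA T ?b = FA T (src A) \<cdot> FA T q"
      using A pq by (intro T_eq) simp_all
    have elts: "FA T ?a \<cdot> h = x" "FA T ?b \<cdot> h = y"
      using A pq h xy by simp_all
    have "icomp C A q (icomp C A ?b ?a) = icomp C A (icomp C A q ?b) ?a"
      using A pq ab by simp
    then have "FA T (icomp C A q (icomp C A ?b ?a)) \<cdot> h = FA T (icomp C A (icomp C A q ?b) ?a) \<cdot> h"
      by simp
    moreover have "FA T (icomp C A q (icomp C A ?b ?a)) \<cdot> h = icomp C ?TA z (icomp C ?TA y x)"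
    proof -
      have "FA T (icomp C A q (icomp C A ?b ?a)) = icomp C ?TA (FA T q) (icomp C ?TA (FA T ?b) (FA T ?a))"
        using A pq ab by (simp add: lift_icomp del: T_typ(6))
      also have "\<dots> \<cdot> h = icomp C ?TA (FA T q \<cdot> h) (icomp C ?TA (FA T ?b \<cdot> h) (FA T ?a \<cdot> h))"
        using A pq h(1-3) ab' bq by (intro icomp_comp3[OF pre]) simp_all
      finally show ?thesis
        by (simp only: elts h(5))
    qed
    moreover have "FA T (icomp C A (icomp C A q ?b) ?a) \<cdot> h = icomp C ?TA (icomp C ?TA z y) x"
    proof -
      have "FA T (icomp C A (icomp C A q ?b) ?a) = icomp C ?TA (icomp C ?TA (FA T q) (FA T ?b)) (FA T ?a)"
        using A pq ab by (simp add: lift_icomp del: T_typ(6) icomp_assoc)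
      also have "\<dots> \<cdot> h = icomp C ?TA (icomp C ?TA (FA T q \<cdot> h) (FA T ?b \<cdot> h)) (FA T ?a \<cdot> h)"
        using A pq h(1-3) ab' bq by (intro icomp_comp3[OF pre]) simp_all
      finally show ?thesis
        by (simp only: elts h(5))
    qed
    ultimately show ?thesis by simp
  qed
  show ?thesis
    using pre unit assoc unfolding is_icat_def is_precat_def by (elim conjE, intro conjI; blast)
qed

declare lift_icat [simp]

lemma lift_ifun_simps [simp]:
  "IDom (lift_ifun T f) = lift_icat T (IDom f)" "ICod (lift_ifun T f) = lift_icat T (ICod f)"
  "F0 (lift_ifun T f) = FA T (F0 f)" "F1 (lift_ifun T f) = FA T (F1 f)" "F2 (lift_ifun T f) = FA T (F2 f)"
  by (simp_all add: lift_ifun_def)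

lemma lift_ifun:
  assumes "is_ifun C f"
  shows "is_ifun C (lift_ifun T f)"
  unfolding is_ifun_def Let_def
  using assms T_eq[OF ifun_eq(1)[OF assms refl refl]] T_eq[OF ifun_eq(2)[OF assms refl refl]]
    T_eq[OF ifun_eq(3)[OF assms refl refl]] T_eq[OF ifun_eq(4)[OF assms refl refl]]
    T_eq[OF ifun_eq(5)[OF assms refl refl]] T_eq[OF ifun_eq(6)[OF assms refl refl]]
  by (simp add: hom_iff)

lemma lift_itrans:
  assumes "is_itrans C (Tr f g t)"
  shows "is_itrans C (Tr (lift_ifun T f) (lift_ifun T g) (FA T t))"
proof -
  define A B where AB: "A = IDom f" "B = ICod f"
  note t = tr[OF assms AB[symmetric]]
  have st: "FA T (src B) \<cdot> FA T t = FA T (F0 f)" "FA T (tgt B) \<cdot> FA T t = FA T (F0 g)"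
    using t T_typ(6)[of t "src B"] T_typ(6)[of t "tgt B"] by simp_all
  have "FA T (icomp C B (F1 g) (t \<cdot> src A)) = FA T (icomp C B (t \<cdot> tgt A) (F1 f))"
    by (simp only: tr_nat0[OF assms t(3,4)])
  then have "icomp C (lift_icat T B) (FA T (F1 g)) (FA T t \<cdot> FA T (src A))
      = icomp C (lift_icat T B) (FA T t \<cdot> FA T (tgt A)) (FA T (F1 f))"
    using t by (simp add: lift_icomp)
  then show ?thesis
    using t st by (intro trI[of _ _ "lift_icat T A" "lift_icat T B"]) (simp_all add: lift_ifun)
qed

lemma lift_monad_simps [simp]:
  "M0 (lift_monad T) = lift_icat T" "M1 (lift_monad T) = lift_ifun T"
  "M2 (lift_monad T) \<tau> = \<lparr>TDom = lift_ifun T (TDom \<tau>), TCod = lift_ifun T (TCod \<tau>), TMap = FA T (TMap \<tau>)\<rparr>"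
  "Mu2 (lift_monad T) A = \<lparr>IDom = lift_icat T (lift_icat T A), ICod = lift_icat T A,
     F0 = Mu T (O0 A), F1 = Mu T (O1 A), F2 = Mu T (O2 A)\<rparr>"
  "Eps2 (lift_monad T) A = \<lparr>IDom = A, ICod = lift_icat T A,
     F0 = Eps T (O0 A), F1 = Eps T (O1 A), F2 = Eps T (O2 A)\<rparr>"
  by (simp_all add: lift_monad_def)

lemma Mu_ifun: "is_icat C A \<Longrightarrow> is_ifun C (Mu2 (lift_monad T) A)"
  unfolding is_ifun_def Let_def by (simp add: hom_iff Mu_nat)

lemma Eps_ifun: "is_icat C A \<Longrightarrow> is_ifun C (Eps2 (lift_monad T) A)"
  unfolding is_ifun_def Let_def by (simp add: hom_iff Eps_nat)

sublocale ICat: two_endofunctor "ICat C" "lift_monad T"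
proof (intro two_endofunctor.intro two_endofunctor_axioms.intro)
  show "two_category (ICat C)" by (rule ICat_two_category)
next
  fix A assume "A \<in> Obj (ICat C)"
  then have A: "is_icat C A" by simp
  then show "M0 (lift_monad T) A \<in> Obj (ICat C)" by simp
  show "M1 (lift_monad T) (Ident (ICat C) A) = Ident (ICat C) (M0 (lift_monad T) A)"
    using A by (simp add: lift_ifun_def)
  show "Mu2 (lift_monad T) A \<in> hom (ICat C) (M0 (lift_monad T) (M0 (lift_monad T) A)) (M0 (lift_monad T) A)"
    using Mu_ifun[OF A] by (simp add: hom_def)
  show "Eps2 (lift_monad T) A \<in> hom (ICat C) A (M0 (lift_monad T) A)"
    using Eps_ifun[OF A] by (simp add: hom_def)
next
  fix f A B assume "f \<in> hom (ICat C) A B"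
  then show "M1 (lift_monad T) f \<in> hom (ICat C) (M0 (lift_monad T) A) (M0 (lift_monad T) B)"
    by (auto simp: hom_def lift_ifun)
next
  fix f A B g D assume "f \<in> hom (ICat C) A B" "g \<in> hom (ICat C) B D"
  then show "M1 (lift_monad T) (g \<cdot>\<^bsub>ICat C\<^esub> f) = M1 (lift_monad T) g \<cdot>\<^bsub>ICat C\<^esub> M1 (lift_monad T) f"
    by (auto simp: hom_def lift_ifun_def icomp1_def)
next
  fix \<tau> f g assume *: "\<tau> \<in> cell (ICat C) f g"
  obtain t where "\<tau> = Tr f g t" "is_itrans C (Tr f g t)" using * by (rule cell_ICatE)
  then show "M2 (lift_monad T) \<tau> \<in> cell (ICat C) (M1 (lift_monad T) f) (M1 (lift_monad T) g)"
    using lift_itrans by (simp add: cell_ICat)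
next
  fix f assume "f \<in> Arr (ICat C)"
  then show "M2 (lift_monad T) (Id2 (ICat C) f) = Id2 (ICat C) (M1 (lift_monad T) f)"
    by simp
next
  fix \<tau> f g \<sigma> h assume *: "\<tau> \<in> cell (ICat C) f g" "\<sigma> \<in> cell (ICat C) g h"
  obtain t where t: "\<tau> = Tr f g t" "is_itrans C (Tr f g t)" using *(1) by (rule cell_ICatE)
  obtain s where s: "\<sigma> = Tr g h s" "is_itrans C (Tr g h s)" using *(2) by (rule cell_ICatE)
  note t' = tr[OF t(2) refl refl]
  show "M2 (lift_monad T) (\<sigma> \<bullet>\<^bsub>ICat C\<^esub> \<tau>) = M2 (lift_monad T) \<sigma> \<bullet>\<^bsub>ICat C\<^esub> M2 (lift_monad T) \<tau>"
    using t' tr[OF s(2) t'(5,6)] by (simp add: t(1) s(1) lift_icomp)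
next
  fix f A B g D \<tau> f' \<sigma> g'
  assume *: "f \<in> hom (ICat C) A B" "g \<in> hom (ICat C) B D" "\<tau> \<in> cell (ICat C) f f'" "\<sigma> \<in> cell (ICat C) g g'"
  obtain t where t: "\<tau> = Tr f f' t" "is_itrans C (Tr f f' t)" using *(3) by (rule cell_ICatE)
  obtain s where s: "\<sigma> = Tr g g' s" "is_itrans C (Tr g g' s)" using *(4) by (rule cell_ICatE)
  have fg: "IDom f = A" "ICod f = B" "IDom g = B" "ICod g = D"
    using *(1,2) by (auto simp: hom_def)
  show "M2 (lift_monad T) (\<sigma> \<star>\<^bsub>ICat C\<^esub> \<tau>) = M2 (lift_monad T) \<sigma> \<star>\<^bsub>ICat C\<^esub> M2 (lift_monad T) \<tau>"
    using tr[OF t(2) fg(1,2)] tr[OF s(2) fg(3,4)]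
    by (simp add: t(1) s(1) lift_icomp lift_ifun_def icomp1_def)
qed

end


section \<open>Representability of 2-functors to Cat\<close>

lemma hom_two_functor_simps [simp]:
  "P0 (hom_two_functor K H) = hom_cat K H"
  "FO (P1 (hom_two_functor K H) f) h = f \<cdot>\<^bsub>K\<^esub> h"
  "FA (P1 (hom_two_functor K H) f) \<theta> = Id2 K f \<star>\<^bsub>K\<^esub> \<theta>"
  "P2 (hom_two_functor K H) \<theta> h = \<theta> \<star>\<^bsub>K\<^esub> Id2 K h"
  by (simp_all add: hom_two_functor_def)

lemma hom_cat_simps [simp]:
  "Obj (hom_cat K A B) = hom K A B" "Dom (hom_cat K A B) = Dom2 K" "Cod (hom_cat K A B) = Cod2 K"
  "Ident (hom_cat K A B) = Id2 K" "Comp (hom_cat K A B) = VComp K"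
  "Arr (hom_cat K A B) = {\<theta> \<in> Cell2 K. Dom2 K \<theta> \<in> hom K A B \<and> Cod2 K \<theta> \<in> hom K A B}"
  by (simp_all add: hom_cat_def)

context two_category
begin

text \<open>The 2-dimensional Yoneda argument: an element \<open>u\<close> of \<open>P(H)\<close> induces the 2-natural
  transformation sending \<open>h : H \<rightarrow> A\<close> to \<open>P(h)(u)\<close>, so only bijectivity on objects and on the
  cells between two fixed objects has to be supplied.\<close>

theorem represents_by_universal_element:
  assumes P: "is_two_functor_to_Cat K P" and H: "H \<in> Obj K" and u: "u \<in> Obj (P0 P H)"
    and obj: "\<And>A. A \<in> Obj K \<Longrightarrow> bij_betw (\<lambda>h. FO (P1 P h) u) (hom K H A) (Obj (P0 P A))"
    and cells: "\<And>A h k. h \<in> hom K H A \<Longrightarrow> k \<in> hom K H A \<Longrightarrow>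
        bij_betw (\<lambda>\<theta>. P2 P \<theta> u) (cell K h k) (hom (P0 P A) (FO (P1 P h) u) (FO (P1 P k) u))"
  shows "represents K P H"
proof -
  define \<Phi> where "\<Phi> = (\<lambda>A::'o. \<lparr>FO = \<lambda>h. FO (P1 P h) u, FA = \<lambda>\<theta>. P2 P \<theta> u\<rparr>)"
  have cat: "category (P0 P A)" if "A \<in> Obj K" for A
    using P that unfolding is_two_functor_to_Cat_def by blast
  have functor_P: "is_functor (P0 P (Dom K f)) (P0 P (Cod K f)) (P1 P f)" if "f \<in> Arr K" for f
    using P that unfolding is_two_functor_to_Cat_def by blast
  have nat: "is_nat_trans (P0 P (Dom K (Dom2 K \<theta>))) (P0 P (Cod K (Dom2 K \<theta>)))
      (P1 P (Dom2 K \<theta>)) (P1 P (Cod2 K \<theta>)) (P2 P \<theta>)" if "\<theta> \<in> Cell2 K" for \<theta>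
    using P that unfolding is_two_functor_to_Cat_def by blast
  have comp: "FO (P1 P (g \<cdot> f)) x = FO (P1 P g) (FO (P1 P f) x)"
    if "f \<in> Arr K" "g \<in> Arr K" "Dom K g = Cod K f" "x \<in> Obj (P0 P (Dom K f))" for f g x
    using P that unfolding is_two_functor_to_Cat_def by blast
  have id2: "P2 P (Id2 K f) x = Ident (P0 P (Cod K f)) (FO (P1 P f) x)"
    if "f \<in> Arr K" "x \<in> Obj (P0 P (Dom K f))" for f x
    using P that unfolding is_two_functor_to_Cat_def by blast
  have vcomp: "P2 P (\<theta>' \<bullet> \<theta>) x = P2 P \<theta>' x \<cdot>\<^bsub>P0 P (Cod K (Dom2 K \<theta>))\<^esub> P2 P \<theta> x"
    if "\<theta> \<in> Cell2 K" "\<theta>' \<in> Cell2 K" "Dom2 K \<theta>' = Cod2 K \<theta>" "x \<in> Obj (P0 P (Dom K (Dom2 K \<theta>)))" for \<theta> \<theta>' x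
    using P that unfolding is_two_functor_to_Cat_def by blast
  have hcomp: "P2 P (\<sigma> \<star> \<tau>) x = P2 P \<sigma> (FO (P1 P (Cod2 K \<tau>)) x)
      \<cdot>\<^bsub>P0 P (Cod K (Dom2 K \<sigma>))\<^esub> FA (P1 P (Dom2 K \<sigma>)) (P2 P \<tau> x)"
    if "\<tau> \<in> Cell2 K" "\<sigma> \<in> Cell2 K" "Dom K (Dom2 K \<sigma>) = Cod K (Dom2 K \<tau>)"
      "x \<in> Obj (P0 P (Dom K (Dom2 K \<tau>)))" for \<tau> \<sigma> x
    using P that unfolding is_two_functor_to_Cat_def by blast
  have FO_obj: "FO (P1 P f) x \<in> Obj (P0 P (Cod K f))" if "f \<in> Arr K" "x \<in> Obj (P0 P (Dom K f))" for f x
    using functor_P[OF that(1)] that(2) unfolding is_functor_def by blast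
  have FA_hom: "FA (P1 P f) w \<in> hom (P0 P (Cod K f)) (FO (P1 P f) (Dom (P0 P (Dom K f)) w)) (FO (P1 P f) (Cod (P0 P (Dom K f)) w))"
    if "f \<in> Arr K" "w \<in> Arr (P0 P (Dom K f))" for f w
    using functor_P[OF that(1)] that(2) unfolding is_functor_def by blast
  have FA_id: "FA (P1 P f) (Ident (P0 P (Dom K f)) x) = Ident (P0 P (Cod K f)) (FO (P1 P f) x)"
    if "f \<in> Arr K" "x \<in> Obj (P0 P (Dom K f))" for f x
    using functor_P[OF that(1)] that(2) unfolding is_functor_def by blast
  have P2_hom: "P2 P \<theta> x \<in> hom (P0 P (Cod K (Dom2 K \<theta>))) (FO (P1 P (Dom2 K \<theta>)) x) (FO (P1 P (Cod2 K \<theta>)) x)"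
    if "\<theta> \<in> Cell2 K" "x \<in> Obj (P0 P (Dom K (Dom2 K \<theta>)))" for \<theta> x
    using nat[OF that(1)] that(2) unfolding is_nat_trans_def by blast
  have iso: "is_two_nat_iso K (hom_two_functor K H) P \<Phi>"
    unfolding is_two_nat_iso_def
  proof (intro conjI ballI)
    fix A assume A: "A \<in> Obj K"
    show "is_functor (P0 (hom_two_functor K H) A) (P0 P A) (\<Phi> A)"
      unfolding is_functor_def
    proof (intro conjI ballI impI)
      fix h assume "h \<in> Obj (P0 (hom_two_functor K H) A)"
      then show "FO (\<Phi> A) h \<in> Obj (P0 P A)"
        "FA (\<Phi> A) (Ident (P0 (hom_two_functor K H) A) h) = Ident (P0 P A) (FO (\<Phi> A) h)"
        using FO_obj[of h u] id2[of h u] u by (auto simp: \<Phi>_def hom_iff)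
    next
      fix \<theta> assume "\<theta> \<in> Arr (P0 (hom_two_functor K H) A)"
      then show "FA (\<Phi> A) \<theta> \<in> hom (P0 P A) (FO (\<Phi> A) (Dom (P0 (hom_two_functor K H) A) \<theta>))
          (FO (\<Phi> A) (Cod (P0 (hom_two_functor K H) A) \<theta>))"
        using P2_hom[of \<theta> u] u by (auto simp: \<Phi>_def hom_iff)
    next
      fix \<theta> \<theta>' assume "\<theta> \<in> Arr (P0 (hom_two_functor K H) A)" "\<theta>' \<in> Arr (P0 (hom_two_functor K H) A)"
        "Dom (P0 (hom_two_functor K H) A) \<theta>' = Cod (P0 (hom_two_functor K H) A) \<theta>"
      then show "FA (\<Phi> A) (\<theta>' \<cdot>\<^bsub>P0 (hom_two_functor K H) A\<^esub> \<theta>) = FA (\<Phi> A) \<theta>' \<cdot>\<^bsub>P0 P A\<^esub> FA (\<Phi> A) \<theta>"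
        using vcomp[of \<theta> \<theta>' u] u by (auto simp: \<Phi>_def hom_iff)
    qed
    show "bij_betw (FO (\<Phi> A)) (Obj (P0 (hom_two_functor K H) A)) (Obj (P0 P A))"
      using obj[OF A] by (simp add: \<Phi>_def)
    have P2_in: "P2 P \<theta> u \<in> hom (P0 P A) (FO (P1 P (Dom2 K \<theta>)) u) (FO (P1 P (Cod2 K \<theta>)) u)"
      if "\<theta> \<in> Arr (hom_cat K H A)" for \<theta>
      using P2_hom[of \<theta> u] u that by (auto simp: hom_iff)
    show "bij_betw (FA (\<Phi> A)) (Arr (P0 (hom_two_functor K H) A)) (Arr (P0 P A))"
      unfolding bij_betw_def
    proof
      show "inj_on (FA (\<Phi> A)) (Arr (P0 (hom_two_functor K H) A))"
      proof (rule inj_onI)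
        fix \<theta> \<theta>'
        assume t: "\<theta> \<in> Arr (P0 (hom_two_functor K H) A)" "\<theta>' \<in> Arr (P0 (hom_two_functor K H) A)"
          and "FA (\<Phi> A) \<theta> = FA (\<Phi> A) \<theta>'"
        then have eq: "P2 P \<theta> u = P2 P \<theta>' u" by (simp add: \<Phi>_def)
        then have "FO (P1 P (Dom2 K \<theta>)) u = FO (P1 P (Dom2 K \<theta>')) u"
            "FO (P1 P (Cod2 K \<theta>)) u = FO (P1 P (Cod2 K \<theta>')) u"
          using P2_in[of \<theta>] P2_in[of \<theta>'] t unfolding hom_def by auto
        moreover have "Dom2 K \<theta> \<in> hom K H A" "Dom2 K \<theta>' \<in> hom K H A" "Cod2 K \<theta> \<in> hom K H A" "Cod2 K \<theta>' \<in> hom K H A"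
          using t by auto
        ultimately have "Dom2 K \<theta> = Dom2 K \<theta>'" "Cod2 K \<theta> = Cod2 K \<theta>'"
          using bij_betw_imp_inj_on[OF obj[OF A]] by (auto dest: inj_onD)
        then have "\<theta> \<in> cell K (Dom2 K \<theta>) (Cod2 K \<theta>)" "\<theta>' \<in> cell K (Dom2 K \<theta>) (Cod2 K \<theta>)"
          using t by (auto simp: cell_iff)
        then show "\<theta> = \<theta>'"
          using bij_betw_imp_inj_on[OF cells[of "Dom2 K \<theta>" A "Cod2 K \<theta>"]] t eq by (auto dest: inj_onD)
      qed
      show "FA (\<Phi> A) ` Arr (P0 (hom_two_functor K H) A) = Arr (P0 P A)"
      proof (intro equalityI subsetI)
        fix w assume "w \<in> FA (\<Phi> A) ` Arr (P0 (hom_two_functor K H) A)"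
        then show "w \<in> Arr (P0 P A)"
          using P2_in by (auto simp: \<Phi>_def hom_def)
      next
        fix w assume w: "w \<in> Arr (P0 P A)"
        then have "Dom (P0 P A) w \<in> Obj (P0 P A)" "Cod (P0 P A) w \<in> Obj (P0 P A)"
          using category.dom_obj[OF cat[OF A]] category.cod_obj[OF cat[OF A]] by auto
        then have "Dom (P0 P A) w \<in> (\<lambda>h. FO (P1 P h) u) ` hom K H A" "Cod (P0 P A) w \<in> (\<lambda>h. FO (P1 P h) u) ` hom K H A"
          using bij_betw_imp_surj_on[OF obj[OF A]] by auto
        then obtain h k where hk: "h \<in> hom K H A" "k \<in> hom K H A" "FO (P1 P h) u = Dom (P0 P A) w" "FO (P1 P k) u = Cod (P0 P A) w"
          by auto
        then have "w \<in> hom (P0 P A) (FO (P1 P h) u) (FO (P1 P k) u)"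
          using w by (simp add: hom_def)
        then have "w \<in> (\<lambda>\<theta>. P2 P \<theta> u) ` cell K h k"
          using bij_betw_imp_surj_on[OF cells[OF hk(1,2)]] by simp
        then obtain \<theta> where "\<theta> \<in> cell K h k" "w = P2 P \<theta> u"
          by auto
        then show "w \<in> FA (\<Phi> A) ` Arr (P0 (hom_two_functor K H) A)"
          using hk(1,2) by (auto simp: \<Phi>_def cell_iff)
      qed
    qed
  next
    fix f h assume "f \<in> Arr K" "h \<in> Obj (P0 (hom_two_functor K H) (Dom K f))"
    then show "FO (P1 P f) (FO (\<Phi> (Dom K f)) h) = FO (\<Phi> (Cod K f)) (FO (P1 (hom_two_functor K H) f) h)"
      using comp[of h f u] u by (auto simp: \<Phi>_def hom_iff)
  next
    fix f \<theta> assume f: "f \<in> Arr K" and t: "\<theta> \<in> Arr (P0 (hom_two_functor K H) (Dom K f))"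
    let ?h = "Dom2 K \<theta>" and ?k = "Cod2 K \<theta>"
    have t': "\<theta> \<in> Cell2 K" "Dom K ?h = H" "Cod K ?h = Dom K f" "?h \<in> Arr K" "?k \<in> Arr K"
        "Dom K ?k = H" "Cod K ?k = Dom K f"
      using t by (auto simp: hom_iff)
    have w: "P2 P \<theta> u \<in> hom (P0 P (Dom K f)) (FO (P1 P ?h) u) (FO (P1 P ?k) u)"
      using P2_hom[of \<theta> u] t' u by simp
    then have "FA (P1 P f) (P2 P \<theta> u) \<in> hom (P0 P (Cod K f)) (FO (P1 P f) (FO (P1 P ?h) u)) (FO (P1 P f) (FO (P1 P ?k) u))"
      using FA_hom[OF f, of "P2 P \<theta> u"] by (simp add: hom_def)
    from category.ident_left[OF cat this] f
    have "Ident (P0 P (Cod K f)) (FO (P1 P f) (FO (P1 P ?k) u)) \<cdot>\<^bsub>P0 P (Cod K f)\<^esub> FA (P1 P f) (P2 P \<theta> u)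
        = FA (P1 P f) (P2 P \<theta> u)" by simp
    moreover have "P2 P (Id2 K f) (FO (P1 P ?k) u) = Ident (P0 P (Cod K f)) (FO (P1 P f) (FO (P1 P ?k) u))"
      using id2[OF f, of "FO (P1 P ?k) u"] FO_obj[of ?k u] t' u by simp
    ultimately show "FA (P1 P f) (FA (\<Phi> (Dom K f)) \<theta>) = FA (\<Phi> (Cod K f)) (FA (P1 (hom_two_functor K H) f) \<theta>)"
      using hcomp[of \<theta> "Id2 K f" u] t' u f by (simp add: \<Phi>_def)
  next
    fix \<theta> h assume t: "\<theta> \<in> Cell2 K" and h: "h \<in> Obj (P0 (hom_two_functor K H) (Dom K (Dom2 K \<theta>)))"
    then have h': "h \<in> Arr K" "Dom K h = H" "Cod K h = Dom K (Dom2 K \<theta>)"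
      by (auto simp: hom_iff)
    let ?x = "FO (P1 P h) u"
    have x: "?x \<in> Obj (P0 P (Dom K (Dom2 K \<theta>)))"
      using FO_obj[of h u] h' u by simp
    have "P2 P \<theta> ?x \<cdot>\<^bsub>P0 P (Cod K (Dom2 K \<theta>))\<^esub> Ident (P0 P (Cod K (Dom2 K \<theta>))) (FO (P1 P (Dom2 K \<theta>)) ?x) = P2 P \<theta> ?x"
      using category.ident_right[OF cat P2_hom[OF t x]] t by simp
    then show "P2 P \<theta> (FO (\<Phi> (Dom K (Dom2 K \<theta>))) h) = FA (\<Phi> (Cod K (Dom2 K \<theta>))) (P2 (hom_two_functor K H) \<theta> h)"
      using hcomp[of "Id2 K h" \<theta> u] id2[of h u] FA_id[of "Dom2 K \<theta>" ?x] x t h' u by (simp add: \<Phi>_def)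
  qed
  show ?thesis
    unfolding represents_def using H iso by blast
qed

text \<open>Evaluating one isomorphism at the identity and inverting the other gives mutually inverse comparison
  morphisms; naturality in 1-cells identifies their composites.\<close>

theorem representing_objects_iso:
  assumes "represents K P H" "represents K P H'"
  shows "\<exists>f. is_iso K H H' f"
proof -
  obtain \<Phi> where \<Phi>: "is_two_nat_iso K (hom_two_functor K H) P \<Phi>" and H: "H \<in> Obj K"
    using assms(1) unfolding represents_def by blast
  obtain \<Psi> where \<Psi>: "is_two_nat_iso K (hom_two_functor K H') P \<Psi>" and H': "H' \<in> Obj K"
    using assms(2) unfolding represents_def by blast
  have \<Phi>b: "bij_betw (FO (\<Phi> A)) (hom K H A) (Obj (P0 P A))"
    and \<Psi>b: "bij_betw (FO (\<Psi> A)) (hom K H' A) (Obj (P0 P A))" if "A \<in> Obj K" for A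
    using \<Phi> \<Psi> that unfolding is_two_nat_iso_def by auto
  have \<Phi>n: "FO (P1 P f) (FO (\<Phi> A) h) = FO (\<Phi> B) (f \<cdot> h)" if "f \<in> hom K A B" "h \<in> hom K H A" for f A B h
    using \<Phi> that unfolding is_two_nat_iso_def by (auto simp: hom_iff)
  have \<Psi>n: "FO (P1 P f) (FO (\<Psi> A) h) = FO (\<Psi> B) (f \<cdot> h)" if "f \<in> hom K A B" "h \<in> hom K H' A" for f A B h
    using \<Psi> that unfolding is_two_nat_iso_def by (auto simp: hom_iff)
  let ?i = "Ident K H" and ?i' = "Ident K H'"
  have i: "?i \<in> hom K H H" "?i' \<in> hom K H' H'"
    using H H' by (auto simp: hom_iff)
  have "FO (\<Phi> H) ?i \<in> Obj (P0 P H)" "FO (\<Psi> H') ?i' \<in> Obj (P0 P H')"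
    using bij_betwE[OF \<Phi>b[OF H]] bij_betwE[OF \<Psi>b[OF H']] i by auto
  then have "FO (\<Phi> H) ?i \<in> FO (\<Psi> H) ` hom K H' H" "FO (\<Psi> H') ?i' \<in> FO (\<Phi> H') ` hom K H H'"
    using bij_betw_imp_surj_on[OF \<Psi>b[OF H]] bij_betw_imp_surj_on[OF \<Phi>b[OF H']] by auto
  then obtain f g where f: "f \<in> hom K H' H" "FO (\<Psi> H) f = FO (\<Phi> H) ?i"
      and g: "g \<in> hom K H H'" "FO (\<Phi> H') g = FO (\<Psi> H') ?i'"
    by (elim imageE) auto
  have "FO (\<Phi> H) (f \<cdot> g) = FO (\<Psi> H) (f \<cdot> ?i')"
    using \<Phi>n[OF f(1) g(1)] \<Psi>n[OF f(1) i(2)] g(2) by simp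
  then have "FO (\<Phi> H) (f \<cdot> g) = FO (\<Phi> H) ?i"
    using f by (simp add: hom_iff)
  then have 1: "f \<cdot> g = ?i"
    using bij_betw_imp_inj_on[OF \<Phi>b[OF H]] i comp_hom[OF g(1) f(1)] by (auto dest: inj_onD)
  have "FO (\<Psi> H') (g \<cdot> f) = FO (\<Phi> H') (g \<cdot> ?i)"
    using \<Psi>n[OF g(1) f(1)] \<Phi>n[OF g(1) i(1)] f(2) by simp
  then have "FO (\<Psi> H') (g \<cdot> f) = FO (\<Psi> H') ?i'"
    using g by (simp add: hom_iff)
  then have 2: "g \<cdot> f = ?i'"
    using bij_betw_imp_inj_on[OF \<Psi>b[OF H']] i comp_hom[OF f(1) g(1)] by (auto dest: inj_onD)
  show ?thesis
    unfolding is_iso_def using f g 1 2 by blast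
qed

text \<open>Precomposition with an isomorphism and with its inverse are inverse to each other.\<close>

theorem represents_transport:
  assumes rep: "represents K P H" and iso: "is_iso K H H' i"
  shows "represents K P H'"
proof -
  obtain \<Phi> where \<Phi>: "is_two_nat_iso K (hom_two_functor K H) P \<Phi>" and H: "H \<in> Obj K"
    using rep unfolding represents_def by blast
  obtain j where i: "i \<in> Arr K" "Dom K i = H" "Cod K i = H'" and j: "j \<in> Arr K" "Dom K j = H'" "Cod K j = H"
    and ij: "j \<cdot> i = Ident K H" "i \<cdot> j = Ident K H'"
    using iso unfolding is_iso_def by (auto simp: hom_iff)
  have H': "H' \<in> Obj K" using i by auto
  define \<Psi> where "\<Psi> = (\<lambda>A. \<lparr>FO = \<lambda>h. FO (\<Phi> A) (h \<cdot> i), FA = \<lambda>\<theta>. FA (\<Phi> A) (\<theta> \<star> Id2 K i)\<rparr>)"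
  have bo: "bij_betw (\<lambda>h. h \<cdot> i) (hom K H' A) (hom K H A)" for A
    by (rule bij_betw_byWitness[where f' = "\<lambda>h. h \<cdot> j"]) (auto simp: hom_iff i j ij)
  have ba: "bij_betw (\<lambda>\<theta>. \<theta> \<star> Id2 K i) (Arr (hom_cat K H' A)) (Arr (hom_cat K H A))" for A
    by (rule bij_betw_byWitness[where f' = "\<lambda>\<theta>. \<theta> \<star> Id2 K j"]) (auto simp: hom_iff i j ij)
  have "is_two_nat_iso K (hom_two_functor K H') P \<Psi>"
    unfolding is_two_nat_iso_def
  proof (intro conjI ballI)
    fix A assume A: "A \<in> Obj K"
    have \<Phi>A: "is_functor (hom_cat K H A) (P0 P A) (\<Phi> A)" "bij_betw (FO (\<Phi> A)) (hom K H A) (Obj (P0 P A))"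
      "bij_betw (FA (\<Phi> A)) (Arr (hom_cat K H A)) (Arr (P0 P A))"
      using \<Phi> A unfolding is_two_nat_iso_def by simp_all
    show "is_functor (P0 (hom_two_functor K H') A) (P0 P A) (\<Psi> A)"
      unfolding is_functor_def
    proof (intro conjI ballI impI)
      fix h assume "h \<in> Obj (P0 (hom_two_functor K H') A)"
      then have h: "h \<in> Arr K" "Dom K h = H'" "h \<cdot> i \<in> Obj (hom_cat K H A)"
        using i by (auto simp: hom_iff)
      from \<Phi>A(1) h(3) have "FO (\<Phi> A) (h \<cdot> i) \<in> Obj (P0 P A)"
        "FA (\<Phi> A) (Ident (hom_cat K H A) (h \<cdot> i)) = Ident (P0 P A) (FO (\<Phi> A) (h \<cdot> i))"
        unfolding is_functor_def by blast+
      then show "FO (\<Psi> A) h \<in> Obj (P0 P A)"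
        "FA (\<Psi> A) (Ident (P0 (hom_two_functor K H') A) h) = Ident (P0 P A) (FO (\<Psi> A) h)"
        using h(1,2) i by (simp_all add: \<Psi>_def)
    next
      fix \<theta> assume t: "\<theta> \<in> Arr (P0 (hom_two_functor K H') A)"
      then have "\<theta> \<star> Id2 K i \<in> Arr (hom_cat K H A)"
        using i by (auto simp: hom_iff)
      with \<Phi>A(1) have "FA (\<Phi> A) (\<theta> \<star> Id2 K i) \<in> hom (P0 P A)
          (FO (\<Phi> A) (Dom (hom_cat K H A) (\<theta> \<star> Id2 K i))) (FO (\<Phi> A) (Cod (hom_cat K H A) (\<theta> \<star> Id2 K i)))"
        unfolding is_functor_def by blast
      then show "FA (\<Psi> A) \<theta> \<in> hom (P0 P A) (FO (\<Psi> A) (Dom (P0 (hom_two_functor K H') A) \<theta>))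
          (FO (\<Psi> A) (Cod (P0 (hom_two_functor K H') A) \<theta>))"
        using t i by (auto simp: \<Psi>_def hom_iff)
    next
      fix \<theta> \<theta>' assume t: "\<theta> \<in> Arr (P0 (hom_two_functor K H') A)" "\<theta>' \<in> Arr (P0 (hom_two_functor K H') A)"
        "Dom (P0 (hom_two_functor K H') A) \<theta>' = Cod (P0 (hom_two_functor K H') A) \<theta>"
      then have t': "\<theta> \<in> Cell2 K" "\<theta>' \<in> Cell2 K" "Dom2 K \<theta>' = Cod2 K \<theta>" "Dom K (Dom2 K \<theta>) = H'"
        by (auto simp: hom_iff)
      have "\<theta> \<star> Id2 K i \<in> Arr (hom_cat K H A)" "\<theta>' \<star> Id2 K i \<in> Arr (hom_cat K H A)"
        "Dom (hom_cat K H A) (\<theta>' \<star> Id2 K i) = Cod (hom_cat K H A) (\<theta> \<star> Id2 K i)"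
        using t i by (auto simp: hom_iff)
      with \<Phi>A(1) have "FA (\<Phi> A) ((\<theta>' \<star> Id2 K i) \<cdot>\<^bsub>hom_cat K H A\<^esub> (\<theta> \<star> Id2 K i))
          = FA (\<Phi> A) (\<theta>' \<star> Id2 K i) \<cdot>\<^bsub>P0 P A\<^esub> FA (\<Phi> A) (\<theta> \<star> Id2 K i)"
        unfolding is_functor_def by blast
      then show "FA (\<Psi> A) (\<theta>' \<cdot>\<^bsub>P0 (hom_two_functor K H') A\<^esub> \<theta>) = FA (\<Psi> A) \<theta>' \<cdot>\<^bsub>P0 P A\<^esub> FA (\<Psi> A) \<theta>"
        using t' i by (simp add: \<Psi>_def whisker_right)
    qed
    show "bij_betw (FO (\<Psi> A)) (Obj (P0 (hom_two_functor K H') A)) (Obj (P0 P A))"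
      using bij_betw_trans[OF bo \<Phi>A(2)] by (simp add: \<Psi>_def comp_def)
    show "bij_betw (FA (\<Psi> A)) (Arr (P0 (hom_two_functor K H') A)) (Arr (P0 P A))"
      using bij_betw_trans[OF ba \<Phi>A(3)] by (simp add: \<Psi>_def comp_def)
  next
    fix f h assume f: "f \<in> Arr K" and h: "h \<in> Obj (P0 (hom_two_functor K H') (Dom K f))"
    then have "h \<cdot> i \<in> hom K H (Dom K f)"
      using i by (auto simp: hom_iff)
    then have "FO (P1 P f) (FO (\<Phi> (Dom K f)) (h \<cdot> i)) = FO (\<Phi> (Cod K f)) (f \<cdot> (h \<cdot> i))"
      using \<Phi> f unfolding is_two_nat_iso_def by simp
    then show "FO (P1 P f) (FO (\<Psi> (Dom K f)) h) = FO (\<Psi> (Cod K f)) (FO (P1 (hom_two_functor K H') f) h)"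
      using f h i by (auto simp: \<Psi>_def hom_iff)
  next
    fix f \<theta> assume f: "f \<in> Arr K" and t: "\<theta> \<in> Arr (P0 (hom_two_functor K H') (Dom K f))"
    then have "\<theta> \<star> Id2 K i \<in> Arr (hom_cat K H (Dom K f))"
      using i by (auto simp: hom_iff)
    then have "FA (P1 P f) (FA (\<Phi> (Dom K f)) (\<theta> \<star> Id2 K i)) = FA (\<Phi> (Cod K f)) (Id2 K f \<star> (\<theta> \<star> Id2 K i))"
      using \<Phi> f unfolding is_two_nat_iso_def by simp
    then show "FA (P1 P f) (FA (\<Psi> (Dom K f)) \<theta>) = FA (\<Psi> (Cod K f)) (FA (P1 (hom_two_functor K H') f) \<theta>)"
      using f t i by (auto simp: \<Psi>_def hom_iff)
  next
    fix \<theta> h assume t: "\<theta> \<in> Cell2 K" and h: "h \<in> Obj (P0 (hom_two_functor K H') (Dom K (Dom2 K \<theta>)))"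
    then have "h \<cdot> i \<in> hom K H (Dom K (Dom2 K \<theta>))"
      using i by (auto simp: hom_iff)
    then have "P2 P \<theta> (FO (\<Phi> (Dom K (Dom2 K \<theta>))) (h \<cdot> i)) = FA (\<Phi> (Cod K (Dom2 K \<theta>))) (\<theta> \<star> Id2 K (h \<cdot> i))"
      using \<Phi> t unfolding is_two_nat_iso_def by simp
    then show "P2 P \<theta> (FO (\<Psi> (Dom K (Dom2 K \<theta>))) h) = FA (\<Psi> (Cod K (Dom2 K \<theta>))) (P2 (hom_two_functor K H') \<theta> h)"
      using t h i by (auto simp: \<Psi>_def hom_iff)
  qed
  then show ?thesis
    unfolding represents_def using H' by blast
qed

end


section \<open>Categorical algebras in components\<close>

text \<open>From here on, cells are evaluated through their whiskerings rather than through the general formula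
  for horizontal composites.\<close>

declare ICat_simps(10-12) [simp del]

context category
begin

lemma Tr_simps:
  "VComp (ICat C) (Tr g h t) (Tr f g' s) = Tr f h (icomp C (ICod f) t s)"
  by (simp add: ICat_simps)

lemma whisker_right_Tr:
  assumes "is_itrans C (Tr g g' s)" "is_ifun C f" "IDom g = ICod f"
  shows "HComp (ICat C) (Tr g g' s) (Id2 (ICat C) f) = Tr (icomp1 C g f) (icomp1 C g' f) (s \<cdot> F0 f)"
proof -
  define B D where BD: "B = ICod f" "D = ICod g"
  have "IDom g = B" using assms(3) BD by simp
  note s = tr[OF assms(1) this BD(2)[symmetric]]
  show ?thesis
    using assms(2) BD(1)[symmetric] by (simp add: ICat_simps s)
qed

lemma whisker_left_Tr:
  assumes "is_itrans C (Tr f f' t)" "is_ifun C h" "IDom h = ICod f"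
  shows "HComp (ICat C) (Id2 (ICat C) h) (Tr f f' t) = Tr (icomp1 C h f) (icomp1 C h f') (F1 h \<cdot> t)"
proof -
  define B D where BD: "B = ICod f" "D = ICod h"
  note t = tr[OF assms(1) refl BD(1)[symmetric]]
  show ?thesis
    using assms(2,3) BD(2)[symmetric] ifun_icat(2)[OF assms(2) BD(2)[symmetric]] by (simp add: ICat_simps t)
qed

end

context cartesian_monad
begin

lemma Mu2_simps:
  "IDom (Mu2 (lift_monad T) A) = lift_icat T (lift_icat T A)" "ICod (Mu2 (lift_monad T) A) = lift_icat T A"
  "F0 (Mu2 (lift_monad T) A) = Mu T (O0 A)" "F1 (Mu2 (lift_monad T) A) = Mu T (O1 A)"
  "IDom (Eps2 (lift_monad T) A) = A" "ICod (Eps2 (lift_monad T) A) = lift_icat T A"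
  "F0 (Eps2 (lift_monad T) A) = Eps T (O0 A)" "F1 (Eps2 (lift_monad T) A) = Eps T (O1 A)"
  by simp_all

declare lift_monad_simps(4,5) [simp del] Mu2_simps [simp]

abbreviation calgs :: "('o, 'a) calg set" where
  "calgs \<equiv> strict_algs (ICat C) (lift_monad T)"

lemma Obj_CAlg: "Obj (CAlg C T) = calgs"
  by (simp add: CAlg_def)

lemma calg_iff:
  "(A, \<alpha>) \<in> calgs \<longleftrightarrow> is_icat C A \<and> is_ifun C \<alpha> \<and> IDom \<alpha> = lift_icat T A \<and> ICod \<alpha> = A \<and>
     F0 \<alpha> \<cdot> FA T (F0 \<alpha>) = F0 \<alpha> \<cdot> Mu T (O0 A) \<and> F0 \<alpha> \<cdot> Eps T (O0 A) = Ident C (O0 A) \<and>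
     F1 \<alpha> \<cdot> FA T (F1 \<alpha>) = F1 \<alpha> \<cdot> Mu T (O1 A) \<and> F1 \<alpha> \<cdot> Eps T (O1 A) = Ident C (O1 A) \<and>
     F2 \<alpha> \<cdot> FA T (F2 \<alpha>) = F2 \<alpha> \<cdot> Mu T (O2 A) \<and> F2 \<alpha> \<cdot> Eps T (O2 A) = Ident C (O2 A)"
  by (auto simp: strict_algs_def hom_def icomp1_def lift_monad_simps(4,5))

lemma calg_facts:
  assumes "(A, \<alpha>) \<in> calgs"
  shows "is_icat C A" "is_ifun C \<alpha>" "IDom \<alpha> = lift_icat T A" "ICod \<alpha> = A"
    "F0 \<alpha> \<in> Arr C" "Dom C (F0 \<alpha>) = FO T (O0 A)" "Cod C (F0 \<alpha>) = O0 A"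
    "F1 \<alpha> \<in> Arr C" "Dom C (F1 \<alpha>) = FO T (O1 A)" "Cod C (F1 \<alpha>) = O1 A"
    "F2 \<alpha> \<in> Arr C" "Dom C (F2 \<alpha>) = FO T (O2 A)" "Cod C (F2 \<alpha>) = O2 A"
  using assms unfolding calg_iff by auto

lemma calg_alg:
  assumes "(A, \<alpha>) \<in> calgs"
  shows "\<And>x. x \<in> Arr C \<Longrightarrow> Cod C x = FO T (FO T (O0 A)) \<Longrightarrow> F0 \<alpha> \<cdot> (FA T (F0 \<alpha>) \<cdot> x) = F0 \<alpha> \<cdot> (Mu T (O0 A) \<cdot> x)"
    "\<And>x. x \<in> Arr C \<Longrightarrow> Cod C x = FO T (FO T (O1 A)) \<Longrightarrow> F1 \<alpha> \<cdot> (FA T (F1 \<alpha>) \<cdot> x) = F1 \<alpha> \<cdot> (Mu T (O1 A) \<cdot> x)"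
    "\<And>x. x \<in> Arr C \<Longrightarrow> Cod C x = O0 A \<Longrightarrow> F0 \<alpha> \<cdot> (Eps T (O0 A) \<cdot> x) = x"
    "\<And>x. x \<in> Arr C \<Longrightarrow> Cod C x = O1 A \<Longrightarrow> F1 \<alpha> \<cdot> (Eps T (O1 A) \<cdot> x) = x"
proof -
  note f = calg_facts[OF assms] and e = assms[unfolded calg_iff]
  have e0: "F0 \<alpha> \<cdot> FA T (F0 \<alpha>) = F0 \<alpha> \<cdot> Mu T (O0 A)" and e1: "F1 \<alpha> \<cdot> FA T (F1 \<alpha>) = F1 \<alpha> \<cdot> Mu T (O1 A)"
    and u0: "F0 \<alpha> \<cdot> Eps T (O0 A) = Ident C (O0 A)" and u1: "F1 \<alpha> \<cdot> Eps T (O1 A) = Ident C (O1 A)"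
    using e by simp_all
  show "\<And>x. x \<in> Arr C \<Longrightarrow> Cod C x = FO T (FO T (O0 A)) \<Longrightarrow> F0 \<alpha> \<cdot> (FA T (F0 \<alpha>) \<cdot> x) = F0 \<alpha> \<cdot> (Mu T (O0 A) \<cdot> x)"
    using reassoc[OF e0] f by simp
  show "\<And>x. x \<in> Arr C \<Longrightarrow> Cod C x = FO T (FO T (O1 A)) \<Longrightarrow> F1 \<alpha> \<cdot> (FA T (F1 \<alpha>) \<cdot> x) = F1 \<alpha> \<cdot> (Mu T (O1 A) \<cdot> x)"
    using reassoc[OF e1] f by simp
  show "\<And>x. x \<in> Arr C \<Longrightarrow> Cod C x = O0 A \<Longrightarrow> F0 \<alpha> \<cdot> (Eps T (O0 A) \<cdot> x) = x"
    using reassoc[OF u0] f by simp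
  show "\<And>x. x \<in> Arr C \<Longrightarrow> Cod C x = O1 A \<Longrightarrow> F1 \<alpha> \<cdot> (Eps T (O1 A) \<cdot> x) = x"
    using reassoc[OF u1] f by simp
qed

text \<open>Since the action \<open>\<alpha>\<close> is an internal functor, extending generalized elements \<open>x\<close> to algebra maps
  \<open>F1 \<alpha> \<cdot> T x\<close> out of free algebras is compatible with the structure of \<open>A\<close>.\<close>

lemma calg_extend:
  assumes "(A, \<alpha>) \<in> calgs" "x \<in> Arr C" "Cod C x = O1 A"
  shows "src A \<cdot> (F1 \<alpha> \<cdot> FA T x) = F0 \<alpha> \<cdot> FA T (src A \<cdot> x)"
    "tgt A \<cdot> (F1 \<alpha> \<cdot> FA T x) = F0 \<alpha> \<cdot> FA T (tgt A \<cdot> x)"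
  using assms(2,3) ifun_src_elt[of \<alpha> A "FA T x"] ifun_tgt_elt[of \<alpha> A "FA T x"] calg_facts[OF assms(1)]
  by simp_all

lemma calg_extend_idn:
  assumes "(A, \<alpha>) \<in> calgs" "x \<in> Arr C" "Cod C x = O0 A"
  shows "F1 \<alpha> \<cdot> FA T (idn A \<cdot> x) = idn A \<cdot> (F0 \<alpha> \<cdot> FA T x)"
  using assms(2,3) ifun_idn_elt[of \<alpha> "lift_icat T A" "FA T x"] calg_facts[OF assms(1)] by simp

lemma calg_extend_icomp:
  assumes "(A, \<alpha>) \<in> calgs" "x \<in> Arr C" "y \<in> Arr C" "Cod C x = O1 A" "Cod C y = O1 A" "tgt A \<cdot> x = src A \<cdot> y"
  shows "F1 \<alpha> \<cdot> FA T (icomp C A y x) = icomp C A (F1 \<alpha> \<cdot> FA T y) (F1 \<alpha> \<cdot> FA T x)"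
proof -
  note f = calg_facts[OF assms(1)]
  have "FA T (tgt A) \<cdot> FA T x = FA T (src A) \<cdot> FA T y"
    using f assms(2-5) by (intro T_eq[OF assms(6)]) simp_all
  then show ?thesis
    using assms f ifun_icomp[of \<alpha> "lift_icat T A" "FA T x" "FA T y"] by (simp add: lift_icomp)
qed

text \<open>Levels 0 and 1 suffice, since the action on composable pairs is forced.\<close>

lemma strict_mor_iff:
  assumes "(A, \<alpha>) \<in> calgs" "(B, \<beta>) \<in> calgs"
  shows "((A, \<alpha>), (B, \<beta>), f) \<in> Arr (CAlg C T) \<longleftrightarrow> is_ifun C f \<and> IDom f = A \<and> ICod f = B \<and>
     F0 f \<cdot> F0 \<alpha> = F0 \<beta> \<cdot> FA T (F0 f) \<and> F1 f \<cdot> F1 \<alpha> = F1 \<beta> \<cdot> FA T (F1 f)"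
proof -
  note a = calg_facts[OF assms(1)] and b = calg_facts[OF assms(2)]
  have "icomp1 C f \<alpha> = icomp1 C \<beta> (lift_ifun T f)"
    if "is_ifun C f" "IDom f = A" "ICod f = B" "F0 f \<cdot> F0 \<alpha> = F0 \<beta> \<cdot> FA T (F0 f)" "F1 f \<cdot> F1 \<alpha> = F1 \<beta> \<cdot> FA T (F1 f)"
    using that a b by (intro ifun_eqI ifun_comp lift_ifun) simp_all
  moreover have "F0 f \<cdot> F0 \<alpha> = F0 \<beta> \<cdot> FA T (F0 f) \<and> F1 f \<cdot> F1 \<alpha> = F1 \<beta> \<cdot> FA T (F1 f)"
    if "icomp1 C f \<alpha> = icomp1 C \<beta> (lift_ifun T f)"
    using arg_cong[OF that, of F0] arg_cong[OF that, of F1] by simp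
  ultimately show ?thesis
    using assms unfolding CAlg_def ICat.Alg2_arr by auto
qed

lemma strict_cell_iff:
  assumes "(A, \<alpha>) \<in> calgs" "(B, \<beta>) \<in> calgs"
    "((A, \<alpha>), (B, \<beta>), f) \<in> Arr (CAlg C T)" "((A, \<alpha>), (B, \<beta>), g) \<in> Arr (CAlg C T)"
  shows "((A, \<alpha>), (B, \<beta>), Tr f g t) \<in> Cell2 (CAlg C T) \<longleftrightarrow>
     is_itrans C (Tr f g t) \<and> t \<cdot> F0 \<alpha> = F1 \<beta> \<cdot> FA T t"
proof -
  note a = calg_facts[OF assms(1)] and b = calg_facts[OF assms(2)]
  note f = assms(3)[unfolded strict_mor_iff[OF assms(1,2)]] and g = assms(4)[unfolded strict_mor_iff[OF assms(1,2)]]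
  have eqs: "icomp1 C f \<alpha> = icomp1 C \<beta> (lift_ifun T f)" "icomp1 C g \<alpha> = icomp1 C \<beta> (lift_ifun T g)"
    using assms(3,4) unfolding CAlg_def ICat.Alg2_arr by auto
  have "Tr f g t \<star>\<^bsub>ICat C\<^esub> Id2 (ICat C) \<alpha> = Id2 (ICat C) \<beta> \<star>\<^bsub>ICat C\<^esub> M2 (lift_monad T) (Tr f g t) \<longleftrightarrow>
      t \<cdot> F0 \<alpha> = F1 \<beta> \<cdot> FA T t" if t: "is_itrans C (Tr f g t)"
  proof -
    have "Tr f g t \<star>\<^bsub>ICat C\<^esub> Id2 (ICat C) \<alpha> = Tr (icomp1 C f \<alpha>) (icomp1 C g \<alpha>) (t \<cdot> F0 \<alpha>)"
      using a f by (intro whisker_right_Tr[OF t]) simp_all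
    moreover have "Id2 (ICat C) \<beta> \<star>\<^bsub>ICat C\<^esub> M2 (lift_monad T) (Tr f g t)
        = Tr (icomp1 C f \<alpha>) (icomp1 C g \<alpha>) (F1 \<beta> \<cdot> FA T t)"
      using whisker_left_Tr[OF lift_itrans[OF t] b(2)] b(3) f unfolding eqs by simp
    ultimately show ?thesis by simp
  qed
  then show ?thesis
    using assms(3,4) unfolding CAlg_def ICat.Alg2_cell by (simp cong: conj_cong)
qed

end


section \<open>Internal algebras in components\<close>

locale cartesian_monad_terminal = cartesian_monad C T
  for C :: "('o, 'a, 'm) cat_scheme" (structure) and T +
  fixes one :: 'o
  assumes terminal: "is_terminal C one"
begin

abbreviation bng :: "'o \<Rightarrow> 'a" where "bng \<equiv> bang C one"

lemma one_obj [simp]: "one \<in> Obj C"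
  using terminal unfolding is_terminal_def by blast

lemma bang_hom: "X \<in> Obj C \<Longrightarrow> bng X \<in> hom C X one"
  using terminal unfolding is_terminal_def bang_def by (metis (no_types, lifting) theI')

lemma bang_typ [simp]: "X \<in> Obj C \<Longrightarrow> bng X \<in> Arr C" "X \<in> Obj C \<Longrightarrow> Dom C (bng X) = X" "X \<in> Obj C \<Longrightarrow> Cod C (bng X) = one"
  using bang_hom by (auto simp: hom_iff)

lemma to_one_unique: "f \<in> Arr C \<Longrightarrow> g \<in> Arr C \<Longrightarrow> Cod C f = one \<Longrightarrow> Cod C g = one \<Longrightarrow> Dom C f = Dom C g \<Longrightarrow> f = g"
  using terminal unfolding is_terminal_def by (metis hom_iff dom_obj)

lemma bang_comp [simp]: "f \<in> Arr C \<Longrightarrow> Cod C f = X \<Longrightarrow> bng X \<cdot> f = bng (Dom C f)"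
  by (rule to_one_unique) auto

lemma bang_one [simp]: "bng one = Ident C one"
  by (rule to_one_unique) auto

abbreviation one_alg2 :: "('o, 'a) calg" where "one_alg2 \<equiv> one_calg C T one"

lemma one_icat_simps [simp]:
  "O0 (one_icat C one) = one" "O1 (one_icat C one) = one" "O2 (one_icat C one) = one"
  "src (one_icat C one) = Ident C one" "tgt (one_icat C one) = Ident C one" "idn (one_icat C one) = Ident C one"
  "pr1 (one_icat C one) = Ident C one" "pr2 (one_icat C one) = Ident C one" "cmp (one_icat C one) = Ident C one"
  by (simp_all add: one_icat_def Let_def)

lemma one_icat [simp]: "is_icat C (one_icat C one)"
proof -
  have pb: "is_pullback C (Ident C one) (Ident C one) (Ident C one) (Ident C one)"
    by (rule pullbackI) auto
  then have pre: "is_precat (one_icat C one)"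
    unfolding is_precat_def by (simp add: hom_iff)
  have "icomp C (one_icat C one) y x = x" "icomp C (one_icat C one) y x = y"
    if "x \<in> hom C Z one" "y \<in> hom C Z one" for x y Z
  proof -
    have "x = y" using that by (intro to_one_unique) (auto simp: hom_iff)
    moreover have "ipair C (one_icat C one) x y = x"
      using that \<open>x = y\<close> by (intro ipair_eqI[OF pre]) (auto simp: hom_iff)
    ultimately show "icomp C (one_icat C one) y x = x" "icomp C (one_icat C one) y x = y"
      using that by (simp_all add: icomp_def hom_iff)
  qed
  then show ?thesis
    using pre unfolding is_icat_def is_precat_def by (simp add: hom_iff)
qed

lemma one_alg2_simps [simp]:
  "fst one_alg2 = one_icat C one" "IDom (snd one_alg2) = lift_icat T (one_icat C one)"
  "ICod (snd one_alg2) = one_icat C one" "F0 (snd one_alg2) = bng (FO T one)"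
  "F1 (snd one_alg2) = bng (FO T one)" "F2 (snd one_alg2) = bng (FO T one)"
  by (simp_all add: one_calg_def Let_def)

lemma one_action: "is_ifun C (snd one_alg2)"
  unfolding is_ifun_def Let_def by (simp add: hom_iff)

declare one_action [simp]

lemma one_calg: "one_alg2 \<in> calgs"
proof -
  have "(one_icat C one, snd one_alg2) \<in> calgs"
    unfolding calg_iff by simp
  then show ?thesis
    by (metis one_alg2_simps(1) prod.collapse)
qed

text \<open>An internal functor out of the terminal internal category is a global object.\<close>

lemma ifun_one:
  assumes "is_ifun C f" "IDom f = one_icat C one" "ICod f = A"
  shows "F1 f = idn A \<cdot> F0 f"
  using ifun_idn[OF assms(1,2)] assms by simp

lemma point_ifun:
  assumes "is_icat C A" "a \<in> Arr C" "Dom C a = one" "Cod C a = O0 A"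
  shows "is_ifun C \<lparr>IDom = one_icat C one, ICod = A, F0 = a, F1 = idn A \<cdot> a, F2 = ipair C A (idn A \<cdot> a) (idn A \<cdot> a)\<rparr>"
  using assms by (intro ifunI) simp_all

text \<open>An internal algebra consists of a global object \<open>a\<close> and a map \<open>p\<close> from \<open>T(1)\<close> to the object of
  arrows, subject to unit and multiplication equations between generalized elements.\<close>

lemma lax_one_iff:
  assumes "(A, \<alpha>) \<in> calgs" "is_ifun C f" "IDom f = one_icat C one" "ICod f = A"
  shows "(f, Tr (icomp1 C \<alpha> (lift_ifun T f)) (icomp1 C f (snd one_alg2)) p)
      \<in> lax_mors (ICat C) (lift_monad T) one_alg2 (A, \<alpha>) \<longleftrightarrow>
    p \<in> Arr C \<and> Dom C p = FO T one \<and> Cod C p = O1 A \<and>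
    src A \<cdot> p = F0 \<alpha> \<cdot> FA T (F0 f) \<and> tgt A \<cdot> p = F0 f \<cdot> bng (FO T one) \<and>
    p \<cdot> Eps T one = idn A \<cdot> F0 f \<and>
    p \<cdot> Mu T one = icomp C A (p \<cdot> FA T (bng (FO T one))) (F1 \<alpha> \<cdot> FA T p)"
    (is "?L \<longleftrightarrow> ?R")
proof -
  note a = calg_facts[OF assms(1)]
  let ?d = "icomp1 C \<alpha> (lift_ifun T f)" and ?c = "icomp1 C f (snd one_alg2)"
  let ?\<epsilon> = "Eps2 (lift_monad T) (one_icat C one)" and ?\<mu> = "Mu2 (lift_monad T) (one_icat C one)"
  let ?\<xi> = "lift_ifun T (snd one_alg2)"
  note F1f = ifun_one[OF assms(2-4)]
  have d: "is_ifun C ?d" and c: "is_ifun C ?c"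
    using assms a by (auto intro!: ifun_comp lift_ifun)
  have \<epsilon>: "is_ifun C ?\<epsilon>" and \<mu>: "is_ifun C ?\<mu>" and \<xi>: "is_ifun C ?\<xi>"
    using Eps_ifun[OF one_icat] Mu_ifun[OF one_icat] lift_ifun[OF one_action] .
  have trp: "is_itrans C (Tr ?d ?c p) \<longleftrightarrow> p \<in> Arr C \<and> Dom C p = FO T one \<and> Cod C p = O1 A \<and>
    src A \<cdot> p = F0 \<alpha> \<cdot> FA T (F0 f) \<and> tgt A \<cdot> p = F0 f \<cdot> bng (FO T one)"
  proof
    assume "is_itrans C (Tr ?d ?c p)"
    from tr[OF this, of "lift_icat T (one_icat C one)" A]
    show "p \<in> Arr C \<and> Dom C p = FO T one \<and> Cod C p = O1 A \<and>
        src A \<cdot> p = F0 \<alpha> \<cdot> FA T (F0 f) \<and> tgt A \<cdot> p = F0 f \<cdot> bng (FO T one)"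
      using assms a by simp
  next
    assume p: "p \<in> Arr C \<and> Dom C p = FO T one \<and> Cod C p = O1 A \<and>
        src A \<cdot> p = F0 \<alpha> \<cdot> FA T (F0 f) \<and> tgt A \<cdot> p = F0 f \<cdot> bng (FO T one)"
    have "F1 \<alpha> \<cdot> FA T (F1 f) = idn A \<cdot> (F0 \<alpha> \<cdot> FA T (F0 f))"
      unfolding F1f using assms by (intro calg_extend_idn) simp_all
    then show "is_itrans C (Tr ?d ?c p)"
      using assms a d c p F1f by (intro trI[of _ _ "lift_icat T (one_icat C one)" A]) simp_all
  qed
  have "?L \<longleftrightarrow> ?R" if p: "is_itrans C (Tr ?d ?c p)"
  proof -
    note p' = p[unfolded trp]
    have lp: "is_itrans C (Tr (lift_ifun T ?d) (lift_ifun T ?c) (FA T p))"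
      by (rule lift_itrans[OF p])
    have unit: "Tr ?d ?c p \<star>\<^bsub>ICat C\<^esub> Id2 (ICat C) ?\<epsilon> = Id2 (ICat C) f \<longleftrightarrow> p \<cdot> Eps T one = idn A \<cdot> F0 f"
    proof -
      have "F0 \<alpha> \<cdot> (FA T (F0 f) \<cdot> Eps T one) = F0 f"
        using assms a Eps_nat[of "F0 f" one "O0 A"] calg_alg(3)[OF assms(1), of "F0 f"] by simp
      moreover have "F1 \<alpha> \<cdot> (FA T (F1 f) \<cdot> Eps T one) = F1 f"
        using assms a Eps_nat[of "F1 f" one "O1 A"] calg_alg(4)[OF assms(1), of "F1 f"] by simp
      ultimately have "icomp1 C ?d ?\<epsilon> = f"
        using assms a d \<epsilon> by (intro ifun_eqI ifun_comp lift_ifun) simp_all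
      moreover have "icomp1 C ?c ?\<epsilon> = f"
        using assms a c \<epsilon> by (intro ifun_eqI ifun_comp) simp_all
      moreover have "Tr ?d ?c p \<star>\<^bsub>ICat C\<^esub> Id2 (ICat C) ?\<epsilon>
          = Tr (icomp1 C ?d ?\<epsilon>) (icomp1 C ?c ?\<epsilon>) (p \<cdot> F0 ?\<epsilon>)"
        using assms a \<epsilon> by (intro whisker_right_Tr[OF p]) simp_all
      ultimately show ?thesis
        using assms(4) by (simp add: ICat_simps(10))
    qed
    have mult: "Tr ?d ?c p \<star>\<^bsub>ICat C\<^esub> Id2 (ICat C) ?\<mu>
        = (Tr ?d ?c p \<star>\<^bsub>ICat C\<^esub> Id2 (ICat C) ?\<xi>) \<bullet>\<^bsub>ICat C\<^esub> (Id2 (ICat C) \<alpha> \<star>\<^bsub>ICat C\<^esub> M2 (lift_monad T) (Tr ?d ?c p))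
        \<longleftrightarrow> p \<cdot> Mu T one = icomp C A (p \<cdot> FA T (bng (FO T one))) (F1 \<alpha> \<cdot> FA T p)"
    proof -
      have "F0 \<alpha> \<cdot> (FA T (F0 f) \<cdot> Mu T one) = F0 \<alpha> \<cdot> (FA T (F0 \<alpha>) \<cdot> FA T (FA T (F0 f)))"
        using assms a Mu_nat[of "F0 f" one "O0 A"] calg_alg(1)[OF assms(1), of "FA T (FA T (F0 f))"] by simp
      moreover have "F1 \<alpha> \<cdot> (FA T (F1 f) \<cdot> Mu T one) = F1 \<alpha> \<cdot> (FA T (F1 \<alpha>) \<cdot> FA T (FA T (F1 f)))"
        using assms a Mu_nat[of "F1 f" one "O1 A"] calg_alg(2)[OF assms(1), of "FA T (FA T (F1 f))"] by simp
      ultimately have 1: "icomp1 C ?d ?\<mu> = icomp1 C \<alpha> (lift_ifun T ?d)"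
        using assms a d \<mu> by (intro ifun_eqI ifun_comp lift_ifun) simp_all
      have 2: "icomp1 C ?c ?\<mu> = icomp1 C ?c ?\<xi>"
        using assms a c \<mu> \<xi> by (intro ifun_eqI ifun_comp) simp_all
      have "Tr ?d ?c p \<star>\<^bsub>ICat C\<^esub> Id2 (ICat C) ?\<mu> = Tr (icomp1 C ?d ?\<mu>) (icomp1 C ?c ?\<mu>) (p \<cdot> F0 ?\<mu>)"
        using assms a \<mu> by (intro whisker_right_Tr[OF p]) simp_all
      moreover have "Tr ?d ?c p \<star>\<^bsub>ICat C\<^esub> Id2 (ICat C) ?\<xi> = Tr (icomp1 C ?d ?\<xi>) (icomp1 C ?c ?\<xi>) (p \<cdot> F0 ?\<xi>)"
        using assms a \<xi> by (intro whisker_right_Tr[OF p]) simp_all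
      moreover have "Id2 (ICat C) \<alpha> \<star>\<^bsub>ICat C\<^esub> M2 (lift_monad T) (Tr ?d ?c p)
          = Tr (icomp1 C \<alpha> (lift_ifun T ?d)) (icomp1 C \<alpha> (lift_ifun T ?c)) (F1 \<alpha> \<cdot> FA T p)"
        using assms a whisker_left_Tr[OF lp a(2)] by simp
      ultimately show ?thesis
        unfolding 1 2 using a by (simp add: Tr_simps)
    qed
    show ?thesis
      unfolding ICat.lax_mors_iff using assms p p' a unit mult by simp
  qed
  moreover have "is_itrans C (Tr ?d ?c p)" if ?L
    using that unfolding ICat.lax_mors_iff by simp
  ultimately show ?thesis
    using trp by blast
qed

lemma lax_oneE:
  assumes "u \<in> lax_mors (ICat C) (lift_monad T) one_alg2 (A, \<alpha>)"
  obtains f p where "is_ifun C f" "IDom f = one_icat C one" "ICod f = A"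
    "u = (f, Tr (icomp1 C \<alpha> (lift_ifun T f)) (icomp1 C f (snd one_alg2)) p)"
proof -
  obtain f \<phi> where u: "u = (f, \<phi>)" by (cases u)
  from assms have "is_ifun C f" "IDom f = one_icat C one" "ICod f = A"
    "\<phi> = Tr (icomp1 C \<alpha> (lift_ifun T f)) (icomp1 C f (snd one_alg2)) (TMap \<phi>)"
    unfolding u ICat.lax_mors_iff by (cases \<phi>; simp)+
  then show ?thesis using that u by blast
qed

lemma lax_one_eqI:
  assumes "u \<in> lax_mors (ICat C) (lift_monad T) one_alg2 (A, \<alpha>)"
    "v \<in> lax_mors (ICat C) (lift_monad T) one_alg2 (A, \<alpha>)"
    "F0 (fst u) = F0 (fst v)" "TMap (snd u) = TMap (snd v)"
  shows "u = v"
proof -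
  obtain f p where u: "is_ifun C f" "IDom f = one_icat C one" "ICod f = A"
    "u = (f, Tr (icomp1 C \<alpha> (lift_ifun T f)) (icomp1 C f (snd one_alg2)) p)"
    by (rule lax_oneE[OF assms(1)])
  obtain g q where v: "is_ifun C g" "IDom g = one_icat C one" "ICod g = A"
    "v = (g, Tr (icomp1 C \<alpha> (lift_ifun T g)) (icomp1 C g (snd one_alg2)) q)"
    by (rule lax_oneE[OF assms(2)])
  have "f = g"
    using u v assms(3) ifun_one[OF u(1-3)] ifun_one[OF v(1-3)] by (intro ifun_eqI) simp_all
  then show ?thesis
    using u v assms(4) by simp
qed

end


section \<open>The representing categorical algebra\<close>

context cartesian_monad_terminal
begin

abbreviation T1 :: 'o where "T1 \<equiv> FO T one"
abbreviation T2 :: 'o where "T2 \<equiv> FO T T1"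
abbreviation T3 :: 'o where "T3 \<equiv> FO T T2"

text \<open>The truncation of the bar construction to degrees 0, 1 and 2.\<close>

definition HT :: "('o, 'a) icat" where
  "HT = \<lparr>O0 = T1, O1 = T2, O2 = T3,
     src = Mu T one, tgt = FA T (bng T1), idn = FA T (Eps T one),
     pr1 = Mu T T1, pr2 = FA T (FA T (bng T1)), cmp = FA T (Mu T one)\<rparr>"

lemma HT_simps [simp]:
  "O0 HT = T1" "O1 HT = T2" "O2 HT = T3"
  "src HT = Mu T one" "tgt HT = FA T (bng T1)" "idn HT = FA T (Eps T one)"
  "pr1 HT = Mu T T1" "pr2 HT = FA T (FA T (bng T1))" "cmp HT = FA T (Mu T one)"
  by (simp_all add: HT_def)

lemma Tbang_Mu: "FA T (bng T1) \<cdot> Mu T T1 = Mu T one \<cdot> FA T (FA T (bng T1))"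
  using Mu_nat[of "bng T1" T1 one] by simp

lemma HT_precat: "is_precat HT"
proof -
  have "is_pullback C (FA T (bng T1)) (Mu T one) (Mu T T1) (FA T (FA T (bng T1)))"
    using Mu_pullback[of "bng T1"] by simp
  moreover have "FA T (bng T1) \<cdot> FA T (Eps T one) = Ident C T1"
    using T_comp[of "bng T1" "Eps T one" "Ident C one"] by simp
  moreover have "FA T (bng T1) \<cdot> FA T (Mu T one) = FA T (bng T1) \<cdot> FA T (FA T (bng T1))"
    by (intro T_eq) simp_all
  ultimately show ?thesis
    unfolding is_precat_def by (simp add: hom_iff Mu_unit Mu_assoc)
qed

text \<open>The composable pairs are parametrized by \<open>T\<^sup>3(1)\<close>.\<close>

lemma HT_icomp:
  assumes "h \<in> Arr C" "Cod C h = T3" "Mu T T1 \<cdot> h = x" "FA T (FA T (bng T1)) \<cdot> h = y"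
  shows "icomp C HT y x = FA T (Mu T one) \<cdot> h"
  unfolding icomp_def using ipair_eqI[OF HT_precat, of h x y] assms by simp

text \<open>Associativity: by two pullback squares \<open>T\<^sup>4(1)\<close> parametrizes composable triples, and there
  it is the image under \<open>T\<close> of the associativity of \<open>\<mu>\<close>.\<close>

lemma HT_icat: "is_icat C HT"
proof -
  note pre = HT_precat
  have unit: "icomp C HT x (idn HT \<cdot> (src HT \<cdot> x)) = x \<and> icomp C HT (idn HT \<cdot> (tgt HT \<cdot> x)) x = x"
    if "x \<in> hom C Z (O1 HT)" for Z x
  proof
    have x: "x \<in> Arr C" "Cod C x = T2"
      using that by (auto simp: hom_iff)
    have 1: "Mu T T1 \<cdot> (FA T (FA T (Eps T one)) \<cdot> x) = FA T (Eps T one) \<cdot> (Mu T one \<cdot> x)"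
      using x reassoc[OF Mu_nat[of "Eps T one" one T1]] by simp
    have 2: "FA T (FA T (bng T1)) \<cdot> FA T (FA T (Eps T one)) = Ident C T2"
      "FA T (Mu T one) \<cdot> FA T (FA T (Eps T one)) = Ident C T2"
      using T_comp[of "FA T (bng T1)" "FA T (Eps T one)" "Ident C T1"] T_comp[of "bng T1" "Eps T one" "Ident C one"]
        T_comp[OF Mu_unit(1)[OF one_obj]] by simp_all
    have 3: "FA T (FA T (bng T1)) \<cdot> (FA T (FA T (Eps T one)) \<cdot> x) = x" "FA T (Mu T one) \<cdot> (FA T (FA T (Eps T one)) \<cdot> x) = x"
      using x reassoc[OF 2(1), of x] reassoc[OF 2(2), of x] by simp_all
    show "icomp C HT x (idn HT \<cdot> (src HT \<cdot> x)) = x"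
      using HT_icomp[OF _ _ 1 3(1)] x 3(2) by simp
    have 4: "Mu T T1 \<cdot> (FA T (Eps T T1) \<cdot> x) = x" "FA T (Mu T one) \<cdot> (FA T (Eps T T1) \<cdot> x) = x"
      using x reassoc[OF Mu_unit(1)[of T1], of x] reassoc[OF T_comp[OF Mu_unit(2)[OF one_obj]], of x] by simp_all
    have 5: "FA T (FA T (bng T1)) \<cdot> FA T (Eps T T1) = FA T (Eps T one) \<cdot> FA T (bng T1)"
      using Eps_nat[of "bng T1" T1 one] by (intro T_eq) simp_all
    have 6: "FA T (FA T (bng T1)) \<cdot> (FA T (Eps T T1) \<cdot> x) = FA T (Eps T one) \<cdot> (FA T (bng T1) \<cdot> x)"
      using x reassoc[OF 5, of x] by simp
    show "icomp C HT (idn HT \<cdot> (tgt HT \<cdot> x)) x = x"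
      using HT_icomp[OF _ _ 4(1) 6] x 4(2) by simp
  qed
  have asc: "icomp C HT z (icomp C HT y x) = icomp C HT (icomp C HT z y) x"
    if "x \<in> hom C Z (O1 HT)" "y \<in> hom C Z (O1 HT)" "z \<in> hom C Z (O1 HT)"
      "tgt HT \<cdot> x = src HT \<cdot> y" "tgt HT \<cdot> y = src HT \<cdot> z" for Z x y z
  proof -
    have xyz: "x \<in> Arr C" "y \<in> Arr C" "z \<in> Arr C" "Cod C x = T2" "Cod C y = T2" "Cod C z = T2"
      "Dom C x = Z" "Dom C y = Z" "Dom C z = Z"
      using that(1-3) by (auto simp: hom_iff)
    note xy = ipair[OF pre, of x y] and yz = ipair[OF pre, of y z]
    define h h' where "h = ipair C HT x y" and "h' = ipair C HT y z"
    have h: "h \<in> Arr C" "Dom C h = Z" "Cod C h = T3" "Mu T T1 \<cdot> h = x" "FA T (FA T (bng T1)) \<cdot> h = y"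
      using xy xyz that(4) by (simp_all add: h_def)
    have h': "h' \<in> Arr C" "Dom C h' = Z" "Cod C h' = T3" "Mu T T1 \<cdot> h' = y" "FA T (FA T (bng T1)) \<cdot> h' = z"
      using yz xyz that(5) by (simp_all add: h'_def)
    have "is_pullback C (FA T (FA T (bng T1))) (Mu T T1) (Mu T T2) (FA T (FA T (FA T (bng T1))))"
      using Mu_pullback[of "FA T (bng T1)"] by simp
    from pullback_lift[OF this, of h h']
    obtain k where k: "k \<in> Arr C" "Dom C k = Z" "Cod C k = FO T T3" "Mu T T2 \<cdot> k = h"
        "FA T (FA T (FA T (bng T1))) \<cdot> k = h'"
      using h h' by auto
    have "Mu T T1 \<cdot> (FA T (Mu T T1) \<cdot> k) = x"
      using k(1,3) h(4) reassoc[OF Mu_assoc[of T1], of k] by (simp add: k(4))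
    moreover have "FA T (FA T (bng T1)) \<cdot> FA T (Mu T T1) = FA T (Mu T one) \<cdot> FA T (FA T (FA T (bng T1)))"
      using Tbang_Mu by (intro T_eq) auto
    then have "FA T (FA T (bng T1)) \<cdot> (FA T (Mu T T1) \<cdot> k) = FA T (Mu T one) \<cdot> h'"
      using k(1,3) reassoc[of "FA T (FA T (bng T1))" "FA T (Mu T T1)" _ k] by (simp add: k(5))
    ultimately have 1: "icomp C HT (FA T (Mu T one) \<cdot> h') x = FA T (Mu T one) \<cdot> (FA T (Mu T T1) \<cdot> k)"
      using k(1,3) by (intro HT_icomp) simp_all
    have "Mu T T1 \<cdot> (FA T (FA T (Mu T one)) \<cdot> k) = FA T (Mu T one) \<cdot> h"
      using k(1,3) reassoc[OF Mu_nat[of "Mu T one" T2 T1], of k] by (simp add: k(4))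
    moreover have "FA T (FA T (bng T1)) \<cdot> FA T (FA T (Mu T one)) = FA T (FA T (bng T1)) \<cdot> FA T (FA T (FA T (bng T1)))"
      by (intro T_eq) simp_all
    then have "FA T (FA T (bng T1)) \<cdot> (FA T (FA T (Mu T one)) \<cdot> k) = z"
      using k(1,3) h'(5) reassoc[of "FA T (FA T (bng T1))" "FA T (FA T (Mu T one))" _ k] by (simp add: k(5))
    ultimately have 2: "icomp C HT z (FA T (Mu T one) \<cdot> h) = FA T (Mu T one) \<cdot> (FA T (FA T (Mu T one)) \<cdot> k)"
      using k(1,3) by (intro HT_icomp) simp_all
    have "FA T (Mu T one) \<cdot> FA T (FA T (Mu T one)) = FA T (Mu T one) \<cdot> FA T (Mu T T1)"
      using Mu_assoc by (intro T_eq) simp_all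
    then have "FA T (Mu T one) \<cdot> (FA T (FA T (Mu T one)) \<cdot> k) = FA T (Mu T one) \<cdot> (FA T (Mu T T1) \<cdot> k)"
      using k(1,3) reassoc[of "FA T (Mu T one)" "FA T (FA T (Mu T one))" _ k] by simp
    moreover have "icomp C HT y x = FA T (Mu T one) \<cdot> h" "icomp C HT z y = FA T (Mu T one) \<cdot> h'"
      by (simp_all add: icomp_def h_def h'_def)
    ultimately show ?thesis
      using 1 2 by simp
  qed
  show ?thesis
    using pre unit asc unfolding is_icat_def is_precat_def by (elim conjE, intro conjI; blast)
qed

declare HT_icat [simp]

definition HT_alg :: "('o, 'a) calg" where
  "HT_alg = (HT, \<lparr>IDom = lift_icat T HT, ICod = HT, F0 = Mu T one, F1 = Mu T T1, F2 = Mu T T2\<rparr>)"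

lemma HT_alg_simps [simp]:
  "fst HT_alg = HT" "IDom (snd HT_alg) = lift_icat T HT" "ICod (snd HT_alg) = HT"
  "F0 (snd HT_alg) = Mu T one" "F1 (snd HT_alg) = Mu T T1" "F2 (snd HT_alg) = Mu T T2"
  by (simp_all add: HT_alg_def)

lemma HT_calg: "(HT, snd HT_alg) \<in> calgs"
proof -
  have "is_ifun C (snd HT_alg)"
    unfolding is_ifun_def Let_def
    by (simp add: hom_iff Mu_assoc Mu_nat)
  then show ?thesis
    unfolding calg_iff by (simp add: Mu_assoc Mu_unit)
qed

lemma HT_alg: "HT_alg \<in> calgs"
  using HT_calg by (metis HT_alg_simps(1) prod.collapse)

text \<open>The universal internal algebra: the unit \<open>1 \<rightarrow> T(1)\<close> and the unit \<open>T(1) \<rightarrow> T(T(1))\<close>.\<close>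

definition gen_point :: "('o, 'a) ifun" where
  "gen_point = \<lparr>IDom = one_icat C one, ICod = HT, F0 = Eps T one, F1 = idn HT \<cdot> Eps T one,
     F2 = ipair C HT (idn HT \<cdot> Eps T one) (idn HT \<cdot> Eps T one)\<rparr>"

definition gen :: "('o, 'a) ialg" where
  "gen = (gen_point, Tr (icomp1 C (snd HT_alg) (lift_ifun T gen_point)) (icomp1 C gen_point (snd one_alg2)) (Eps T T1))"

lemma gen_point_simps [simp]:
  "IDom gen_point = one_icat C one" "ICod gen_point = HT" "F0 gen_point = Eps T one"
  by (simp_all add: gen_point_def)

lemma gen_point: "is_ifun C gen_point"
  unfolding gen_point_def by (rule point_ifun) simp_all

lemma gen: "gen \<in> lax_mors (ICat C) (lift_monad T) one_alg2 HT_alg"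
proof -
  have "Eps T T1 \<cdot> Mu T one = FA T (Mu T one) \<cdot> Eps T T2"
    by (rule Eps_nat) simp_all
  also have "\<dots> = icomp C HT (Eps T T1 \<cdot> FA T (bng T1)) (Ident C T2)"
    using Eps_nat[of "FA T (bng T1)" T2 T1] by (intro HT_icomp[symmetric]) (simp_all add: Mu_unit)
  finally have "gen \<in> lax_mors (ICat C) (lift_monad T) one_alg2 (HT, snd HT_alg)"
    unfolding gen_def lax_one_iff[OF HT_calg gen_point gen_point_simps(1,2)]
    using Eps_nat[of "bng T1" T1 one] Eps_nat[of "Eps T one" one T1] by (simp add: Mu_unit)
  then show ?thesis
    by (metis HT_alg_simps(1) prod.collapse)
qed

lemma gen_itrans:
  "is_itrans C (Tr (icomp1 C (snd HT_alg) (lift_ifun T gen_point)) (icomp1 C gen_point (snd one_alg2)) (Eps T T1))"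
  using gen unfolding gen_def ICat.lax_mors_iff by simp

lemma gen_image:
  assumes "(HT_alg, (A, \<alpha>), h) \<in> Arr (CAlg C T)"
  shows "F0 (fst (lax_post (ICat C) h gen)) = F0 h \<cdot> Eps T one"
    "TMap (snd (lax_post (ICat C) h gen)) = F1 h \<cdot> Eps T T1"
proof -
  have "is_ifun C h" "IDom h = HT"
    using assms unfolding CAlg_def ICat.Alg2_arr by simp_all
  then show "F0 (fst (lax_post (ICat C) h gen)) = F0 h \<cdot> Eps T one"
    "TMap (snd (lax_post (ICat C) h gen)) = F1 h \<cdot> Eps T T1"
    using whisker_left_Tr[OF gen_itrans, of h] by (simp_all add: lax_post_def gen_def)
qed

lemma CAlg_HT_arr: "(HT_alg, y, h) \<in> Arr (CAlg C T) \<longleftrightarrow> ((HT, snd HT_alg), y, h) \<in> Arr (CAlg C T)"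
  by (simp add: HT_alg_def)

lemma CAlg_arr_calg: "(x, y, h) \<in> Arr (CAlg C T) \<Longrightarrow> x \<in> calgs \<and> y \<in> calgs"
  unfolding CAlg_def ICat.Alg2_arr by simp

text \<open>An algebra map out of a free algebra is the structure map after \<open>T\<close> of its restriction along the unit.\<close>

lemma HT_mor_determined:
  assumes "(HT_alg, (A, \<alpha>), h) \<in> Arr (CAlg C T)"
  shows "F0 h = F0 \<alpha> \<cdot> FA T (F0 h \<cdot> Eps T one)" "F1 h = F1 \<alpha> \<cdot> FA T (F1 h \<cdot> Eps T T1)"
proof -
  have y: "(A, \<alpha>) \<in> calgs"
    using CAlg_arr_calg[OF assms] by simp
  note f = calg_facts[OF y]
  note h = assms[unfolded CAlg_HT_arr strict_mor_iff[OF HT_calg y]]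
  have e: "F0 h \<cdot> Mu T one = F0 \<alpha> \<cdot> FA T (F0 h)" "F1 h \<cdot> Mu T T1 = F1 \<alpha> \<cdot> FA T (F1 h)"
    using h by simp_all
  show "F0 h = F0 \<alpha> \<cdot> FA T (F0 h \<cdot> Eps T one)" "F1 h = F1 \<alpha> \<cdot> FA T (F1 h \<cdot> Eps T T1)"
    using h f reassoc[OF e(1), of "FA T (Eps T one)"] reassoc[OF e(2), of "FA T (Eps T T1)"]
    by (simp_all add: Mu_unit)
qed

text \<open>Every internal algebra extends: the unit law gives preservation of identities, the
  multiplication law gives preservation of composition.\<close>

lemma HT_mor_exists:
  assumes y: "(A, \<alpha>) \<in> calgs" and v: "v \<in> lax_mors (ICat C) (lift_monad T) one_alg2 (A, \<alpha>)"
  shows "\<exists>h. (HT_alg, (A, \<alpha>), h) \<in> Arr (CAlg C T) \<and> lax_post (ICat C) h gen = v"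
proof -
  note A = calg_facts[OF y]
  obtain f p where f: "is_ifun C f" "IDom f = one_icat C one" "ICod f = A"
    and vf: "v = (f, Tr (icomp1 C \<alpha> (lift_ifun T f)) (icomp1 C f (snd one_alg2)) p)"
    by (rule lax_oneE[OF v])
  define a where "a = F0 f"
  have a: "a \<in> Arr C" "Dom C a = one" "Cod C a = O0 A"
    using f by (simp_all add: a_def)
  have p: "p \<in> Arr C" "Dom C p = T1" "Cod C p = O1 A" "src A \<cdot> p = F0 \<alpha> \<cdot> FA T a" "tgt A \<cdot> p = a \<cdot> bng T1"
    "p \<cdot> Eps T one = idn A \<cdot> a" "p \<cdot> Mu T one = icomp C A (p \<cdot> FA T (bng T1)) (F1 \<alpha> \<cdot> FA T p)"
    using v[unfolded vf lax_one_iff[OF y f]] by (simp_all add: a_def)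
  let ?ha = "F0 \<alpha> \<cdot> FA T a" and ?hb = "F1 \<alpha> \<cdot> FA T p"
  let ?H = "\<lparr>IDom = HT, ICod = A, F0 = ?ha, F1 = ?hb, F2 = ipair C A (?hb \<cdot> pr1 HT) (?hb \<cdot> pr2 HT)\<rparr>"
  have h0: "?ha \<cdot> Mu T one = F0 \<alpha> \<cdot> FA T ?ha"
    using a A Mu_nat[of a one "O0 A"] calg_alg(1)[OF y, of "FA T (FA T a)"] by simp
  have h1: "?hb \<cdot> Mu T T1 = F1 \<alpha> \<cdot> FA T ?hb"
    using p(1-3) A Mu_nat[of p T1 "O1 A"] calg_alg(2)[OF y, of "FA T (FA T p)"] by simp
  have s: "src A \<cdot> ?hb = ?ha \<cdot> src HT"
    unfolding calg_extend(1)[OF y p(1,3)] p(4) using h0 by simp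
  have t: "tgt A \<cdot> ?hb = ?ha \<cdot> tgt HT"
    unfolding calg_extend(2)[OF y p(1,3)] p(5) using a A by simp
  have i: "?hb \<cdot> idn HT = idn A \<cdot> ?ha"
    using p(1-3,6) a A calg_extend_idn[OF y, of a] T_comp[OF p(6)] by simp
  have t': "tgt A \<cdot> ?hb = src A \<cdot> (p \<cdot> FA T (bng T1))"
    unfolding t using p(1-3) A a reassoc[OF p(4), of "FA T (bng T1)"] by simp
  have "?hb \<cdot> cmp HT = F1 \<alpha> \<cdot> FA T (p \<cdot> Mu T one)"
    using p(1-3) A by simp
  also have "\<dots> = icomp C A (F1 \<alpha> \<cdot> FA T (p \<cdot> FA T (bng T1))) (F1 \<alpha> \<cdot> FA T ?hb)"
    unfolding p(7) using p(1-3) A t' by (intro calg_extend_icomp[OF y]) simp_all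
  also have "\<dots> = icomp C A (?hb \<cdot> pr2 HT) (?hb \<cdot> pr1 HT)"
    unfolding h1[symmetric] using p(1-3) A by simp
  finally have hf: "is_ifun C ?H"
    using s t i A a p(1-3) by (intro ifunI) simp_all
  have h: "(HT_alg, (A, \<alpha>), ?H) \<in> Arr (CAlg C T)"
    unfolding CAlg_HT_arr strict_mor_iff[OF HT_calg y] using hf h0 h1 by simp
  have "?ha \<cdot> Eps T one = a" "?hb \<cdot> Eps T T1 = p"
    using a p(1-3) A Eps_nat[of a one "O0 A"] Eps_nat[of p T1 "O1 A"] calg_alg(3)[OF y, of a] calg_alg(4)[OF y, of p]
    by simp_all
  then have "lax_post (ICat C) ?H gen = v"
    using gen_image[OF h] ICat.lax_post_mor[OF one_calg h[unfolded CAlg_def] gen] v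
    by (intro lax_one_eqI[of _ A \<alpha>]) (simp_all add: vf a_def)
  then show ?thesis using h by blast
qed

text \<open>A morphism of internal algebras, in components: its defining square is one equation between
  composites in \<open>A\<close>.\<close>

lemma lax_one_arr:
  assumes y: "(A, \<alpha>) \<in> calgs"
    and w: "(u, v, \<tau>) \<in> Arr (lax_cat (ICat C) (lift_monad T) one_alg2 (A, \<alpha>))"
  shows "\<exists>s. \<tau> = Tr (fst u) (fst v) s \<and> is_itrans C (Tr (fst u) (fst v) s) \<and>
     icomp C A (TMap (snd v)) (F1 \<alpha> \<cdot> FA T s) = icomp C A (s \<cdot> bng T1) (TMap (snd u))"
proof -
  note A = calg_facts[OF y]
  have uv: "u \<in> lax_mors (ICat C) (lift_monad T) one_alg2 (A, \<alpha>)" "v \<in> lax_mors (ICat C) (lift_monad T) one_alg2 (A, \<alpha>)"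
    using w unfolding ICat.lax_arr_iff by simp_all
  obtain f p where f: "is_ifun C f" "IDom f = one_icat C one" "ICod f = A"
    and uf: "u = (f, Tr (icomp1 C \<alpha> (lift_ifun T f)) (icomp1 C f (snd one_alg2)) p)"
    by (rule lax_oneE[OF uv(1)])
  obtain g q where g: "is_ifun C g" "IDom g = one_icat C one" "ICod g = A"
    and vg: "v = (g, Tr (icomp1 C \<alpha> (lift_ifun T g)) (icomp1 C g (snd one_alg2)) q)"
    by (rule lax_oneE[OF uv(2)])
  obtain s where s: "\<tau> = Tr f g s"
    using w unfolding uf vg ICat.lax_arr_iff by (cases \<tau>) simp
  have st: "is_itrans C (Tr f g s)"
    using w unfolding s uf vg ICat.lax_arr_iff by simp
  have eq: "snd v \<bullet>\<^bsub>ICat C\<^esub> (Id2 (ICat C) \<alpha> \<star>\<^bsub>ICat C\<^esub> M2 (lift_monad T) \<tau>)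
      = (\<tau> \<star>\<^bsub>ICat C\<^esub> Id2 (ICat C) (snd one_alg2)) \<bullet>\<^bsub>ICat C\<^esub> snd u"
    using w unfolding ICat.lax_arr_iff by (simp only: snd_conv)
  have "Id2 (ICat C) \<alpha> \<star>\<^bsub>ICat C\<^esub> M2 (lift_monad T) \<tau>
      = Tr (icomp1 C \<alpha> (lift_ifun T f)) (icomp1 C \<alpha> (lift_ifun T g)) (F1 \<alpha> \<cdot> FA T s)"
    using A f whisker_left_Tr[OF lift_itrans[OF st] A(2)] by (simp add: s)
  moreover have "\<tau> \<star>\<^bsub>ICat C\<^esub> Id2 (ICat C) (snd one_alg2)
      = Tr (icomp1 C f (snd one_alg2)) (icomp1 C g (snd one_alg2)) (s \<cdot> bng T1)"
    using f whisker_right_Tr[OF st one_action] by (simp add: s)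
  ultimately have "icomp C A q (F1 \<alpha> \<cdot> FA T s) = icomp C A (s \<cdot> bng T1) p"
    using eq f A by (simp add: uf vg Tr_simps)
  then show ?thesis
    using s st by (simp add: uf vg)
qed

lemma HT_cell_whisker:
  assumes "(HT_alg, (A, \<alpha>), Tr h k t) \<in> Cell2 (CAlg C T)"
  shows "HComp (ICat C) (Tr h k t) (Id2 (ICat C) (fst gen)) = Tr (icomp1 C h gen_point) (icomp1 C k gen_point) (t \<cdot> Eps T one)"
proof -
  have t: "is_itrans C (Tr h k t)" "IDom h = HT"
    using assms unfolding CAlg_def ICat.Alg2_cell ICat.Alg2_arr by simp_all
  then show ?thesis
    using whisker_right_Tr[OF t(1) gen_point] by (simp add: gen_def)
qed

lemma HT_cell_determined:
  assumes "(HT_alg, (A, \<alpha>), Tr h k t) \<in> Cell2 (CAlg C T)"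
  shows "t = F1 \<alpha> \<cdot> FA T (t \<cdot> Eps T one)"
proof -
  have hk: "(HT_alg, (A, \<alpha>), h) \<in> Arr (CAlg C T)" "(HT_alg, (A, \<alpha>), k) \<in> Arr (CAlg C T)"
    using assms unfolding CAlg_def ICat.Alg2_cell by simp_all
  have y: "(A, \<alpha>) \<in> calgs"
    using CAlg_arr_calg[OF hk(1)] by simp
  note h = hk(1)[unfolded CAlg_HT_arr] and k = hk(2)[unfolded CAlg_HT_arr]
  have "((HT, snd HT_alg), (A, \<alpha>), Tr h k t) \<in> Cell2 (CAlg C T)"
    using assms by (simp add: HT_alg_def)
  then have t: "is_itrans C (Tr h k t)" "t \<cdot> Mu T one = F1 \<alpha> \<cdot> FA T t"
    unfolding strict_cell_iff[OF HT_calg y h k] by simp_all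
  have "t \<in> Arr C" "Dom C t = T1" "Cod C t = O1 A"
    using tr[OF t(1), of HT A] h unfolding strict_mor_iff[OF HT_calg y] by simp_all
  then show ?thesis
    using calg_facts[OF y] reassoc[OF t(2), of "FA T (Eps T one)"] by (simp add: Mu_unit)
qed

text \<open>The naturality square of the extended cell is \<open>T\<close> applied to the defining square of the given morphism
  of internal algebras, followed by the structure map.\<close>

lemma HT_cell_exists:
  assumes h: "(HT_alg, (A, \<alpha>), h) \<in> Arr (CAlg C T)" and k: "(HT_alg, (A, \<alpha>), k) \<in> Arr (CAlg C T)"
    and w: "(lax_post (ICat C) h gen, lax_post (ICat C) k gen, \<tau>)
        \<in> Arr (lax_cat (ICat C) (lift_monad T) one_alg2 (A, \<alpha>))"
  shows "\<exists>t. (HT_alg, (A, \<alpha>), Tr h k t) \<in> Cell2 (CAlg C T) \<and>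
     HComp (ICat C) (Tr h k t) (Id2 (ICat C) (fst gen)) = \<tau>"
proof -
  have y: "(A, \<alpha>) \<in> calgs"
    using CAlg_arr_calg[OF h] by simp
  note A = calg_facts[OF y]
  note h' = h[unfolded CAlg_HT_arr] and k' = k[unfolded CAlg_HT_arr]
  have hf: "is_ifun C h" "IDom h = HT" "ICod h = A" and kf: "is_ifun C k" "IDom k = HT" "ICod k = A"
    using h' k' unfolding strict_mor_iff[OF HT_calg y] by simp_all
  let ?f = "icomp1 C h gen_point" and ?g = "icomp1 C k gen_point"
  have fg: "fst (lax_post (ICat C) h gen) = ?f" "fst (lax_post (ICat C) k gen) = ?g"
    by (simp_all add: gen_def)
  obtain s where s: "\<tau> = Tr ?f ?g s" "is_itrans C (Tr ?f ?g s)"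
    and sq: "icomp C A (F1 k \<cdot> Eps T T1) (F1 \<alpha> \<cdot> FA T s) = icomp C A (s \<cdot> bng T1) (F1 h \<cdot> Eps T T1)"
    using lax_one_arr[OF y w] unfolding fg gen_image[OF h] gen_image[OF k] by blast
  have s': "s \<in> Arr C" "Dom C s = one" "Cod C s = O1 A" "src A \<cdot> s = F0 h \<cdot> Eps T one" "tgt A \<cdot> s = F0 k \<cdot> Eps T one"
    using tr[OF s(2), of "one_icat C one" A] hf by simp_all
  let ?t = "F1 \<alpha> \<cdot> FA T s"
  have t: "?t \<in> Arr C" "Dom C ?t = T1" "Cod C ?t = O1 A"
    using s' A by simp_all
  have ends: "src A \<cdot> ?t = F0 h" "tgt A \<cdot> ?t = F0 k"
    unfolding calg_extend[OF y s'(1,3)] s'(4,5)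
    using HT_mor_determined(1)[OF h] HT_mor_determined(1)[OF k] by simp_all
  have mu: "?t \<cdot> Mu T one = F1 \<alpha> \<cdot> FA T ?t"
    using s' A Mu_nat[of s one "O1 A"] calg_alg(2)[OF y, of "FA T (FA T s)"] by simp
  have "src A \<cdot> (F1 k \<cdot> Eps T T1) = F0 k"
    using kf reassoc[OF Mu_unit(2)[OF one_obj]] ifun_src_elt[OF kf(1,3), of "Eps T T1"] by (simp add: Mu_unit)
  then have c1: "tgt A \<cdot> ?t = src A \<cdot> (F1 k \<cdot> Eps T T1)"
    using ends by simp
  have "tgt A \<cdot> (F1 h \<cdot> Eps T T1) = F0 h \<cdot> (Eps T one \<cdot> bng T1)"
    using hf ifun_tgt_elt[OF hf(1,3), of "Eps T T1"] Eps_nat[of "bng T1" T1 one] by simp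
  also have "\<dots> = src A \<cdot> (s \<cdot> bng T1)"
    using s' A hf reassoc[OF s'(4), of "bng T1"] by simp
  finally have c2: "tgt A \<cdot> (F1 h \<cdot> Eps T T1) = src A \<cdot> (s \<cdot> bng T1)" .
  have "icomp C A (F1 k) (?t \<cdot> src HT) = icomp C A (F1 \<alpha> \<cdot> FA T (F1 k \<cdot> Eps T T1)) (F1 \<alpha> \<cdot> FA T ?t)"
    unfolding HT_mor_determined(2)[OF k, symmetric] mu[symmetric] by simp
  also have "\<dots> = F1 \<alpha> \<cdot> FA T (icomp C A (F1 k \<cdot> Eps T T1) ?t)"
    using t kf c1 by (intro calg_extend_icomp[OF y, symmetric]) simp_all
  also have "\<dots> = F1 \<alpha> \<cdot> FA T (icomp C A (s \<cdot> bng T1) (F1 h \<cdot> Eps T T1))"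
    unfolding sq ..
  also have "\<dots> = icomp C A (F1 \<alpha> \<cdot> FA T (s \<cdot> bng T1)) (F1 \<alpha> \<cdot> FA T (F1 h \<cdot> Eps T T1))"
    using s' hf c2 by (intro calg_extend_icomp[OF y]) simp_all
  also have "\<dots> = icomp C A (?t \<cdot> tgt HT) (F1 h)"
    unfolding HT_mor_determined(2)[OF h, symmetric] using s' A by simp
  finally have "is_itrans C (Tr h k ?t)"
    using hf kf t ends by (intro trI[of _ _ HT A]) simp_all
  then have cell: "(HT_alg, (A, \<alpha>), Tr h k ?t) \<in> Cell2 (CAlg C T)"
    using strict_cell_iff[OF HT_calg y h' k', of ?t] mu by (simp add: HT_alg_def)
  have "?t \<cdot> Eps T one = s"
    using s' A Eps_nat[of s one "O1 A"] calg_alg(4)[OF y, of s] by simp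
  then have "HComp (ICat C) (Tr h k ?t) (Id2 (ICat C) (fst gen)) = \<tau>"
    using HT_cell_whisker[OF cell] s(1) by simp
  then show ?thesis using cell by blast
qed

theorem HT_represents: "represents (CAlg C T) (IAlg C T one) HT_alg"
proof (rule two_category.represents_by_universal_element[where u = gen])
  show "two_category (CAlg C T)"
    unfolding CAlg_def by (rule ICat.Alg2_two_category)
  show "is_two_functor_to_Cat (CAlg C T) (IAlg C T one)"
    unfolding CAlg_def IAlg_def by (rule ICat.lax_two_functor[OF one_calg])
  show "HT_alg \<in> Obj (CAlg C T)"
    using HT_alg by (simp add: Obj_CAlg)
  show "gen \<in> Obj (P0 (IAlg C T one) HT_alg)"
    using gen by (simp add: IAlg_def)
next
  fix y assume "y \<in> Obj (CAlg C T)"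
  then obtain A \<alpha> where y: "y = (A, \<alpha>)" "(A, \<alpha>) \<in> calgs"
    by (cases y) (simp add: Obj_CAlg)
  show "bij_betw (\<lambda>h. FO (P1 (IAlg C T one) h) gen) (hom (CAlg C T) HT_alg y) (Obj (P0 (IAlg C T one) y))"
    unfolding bij_betw_def
  proof
    show "inj_on (\<lambda>h. FO (P1 (IAlg C T one) h) gen) (hom (CAlg C T) HT_alg y)"
    proof (rule inj_onI)
      fix u v assume u: "u \<in> hom (CAlg C T) HT_alg y" and v: "v \<in> hom (CAlg C T) HT_alg y"
        and eq: "FO (P1 (IAlg C T one) u) gen = FO (P1 (IAlg C T one) v) gen"
      obtain h where h: "u = (HT_alg, y, h)" "(HT_alg, (A, \<alpha>), h) \<in> Arr (CAlg C T)"
        using u unfolding CAlg_def y(1) by (rule ICat.Alg2_homE)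
      obtain k where k: "v = (HT_alg, y, k)" "(HT_alg, (A, \<alpha>), k) \<in> Arr (CAlg C T)"
        using v unfolding CAlg_def y(1) by (rule ICat.Alg2_homE)
      have post: "lax_post (ICat C) h gen = lax_post (ICat C) k gen"
        using eq by (simp add: h(1) k(1) IAlg_def)
      have "F0 h = F0 k" "F1 h = F1 k"
        using HT_mor_determined[OF h(2)] HT_mor_determined[OF k(2)] gen_image[OF h(2)] gen_image[OF k(2)] post
        by simp_all
      moreover note h(2)[unfolded CAlg_HT_arr strict_mor_iff[OF HT_calg y(2)]]
        k(2)[unfolded CAlg_HT_arr strict_mor_iff[OF HT_calg y(2)]]
      ultimately have "h = k"
        by (intro ifun_eqI) simp_all
      then show "u = v" using h(1) k(1) by simp
    qed
    show "(\<lambda>h. FO (P1 (IAlg C T one) h) gen) ` hom (CAlg C T) HT_alg y = Obj (P0 (IAlg C T one) y)"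
    proof (intro equalityI subsetI)
      fix v assume "v \<in> (\<lambda>h. FO (P1 (IAlg C T one) h) gen) ` hom (CAlg C T) HT_alg y"
      then obtain u where u: "u \<in> hom (CAlg C T) HT_alg y" "v = FO (P1 (IAlg C T one) u) gen"
        by auto
      obtain h where h: "u = (HT_alg, y, h)" "(HT_alg, y, h) \<in> Arr (Alg2 (ICat C) (lift_monad T))"
        using u(1) unfolding CAlg_def by (rule ICat.Alg2_homE)
      show "v \<in> Obj (P0 (IAlg C T one) y)"
        using ICat.lax_post_mor[OF one_calg h(2) gen] by (simp add: u(2) h(1) IAlg_def)
    next
      fix v assume "v \<in> Obj (P0 (IAlg C T one) y)"
      then obtain h where "(HT_alg, (A, \<alpha>), h) \<in> Arr (CAlg C T)" "lax_post (ICat C) h gen = v"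
        using HT_mor_exists[OF y(2), of v] by (auto simp: IAlg_def y(1))
      then have "(HT_alg, y, h) \<in> hom (CAlg C T) HT_alg y" "v = FO (P1 (IAlg C T one) (HT_alg, y, h)) gen"
        by (simp_all add: CAlg_def IAlg_def ICat.Alg2_hom y(1))
      then show "v \<in> (\<lambda>h. FO (P1 (IAlg C T one) h) gen) ` hom (CAlg C T) HT_alg y"
        by blast
    qed
  qed
next
  fix y u v assume u: "u \<in> hom (CAlg C T) HT_alg y" and v: "v \<in> hom (CAlg C T) HT_alg y"
  obtain A \<alpha> where y: "y = (A, \<alpha>)" by (cases y)
  obtain h where h: "u = (HT_alg, y, h)" "(HT_alg, (A, \<alpha>), h) \<in> Arr (CAlg C T)"
    using u unfolding CAlg_def y(1) by (rule ICat.Alg2_homE)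
  obtain k where k: "v = (HT_alg, y, k)" "(HT_alg, (A, \<alpha>), k) \<in> Arr (CAlg C T)"
    using v unfolding CAlg_def y(1) by (rule ICat.Alg2_homE)
  have yc: "(A, \<alpha>) \<in> calgs"
    using CAlg_arr_calg[OF h(2)] by simp
  have cellE: "\<exists>t. w = (HT_alg, (A, \<alpha>), Tr h k t) \<and> (HT_alg, (A, \<alpha>), Tr h k t) \<in> Cell2 (CAlg C T)"
    if w: "w \<in> cell (CAlg C T) u v" for w
  proof -
    obtain \<theta> where t: "w = (HT_alg, y, \<theta>)" "(HT_alg, y, \<theta>) \<in> Cell2 (CAlg C T)" "v = (HT_alg, y, TCod \<theta>)" "TDom \<theta> = h"
      using w unfolding CAlg_def h(1) by (rule ICat.Alg2_cellE) simp
    then have "\<theta> = Tr h k (TMap \<theta>)"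
      using k(1) by (cases \<theta>) simp
    then show ?thesis using t(1,2) y by metis
  qed
  have P2: "P2 (IAlg C T one) (HT_alg, (A, \<alpha>), Tr h k t) gen
      = (lax_post (ICat C) h gen, lax_post (ICat C) k gen, Tr h k t \<star>\<^bsub>ICat C\<^esub> Id2 (ICat C) (fst gen))" for t
    by (simp add: IAlg_def)
  show "bij_betw (\<lambda>\<theta>. P2 (IAlg C T one) \<theta> gen) (cell (CAlg C T) u v)
      (hom (P0 (IAlg C T one) y) (FO (P1 (IAlg C T one) u) gen) (FO (P1 (IAlg C T one) v) gen))"
    unfolding bij_betw_def
  proof
    show "inj_on (\<lambda>\<theta>. P2 (IAlg C T one) \<theta> gen) (cell (CAlg C T) u v)"
    proof (rule inj_onI)
      fix w w' assume "w \<in> cell (CAlg C T) u v" "w' \<in> cell (CAlg C T) u v"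
        and eq: "P2 (IAlg C T one) w gen = P2 (IAlg C T one) w' gen"
      then obtain t t' where t: "w = (HT_alg, (A, \<alpha>), Tr h k t)" "(HT_alg, (A, \<alpha>), Tr h k t) \<in> Cell2 (CAlg C T)"
        "w' = (HT_alg, (A, \<alpha>), Tr h k t')" "(HT_alg, (A, \<alpha>), Tr h k t') \<in> Cell2 (CAlg C T)"
        using cellE by blast
      have "t \<cdot> Eps T one = t' \<cdot> Eps T one"
        using eq unfolding t(1,3) P2 by (simp add: HT_cell_whisker[OF t(2)] HT_cell_whisker[OF t(4)])
      then have "t = t'"
        using HT_cell_determined[OF t(2)] HT_cell_determined[OF t(4)] by simp
      then show "w = w'" using t by simp
    qed
    show "(\<lambda>\<theta>. P2 (IAlg C T one) \<theta> gen) ` cell (CAlg C T) u v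
        = hom (P0 (IAlg C T one) y) (FO (P1 (IAlg C T one) u) gen) (FO (P1 (IAlg C T one) v) gen)"
    proof (intro equalityI subsetI)
      fix r assume "r \<in> (\<lambda>\<theta>. P2 (IAlg C T one) \<theta> gen) ` cell (CAlg C T) u v"
      then obtain t where t: "(HT_alg, (A, \<alpha>), Tr h k t) \<in> Cell2 (CAlg C T)"
        "r = P2 (IAlg C T one) (HT_alg, (A, \<alpha>), Tr h k t) gen"
        using cellE by blast
      show "r \<in> hom (P0 (IAlg C T one) y) (FO (P1 (IAlg C T one) u) gen) (FO (P1 (IAlg C T one) v) gen)"
        using ICat.lax_whisker_arr[OF one_calg t(1)[unfolded CAlg_def] gen]
        unfolding t(2) P2 by (simp add: h(1) k(1) y IAlg_def ICat.lax_hom_iff)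
    next
      fix r assume "r \<in> hom (P0 (IAlg C T one) y) (FO (P1 (IAlg C T one) u) gen) (FO (P1 (IAlg C T one) v) gen)"
      then have "r \<in> hom (lax_cat (ICat C) (lift_monad T) one_alg2 (A, \<alpha>)) (lax_post (ICat C) h gen) (lax_post (ICat C) k gen)"
        by (simp add: h(1) k(1) y IAlg_def)
      then obtain \<tau> where r: "r = (lax_post (ICat C) h gen, lax_post (ICat C) k gen, \<tau>)"
        "(lax_post (ICat C) h gen, lax_post (ICat C) k gen, \<tau>) \<in> Arr (lax_cat (ICat C) (lift_monad T) one_alg2 (A, \<alpha>))"
        by (rule ICat.lax_homE)
      obtain t where t: "(HT_alg, (A, \<alpha>), Tr h k t) \<in> Cell2 (CAlg C T)"
        "HComp (ICat C) (Tr h k t) (Id2 (ICat C) (fst gen)) = \<tau>"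
        using HT_cell_exists[OF h(2) k(2) r(2)] by blast
      have "(HT_alg, (A, \<alpha>), Tr h k t) \<in> cell (CAlg C T) u v"
        using t(1) by (simp add: cell_def h(1) k(1) y CAlg_def)
      moreover have "r = P2 (IAlg C T one) (HT_alg, (A, \<alpha>), Tr h k t) gen"
        unfolding P2 r(1) t(2) ..
      ultimately show "r \<in> (\<lambda>\<theta>. P2 (IAlg C T one) \<theta> gen) ` cell (CAlg C T) u v"
        by blast
    qed
  qed
qed

end


section \<open>Nerves\<close>

context category
begin

lemma is_isoE:
  assumes "is_iso C X Y f"
  obtains g where "f \<in> Arr C" "Dom C f = X" "Cod C f = Y" "g \<in> Arr C" "Dom C g = Y" "Cod C g = X"
    "g \<cdot> f = Ident C X" "f \<cdot> g = Ident C Y"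
    "\<And>x. x \<in> Arr C \<Longrightarrow> Cod C x = X \<Longrightarrow> g \<cdot> (f \<cdot> x) = x"
    "\<And>x. x \<in> Arr C \<Longrightarrow> Cod C x = Y \<Longrightarrow> f \<cdot> (g \<cdot> x) = x"
proof -
  obtain g where g: "f \<in> Arr C" "Dom C f = X" "Cod C f = Y" "g \<in> Arr C" "Dom C g = Y" "Cod C g = X"
    "g \<cdot> f = Ident C X" "f \<cdot> g = Ident C Y"
    using assms unfolding is_iso_def by (auto simp: hom_iff)
  moreover have "g \<cdot> (f \<cdot> x) = x" if "x \<in> Arr C" "Cod C x = X" for x
    using reassoc[OF g(7), of x] g that by simp
  moreover have "f \<cdot> (g \<cdot> x) = x" if "x \<in> Arr C" "Cod C x = Y" for x
    using reassoc[OF g(8), of x] g that by simp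
  ultimately show ?thesis by (rule that)
qed

lemma is_isoI:
  assumes "f \<in> Arr C" "Dom C f = X" "Cod C f = Y" "g \<in> Arr C" "Dom C g = Y" "Cod C g = X"
    "g \<cdot> f = Ident C X" "f \<cdot> g = Ident C Y"
  shows "is_iso C X Y f"
  using assms unfolding is_iso_def by (auto simp: hom_iff)

text \<open>The condition on a nerve with the vertices \<open>v\<close> and edges \<open>e\<close> of its universal chains exposed, so that
  they can be transported along isomorphisms.\<close>

definition exhibits_nerve :: "('o, 'a) icat \<Rightarrow> ('o, 'a) simp_obj \<Rightarrow> (nat \<Rightarrow> nat \<Rightarrow> 'a) \<Rightarrow> (nat \<Rightarrow> nat \<Rightarrow> 'a) \<Rightarrow> bool" where
  "exhibits_nerve A X v e \<longleftrightarrow>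
     (\<forall>n. is_chain C A n (SOb X n) (v n) (e n)) \<and>
     (\<forall>n Z w g. is_chain C A n Z w g \<longrightarrow>
        (\<exists>!h. h \<in> hom C Z (SOb X n) \<and> (\<forall>i\<le>n. v n i \<cdot> h = w i) \<and> (\<forall>i<n. e n i \<cdot> h = g i))) \<and>
     (\<forall>n. \<forall>j\<le>Suc n.
        (\<forall>i\<le>n. v n i \<cdot> Face X n j = v (Suc n) (if i < j then i else Suc i)) \<and>
        (\<forall>i<n. e n i \<cdot> Face X n j =
           (if Suc i < j then e (Suc n) i
            else if Suc i = j then icomp C A (e (Suc n) i) (e (Suc n) (Suc i))
            else e (Suc n) (Suc i)))) \<and>
     (\<forall>n. \<forall>j\<le>n.
        (\<forall>i\<le>Suc n. v (Suc n) i \<cdot> Degen X n j = v n (if i \<le> j then i else i - 1)) \<and>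
        (\<forall>i<Suc n. e (Suc n) i \<cdot> Degen X n j =
           (if i < j then e n i else if i = j then idn A \<cdot> v n j else e n (i - 1))))"

lemma is_nerve_iff: "is_nerve C A X \<longleftrightarrow> is_simplicial C X \<and> (\<exists>v e. exhibits_nerve A X v e)"
  unfolding is_nerve_def exhibits_nerve_def by (rule refl)

lemma simplicial_typ:
  assumes "is_simplicial C X"
  shows "SOb X n \<in> Obj C"
    "i \<le> Suc n \<Longrightarrow> Face X n i \<in> Arr C" "i \<le> Suc n \<Longrightarrow> Dom C (Face X n i) = SOb X (Suc n)"
    "i \<le> Suc n \<Longrightarrow> Cod C (Face X n i) = SOb X n"
    "i \<le> n \<Longrightarrow> Degen X n i \<in> Arr C" "i \<le> n \<Longrightarrow> Dom C (Degen X n i) = SOb X n"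
    "i \<le> n \<Longrightarrow> Cod C (Degen X n i) = SOb X (Suc n)"
proof -
  have 1: "SOb X n \<in> Obj C" for n
    using assms unfolding is_simplicial_def by (elim conjE) blast
  have 2: "Face X n i \<in> hom C (SOb X (Suc n)) (SOb X n)" if "i \<le> Suc n" for n i
    using assms that unfolding is_simplicial_def by (elim conjE) blast
  have 3: "Degen X n i \<in> hom C (SOb X n) (SOb X (Suc n))" if "i \<le> n" for n i
    using assms that unfolding is_simplicial_def by (elim conjE) blast
  show "SOb X n \<in> Obj C"
    "i \<le> Suc n \<Longrightarrow> Face X n i \<in> Arr C" "i \<le> Suc n \<Longrightarrow> Dom C (Face X n i) = SOb X (Suc n)"
    "i \<le> Suc n \<Longrightarrow> Cod C (Face X n i) = SOb X n"
    "i \<le> n \<Longrightarrow> Degen X n i \<in> Arr C" "i \<le> n \<Longrightarrow> Dom C (Degen X n i) = SOb X n"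
    "i \<le> n \<Longrightarrow> Cod C (Degen X n i) = SOb X (Suc n)"
    using 1[of n] 2[of i n] 3[of i n] by (auto simp: hom_iff)
qed

lemma chain_typ:
  assumes "is_chain C A n Z w g"
  shows "Z \<in> Obj C" "i \<le> n \<Longrightarrow> w i \<in> Arr C" "i \<le> n \<Longrightarrow> Dom C (w i) = Z" "i \<le> n \<Longrightarrow> Cod C (w i) = O0 A"
    "i < n \<Longrightarrow> g i \<in> Arr C" "i < n \<Longrightarrow> Dom C (g i) = Z" "i < n \<Longrightarrow> Cod C (g i) = O1 A"
    "i < n \<Longrightarrow> src A \<cdot> g i = w (Suc i)" "i < n \<Longrightarrow> tgt A \<cdot> g i = w i"
  using assms unfolding is_chain_def by (auto simp: hom_iff)

lemma chainI:
  assumes "Z \<in> Obj C" "\<And>i. i \<le> n \<Longrightarrow> w i \<in> Arr C \<and> Dom C (w i) = Z \<and> Cod C (w i) = O0 A"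
    "\<And>i. i < n \<Longrightarrow> g i \<in> Arr C \<and> Dom C (g i) = Z \<and> Cod C (g i) = O1 A \<and> src A \<cdot> g i = w (Suc i) \<and> tgt A \<cdot> g i = w i"
  shows "is_chain C A n Z w g"
  using assms unfolding is_chain_def by (auto simp: hom_iff)

lemma exhibits_chain: "exhibits_nerve A X v e \<Longrightarrow> is_chain C A n (SOb X n) (v n) (e n)"
  unfolding exhibits_nerve_def by (drule conjunct1) (erule spec)

lemma exhibits_unique:
  assumes "exhibits_nerve A X v e" "is_chain C A n Z w g"
  shows "\<exists>!h. h \<in> hom C Z (SOb X n) \<and> (\<forall>i\<le>n. v n i \<cdot> h = w i) \<and> (\<forall>i<n. e n i \<cdot> h = g i)"
  using assms(1)[unfolded exhibits_nerve_def, THEN conjunct2, THEN conjunct1, rule_format, OF assms(2)] .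

lemma exhibits_univ:
  assumes "exhibits_nerve A X v e" "is_chain C A n Z w g"
  shows "\<exists>h. h \<in> Arr C \<and> Dom C h = Z \<and> Cod C h = SOb X n \<and> (\<forall>i\<le>n. v n i \<cdot> h = w i) \<and> (\<forall>i<n. e n i \<cdot> h = g i)"
  using ex1_implies_ex[OF exhibits_unique[OF assms]] unfolding hom_iff by (elim exE conjE, intro exI conjI)

lemma exhibits_ext:
  assumes A: "is_precat A" and ex: "exhibits_nerve A X v e"
    and h: "h \<in> Arr C" "Cod C h = SOb X n" and k: "k \<in> Arr C" "Cod C k = SOb X n" "Dom C h = Dom C k"
    and eq: "\<And>i. i \<le> n \<Longrightarrow> v n i \<cdot> h = v n i \<cdot> k" "\<And>i. i < n \<Longrightarrow> e n i \<cdot> h = e n i \<cdot> k"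
  shows "h = k"
proof -
  note c = chain_typ[OF exhibits_chain[OF ex, of n]]
  have "is_chain C A n (Dom C h) (\<lambda>i. v n i \<cdot> h) (\<lambda>i. e n i \<cdot> h)"
  proof (rule chainI)
    fix i assume i: "i < n"
    then show "e n i \<cdot> h \<in> Arr C \<and> Dom C (e n i \<cdot> h) = Dom C h \<and> Cod C (e n i \<cdot> h) = O1 A \<and>
        src A \<cdot> (e n i \<cdot> h) = v n (Suc i) \<cdot> h \<and> tgt A \<cdot> (e n i \<cdot> h) = v n i \<cdot> h"
      using A i c(5-7)[of i] h reassoc[OF c(8)[OF i], of h] reassoc[OF c(9)[OF i], of h] by simp
  qed (use c h in auto)
  from exhibits_unique[OF ex this] show "h = k"
  proof (rule ex1E)
    fix l
    assume l: "\<forall>y. y \<in> hom C (Dom C h) (SOb X n) \<and> (\<forall>i\<le>n. v n i \<cdot> y = v n i \<cdot> h) \<and> (\<forall>i<n. e n i \<cdot> y = e n i \<cdot> h) \<longrightarrow> y = l"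
    have "h = l"
      using h by (intro l[rule_format]) (simp add: hom_iff)
    moreover have "k = l"
      using k eq by (intro l[rule_format]) (simp add: hom_iff)
    ultimately show "h = k" by simp
  qed
qed

lemma exhibits_faces:
  assumes "exhibits_nerve A X v e" "j \<le> Suc n"
  shows "i \<le> n \<Longrightarrow> v n i \<cdot> Face X n j = v (Suc n) (if i < j then i else Suc i)"
    "i < n \<Longrightarrow> e n i \<cdot> Face X n j = (if Suc i < j then e (Suc n) i
            else if Suc i = j then icomp C A (e (Suc n) i) (e (Suc n) (Suc i)) else e (Suc n) (Suc i))"
  using assms(1)[unfolded exhibits_nerve_def, THEN conjunct2, THEN conjunct2, THEN conjunct1, rule_format, OF assms(2)]
  by (simp_all del: if_split)

lemma exhibits_degens:
  assumes "exhibits_nerve A X v e" "j \<le> n"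
  shows "i \<le> Suc n \<Longrightarrow> v (Suc n) i \<cdot> Degen X n j = v n (if i \<le> j then i else i - 1)"
    "i < Suc n \<Longrightarrow> e (Suc n) i \<cdot> Degen X n j = (if i < j then e n i else if i = j then idn A \<cdot> v n j else e n (i - 1))"
  using assms(1)[unfolded exhibits_nerve_def, THEN conjunct2, THEN conjunct2, THEN conjunct2, rule_format, OF assms(2)]
  by (simp_all del: if_split)

text \<open>An isomorphism of internal categories in elementary terms; its action on composable pairs is forced
  and therefore left out.\<close>

definition precat_iso :: "('o, 'a) icat \<Rightarrow> ('o, 'a) icat \<Rightarrow> 'a \<Rightarrow> 'a \<Rightarrow> bool" where
  "precat_iso B A f0 f1 \<longleftrightarrow> is_iso C (O0 B) (O0 A) f0 \<and> is_iso C (O1 B) (O1 A) f1 \<and>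
     src A \<cdot> f1 = f0 \<cdot> src B \<and> tgt A \<cdot> f1 = f0 \<cdot> tgt B \<and> f1 \<cdot> idn B = idn A \<cdot> f0 \<and>
     f1 \<cdot> cmp B = icomp C A (f1 \<cdot> pr2 B) (f1 \<cdot> pr1 B)"

lemma graph_map_icomp:
  assumes "is_precat A" "is_precat B"
    and "f0 \<in> Arr C" "f1 \<in> Arr C" "Dom C f0 = O0 B" "Cod C f0 = O0 A" "Dom C f1 = O1 B" "Cod C f1 = O1 A"
    and "src A \<cdot> f1 = f0 \<cdot> src B" "tgt A \<cdot> f1 = f0 \<cdot> tgt B" "f1 \<cdot> cmp B = icomp C A (f1 \<cdot> pr2 B) (f1 \<cdot> pr1 B)"
    and "x \<in> Arr C" "y \<in> Arr C" "Cod C x = O1 B" "Cod C y = O1 B" "tgt B \<cdot> x = src B \<cdot> y"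
  shows "f1 \<cdot> icomp C B y x = icomp C A (f1 \<cdot> y) (f1 \<cdot> x)"
proof -
  note p = ipair[OF assms(2,12-16)]
  have c: "tgt A \<cdot> (f1 \<cdot> pr1 B) = src A \<cdot> (f1 \<cdot> pr2 B)"
    using assms(1-8) icat_eq(1)[OF assms(2)] reassoc[OF assms(9), of "pr2 B"] reassoc[OF assms(10), of "pr1 B"]
    by simp
  have "f1 \<cdot> icomp C B y x = (f1 \<cdot> cmp B) \<cdot> ipair C B x y"
    unfolding icomp_def using assms(1-8) p by simp
  also have "\<dots> = icomp C A ((f1 \<cdot> pr2 B) \<cdot> ipair C B x y) ((f1 \<cdot> pr1 B) \<cdot> ipair C B x y)"
    unfolding assms(11) using assms(1-8) p c by (intro icomp_comp) simp_all
  also have "\<dots> = icomp C A (f1 \<cdot> y) (f1 \<cdot> x)"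
    using assms(1-8) p by simp
  finally show ?thesis .
qed

text \<open>Vertices and edges are mapped along the isomorphism.\<close>

lemma nerve_transport_precat:
  assumes A: "is_precat A" and B: "is_precat B" and iso: "precat_iso B A f0 f1" and X: "is_nerve C B X"
  shows "is_nerve C A X"
proof -
  obtain v e where ex: "exhibits_nerve B X v e" and simp: "is_simplicial C X"
    using X unfolding is_nerve_iff by blast
  obtain g0 where 0: "f0 \<in> Arr C" "Dom C f0 = O0 B" "Cod C f0 = O0 A" "g0 \<in> Arr C" "Dom C g0 = O0 A" "Cod C g0 = O0 B"
    "g0 \<cdot> f0 = Ident C (O0 B)" "f0 \<cdot> g0 = Ident C (O0 A)"
    "\<And>x. x \<in> Arr C \<Longrightarrow> Cod C x = O0 B \<Longrightarrow> g0 \<cdot> (f0 \<cdot> x) = x"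
    "\<And>x. x \<in> Arr C \<Longrightarrow> Cod C x = O0 A \<Longrightarrow> f0 \<cdot> (g0 \<cdot> x) = x"
    using iso unfolding precat_iso_def by (elim conjE is_isoE) blast
  obtain g1 where 1: "f1 \<in> Arr C" "Dom C f1 = O1 B" "Cod C f1 = O1 A" "g1 \<in> Arr C" "Dom C g1 = O1 A" "Cod C g1 = O1 B"
    "g1 \<cdot> f1 = Ident C (O1 B)" "f1 \<cdot> g1 = Ident C (O1 A)"
    "\<And>x. x \<in> Arr C \<Longrightarrow> Cod C x = O1 B \<Longrightarrow> g1 \<cdot> (f1 \<cdot> x) = x"
    "\<And>x. x \<in> Arr C \<Longrightarrow> Cod C x = O1 A \<Longrightarrow> f1 \<cdot> (g1 \<cdot> x) = x"
    using iso unfolding precat_iso_def by (elim conjE is_isoE) blast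
  have eqs: "src A \<cdot> f1 = f0 \<cdot> src B" "tgt A \<cdot> f1 = f0 \<cdot> tgt B" "f1 \<cdot> idn B = idn A \<cdot> f0"
     "f1 \<cdot> cmp B = icomp C A (f1 \<cdot> pr2 B) (f1 \<cdot> pr1 B)"
    using iso unfolding precat_iso_def by simp_all
  have f_elt: "src A \<cdot> (f1 \<cdot> x) = f0 \<cdot> (src B \<cdot> x)" "tgt A \<cdot> (f1 \<cdot> x) = f0 \<cdot> (tgt B \<cdot> x)"
    if "x \<in> Arr C" "Cod C x = O1 B" for x
    using that A B 0(1-3) 1(1-3) reassoc[OF eqs(1), of x] reassoc[OF eqs(2), of x] by simp_all
  have idn_elt: "f1 \<cdot> (idn B \<cdot> x) = idn A \<cdot> (f0 \<cdot> x)" if "x \<in> Arr C" "Cod C x = O0 B" for x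
    using that A B 0(1-3) 1(1-3) reassoc[OF eqs(3), of x] by simp
  have g_elt: "src B \<cdot> (g1 \<cdot> x) = g0 \<cdot> (src A \<cdot> x)" "tgt B \<cdot> (g1 \<cdot> x) = g0 \<cdot> (tgt A \<cdot> x)"
    if x: "x \<in> Arr C" "Cod C x = O1 A" for x
  proof -
    have "src A \<cdot> x = f0 \<cdot> (src B \<cdot> (g1 \<cdot> x))" "tgt A \<cdot> x = f0 \<cdot> (tgt B \<cdot> (g1 \<cdot> x))"
      using f_elt[of "g1 \<cdot> x"] 1 x by simp_all
    then show "src B \<cdot> (g1 \<cdot> x) = g0 \<cdot> (src A \<cdot> x)" "tgt B \<cdot> (g1 \<cdot> x) = g0 \<cdot> (tgt A \<cdot> x)"
      using 0(9) 1(4-6) x B by simp_all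
  qed
  note ch = chain_typ[OF exhibits_chain[OF ex]]
  note st = simplicial_typ[OF simp]
  have ic: "f1 \<cdot> icomp C B (e n i) (e n (Suc i)) = icomp C A (f1 \<cdot> e n i) (f1 \<cdot> e n (Suc i))" if "Suc i < n" for n i
    using that ch(2-9)[of _ n] by (intro graph_map_icomp[OF A B 0(1) 1(1) 0(2,3) 1(2,3) eqs(1,2,4)]) simp_all
  let ?v = "\<lambda>n i. f0 \<cdot> v n i" and ?e = "\<lambda>n i. f1 \<cdot> e n i"
  have "exhibits_nerve A X ?v ?e"
    unfolding exhibits_nerve_def
  proof (intro conjI allI impI)
    fix n show "is_chain C A n (SOb X n) (?v n) (?e n)"
      using 0(1-3) 1(1-3) ch(2-9)[of _ n] by (intro chainI) (simp_all add: f_elt st)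
  next
    fix n Z w g assume c: "is_chain C A n Z w g"
    note cw = chain_typ[OF c]
    have "is_chain C B n Z (\<lambda>i. g0 \<cdot> w i) (\<lambda>i. g1 \<cdot> g i)"
      using 0(4-6) 1(4-6) cw by (intro chainI) (simp_all add: g_elt)
    from exhibits_univ[OF ex this] obtain h where h: "h \<in> Arr C" "Dom C h = Z" "Cod C h = SOb X n"
      "\<forall>i\<le>n. v n i \<cdot> h = g0 \<cdot> w i" "\<forall>i<n. e n i \<cdot> h = g1 \<cdot> g i"
      by blast
    show "\<exists>!h. h \<in> hom C Z (SOb X n) \<and> (\<forall>i\<le>n. ?v n i \<cdot> h = w i) \<and> (\<forall>i<n. ?e n i \<cdot> h = g i)"
    proof (rule ex1I[of _ h])
      show "h \<in> hom C Z (SOb X n) \<and> (\<forall>i\<le>n. ?v n i \<cdot> h = w i) \<and> (\<forall>i<n. ?e n i \<cdot> h = g i)"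
        using h ch(2-9)[of _ n] cw 0(1-3,10) 1(1-3,10) by (simp add: hom_iff)
    next
      fix k assume k: "k \<in> hom C Z (SOb X n) \<and> (\<forall>i\<le>n. ?v n i \<cdot> k = w i) \<and> (\<forall>i<n. ?e n i \<cdot> k = g i)"
      have k': "k \<in> Arr C" "Dom C k = Z" "Cod C k = SOb X n"
        using k by (auto simp: hom_iff)
      have "v n i \<cdot> k = g0 \<cdot> w i" if "i \<le> n" for i
        using k k' that 0(1-3) 0(9)[of "v n i \<cdot> k"] ch(2-4)[of i n] by auto
      moreover have "e n i \<cdot> k = g1 \<cdot> g i" if "i < n" for i
        using k k' that 1(1-3) 1(9)[of "e n i \<cdot> k"] ch(5-7)[of i n] by auto
      ultimately show "k = h"
        using h k' by - (rule exhibits_ext[OF B ex, of _ n]; simp)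
    qed
  next
    fix n j i assume j: "j \<le> Suc n" and i: "i \<le> n"
    show "?v n i \<cdot> Face X n j = ?v (Suc n) (if i < j then i else Suc i)"
      using exhibits_faces(1)[OF ex j i] 0(1-3) ch(2-4)[of i n] st(2-4)[of j n] i j by simp
  next
    fix n j i assume j: "j \<le> Suc n" and i: "i < n"
    show "?e n i \<cdot> Face X n j = (if Suc i < j then ?e (Suc n) i
        else if Suc i = j then icomp C A (?e (Suc n) i) (?e (Suc n) (Suc i)) else ?e (Suc n) (Suc i))"
      using exhibits_faces(2)[OF ex j i] 1(1-3) ch(5-7)[of i n] st(2-4)[of j n] i j ic[of i "Suc n"] by auto
  next
    fix n j i assume j: "j \<le> n" and i: "i \<le> Suc n"
    show "?v (Suc n) i \<cdot> Degen X n j = ?v n (if i \<le> j then i else i - 1)"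
      using exhibits_degens(1)[OF ex j i] 0(1-3) ch(2-4)[of i "Suc n"] st(5-7)[of j n] i j by simp
  next
    fix n j i assume j: "j \<le> n" and i: "i < Suc n"
    show "?e (Suc n) i \<cdot> Degen X n j = (if i < j then ?e n i else if i = j then idn A \<cdot> ?v n j else ?e n (i - 1))"
      using exhibits_degens(2)[OF ex j i] 1(1-3) ch(5-7)[of i "Suc n"] ch(2-4)[of j n] st(5-7)[of j n] i j idn_elt[of "v n j"]
      by simp
  qed
  then show ?thesis
    using simp unfolding is_nerve_iff by blast
qed

lemma simplicial_isomorphic_refl:
  assumes "is_simplicial C X"
  shows "simplicial_isomorphic C X X"
proof -
  note st = simplicial_typ[OF assms]
  have "is_iso C (SOb X n) (SOb X n) (Ident C (SOb X n))" for n
    using st(1)[of n] by (intro is_isoI[of _ _ _ "Ident C (SOb X n)"]) simp_all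
  then show ?thesis
    unfolding simplicial_isomorphic_def using assms st
    by (intro conjI exI[of _ "\<lambda>n. Ident C (SOb X n)"]) simp_all
qed

text \<open>Vertices and edges are precomposed with the inverse isomorphism.\<close>

lemma nerve_transport_simplicial:
  assumes A: "is_precat A" and X: "is_nerve C A X" and iso: "simplicial_isomorphic C X Y"
  shows "is_nerve C A Y"
proof -
  obtain v e where ex: "exhibits_nerve A X v e" and simp: "is_simplicial C X"
    using X unfolding is_nerve_iff by blast
  obtain \<eta> where \<eta>: "\<forall>n. is_iso C (SOb X n) (SOb Y n) (\<eta> n)"
    "\<forall>n. \<forall>i\<le>Suc n. Face Y n i \<cdot> \<eta> (Suc n) = \<eta> n \<cdot> Face X n i"
    "\<forall>n. \<forall>i\<le>n. Degen Y n i \<cdot> \<eta> n = \<eta> (Suc n) \<cdot> Degen X n i"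
    and simpY: "is_simplicial C Y"
    using iso unfolding simplicial_isomorphic_def by blast
  have "\<forall>n. \<exists>k. k \<in> hom C (SOb Y n) (SOb X n) \<and> k \<cdot> \<eta> n = Ident C (SOb X n) \<and> \<eta> n \<cdot> k = Ident C (SOb Y n)"
    using \<eta>(1) unfolding is_iso_def by blast
  then obtain \<kappa> where k: "\<And>n. \<kappa> n \<in> hom C (SOb Y n) (SOb X n)" "\<And>n. \<kappa> n \<cdot> \<eta> n = Ident C (SOb X n)"
    "\<And>n. \<eta> n \<cdot> \<kappa> n = Ident C (SOb Y n)"
    by metis
  have \<eta>t: "\<eta> n \<in> Arr C" "Dom C (\<eta> n) = SOb X n" "Cod C (\<eta> n) = SOb Y n" for n
    using \<eta>(1) unfolding is_iso_def by (auto simp: hom_iff)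
  have kt: "\<kappa> n \<in> Arr C" "Dom C (\<kappa> n) = SOb Y n" "Cod C (\<kappa> n) = SOb X n" for n
    using k(1)[of n] by (auto simp: hom_iff)
  note st = simplicial_typ[OF simp] and stY = simplicial_typ[OF simpY]
  have k\<eta>: "\<kappa> n \<cdot> (\<eta> n \<cdot> x) = x" if "x \<in> Arr C" "Cod C x = SOb X n" for n x
    using that reassoc[OF k(2), of n x] kt \<eta>t by simp
  have \<eta>k: "\<eta> n \<cdot> (\<kappa> n \<cdot> x) = x" if "x \<in> Arr C" "Cod C x = SOb Y n" for n x
    using that reassoc[OF k(3), of n x] kt \<eta>t by simp
  have kF: "\<kappa> n \<cdot> Face Y n j = Face X n j \<cdot> \<kappa> (Suc n)" if j: "j \<le> Suc n" for n j
  proof -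
    have "Face Y n j = Face Y n j \<cdot> (\<eta> (Suc n) \<cdot> \<kappa> (Suc n))"
      using j stY(2-7)[of _ n] by (simp add: k(3))
    also have "\<dots> = \<eta> n \<cdot> (Face X n j \<cdot> \<kappa> (Suc n))"
      using j stY(2-7)[of _ n] st(2-7)[of _ n] kt \<eta>t reassoc[of "Face Y n j" "\<eta> (Suc n)" _ "\<kappa> (Suc n)"] \<eta>(2) by simp
    finally have "\<kappa> n \<cdot> Face Y n j = \<kappa> n \<cdot> (\<eta> n \<cdot> (Face X n j \<cdot> \<kappa> (Suc n)))" by simp
    also have "\<dots> = Face X n j \<cdot> \<kappa> (Suc n)"
      using j st(2-7)[of _ n] kt by (intro k\<eta>) simp_all
    finally show ?thesis .
  qed
  have kD: "\<kappa> (Suc n) \<cdot> Degen Y n j = Degen X n j \<cdot> \<kappa> n" if j: "j \<le> n" for n j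
  proof -
    have "Degen Y n j = Degen Y n j \<cdot> (\<eta> n \<cdot> \<kappa> n)"
      using j stY(2-7)[of _ n] by (simp add: k(3))
    also have "\<dots> = \<eta> (Suc n) \<cdot> (Degen X n j \<cdot> \<kappa> n)"
      using j stY(2-7)[of _ n] st(2-7)[of _ n] kt \<eta>t reassoc[of "Degen Y n j" "\<eta> n" _ "\<kappa> n"] \<eta>(3) by simp
    finally have "\<kappa> (Suc n) \<cdot> Degen Y n j = \<kappa> (Suc n) \<cdot> (\<eta> (Suc n) \<cdot> (Degen X n j \<cdot> \<kappa> n))" by simp
    also have "\<dots> = Degen X n j \<cdot> \<kappa> n"
      using j st(2-7)[of _ n] kt by (intro k\<eta>) simp_all
    finally show ?thesis .
  qed
  note ch = chain_typ[OF exhibits_chain[OF ex]]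
  let ?v = "\<lambda>n i. v n i \<cdot> \<kappa> n" and ?e = "\<lambda>n i. e n i \<cdot> \<kappa> n"
  have "exhibits_nerve A Y ?v ?e"
    unfolding exhibits_nerve_def
  proof (intro conjI allI impI)
    fix n show "is_chain C A n (SOb Y n) (?v n) (?e n)"
    proof (rule chainI)
      fix i assume i: "i < n"
      show "?e n i \<in> Arr C \<and> Dom C (?e n i) = SOb Y n \<and> Cod C (?e n i) = O1 A \<and>
          src A \<cdot> ?e n i = ?v n (Suc i) \<and> tgt A \<cdot> ?e n i = ?v n i"
        using A i kt ch(2-9)[of i n] reassoc[OF ch(8)[OF i], of "\<kappa> n"] reassoc[OF ch(9)[OF i], of "\<kappa> n"] by simp
    qed (use kt ch(2-9)[of _ n] stY in auto)
  next
    fix n Z w g assume c: "is_chain C A n Z w g"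
    from exhibits_univ[OF ex this] obtain h where h: "h \<in> Arr C" "Dom C h = Z" "Cod C h = SOb X n"
      "\<forall>i\<le>n. v n i \<cdot> h = w i" "\<forall>i<n. e n i \<cdot> h = g i"
      by blast
    show "\<exists>!h. h \<in> hom C Z (SOb Y n) \<and> (\<forall>i\<le>n. ?v n i \<cdot> h = w i) \<and> (\<forall>i<n. ?e n i \<cdot> h = g i)"
    proof (rule ex1I[of _ "\<eta> n \<cdot> h"])
      show "\<eta> n \<cdot> h \<in> hom C Z (SOb Y n) \<and> (\<forall>i\<le>n. ?v n i \<cdot> (\<eta> n \<cdot> h) = w i) \<and> (\<forall>i<n. ?e n i \<cdot> (\<eta> n \<cdot> h) = g i)"
        using h ch(2-9)[of _ n] kt \<eta>t by (simp add: hom_iff k\<eta>)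
    next
      fix l assume l: "l \<in> hom C Z (SOb Y n) \<and> (\<forall>i\<le>n. ?v n i \<cdot> l = w i) \<and> (\<forall>i<n. ?e n i \<cdot> l = g i)"
      then have l': "l \<in> Arr C" "Dom C l = Z" "Cod C l = SOb Y n"
        by (auto simp: hom_iff)
      have "v n i \<cdot> (\<kappa> n \<cdot> l) = w i" if "i \<le> n" for i
        using l l' that ch(2-4)[of i n] kt by auto
      moreover have "e n i \<cdot> (\<kappa> n \<cdot> l) = g i" if "i < n" for i
        using l l' that ch(5-7)[of i n] kt by auto
      ultimately have "\<kappa> n \<cdot> l = h"
        using h l' kt by - (rule exhibits_ext[OF A ex, of _ n]; simp)
      then show "l = \<eta> n \<cdot> h"
        using \<eta>k[of l n] l' by simp
    qed
  next
    fix n j i assume j: "j \<le> Suc n" and i: "i \<le> n"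
    show "?v n i \<cdot> Face Y n j = ?v (Suc n) (if i < j then i else Suc i)"
      using exhibits_faces(1)[OF ex j i] kt ch(2-4)[of i n] st(2-4)[of j n] stY(2-4)[of j n] i j
        reassoc[of "v n i" "Face X n j" _ "\<kappa> (Suc n)"] by (simp add: kF)
  next
    fix n j i assume j: "j \<le> Suc n" and i: "i < n"
    have "?e n i \<cdot> Face Y n j = (e n i \<cdot> Face X n j) \<cdot> \<kappa> (Suc n)"
      using kt ch(5-7)[of i n] st(2-4)[of j n] stY(2-4)[of j n] i j by (simp add: kF)
    moreover have "icomp C A (e (Suc n) i) (e (Suc n) (Suc i)) \<cdot> \<kappa> (Suc n) = icomp C A (?e (Suc n) i) (?e (Suc n) (Suc i))"
      using i kt ch(2-9)[of _ "Suc n"] by (intro icomp_comp[OF A]) simp_all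
    ultimately show "?e n i \<cdot> Face Y n j = (if Suc i < j then ?e (Suc n) i
        else if Suc i = j then icomp C A (?e (Suc n) i) (?e (Suc n) (Suc i)) else ?e (Suc n) (Suc i))"
      using exhibits_faces(2)[OF ex j i] by auto
  next
    fix n j i assume j: "j \<le> n" and i: "i \<le> Suc n"
    have "?v (Suc n) i \<cdot> Degen Y n j = (v (Suc n) i \<cdot> Degen X n j) \<cdot> \<kappa> n"
      using kt ch(2-4)[of i "Suc n"] st(5-7)[of j n] stY(5-7)[of j n] i j by (simp add: kD)
    then show "?v (Suc n) i \<cdot> Degen Y n j = ?v n (if i \<le> j then i else i - 1)"
      using exhibits_degens(1)[OF ex j i] by simp
  next
    fix n j i assume j: "j \<le> n" and i: "i < Suc n"
    have "?e (Suc n) i \<cdot> Degen Y n j = (e (Suc n) i \<cdot> Degen X n j) \<cdot> \<kappa> n"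
      using kt ch(5-7)[of i "Suc n"] st(5-7)[of j n] stY(5-7)[of j n] i j by (simp add: kD)
    then show "?e (Suc n) i \<cdot> Degen Y n j = (if i < j then ?e n i else if i = j then idn A \<cdot> ?v n j else ?e n (i - 1))"
      using exhibits_degens(2)[OF ex j i] A j kt ch(2-4)[of j n] by simp
  qed
  then show ?thesis
    using simpY unfolding is_nerve_iff by blast
qed

text \<open>A nerve determines its internal category: objects and arrows are recovered in degrees 0 and 1,
  and composition is the inner face of a 2-simplex.\<close>

lemma nerve_determines_precat:
  assumes A: "is_precat A" and X: "is_nerve C A X"
    and B: "SOb X 0 = O0 B" "SOb X (Suc 0) = O1 B" "Face X 0 0 = src B" "Face X 0 (Suc 0) = tgt B"
      "Degen X 0 0 = idn B" "Face X (Suc 0) 0 = pr1 B" "Face X (Suc 0) (Suc 0) = cmp B"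
      "Face X (Suc 0) (Suc (Suc 0)) = pr2 B"
  shows "\<exists>f0 f1. precat_iso B A f0 f1"
proof -
  obtain v e where ex: "exhibits_nerve A X v e" and simp: "is_simplicial C X"
    using X unfolding is_nerve_iff by blast
  note ch = chain_typ[OF exhibits_chain[OF ex]]
  let ?f0 = "v 0 0" and ?f1 = "e (Suc 0) 0"
  have t0: "?f0 \<in> Arr C" "Dom C ?f0 = O0 B" "Cod C ?f0 = O0 A"
    using ch(2-4)[of 0 0] B by simp_all
  have t1: "?f1 \<in> Arr C" "Dom C ?f1 = O1 B" "Cod C ?f1 = O1 A"
    using ch(5-7)[of 0 "Suc 0"] B by simp_all
  have v1: "v (Suc 0) 0 = ?f0 \<cdot> tgt B" "v (Suc 0) (Suc 0) = ?f0 \<cdot> src B"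
    using exhibits_faces(1)[OF ex, of "Suc 0" 0 0] exhibits_faces(1)[OF ex, of 0 0 0] B by simp_all
  then have st: "src A \<cdot> ?f1 = ?f0 \<cdot> src B" "tgt A \<cdot> ?f1 = ?f0 \<cdot> tgt B"
    using ch(8,9)[of 0 "Suc 0"] by simp_all
  have "?f1 \<cdot> idn B = idn A \<cdot> ?f0"
    using exhibits_degens(2)[OF ex, of 0 0 0] B by simp
  moreover have "?f1 \<cdot> cmp B = icomp C A (?f1 \<cdot> pr2 B) (?f1 \<cdot> pr1 B)"
    using exhibits_faces(2)[OF ex, of 0 "Suc 0" 0] exhibits_faces(2)[OF ex, of "Suc 0" "Suc 0" 0]
      exhibits_faces(2)[OF ex, of "Suc (Suc 0)" "Suc 0" 0] B by simp
  moreover have "is_iso C (O0 B) (O0 A) ?f0"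
  proof -
    have "is_chain C A 0 (O0 A) (\<lambda>_. Ident C (O0 A)) (\<lambda>_. Ident C (O0 A))"
      using A by (intro chainI) simp_all
    from exhibits_univ[OF ex this] obtain h where h: "h \<in> Arr C" "Dom C h = O0 A" "Cod C h = O0 B" "?f0 \<cdot> h = Ident C (O0 A)"
      using B by auto
    have "h \<cdot> ?f0 = Ident C (O0 B)"
    proof (rule exhibits_ext[OF A ex, of _ 0])
      fix i assume "i \<le> (0::nat)"
      then show "v 0 i \<cdot> (h \<cdot> ?f0) = v 0 i \<cdot> Ident C (O0 B)"
        using h t0 reassoc[OF h(4), of ?f0] B simplicial_typ(1)[OF simp, of 0] by simp
    qed (use h t0 B simplicial_typ(1)[OF simp, of 0] in auto)
    then show ?thesis
      using h t0 by (intro is_isoI[of _ _ _ h]) simp_all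
  qed
  moreover have "is_iso C (O1 B) (O1 A) ?f1"
  proof -
    have "is_chain C A (Suc 0) (O1 A) (\<lambda>i. if i = 0 then tgt A else src A) (\<lambda>_. Ident C (O1 A))"
      using A by (intro chainI) simp_all
    from exhibits_univ[OF ex this] obtain h where h: "h \<in> Arr C" "Dom C h = O1 A" "Cod C h = O1 B" "?f1 \<cdot> h = Ident C (O1 A)"
      and vh: "\<forall>i\<le>Suc 0. v (Suc 0) i \<cdot> h = (if i = 0 then tgt A else src A)"
      using B by auto
    have o: "O1 B \<in> Obj C"
      using simplicial_typ(1)[OF simp, of "Suc 0"] B by simp
    have "h \<cdot> ?f1 = Ident C (O1 B)"
    proof (rule exhibits_ext[OF A ex, of _ "Suc 0"])
      fix i assume i: "i \<le> Suc 0"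
      have vi: "v (Suc 0) i = (if i = 0 then tgt A else src A) \<cdot> ?f1" "v (Suc 0) i \<in> Arr C" "Dom C (v (Suc 0) i) = O1 B"
        using i ch(8,9)[of 0 "Suc 0"] ch(2,3)[of i "Suc 0"] B by (auto simp: le_Suc_eq)
      have "v (Suc 0) i \<cdot> (h \<cdot> ?f1) = (v (Suc 0) i \<cdot> h) \<cdot> ?f1"
        using h t1 vi(2,3) by simp
      also have "\<dots> = v (Suc 0) i"
        by (simp only: vh[rule_format, OF i] vi(1)[symmetric])
      finally show "v (Suc 0) i \<cdot> (h \<cdot> ?f1) = v (Suc 0) i \<cdot> Ident C (O1 B)"
        using vi(2,3) by (simp add: comp_ident)
    next
      fix i assume "i < Suc 0"
      then show "e (Suc 0) i \<cdot> (h \<cdot> ?f1) = e (Suc 0) i \<cdot> Ident C (O1 B)"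
        using h t1 reassoc[OF h(4), of ?f1] o by simp
    qed (use h t1 B o in auto)
    then show ?thesis
      using h t1 by (intro is_isoI[of _ _ _ h]) simp_all
  qed
  ultimately show ?thesis
    using st unfolding precat_iso_def by blast
qed

end


section \<open>Internal categories in the category of algebras\<close>

context cartesian_monad
begin

lemma Alg_simps:
  "Dom (Alg C T) (x, y, f) = x" "Cod (Alg C T) (x, y, f) = y"
  "Ident (Alg C T) x = (x, x, Ident C (fst x))" "Comp (Alg C T) (y, z, g) (x, y', f) = (x, z, g \<cdot> f)"
  by (simp_all add: Alg_def Let_def)

declare Alg_simps [simp]

lemma Alg_obj: "x \<in> Obj (Alg C T) \<longleftrightarrow> fst x \<in> Obj C \<and> snd x \<in> Arr C \<and> Dom C (snd x) = FO T (fst x) \<and>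
    Cod C (snd x) = fst x \<and> snd x \<cdot> FA T (snd x) = snd x \<cdot> Mu T (fst x) \<and> snd x \<cdot> Eps T (fst x) = Ident C (fst x)"
  by (cases x) (auto simp: Alg_def Let_def hom_iff)

lemma Alg_arr: "(x, y, f) \<in> Arr (Alg C T) \<longleftrightarrow> x \<in> Obj (Alg C T) \<and> y \<in> Obj (Alg C T) \<and>
    f \<in> Arr C \<and> Dom C f = fst x \<and> Cod C f = fst y \<and> f \<cdot> snd x = snd y \<cdot> FA T f"
  by (cases x, cases y) (auto simp: Alg_def Let_def hom_iff)

lemma Alg_hom: "u \<in> hom (Alg C T) x y \<longleftrightarrow> u = (x, y, snd (snd u)) \<and> (x, y, snd (snd u)) \<in> Arr (Alg C T)"
  by (cases u) (auto simp: hom_def)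

lemma Alg_homE:
  assumes "u \<in> hom (Alg C T) x y"
  obtains f where "u = (x, y, f)" "(x, y, f) \<in> Arr (Alg C T)"
  using assms Alg_hom by blast

lemma Alg_comp:
  assumes "(x, y, f) \<in> Arr (Alg C T)" "(y, z, g) \<in> Arr (Alg C T)"
  shows "(x, z, g \<cdot> f) \<in> Arr (Alg C T)"
proof -
  note f = assms(1)[unfolded Alg_arr Alg_obj] and g = assms(2)[unfolded Alg_arr Alg_obj]
  have "(g \<cdot> f) \<cdot> snd x = g \<cdot> (snd y \<cdot> FA T f)"
    using f g by simp
  also have "\<dots> = (g \<cdot> snd y) \<cdot> FA T f"
    using f g by (intro assoc[symmetric]) simp_all
  also have "\<dots> = snd z \<cdot> FA T (g \<cdot> f)"
    using f g by simp
  finally show ?thesis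
    using f g assms by (simp add: Alg_arr)
qed

lemma Alg_category: "category (Alg C T)"
proof
  fix f assume "f \<in> Arr (Alg C T)"
  then show "Dom (Alg C T) f \<in> Obj (Alg C T)" "Cod (Alg C T) f \<in> Obj (Alg C T)"
    by (cases f; simp add: Alg_arr)+
next
  fix x assume "x \<in> Obj (Alg C T)"
  then show "Ident (Alg C T) x \<in> hom (Alg C T) x x"
    by (simp add: Alg_hom Alg_arr Alg_obj)
next
  fix f X Y g Z assume f: "f \<in> hom (Alg C T) X Y" and g: "g \<in> hom (Alg C T) Y Z"
  obtain f' where "f = (X, Y, f')" "(X, Y, f') \<in> Arr (Alg C T)" by (rule Alg_homE[OF f])
  moreover obtain g' where "g = (Y, Z, g')" "(Y, Z, g') \<in> Arr (Alg C T)" by (rule Alg_homE[OF g])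
  ultimately show "g \<cdot>\<^bsub>Alg C T\<^esub> f \<in> hom (Alg C T) X Z"
    using Alg_comp by (simp add: Alg_hom)
next
  fix f X Y g Z h W
  assume f: "f \<in> hom (Alg C T) X Y" and g: "g \<in> hom (Alg C T) Y Z" and h: "h \<in> hom (Alg C T) Z W"
  obtain f' where "f = (X, Y, f')" "(X, Y, f') \<in> Arr (Alg C T)" by (rule Alg_homE[OF f])
  moreover obtain g' where "g = (Y, Z, g')" "(Y, Z, g') \<in> Arr (Alg C T)" by (rule Alg_homE[OF g])
  moreover obtain h' where "h = (Z, W, h')" "(Z, W, h') \<in> Arr (Alg C T)" by (rule Alg_homE[OF h])
  ultimately show "(h \<cdot>\<^bsub>Alg C T\<^esub> g) \<cdot>\<^bsub>Alg C T\<^esub> f = h \<cdot>\<^bsub>Alg C T\<^esub> (g \<cdot>\<^bsub>Alg C T\<^esub> f)"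
    by (simp add: Alg_arr)
next
  fix f X Y assume f: "f \<in> hom (Alg C T) X Y"
  obtain f' where "f = (X, Y, f')" "(X, Y, f') \<in> Arr (Alg C T)" by (rule Alg_homE[OF f])
  then show "Ident (Alg C T) Y \<cdot>\<^bsub>Alg C T\<^esub> f = f" "f \<cdot>\<^bsub>Alg C T\<^esub> Ident (Alg C T) X = f"
    by (simp_all add: Alg_arr)
qed

sublocale Alg: category "Alg C T"
  by (rule Alg_category)

lemma Alg_map_comp:
  assumes "(w, x, p) \<in> Arr (Alg C T)" "h \<in> Arr C" "Cod C h = fst w"
  shows "p \<cdot> (snd w \<cdot> FA T h) = snd x \<cdot> FA T (p \<cdot> h)"
proof -
  note p = assms(1)[unfolded Alg_arr Alg_obj]
  have "p \<cdot> (snd w \<cdot> FA T h) = (snd x \<cdot> FA T p) \<cdot> FA T h"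
    using p assms(2,3) by (intro reassoc) simp_all
  then show ?thesis
    using p assms(2,3) by simp
qed

text \<open>The forgetful functor creates pullbacks: a mediating map between algebras is an algebra map
  because both composites with the structure maps are mediating.\<close>

lemma Alg_pullback:
  assumes "(x, z, f) \<in> Arr (Alg C T)" "(y, z, g) \<in> Arr (Alg C T)" "(w, x, p) \<in> Arr (Alg C T)" "(w, y, q) \<in> Arr (Alg C T)"
    and pb: "is_pullback C f g p q"
  shows "is_pullback (Alg C T) (x, z, f) (y, z, g) (w, x, p) (w, y, q)"
proof (rule Alg.pullbackI)
  note p = assms(3)[unfolded Alg_arr Alg_obj] and q = assms(4)[unfolded Alg_arr Alg_obj]
    and f = assms(1)[unfolded Alg_arr Alg_obj] and g = assms(2)[unfolded Alg_arr Alg_obj]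
  show "(x, z, f) \<cdot>\<^bsub>Alg C T\<^esub> (w, x, p) = (y, z, g) \<cdot>\<^bsub>Alg C T\<^esub> (w, y, q)"
    using pb unfolding is_pullback_def by simp
  fix a b
  assume ab: "a \<in> Arr (Alg C T)" "b \<in> Arr (Alg C T)" "Cod (Alg C T) a = Dom (Alg C T) (x, z, f)"
    "Cod (Alg C T) b = Dom (Alg C T) (y, z, g)" "Dom (Alg C T) a = Dom (Alg C T) b"
    and eq: "(x, z, f) \<cdot>\<^bsub>Alg C T\<^esub> a = (y, z, g) \<cdot>\<^bsub>Alg C T\<^esub> b"
  define v where "v = Dom (Alg C T) a"
  have "a \<in> hom (Alg C T) v x" "b \<in> hom (Alg C T) v y"
    using ab by (simp_all add: hom_def v_def)
  then obtain a' b' where a: "a = (v, x, a')" "(v, x, a') \<in> Arr (Alg C T)" and b: "b = (v, y, b')" "(v, y, b') \<in> Arr (Alg C T)"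
    by (elim Alg_homE) blast
  note a' = a(2)[unfolded Alg_arr Alg_obj] and b' = b(2)[unfolded Alg_arr Alg_obj]
  have "f \<cdot> a' = g \<cdot> b'"
    using eq by (simp add: a(1) b(1))
  then obtain h where h: "h \<in> Arr C" "Dom C h = fst v" "Cod C h = fst w" "p \<cdot> h = a'" "q \<cdot> h = b'"
    using pullback_lift[OF pb, of a' b'] a' b' p q f g by auto
  have "h \<cdot> snd v = snd w \<cdot> FA T h"
  proof (rule pullback_ext[OF pb])
    show "p \<cdot> (h \<cdot> snd v) = p \<cdot> (snd w \<cdot> FA T h)" "q \<cdot> (h \<cdot> snd v) = q \<cdot> (snd w \<cdot> FA T h)"
      using h a' b' p q reassoc[OF h(4), of "snd v"] reassoc[OF h(5), of "snd v"]
        Alg_map_comp[OF assms(3), of h] Alg_map_comp[OF assms(4), of h] by simp_all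
  qed (use h p a' in auto)
  then show "\<exists>h. h \<in> Arr (Alg C T) \<and> Dom (Alg C T) h = Dom (Alg C T) a \<and> Cod (Alg C T) h = Dom (Alg C T) (w, x, p) \<and>
      (w, x, p) \<cdot>\<^bsub>Alg C T\<^esub> h = a \<and> (w, y, q) \<cdot>\<^bsub>Alg C T\<^esub> h = b"
    using h a b assms(3) by (intro exI[of _ "(v, w, h)"]) (simp add: Alg_arr)
next
  fix h k
  assume "h \<in> Arr (Alg C T)" "k \<in> Arr (Alg C T)" "Dom (Alg C T) h = Dom (Alg C T) k" "Cod (Alg C T) h = Dom (Alg C T) (w, x, p)"
    "Cod (Alg C T) k = Dom (Alg C T) (w, x, p)" "(w, x, p) \<cdot>\<^bsub>Alg C T\<^esub> h = (w, x, p) \<cdot>\<^bsub>Alg C T\<^esub> k"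
    "(w, y, q) \<cdot>\<^bsub>Alg C T\<^esub> h = (w, y, q) \<cdot>\<^bsub>Alg C T\<^esub> k"
  then show "h = k"
    using pullback_ext[OF pb, of "snd (snd h)" "snd (snd k)"] assms(3)
    by (cases h; cases k) (simp add: Alg_arr)
qed (use assms in auto)

lemma calg_icat_simps:
  "O0 (calg_icat (A, \<alpha>)) = (O0 A, F0 \<alpha>)" "O1 (calg_icat (A, \<alpha>)) = (O1 A, F1 \<alpha>)" "O2 (calg_icat (A, \<alpha>)) = (O2 A, F2 \<alpha>)"
  "src (calg_icat (A, \<alpha>)) = ((O1 A, F1 \<alpha>), (O0 A, F0 \<alpha>), src A)"
  "tgt (calg_icat (A, \<alpha>)) = ((O1 A, F1 \<alpha>), (O0 A, F0 \<alpha>), tgt A)"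
  "idn (calg_icat (A, \<alpha>)) = ((O0 A, F0 \<alpha>), (O1 A, F1 \<alpha>), idn A)"
  "pr1 (calg_icat (A, \<alpha>)) = ((O2 A, F2 \<alpha>), (O1 A, F1 \<alpha>), pr1 A)"
  "pr2 (calg_icat (A, \<alpha>)) = ((O2 A, F2 \<alpha>), (O1 A, F1 \<alpha>), pr2 A)"
  "cmp (calg_icat (A, \<alpha>)) = ((O2 A, F2 \<alpha>), (O1 A, F1 \<alpha>), cmp A)"
  by (simp_all add: calg_icat_def Let_def)

declare calg_icat_simps [simp]

lemma calg_Alg:
  assumes "(A, \<alpha>) \<in> calgs"
  shows "(O0 A, F0 \<alpha>) \<in> Obj (Alg C T)" "(O1 A, F1 \<alpha>) \<in> Obj (Alg C T)" "(O2 A, F2 \<alpha>) \<in> Obj (Alg C T)"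
    "src (calg_icat (A, \<alpha>)) \<in> Arr (Alg C T)" "tgt (calg_icat (A, \<alpha>)) \<in> Arr (Alg C T)"
    "idn (calg_icat (A, \<alpha>)) \<in> Arr (Alg C T)" "pr1 (calg_icat (A, \<alpha>)) \<in> Arr (Alg C T)"
    "pr2 (calg_icat (A, \<alpha>)) \<in> Arr (Alg C T)" "cmp (calg_icat (A, \<alpha>)) \<in> Arr (Alg C T)"
proof -
  note f = calg_facts[OF assms] and e = assms[unfolded calg_iff]
  show o: "(O0 A, F0 \<alpha>) \<in> Obj (Alg C T)" "(O1 A, F1 \<alpha>) \<in> Obj (Alg C T)" "(O2 A, F2 \<alpha>) \<in> Obj (Alg C T)"
    using e f unfolding Alg_obj by simp_all
  show "src (calg_icat (A, \<alpha>)) \<in> Arr (Alg C T)" "tgt (calg_icat (A, \<alpha>)) \<in> Arr (Alg C T)"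
    "idn (calg_icat (A, \<alpha>)) \<in> Arr (Alg C T)" "pr1 (calg_icat (A, \<alpha>)) \<in> Arr (Alg C T)"
    "pr2 (calg_icat (A, \<alpha>)) \<in> Arr (Alg C T)" "cmp (calg_icat (A, \<alpha>)) \<in> Arr (Alg C T)"
    using o f ifun_eq[OF f(2-4)] by (simp_all add: Alg_arr)
qed

lemma calg_precat:
  assumes "(A, \<alpha>) \<in> calgs"
  shows "Alg.is_precat (calg_icat (A, \<alpha>))"
proof -
  note a = calg_Alg[OF assms, simplified]
  have "is_icat C A" using calg_facts[OF assms] by simp
  then show ?thesis
    unfolding Alg.is_precat_def
    using a Alg_pullback[OF a(5,4,7,8) icat_pullback] icat_eq[of A] by (simp add: Alg.hom_iff)
qed

text \<open>Composites in the internal category of algebras are composites in \<open>C\<close>: the pairing of two algebra maps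
  in algebras is a pairing in \<open>C\<close> as well.\<close>

lemma calg_icomp:
  assumes y: "(A, \<alpha>) \<in> calgs" and f: "(z, (O1 A, F1 \<alpha>), f) \<in> Arr (Alg C T)" and g: "(z, (O1 A, F1 \<alpha>), g) \<in> Arr (Alg C T)"
    and fg: "tgt A \<cdot> f = src A \<cdot> g"
  shows "icomp (Alg C T) (calg_icat (A, \<alpha>)) (z, (O1 A, F1 \<alpha>), g) (z, (O1 A, F1 \<alpha>), f) = (z, (O1 A, F1 \<alpha>), icomp C A g f)"
proof -
  note A = calg_facts[OF y]
  have f': "f \<in> Arr C" "Dom C f = fst z" "Cod C f = O1 A" and g': "g \<in> Arr C" "Dom C g = fst z" "Cod C g = O1 A"
    using f g unfolding Alg_arr by simp_all
  let ?A = "calg_icat (A, \<alpha>)" and ?f = "(z, (O1 A, F1 \<alpha>), f)" and ?g = "(z, (O1 A, F1 \<alpha>), g)"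
  have "tgt ?A \<cdot>\<^bsub>Alg C T\<^esub> ?f = src ?A \<cdot>\<^bsub>Alg C T\<^esub> ?g"
    using fg by simp
  note p = Alg.ipair[OF calg_precat[OF y] f g _ _ this, simplified]
  obtain h where h: "ipair (Alg C T) ?A ?f ?g = (z, (O2 A, F2 \<alpha>), h)"
    using p(2,3) by (cases "ipair (Alg C T) ?A ?f ?g") auto
  have "ipair C A f g = h"
    using p(1,4,5) A unfolding h Alg_arr by (intro ipair_eqI) simp_all
  then show ?thesis
    by (simp add: icomp_def h)
qed

text \<open>Strictness of an internal functor says that its maps on objects and on arrows are algebra maps.\<close>

lemma CAlg_iso_precat_iso:
  assumes x: "(A, \<alpha>) \<in> calgs" and y: "(B, \<beta>) \<in> calgs" and iso: "is_iso (CAlg C T) (A, \<alpha>) (B, \<beta>) u"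
  shows "\<exists>f0 f1. Alg.precat_iso (calg_icat (A, \<alpha>)) (calg_icat (B, \<beta>)) f0 f1"
proof -
  note a = calg_facts[OF x] and b = calg_facts[OF y]
  obtain v where uv: "u \<in> hom (CAlg C T) (A, \<alpha>) (B, \<beta>)" "v \<in> hom (CAlg C T) (B, \<beta>) (A, \<alpha>)"
    "v \<cdot>\<^bsub>CAlg C T\<^esub> u = Ident (CAlg C T) (A, \<alpha>)" "u \<cdot>\<^bsub>CAlg C T\<^esub> v = Ident (CAlg C T) (B, \<beta>)"
    using iso unfolding is_iso_def by blast
  obtain f where f: "u = ((A, \<alpha>), (B, \<beta>), f)" "((A, \<alpha>), (B, \<beta>), f) \<in> Arr (CAlg C T)"
    using uv(1) unfolding CAlg_def by (rule ICat.Alg2_homE)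
  obtain g where g: "v = ((B, \<beta>), (A, \<alpha>), g)" "((B, \<beta>), (A, \<alpha>), g) \<in> Arr (CAlg C T)"
    using uv(2) unfolding CAlg_def by (rule ICat.Alg2_homE)
  note f' = f(2)[unfolded strict_mor_iff[OF x y]] and g' = g(2)[unfolded strict_mor_iff[OF y x]]
  have "icomp1 C g f = Ident (ICat C) A" "icomp1 C f g = Ident (ICat C) B"
    using uv(3,4) by (simp_all add: f(1) g(1) CAlg_def)
  then have inv: "F0 g \<cdot> F0 f = Ident C (O0 A)" "F1 g \<cdot> F1 f = Ident C (O1 A)"
    "F0 f \<cdot> F0 g = Ident C (O0 B)" "F1 f \<cdot> F1 g = Ident C (O1 B)"
    by (simp_all add: icomp1_def)
  let ?f0 = "((O0 A, F0 \<alpha>), (O0 B, F0 \<beta>), F0 f)" and ?f1 = "((O1 A, F1 \<alpha>), (O1 B, F1 \<beta>), F1 f)"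
  let ?g0 = "((O0 B, F0 \<beta>), (O0 A, F0 \<alpha>), F0 g)" and ?g1 = "((O1 B, F1 \<beta>), (O1 A, F1 \<alpha>), F1 g)"
  have arr: "?f0 \<in> Arr (Alg C T)" "?f1 \<in> Arr (Alg C T)" "?g0 \<in> Arr (Alg C T)" "?g1 \<in> Arr (Alg C T)"
    using f' g' calg_Alg(1,2)[OF x] calg_Alg(1,2)[OF y] by (simp_all add: Alg_arr)
  have isos: "is_iso (Alg C T) (O0 A, F0 \<alpha>) (O0 B, F0 \<beta>) ?f0" "is_iso (Alg C T) (O1 A, F1 \<alpha>) (O1 B, F1 \<beta>) ?f1"
    using arr inv by (intro Alg.is_isoI[of _ _ _ ?g0] Alg.is_isoI[of _ _ _ ?g1]; simp)+
  have "cmp A = icomp C A (pr2 A) (pr1 A)"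
    using a ipair_eqI[of A "Ident C (O2 A)" "pr1 A" "pr2 A"] by (simp add: icomp_def)
  then have "F1 f \<cdot> cmp A = F1 f \<cdot> icomp C A (pr2 A) (pr1 A)" by simp
  also have "\<dots> = icomp C B (F1 f \<cdot> pr2 A) (F1 f \<cdot> pr1 A)"
    using a f' icat_eq(1)[of A] ifun_icomp[of f A "pr1 A" "pr2 A"] by simp
  finally have cmp: "F1 f \<cdot> cmp A = icomp C B (F1 f \<cdot> pr2 A) (F1 f \<cdot> pr1 A)" .
  have "tgt B \<cdot> (F1 f \<cdot> pr1 A) = src B \<cdot> (F1 f \<cdot> pr2 A)"
    using a f' icat_eq(1)[of A] by simp
  moreover have "((O2 A, F2 \<alpha>), (O1 B, F1 \<beta>), F1 f \<cdot> pr1 A) \<in> Arr (Alg C T)"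
    "((O2 A, F2 \<alpha>), (O1 B, F1 \<beta>), F1 f \<cdot> pr2 A) \<in> Arr (Alg C T)"
    using Alg_comp[OF _ arr(2)] calg_Alg(7,8)[OF x] by simp_all
  ultimately have "icomp (Alg C T) (calg_icat (B, \<beta>)) ((O2 A, F2 \<alpha>), (O1 B, F1 \<beta>), F1 f \<cdot> pr2 A)
      ((O2 A, F2 \<alpha>), (O1 B, F1 \<beta>), F1 f \<cdot> pr1 A) = ((O2 A, F2 \<alpha>), (O1 B, F1 \<beta>), F1 f \<cdot> cmp A)"
    unfolding cmp by (intro calg_icomp[OF y])
  then have "Alg.precat_iso (calg_icat (A, \<alpha>)) (calg_icat (B, \<beta>)) ?f0 ?f1"
    unfolding Alg.precat_iso_def using isos f' a b by simp
  then show ?thesis by blast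
qed

text \<open>The inverses on objects and arrows form a functor because their composites with the given functor do.\<close>

lemma precat_iso_CAlg_iso:
  assumes x: "(A, \<alpha>) \<in> calgs" and y: "(B, \<beta>) \<in> calgs"
    and iso: "Alg.precat_iso (calg_icat (A, \<alpha>)) (calg_icat (B, \<beta>)) f0 f1"
  shows "\<exists>u. is_iso (CAlg C T) (A, \<alpha>) (B, \<beta>) u"
proof -
  note a = calg_facts[OF x] and b = calg_facts[OF y]
  have i: "is_iso (Alg C T) (O0 A, F0 \<alpha>) (O0 B, F0 \<beta>) f0" "is_iso (Alg C T) (O1 A, F1 \<alpha>) (O1 B, F1 \<beta>) f1"
    using iso unfolding Alg.precat_iso_def by simp_all
  obtain g0 where "f0 \<in> hom (Alg C T) (O0 A, F0 \<alpha>) (O0 B, F0 \<beta>)" "g0 \<in> hom (Alg C T) (O0 B, F0 \<beta>) (O0 A, F0 \<alpha>)"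
    "g0 \<cdot>\<^bsub>Alg C T\<^esub> f0 = Ident (Alg C T) (O0 A, F0 \<alpha>)" "f0 \<cdot>\<^bsub>Alg C T\<^esub> g0 = Ident (Alg C T) (O0 B, F0 \<beta>)"
    using i(1) unfolding is_iso_def by blast
  then obtain p0 q0 where 0: "f0 = ((O0 A, F0 \<alpha>), (O0 B, F0 \<beta>), p0)" "((O0 A, F0 \<alpha>), (O0 B, F0 \<beta>), p0) \<in> Arr (Alg C T)"
    "((O0 B, F0 \<beta>), (O0 A, F0 \<alpha>), q0) \<in> Arr (Alg C T)" "q0 \<cdot> p0 = Ident C (O0 A)" "p0 \<cdot> q0 = Ident C (O0 B)"
    by (elim Alg_homE) simp
  obtain g1 where "f1 \<in> hom (Alg C T) (O1 A, F1 \<alpha>) (O1 B, F1 \<beta>)" "g1 \<in> hom (Alg C T) (O1 B, F1 \<beta>) (O1 A, F1 \<alpha>)"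
    "g1 \<cdot>\<^bsub>Alg C T\<^esub> f1 = Ident (Alg C T) (O1 A, F1 \<alpha>)" "f1 \<cdot>\<^bsub>Alg C T\<^esub> g1 = Ident (Alg C T) (O1 B, F1 \<beta>)"
    using i(2) unfolding is_iso_def by blast
  then obtain p1 q1 where 1: "f1 = ((O1 A, F1 \<alpha>), (O1 B, F1 \<beta>), p1)" "((O1 A, F1 \<alpha>), (O1 B, F1 \<beta>), p1) \<in> Arr (Alg C T)"
    "((O1 B, F1 \<beta>), (O1 A, F1 \<alpha>), q1) \<in> Arr (Alg C T)" "q1 \<cdot> p1 = Ident C (O1 A)" "p1 \<cdot> q1 = Ident C (O1 B)"
    by (elim Alg_homE) simp
  have p0: "p0 \<in> Arr C" "Dom C p0 = O0 A" "Cod C p0 = O0 B" "p0 \<cdot> F0 \<alpha> = F0 \<beta> \<cdot> FA T p0"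
    and q0: "q0 \<in> Arr C" "Dom C q0 = O0 B" "Cod C q0 = O0 A" "q0 \<cdot> F0 \<beta> = F0 \<alpha> \<cdot> FA T q0"
    and p1: "p1 \<in> Arr C" "Dom C p1 = O1 A" "Cod C p1 = O1 B" "p1 \<cdot> F1 \<alpha> = F1 \<beta> \<cdot> FA T p1"
    and q1: "q1 \<in> Arr C" "Dom C q1 = O1 B" "Cod C q1 = O1 A" "q1 \<cdot> F1 \<beta> = F1 \<alpha> \<cdot> FA T q1"
    using 0(2,3) 1(2,3) unfolding Alg_arr by simp_all
  have eqs: "src B \<cdot> p1 = p0 \<cdot> src A" "tgt B \<cdot> p1 = p0 \<cdot> tgt A" "p1 \<cdot> idn A = idn B \<cdot> p0"
    using iso unfolding Alg.precat_iso_def 0(1) 1(1) by simp_all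
  have c: "tgt B \<cdot> (p1 \<cdot> pr1 A) = src B \<cdot> (p1 \<cdot> pr2 A)"
    using a b p0 p1 icat_eq(1)[of A] reassoc[OF eqs(1), of "pr2 A"] reassoc[OF eqs(2), of "pr1 A"] by simp
  have "((O2 A, F2 \<alpha>), (O1 B, F1 \<beta>), p1 \<cdot> cmp A)
      = icomp (Alg C T) (calg_icat (B, \<beta>)) ((O2 A, F2 \<alpha>), (O1 B, F1 \<beta>), p1 \<cdot> pr2 A) ((O2 A, F2 \<alpha>), (O1 B, F1 \<beta>), p1 \<cdot> pr1 A)"
    using iso unfolding Alg.precat_iso_def 0(1) 1(1) by simp
  also have "\<dots> = ((O2 A, F2 \<alpha>), (O1 B, F1 \<beta>), icomp C B (p1 \<cdot> pr2 A) (p1 \<cdot> pr1 A))"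
    using Alg_comp[OF _ 1(2)] calg_Alg(7,8)[OF x] c by (intro calg_icomp[OF y]) simp_all
  finally have cmp: "p1 \<cdot> cmp A = icomp C B (p1 \<cdot> pr2 A) (p1 \<cdot> pr1 A)" by simp
  let ?F = "\<lparr>IDom = A, ICod = B, F0 = p0, F1 = p1, F2 = ipair C B (p1 \<cdot> pr1 A) (p1 \<cdot> pr2 A)\<rparr>"
  let ?G = "\<lparr>IDom = B, ICod = A, F0 = q0, F1 = q1, F2 = ipair C A (q1 \<cdot> pr1 B) (q1 \<cdot> pr2 B)\<rparr>"
  have F: "is_ifun C ?F"
    using a b p0 p1 eqs cmp by (intro ifunI) simp_all
  have q0p0: "q0 \<cdot> (p0 \<cdot> w) = w" if "w \<in> Arr C" "Cod C w = O0 A" for w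
    using that p0 q0 reassoc[OF 0(4), of w] by simp
  have q1p1: "q1 \<cdot> (p1 \<cdot> w) = w" if "w \<in> Arr C" "Cod C w = O1 A" for w
    using that p1 q1 reassoc[OF 1(4), of w] by simp
  have p1q1: "p1 \<cdot> (q1 \<cdot> w) = w" if "w \<in> Arr C" "Cod C w = O1 B" for w
    using that p1 q1 reassoc[OF 1(5), of w] by simp
  have "src A \<cdot> q1 = q0 \<cdot> (p0 \<cdot> (src A \<cdot> q1))" "tgt A \<cdot> q1 = q0 \<cdot> (p0 \<cdot> (tgt A \<cdot> q1))"
    using a q1 by (simp_all add: q0p0)
  moreover have "p0 \<cdot> (src A \<cdot> q1) = src B" "p0 \<cdot> (tgt A \<cdot> q1) = tgt B"
    using a b p0 p1 q1 reassoc[OF eqs(1), of q1] reassoc[OF eqs(2), of q1] 1(5) by simp_all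
  ultimately have st: "src A \<cdot> q1 = q0 \<cdot> src B" "tgt A \<cdot> q1 = q0 \<cdot> tgt B"
    by simp_all
  have "q1 \<cdot> idn B = q1 \<cdot> (p1 \<cdot> (idn A \<cdot> q0))"
    using a b p0 p1 q0 q1 reassoc[OF eqs(3), of q0] 0(5) by simp
  then have i': "q1 \<cdot> idn B = idn A \<cdot> q0"
    using a q0 by (simp add: q1p1)
  have c': "tgt A \<cdot> (q1 \<cdot> pr1 B) = src A \<cdot> (q1 \<cdot> pr2 B)"
    using a b q0 q1 icat_eq(1)[of B] reassoc[OF st(1), of "pr2 B"] reassoc[OF st(2), of "pr1 B"] by simp
  have "p1 \<cdot> icomp C A (q1 \<cdot> pr2 B) (q1 \<cdot> pr1 B) = icomp C B (pr2 B) (pr1 B)"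
    using ifun_icomp[OF F _ _ _ _ _ c'] a b q1 by (simp add: p1q1)
  also have "\<dots> = cmp B"
    using b ipair_eqI[of B "Ident C (O2 B)" "pr1 B" "pr2 B"] by (simp add: icomp_def)
  finally have "q1 \<cdot> cmp B = q1 \<cdot> (p1 \<cdot> icomp C A (q1 \<cdot> pr2 B) (q1 \<cdot> pr1 B))"
    by simp
  then have cmp': "q1 \<cdot> cmp B = icomp C A (q1 \<cdot> pr2 B) (q1 \<cdot> pr1 B)"
    using a b q1 c' by (simp add: q1p1)
  have G: "is_ifun C ?G"
    using a b q0 q1 st i' cmp' by (intro ifunI) simp_all
  have FG: "((A, \<alpha>), (B, \<beta>), ?F) \<in> Arr (CAlg C T)" "((B, \<beta>), (A, \<alpha>), ?G) \<in> Arr (CAlg C T)"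
    unfolding strict_mor_iff[OF x y] strict_mor_iff[OF y x] using F G p0 p1 q0 q1 by simp_all
  have "icomp1 C ?G ?F = Ident (ICat C) A"
    using F G a ident_ifun[of A] 0(4) 1(4) by (intro ifun_eqI ifun_comp) simp_all
  moreover have "icomp1 C ?F ?G = Ident (ICat C) B"
    using F G b ident_ifun[of B] 0(5) 1(5) by (intro ifun_eqI ifun_comp) simp_all
  ultimately have "is_iso (CAlg C T) (A, \<alpha>) (B, \<beta>) ((A, \<alpha>), (B, \<beta>), ?F)"
    using FG unfolding is_iso_def CAlg_def
    by (intro conjI bexI[of _ "((B, \<beta>), (A, \<alpha>), ?G)"]) (simp_all add: ICat.Alg2_hom)
  then show ?thesis by blast
qed

end


section \<open>The bar construction\<close>

context cartesian_monad_terminal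
begin

abbreviation P :: "nat \<Rightarrow> 'o" where "P k \<equiv> (FO T ^^ k) one"

lemma P_obj [simp]: "P k \<in> Obj C"
  by (induction k) simp_all

definition face :: "nat \<Rightarrow> nat \<Rightarrow> 'a" where
  "face n i = (if i \<le> n then (FA T ^^ i) (Mu T (P (n - i))) else (FA T ^^ Suc n) (bng T1))"

definition degen :: "nat \<Rightarrow> nat \<Rightarrow> 'a" where
  "degen n i = (FA T ^^ Suc i) (Eps T (P (n - i)))"

lemma bar_simps:
  "SOb (bar C T one) n = (P (Suc n), Mu T (P n))"
  "Face (bar C T one) n i = ((P (Suc (Suc n)), Mu T (P (Suc n))), (P (Suc n), Mu T (P n)), face n i)"
  "Degen (bar C T one) n i = ((P (Suc n), Mu T (P n)), (P (Suc (Suc n)), Mu T (P (Suc n))), degen n i)"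
  by (simp_all add: bar_def face_def degen_def Let_def)

text \<open>Apart from the zeroth ones, faces and degeneracies are obtained by applying \<open>T\<close> to those of
  one degree lower, or in degree 0 to the map from \<open>T(1)\<close> to \<open>1\<close>.  All simplicial
  identities thereby reduce to those with an index 0.\<close>

lemma face_simps:
  "face n 0 = Mu T (P n)" "face (Suc n) (Suc i) = FA T (face n i)" "face 0 (Suc i) = FA T (bng T1)"
  by (simp_all add: face_def)

lemma degen_simps: "degen n 0 = FA T (Eps T (P n))" "degen (Suc n) (Suc i) = FA T (degen n i)"
  by (simp_all add: degen_def)

lemma face_typ:
  "i \<le> Suc n \<Longrightarrow> face n i \<in> Arr C \<and> Dom C (face n i) = P (Suc (Suc n)) \<and> Cod C (face n i) = P (Suc n)"
proof (induction n arbitrary: i)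
  case 0
  then show ?case by (cases i) (simp_all add: face_simps)
next
  case (Suc n)
  then show ?case by (cases i) (simp_all add: face_simps)
qed

lemma degen_typ:
  "i \<le> n \<Longrightarrow> degen n i \<in> Arr C \<and> Dom C (degen n i) = P (Suc n) \<and> Cod C (degen n i) = P (Suc (Suc n))"
proof (induction n arbitrary: i)
  case 0
  then show ?case by (cases i) (simp_all add: degen_simps)
next
  case (Suc n)
  then show ?case by (cases i) (simp_all add: degen_simps)
qed

lemma face_free:
  assumes "i \<le> n"
  obtains g where "face n (Suc i) = FA T g" "g \<in> Arr C" "Dom C g = P (Suc n)" "Cod C g = P n"
proof (cases n)
  case 0
  then show ?thesis using assms that[of "bng T1"] by (simp add: face_simps)
next
  case (Suc m)
  then show ?thesis using assms that[of "face m i"] face_typ[of i m] by (simp add: face_simps)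
qed

lemma degen_free:
  assumes "i \<le> n"
  obtains g where "degen n i = FA T g" "g \<in> Arr C" "Dom C g = P n" "Cod C g = P (Suc n)"
proof (cases i)
  case 0
  then show ?thesis using that[of "Eps T (P n)"] by (simp add: degen_simps)
next
  case (Suc j)
  then obtain m where "n = Suc m" "j \<le> m" using assms by (cases n) auto
  then show ?thesis using that[of "degen m j"] degen_typ[of j m] Suc by (simp add: degen_simps)
qed

lemma face_alg:
  assumes "i \<le> Suc n"
  shows "face n i \<cdot> Mu T (P (Suc n)) = Mu T (P n) \<cdot> FA T (face n i)"
proof (cases i)
  case 0
  then show ?thesis by (simp add: face_simps Mu_assoc)
next
  case (Suc j)
  then obtain g where "face n (Suc j) = FA T g" "g \<in> Arr C" "Dom C g = P (Suc n)" "Cod C g = P n"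
    using face_free[of j n] assms by auto
  then show ?thesis using Suc by (simp add: Mu_nat)
qed

lemma degen_alg:
  assumes "i \<le> n"
  shows "degen n i \<cdot> Mu T (P n) = Mu T (P (Suc n)) \<cdot> FA T (degen n i)"
proof -
  obtain g where "degen n i = FA T g" "g \<in> Arr C" "Dom C g = P n" "Cod C g = P (Suc n)"
    using degen_free[OF assms] by blast
  then show ?thesis by (simp add: Mu_nat)
qed

lemma face_face:
  "i < j \<Longrightarrow> j \<le> n + 2 \<Longrightarrow> face n i \<cdot> face (Suc n) j = face n (j - 1) \<cdot> face (Suc n) i"
proof (induction n arbitrary: i j)
  case 0
  then obtain k where j: "j = Suc k" "k \<le> 1" by (cases j) auto
  show ?case
  proof (cases i)
    case i: 0
    then show ?thesis
      using j face_alg[of k 0] by (simp add: face_simps)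
  next
    case (Suc l)
    then have "i = Suc 0" "j = Suc (Suc 0)" using 0 by simp_all
    then show ?thesis
      using T_eq[of "bng T1" "Mu T one" "bng T1" "FA T (bng T1)"] by (simp add: face_simps)
  qed
next
  case (Suc n)
  then obtain k where j: "j = Suc k" "k \<le> n + 2" by (cases j) auto
  show ?case
  proof (cases i)
    case 0
    then show ?thesis
      using j face_alg[of k "Suc n"] by (simp add: face_simps)
  next
    case i: (Suc l)
    have "FA T (face n l) \<cdot> FA T (face (Suc n) k) = FA T (face n (k - 1)) \<cdot> FA T (face (Suc n) l)"
      using Suc i j face_typ[of l n] face_typ[of k "Suc n"] face_typ[of "k - 1" n] face_typ[of l "Suc n"]
      by (intro T_eq Suc.IH) simp_all
    moreover obtain k' where "k = Suc k'" using Suc.prems i j by (cases k) auto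
    ultimately show ?thesis
      using i j by (simp add: face_simps)
  qed
qed

lemma degen_degen:
  "i \<le> j \<Longrightarrow> j \<le> n \<Longrightarrow> degen (Suc n) i \<cdot> degen n j = degen (Suc n) (Suc j) \<cdot> degen n i"
proof (induction n arbitrary: i j)
  case 0
  then show ?case
    using T_eq[of "Eps T T1" "Eps T one" "FA T (Eps T one)" "Eps T one"] Eps_nat[of "Eps T one" one T1]
    by (simp add: degen_simps)
next
  case (Suc n)
  show ?case
  proof (cases i)
    case 0
    obtain g where g: "degen (Suc n) j = FA T g" "g \<in> Arr C" "Dom C g = P (Suc n)" "Cod C g = P (Suc (Suc n))"
      using degen_free[OF Suc.prems(2)] by blast
    have "FA T (Eps T (P (Suc (Suc n)))) \<cdot> FA T g = FA T (FA T g) \<cdot> FA T (Eps T (P (Suc n)))"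
      using g Eps_nat[of g "P (Suc n)" "P (Suc (Suc n))"] by (intro T_eq) simp_all
    then show ?thesis
      using 0 g by (simp add: degen_simps(1) degen_simps(2)[of "Suc n"])
  next
    case i: (Suc l)
    then obtain k where j: "j = Suc k" using Suc by (cases j) auto
    have "FA T (degen (Suc n) l) \<cdot> FA T (degen n k) = FA T (degen (Suc n) (Suc k)) \<cdot> FA T (degen n l)"
      using Suc i j degen_typ[of l "Suc n"] degen_typ[of k n] degen_typ[of "Suc k" "Suc n"] degen_typ[of l n]
      by (intro T_eq Suc.IH) simp_all
    then show ?thesis
      using i j by (simp add: degen_simps)
  qed
qed

lemma face_degen_id:
  "j \<le> n \<Longrightarrow> i = j \<or> i = Suc j \<Longrightarrow> face n i \<cdot> degen n j = Ident C (P (Suc n))"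
proof (induction n arbitrary: i j)
  case 0
  then show ?case
    using T_comp[of "bng T1" "Eps T one" "Ident C one"] by (auto simp: face_simps degen_simps Mu_unit)
next
  case (Suc n)
  show ?case
  proof (cases j)
    case 0
    then show ?thesis
      using Suc.prems T_comp[OF Mu_unit(2)[of "P n"]] by (auto simp: face_simps degen_simps Mu_unit)
  next
    case j: (Suc k)
    then obtain l where i: "i = Suc l" using Suc.prems by (cases i) auto
    have "FA T (face n l) \<cdot> FA T (degen n k) = FA T (Ident C (P (Suc n)))"
      using Suc i j face_typ[of l n] degen_typ[of k n] by (intro T_comp Suc.IH) auto
    then show ?thesis
      using i j by (simp add: face_simps degen_simps)
  qed
qed

lemma face_degen_less:
  "i < j \<Longrightarrow> j \<le> Suc n \<Longrightarrow> face (Suc n) i \<cdot> degen (Suc n) j = degen n (j - 1) \<cdot> face n i"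
proof (induction n arbitrary: i j)
  case 0
  then have "i = 0" "j = Suc 0" by auto
  then show ?case
    using degen_alg[of 0 0] by (simp add: face_simps degen_simps(2))
next
  case (Suc n)
  then obtain k where j: "j = Suc k" "k \<le> Suc n" by (cases j) auto
  show ?case
  proof (cases i)
    case 0
    then show ?thesis
      using j degen_alg[of k "Suc n"] by (simp add: face_simps degen_simps(2))
  next
    case i: (Suc l)
    then obtain k' where k: "k = Suc k'" using Suc j by (cases k) auto
    have "FA T (face (Suc n) l) \<cdot> FA T (degen (Suc n) k) = FA T (degen n (k - 1)) \<cdot> FA T (face n l)"
      using Suc i j k face_typ[of l "Suc n"] degen_typ[of k "Suc n"] degen_typ[of "k - 1" n] face_typ[of l n]
      by (intro T_eq Suc.IH) simp_all
    then show ?thesis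
      using i j k by (simp add: face_simps degen_simps(2))
  qed
qed

lemma face_degen_greater:
  "Suc j < i \<Longrightarrow> i \<le> n + 2 \<Longrightarrow> face (Suc n) i \<cdot> degen (Suc n) j = degen n j \<cdot> face n (i - 1)"
proof (induction n arbitrary: i j)
  case 0
  then have "i = Suc (Suc 0)" "j = 0" by auto
  then show ?case
    using T_eq[of "FA T (bng T1)" "Eps T T1" "Eps T one" "bng T1"] Eps_nat[of "bng T1" T1 one]
    by (simp add: face_simps degen_simps(1))
next
  case (Suc n)
  obtain k where i: "i = Suc (Suc k)" "k \<le> Suc n" using Suc.prems by (cases i; cases "i - 1") auto
  show ?case
  proof (cases j)
    case 0
    obtain g where g: "face (Suc n) (Suc k) = FA T g" "g \<in> Arr C" "Dom C g = P (Suc (Suc n))" "Cod C g = P (Suc n)"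
      using face_free[OF i(2)] by blast
    have "FA T (FA T g) \<cdot> FA T (Eps T (P (Suc (Suc n)))) = FA T (Eps T (P (Suc n))) \<cdot> FA T g"
      using g Eps_nat[of g "P (Suc (Suc n))" "P (Suc n)"] by (intro T_eq) simp_all
    then show ?thesis
      using 0 i g by (simp add: face_simps(2)[of "Suc n"] degen_simps(1))
  next
    case j: (Suc l)
    then obtain k' where k: "k = Suc k'" using Suc.prems i by (cases k) auto
    have "FA T (face (Suc n) (Suc k)) \<cdot> FA T (degen (Suc n) l) = FA T (degen n l) \<cdot> FA T (face n (Suc k - 1))"
      using Suc i j k face_typ[of "Suc k" "Suc n"] degen_typ[of l "Suc n"] degen_typ[of l n] face_typ[of k n]
      by (intro T_eq Suc.IH) simp_all
    then show ?thesis
      using i j k by (simp add: face_simps degen_simps(2))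
  qed
qed

lemma free_Alg: "(P (Suc n), Mu T (P n)) \<in> Obj (Alg C T)"
  by (simp add: Alg_obj Mu_assoc Mu_unit)

lemma bar_simplicial: "is_simplicial (Alg C T) (bar C T one)"
proof -
  have f: "((P (Suc (Suc n)), Mu T (P (Suc n))), (P (Suc n), Mu T (P n)), face n i) \<in> Arr (Alg C T)" if "i \<le> Suc n" for n i
    using face_typ[OF that] face_alg[OF that] free_Alg[of n] free_Alg[of "Suc n"] by (simp add: Alg_arr)
  have d: "((P (Suc n), Mu T (P n)), (P (Suc (Suc n)), Mu T (P (Suc n))), degen n i) \<in> Arr (Alg C T)" if "i \<le> n" for n i
    using degen_typ[OF that] degen_alg[OF that] free_Alg[of n] free_Alg[of "Suc n"] by (simp add: Alg_arr)
  show ?thesis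
    unfolding is_simplicial_def bar_simps Alg_simps Alg.hom_iff
    using f d free_Alg face_face degen_degen face_degen_id face_degen_less face_degen_greater
    by simp
qed

text \<open>The vertices and edges of the simplices of the bar construction, as algebra maps to
  \<open>T(1)\<close> and \<open>T(T(1))\<close>.  Vertex and edge 0 forget all but the outermost one or two levels, and
  the remaining ones are those of the zeroth face.\<close>

primrec vtx :: "nat \<Rightarrow> nat \<Rightarrow> 'a" where
  "vtx 0 n = FA T (bng (P n))"
| "vtx (Suc i) n = Mu T one \<cdot> FA T (vtx i (n - 1))"

primrec edg :: "nat \<Rightarrow> nat \<Rightarrow> 'a" where
  "edg 0 n = FA T (FA T (bng (P (n - 1))))"
| "edg (Suc i) n = Mu T T1 \<cdot> FA T (edg i (n - 1))"

lemma vtx_typ: "i \<le> n \<Longrightarrow> vtx i n \<in> Arr C \<and> Dom C (vtx i n) = P (Suc n) \<and> Cod C (vtx i n) = T1"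
proof (induction i arbitrary: n)
  case (Suc i)
  then show ?case by (cases n) simp_all
qed simp

lemma edg_typ: "i < n \<Longrightarrow> edg i n \<in> Arr C \<and> Dom C (edg i n) = P (Suc n) \<and> Cod C (edg i n) = T2"
proof (induction i arbitrary: n)
  case 0
  then show ?case by (cases n) simp_all
next
  case (Suc i)
  then show ?case by (cases n) simp_all
qed

lemma free_ext_alg:
  assumes "f \<in> Arr C" "Cod C f = FO T X" "X \<in> Obj C" "Dom C f = Y"
  shows "(Mu T X \<cdot> FA T f) \<cdot> Mu T Y = Mu T X \<cdot> FA T (Mu T X \<cdot> FA T f)"
  using assms Mu_nat[of f Y "FO T X"] reassoc[OF Mu_assoc[of X], of "FA T (FA T f)"] by auto

lemma vtx_alg:
  assumes "i \<le> n"
  shows "vtx i n \<cdot> Mu T (P n) = Mu T one \<cdot> FA T (vtx i n)"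
proof (cases i)
  case 0
  then show ?thesis by (simp add: Mu_nat)
next
  case (Suc j)
  then obtain m where "n = Suc m" "j \<le> m" using assms by (cases n) auto
  then show ?thesis
    using Suc vtx_typ[of j m] free_ext_alg[of "vtx j m" one] by simp
qed

lemma edg_alg:
  assumes "i < n"
  shows "edg i n \<cdot> Mu T (P n) = Mu T T1 \<cdot> FA T (edg i n)"
proof -
  obtain m where n: "n = Suc m" using assms by (cases n) auto
  show ?thesis
  proof (cases i)
    case 0
    then show ?thesis using n by (simp add: Mu_nat)
  next
    case (Suc j)
    then show ?thesis
      using n assms edg_typ[of j m] free_ext_alg[of "edg j m" T1] by simp
  qed
qed

lemma edg_ends: "i < n \<Longrightarrow> Mu T one \<cdot> edg i n = vtx (Suc i) n \<and> FA T (bng T1) \<cdot> edg i n = vtx i n"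
proof (induction i arbitrary: n)
  case 0
  then obtain m where "n = Suc m" by (cases n) auto
  then show ?case
    using T_comp[of "bng T1" "FA T (bng (P m))" "bng (P (Suc m))"] by simp
next
  case (Suc i)
  then obtain m where n: "n = Suc m" "i < m" by (cases n) auto
  note t = edg_typ[OF n(2)] vtx_typ[of i m] vtx_typ[of "Suc i" m]
  have "Mu T one \<cdot> (Mu T T1 \<cdot> FA T (edg i m)) = (Mu T one \<cdot> FA T (Mu T one)) \<cdot> FA T (edg i m)"
    using t reassoc[OF Mu_assoc[of one, symmetric], of "FA T (edg i m)"] by simp
  also have "\<dots> = Mu T one \<cdot> FA T (vtx (Suc i) m)"
    using t n T_comp[of "Mu T one" "edg i m"] Suc.IH[OF n(2)] by (simp del: vtx.simps)
  finally have 1: "Mu T one \<cdot> edg (Suc i) n = vtx (Suc (Suc i)) n"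
    using n by simp
  have "FA T (bng T1) \<cdot> (Mu T T1 \<cdot> FA T (edg i m)) = (Mu T one \<cdot> FA T (FA T (bng T1))) \<cdot> FA T (edg i m)"
    using t by (intro reassoc[OF Tbang_Mu]) simp_all
  also have "\<dots> = Mu T one \<cdot> FA T (vtx i m)"
    using t n T_comp[of "FA T (bng T1)" "edg i m"] Suc.IH[OF n(2)] by (simp del: vtx.simps)
  finally show ?case
    using 1 n by simp
qed

lemma vtx_face:
  "i \<le> n \<Longrightarrow> j \<le> Suc n \<Longrightarrow> vtx i n \<cdot> face n j = vtx (if i < j then i else Suc i) (Suc n)"
proof (induction n arbitrary: i j)
  case 0
  then show ?case
    by (cases j) (simp_all add: face_simps)
next
  case (Suc n)
  show ?case
  proof (cases j)
    case 0
    then show ?thesis using vtx_alg[of i "Suc n"] Suc.prems by (simp add: face_simps del: vtx.simps(1))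
  next
    case j: (Suc k)
    note fk = face_typ[of k n]
    show ?thesis
    proof (cases i)
      case 0
      then show ?thesis
        using j fk Suc.prems T_comp[of "bng (P (Suc n))" "face n k" "bng (P (Suc (Suc n)))"] by (simp add: face_simps)
    next
      case i: (Suc l)
      have "FA T (vtx l n) \<cdot> FA T (face n k) = FA T (vtx (if l < k then l else Suc l) (Suc n))"
        using Suc i j fk vtx_typ[of l n] by (intro T_comp Suc.IH) simp_all
      then show ?thesis
        using i j fk Suc.prems vtx_typ[of l n] by (simp add: face_simps split: if_splits)
    qed
  qed
qed

lemma HT_extend_icomp:
  assumes "x \<in> Arr C" "y \<in> Arr C" "Cod C x = T2" "Cod C y = T2" "FA T (bng T1) \<cdot> x = Mu T one \<cdot> y"
  shows "Mu T T1 \<cdot> FA T (icomp C HT y x) = icomp C HT (Mu T T1 \<cdot> FA T y) (Mu T T1 \<cdot> FA T x)"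
  using calg_extend_icomp[OF HT_calg, of x y] assms by simp

text \<open>An inner face composes two adjacent edges.  For the two first edges this is a computation in \<open>H\<^sup>T\<close>, and
  the other cases follow because \<open>\<mu> \<cdot> T(_)\<close> preserves composites.\<close>

lemma edg_face:
  "i < n \<Longrightarrow> j \<le> Suc n \<Longrightarrow> edg i n \<cdot> face n j =
     (if Suc i < j then edg i (Suc n)
      else if Suc i = j then icomp C HT (edg i (Suc n)) (edg (Suc i) (Suc n)) else edg (Suc i) (Suc n))"
proof (induction n arbitrary: i j)
  case 0
  then show ?case by simp
next
  case (Suc n)
  show ?case
  proof (cases j)
    case 0
    then show ?thesis using edg_alg[of i "Suc n"] Suc.prems by (simp add: face_simps del: edg.simps(1))
  next
    case j: (Suc k)
    note fk = face_typ[of k n]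
    show ?thesis
    proof (cases i)
      case i: 0
      have "edg 0 (Suc n) \<cdot> face (Suc n) j = FA T (vtx 0 n \<cdot> face n k)"
        using j fk Suc.prems by (simp add: face_simps)
      also have "\<dots> = FA T (vtx (if 0 < k then 0 else Suc 0) (Suc n))"
        using vtx_face[of 0 n k] j Suc.prems by simp
      finally have *: "edg 0 (Suc n) \<cdot> face (Suc n) j = FA T (vtx (if 0 < k then 0 else Suc 0) (Suc n))" .
      show ?thesis
      proof (cases k)
        \<comment> \<open>The inner face: the composable pair of the two first edges is classified by \<open>T\<^sup>3(!)\<close>.\<close>
        case 0
        have "icomp C HT (edg 0 (Suc (Suc n))) (edg (Suc 0) (Suc (Suc n))) = FA T (Mu T one) \<cdot> FA T (FA T (FA T (bng (P n))))"
        proof (rule HT_icomp)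
          show "FA T (FA T (bng T1)) \<cdot> FA T (FA T (FA T (bng (P n)))) = edg 0 (Suc (Suc n))"
            using T_comp[OF T_comp[of "bng T1" "FA T (bng (P n))" "bng (P (Suc n))"]] by simp
        qed simp_all
        then show ?thesis
          using * i j 0 by simp
      next
        case (Suc l)
        then show ?thesis using * i j by simp
      qed
    next
      case i: (Suc l)
      have ln: "l < n" using i Suc.prems by simp
      note t = edg_typ[OF ln]
      have "edg i (Suc n) \<cdot> face (Suc n) j = Mu T T1 \<cdot> FA T (edg l n \<cdot> face n k)"
        using i j fk t Suc.prems by (simp add: face_simps)
      also have "\<dots> = Mu T T1 \<cdot> FA T (if Suc l < k then edg l (Suc n)
          else if Suc l = k then icomp C HT (edg l (Suc n)) (edg (Suc l) (Suc n)) else edg (Suc l) (Suc n))"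
        using Suc.IH[OF ln, of k] j Suc.prems by simp
      also have "\<dots> = (if Suc i < j then edg i (Suc (Suc n))
          else if Suc i = j then Mu T T1 \<cdot> FA T (icomp C HT (edg l (Suc n)) (edg (Suc l) (Suc n))) else edg (Suc i) (Suc (Suc n)))"
        using i j by simp
      also have "Mu T T1 \<cdot> FA T (icomp C HT (edg l (Suc n)) (edg (Suc l) (Suc n)))
          = icomp C HT (edg i (Suc (Suc n))) (edg (Suc i) (Suc (Suc n)))"
        using HT_extend_icomp[of "edg (Suc l) (Suc n)" "edg l (Suc n)"] ln edg_typ[of "Suc l" "Suc n"] edg_typ[of l "Suc n"]
          edg_ends[of "Suc l" "Suc n"] edg_ends[of l "Suc n"] i by simp
      finally show ?thesis .
    qed
  qed
qed

lemma vtx_degen: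
  "i \<le> Suc n \<Longrightarrow> j \<le> n \<Longrightarrow> vtx i (Suc n) \<cdot> degen n j = vtx (if i \<le> j then i else i - 1) n"
proof (induction n arbitrary: i j)
  case 0
  show ?case
  proof (cases i)
    case i: 0
    then show ?thesis
      using 0 T_comp[of "bng T1" "Eps T one" "bng one"] by (simp add: degen_simps)
  next
    case (Suc l)
    then show ?thesis
      using 0 by (simp add: degen_simps Mu_unit)
  qed
next
  case (Suc n)
  note d = degen_typ[OF Suc.prems(2)]
  show ?case
  proof (cases i)
    case 0
    obtain g where g: "degen (Suc n) j = FA T g" "g \<in> Arr C" "Dom C g = P (Suc n)" "Cod C g = P (Suc (Suc n))"
      using degen_free[OF Suc.prems(2)] by blast
    then show ?thesis
      using 0 T_comp[of "bng (P (Suc (Suc n)))" g "bng (P (Suc n))"] by simp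
  next
    case i: (Suc l)
    have l: "l \<le> Suc n" using i Suc.prems by simp
    note t = vtx_typ[OF l]
    show ?thesis
    proof (cases j)
      case 0
      have "vtx i (Suc (Suc n)) = vtx l (Suc n) \<cdot> face (Suc n) 0"
        using vtx_alg[OF l] i by (simp add: face_simps)
      then have "vtx i (Suc (Suc n)) \<cdot> degen (Suc n) j = vtx l (Suc n) \<cdot> (face (Suc n) 0 \<cdot> degen (Suc n) j)"
        using t d face_typ[of 0 "Suc n"] by simp
      then show ?thesis
        using t i 0 face_degen_id[of 0 "Suc n" 0] by (simp add: comp_ident)
    next
      case j: (Suc k)
      have k: "k \<le> n" using j Suc.prems by simp
      have "FA T (vtx l (Suc n)) \<cdot> FA T (degen n k) = FA T (vtx (if l \<le> k then l else l - 1) n)"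
        using t degen_typ[OF k] Suc.IH[OF l k] by (intro T_comp) simp_all
      then have "vtx i (Suc (Suc n)) \<cdot> degen (Suc n) j = Mu T one \<cdot> FA T (vtx (if l \<le> k then l else l - 1) n)"
        using t degen_typ[OF k] i j by (simp add: degen_simps(2))
      then show ?thesis
        using i j by (cases l) (auto simp del: vtx.simps(1))
    qed
  qed
qed

lemma edg_degen:
  "i < Suc n \<Longrightarrow> j \<le> n \<Longrightarrow> edg i (Suc n) \<cdot> degen n j =
     (if i < j then edg i n else if i = j then FA T (Eps T one) \<cdot> vtx j n else edg (i - 1) n)"
proof (induction n arbitrary: i j)
  case 0
  then have "i = 0" "j = 0" by simp_all
  then show ?case
    using T_comp[of "FA T (bng one)" "Eps T one" "Eps T one"] by (simp add: degen_simps)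
next
  case (Suc n)
  note d = degen_typ[OF Suc.prems(2)]
  show ?case
  proof (cases j)
    case j: 0
    show ?thesis
    proof (cases i)
      case 0
      then show ?thesis
        using j T_eq[OF Eps_nat[of "bng (P (Suc n))" "P (Suc n)" one, symmetric]] by (simp add: degen_simps(1))
    next
      case i: (Suc l)
      have l: "l < Suc n" using i Suc.prems by simp
      note t = edg_typ[OF l]
      have "edg i (Suc (Suc n)) = edg l (Suc n) \<cdot> face (Suc n) 0"
        using edg_alg[OF l] i by (simp add: face_simps)
      then have "edg i (Suc (Suc n)) \<cdot> degen (Suc n) j = edg l (Suc n) \<cdot> (face (Suc n) 0 \<cdot> degen (Suc n) j)"
        using t d face_typ[of 0 "Suc n"] by simp
      then show ?thesis
        using t i j face_degen_id[of 0 "Suc n" 0] by (simp add: comp_ident)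
    qed
  next
    case j: (Suc k)
    have k: "k \<le> n" using j Suc.prems by simp
    note dk = degen_typ[OF k]
    show ?thesis
    proof (cases i)
      case 0
      have "FA T (vtx 0 (Suc n)) \<cdot> FA T (degen n k) = FA T (vtx 0 n)"
        using dk vtx_typ[of 0 "Suc n"] vtx_degen[of 0 n k] k by (intro T_comp) simp_all
      then show ?thesis
        using 0 j by (simp add: degen_simps(2))
    next
      case i: (Suc l)
      have l: "l < Suc n" using i Suc.prems by simp
      note t = edg_typ[OF l]
      have "edg i (Suc (Suc n)) \<cdot> degen (Suc n) j = Mu T T1 \<cdot> FA T (edg l (Suc n) \<cdot> degen n k)"
        using i j dk t by (simp add: degen_simps(2))
      also have "\<dots> = Mu T T1 \<cdot> FA T (if l < k then edg l n else if l = k then FA T (Eps T one) \<cdot> vtx k n else edg (l - 1) n)"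
        using Suc.IH[OF l k] by simp
      also have "\<dots> = (if l < k then Mu T T1 \<cdot> FA T (edg l n)
          else if l = k then Mu T T1 \<cdot> FA T (FA T (Eps T one) \<cdot> vtx k n) else Mu T T1 \<cdot> FA T (edg (l - 1) n))"
        by simp
      also have "Mu T T1 \<cdot> FA T (FA T (Eps T one) \<cdot> vtx k n) = FA T (Eps T one) \<cdot> vtx j (Suc n)"
        using j vtx_typ[OF k] calg_extend_idn[OF HT_calg, of "vtx k n"] by simp
      finally show ?thesis
        using i j by (cases l) (auto simp del: edg.simps(1))
    qed
  qed
qed

text \<open>Simplices of the bar construction are the chains: a chain is its tail, which is a simplex
  \<open>h\<close> by induction, together with its edge 0, and such pairs are parametrized by the pullback square
  expressing naturality of \<open>\<mu>\<close> at a map to the terminal object.\<close>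

lemma bar_pullback:
  "is_pullback C (FA T (bng (P n))) (Mu T one) (Mu T (P n)) (FA T (FA T (bng (P n))))"
  using Mu_pullback[of "bng (P n)"] by simp

lemma bar_chain:
  "is_chain C HT n Z w g \<Longrightarrow> \<exists>h. h \<in> Arr C \<and> Dom C h = Z \<and> Cod C h = P (Suc n) \<and>
     (\<forall>i\<le>n. vtx i n \<cdot> h = w i) \<and> (\<forall>i<n. edg i n \<cdot> h = g i)"
proof (induction n arbitrary: w g)
  case 0
  note c = chain_typ(2-4)[OF 0, of 0]
  then show ?case by (intro exI[of _ "w 0"]) simp
next
  case (Suc n)
  note c = chain_typ[OF Suc.prems]
  have "is_chain C HT n Z (\<lambda>i. w (Suc i)) (\<lambda>i. g (Suc i))"
    using c(1) c(2-9)[of "Suc _"] by (intro chainI) simp_all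
  then obtain h where h: "h \<in> Arr C" "Dom C h = Z" "Cod C h = P (Suc n)"
    "\<forall>i\<le>n. vtx i n \<cdot> h = w (Suc i)" "\<forall>i<n. edg i n \<cdot> h = g (Suc i)"
    using Suc.IH by blast
  have "FA T (bng (P n)) \<cdot> h = Mu T one \<cdot> g 0"
    using h(4)[rule_format, of 0] c(8)[of 0] by simp
  then obtain k where k: "k \<in> Arr C" "Dom C k = Z" "Cod C k = P (Suc (Suc n))" "Mu T (P n) \<cdot> k = h"
      "FA T (FA T (bng (P n))) \<cdot> k = g 0"
    using pullback_lift[OF bar_pullback[of n], of h "g 0"] h(1-3) c(5-7)[of 0] by auto
  have "vtx i (Suc n) \<cdot> k = w i" if i: "i \<le> Suc n" for i
  proof (cases i)
    case 0
    have "FA T (bng (P (Suc n))) = FA T (bng T1) \<cdot> FA T (FA T (bng (P n)))"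
      using T_comp[of "bng T1" "FA T (bng (P n))" "bng (P (Suc n))"] by simp
    then have "vtx 0 (Suc n) \<cdot> k = FA T (bng T1) \<cdot> (FA T (FA T (bng (P n))) \<cdot> k)"
      using k(1,3) by simp
    then show ?thesis
      unfolding k(5) using c(9)[of 0] 0 by simp
  next
    case (Suc j)
    then have j: "j \<le> n" using i by simp
    have "vtx i (Suc n) \<cdot> k = (vtx j n \<cdot> Mu T (P n)) \<cdot> k"
      using vtx_alg[OF j] Suc by simp
    also have "\<dots> = vtx j n \<cdot> h"
      using k(1,3) vtx_typ[OF j] by (simp add: k(4))
    finally show ?thesis using h(4) j Suc by simp
  qed
  moreover have "edg i (Suc n) \<cdot> k = g i" if i: "i < Suc n" for i
  proof (cases i)
    case 0
    then show ?thesis using k(5) by simp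
  next
    case (Suc j)
    then have j: "j < n" using i by simp
    have "edg i (Suc n) \<cdot> k = (edg j n \<cdot> Mu T (P n)) \<cdot> k"
      using edg_alg[OF j] Suc by simp
    also have "\<dots> = edg j n \<cdot> h"
      using k(1,3) edg_typ[OF j] by (simp add: k(4))
    finally show ?thesis using h(5) j Suc by simp
  qed
  ultimately show ?case using k(1-3) by blast
qed

lemma bar_ext:
  assumes "h \<in> Arr C" "k \<in> Arr C" "Dom C h = Dom C k" "Cod C h = P (Suc n)" "Cod C k = P (Suc n)"
    "\<And>i. i \<le> n \<Longrightarrow> vtx i n \<cdot> h = vtx i n \<cdot> k" "\<And>i. i < n \<Longrightarrow> edg i n \<cdot> h = edg i n \<cdot> k"
  shows "h = k"
  using assms
proof (induction n arbitrary: h k)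
  case 0
  then show ?case using 0(6)[of 0] by simp
next
  case (Suc n)
  have "Mu T (P n) \<cdot> h = Mu T (P n) \<cdot> k"
  proof (rule Suc.IH)
    fix i assume i: "i \<le> n"
    have "vtx i n \<cdot> (Mu T (P n) \<cdot> x) = vtx (Suc i) (Suc n) \<cdot> x" if "x \<in> Arr C" "Cod C x = P (Suc (Suc n))" for x
      using reassoc[OF vtx_alg[OF i], of x] vtx_typ[OF i] that by simp
    then show "vtx i n \<cdot> (Mu T (P n) \<cdot> h) = vtx i n \<cdot> (Mu T (P n) \<cdot> k)"
      using Suc.prems(1,2,4,5) Suc.prems(6)[of "Suc i"] i by (simp del: vtx.simps)
  next
    fix i assume i: "i < n"
    have "edg i n \<cdot> (Mu T (P n) \<cdot> x) = edg (Suc i) (Suc n) \<cdot> x" if "x \<in> Arr C" "Cod C x = P (Suc (Suc n))" for x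
      using reassoc[OF edg_alg[OF i], of x] edg_typ[OF i] that by simp
    then show "edg i n \<cdot> (Mu T (P n) \<cdot> h) = edg i n \<cdot> (Mu T (P n) \<cdot> k)"
      using Suc.prems(1,2,4,5) Suc.prems(7)[of "Suc i"] i by (simp del: edg.simps)
  qed (use Suc.prems(1-5) in auto)
  moreover have "FA T (FA T (bng (P n))) \<cdot> h = FA T (FA T (bng (P n))) \<cdot> k"
    using Suc.prems(7)[of 0] by simp
  ultimately show ?case
    using pullback_ext[OF bar_pullback[of n], of h k] Suc.prems(1-5) by simp
qed

abbreviation F1T :: "('o, 'a) alg" where "F1T \<equiv> (T1, Mu T one)"
abbreviation F2T :: "('o, 'a) alg" where "F2T \<equiv> (T2, Mu T T1)"
abbreviation B :: "nat \<Rightarrow> ('o, 'a) alg" where "B n \<equiv> (P (Suc n), Mu T (P n))"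

lemma HT_alg_eq: "(HT, snd HT_alg) = HT_alg"
  by (simp add: HT_alg_def)

lemma HT_calg_icat:
  "O0 (calg_icat HT_alg) = F1T" "O1 (calg_icat HT_alg) = F2T" "O2 (calg_icat HT_alg) = (T3, Mu T T2)"
  "src (calg_icat HT_alg) = (F2T, F1T, Mu T one)" "tgt (calg_icat HT_alg) = (F2T, F1T, FA T (bng T1))"
  "idn (calg_icat HT_alg) = (F1T, F2T, FA T (Eps T one))" "pr1 (calg_icat HT_alg) = ((T3, Mu T T2), F2T, Mu T T1)"
  "pr2 (calg_icat HT_alg) = ((T3, Mu T T2), F2T, FA T (FA T (bng T1)))"
  "cmp (calg_icat HT_alg) = ((T3, Mu T T2), F2T, FA T (Mu T one))"
  by (simp_all add: HT_alg_def)

lemma vtx_Alg: "i \<le> n \<Longrightarrow> (B n, F1T, vtx i n) \<in> Arr (Alg C T)"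
  using free_Alg[of n] free_Alg[of 0] vtx_typ[of i n] vtx_alg[of i n] by (simp add: Alg_arr)

lemma edg_Alg: "i < n \<Longrightarrow> (B n, F2T, edg i n) \<in> Arr (Alg C T)"
  using free_Alg[of n] free_Alg[of 1] edg_typ[of i n] edg_alg[of i n] by (simp add: Alg_arr)

text \<open>The map to the bar construction classifying a chain of algebra maps is an algebra map, since the two
  composites to be compared have the same vertices and edges.\<close>

lemma bar_exhibits:
  "Alg.exhibits_nerve (calg_icat HT_alg) (bar C T one) (\<lambda>n i. (B n, F1T, vtx i n)) (\<lambda>n i. (B n, F2T, edg i n))"
  unfolding Alg.exhibits_nerve_def
proof (intro conjI allI impI)
  fix n show "is_chain (Alg C T) (calg_icat HT_alg) n (SOb (bar C T one) n) (\<lambda>i. (B n, F1T, vtx i n)) (\<lambda>i. (B n, F2T, edg i n))"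
    using free_Alg[of n] vtx_Alg[of _ n] edg_Alg[of _ n] edg_ends[of _ n]
    by (intro Alg.chainI) (simp_all add: HT_calg_icat bar_simps)
next
  fix n Z w g assume c: "is_chain (Alg C T) (calg_icat HT_alg) n Z w g"
  note ch = Alg.chain_typ[OF c, unfolded HT_calg_icat]
  define w' g' where "w' = (\<lambda>i. snd (snd (w i)))" and "g' = (\<lambda>i. snd (snd (g i)))"
  have w: "w i = (Z, F1T, w' i)" "(Z, F1T, w' i) \<in> Arr (Alg C T)" if "i \<le> n" for i
    using ch(2-4)[OF that] unfolding w'_def by (cases "w i"; simp)+
  have g: "g i = (Z, F2T, g' i)" "(Z, F2T, g' i) \<in> Arr (Alg C T)" if "i < n" for i
    using ch(5-7)[OF that] unfolding g'_def by (cases "g i"; simp)+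
  note wa = w(2)[unfolded Alg_arr] and ga = g(2)[unfolded Alg_arr]
  have Z: "fst Z \<in> Obj C" "snd Z \<in> Arr C" "Dom C (snd Z) = FO T (fst Z)" "Cod C (snd Z) = fst Z"
    using ch(1) unfolding Alg_obj by simp_all
  have "is_chain C HT n (fst Z) w' g'"
  proof (rule chainI)
    fix i assume i: "i < n"
    show "g' i \<in> Arr C \<and> Dom C (g' i) = fst Z \<and> Cod C (g' i) = O1 HT \<and>
        src HT \<cdot> g' i = w' (Suc i) \<and> tgt HT \<cdot> g' i = w' i"
      using ga[OF i] ch(8,9)[OF i] w(1)[of i] w(1)[of "Suc i"] g(1)[OF i] i by simp
  qed (use Z wa in auto)
  then obtain h where h: "h \<in> Arr C" "Dom C h = fst Z" "Cod C h = P (Suc n)"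
    "\<forall>i\<le>n. vtx i n \<cdot> h = w' i" "\<forall>i<n. edg i n \<cdot> h = g' i"
    using bar_chain by blast
  have "h \<cdot> snd Z = Mu T (P n) \<cdot> FA T h"
  proof (rule bar_ext[of _ _ n])
    fix i assume i: "i \<le> n"
    have "vtx i n \<cdot> (h \<cdot> snd Z) = w' i \<cdot> snd Z"
      using reassoc[of "vtx i n" h "w' i" "snd Z"] h Z vtx_typ[OF i] i by simp
    also have "\<dots> = vtx i n \<cdot> (Mu T (P n) \<cdot> FA T h)"
      using Alg_map_comp[OF vtx_Alg[OF i], of h] h wa[OF i] i by simp
    finally show "vtx i n \<cdot> (h \<cdot> snd Z) = vtx i n \<cdot> (Mu T (P n) \<cdot> FA T h)" .
  next
    fix i assume i: "i < n"
    have "edg i n \<cdot> (h \<cdot> snd Z) = g' i \<cdot> snd Z"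
      using reassoc[of "edg i n" h "g' i" "snd Z"] h Z edg_typ[OF i] i by simp
    also have "\<dots> = edg i n \<cdot> (Mu T (P n) \<cdot> FA T h)"
      using Alg_map_comp[OF edg_Alg[OF i], of h] h ga[OF i] i by simp
    finally show "edg i n \<cdot> (h \<cdot> snd Z) = edg i n \<cdot> (Mu T (P n) \<cdot> FA T h)" .
  qed (use h Z in auto)
  then have hA: "(Z, B n, h) \<in> Arr (Alg C T)"
    using h ch(1) free_Alg[of n] by (simp add: Alg_arr)
  show "\<exists>!h. h \<in> hom (Alg C T) Z (SOb (bar C T one) n) \<and>
      (\<forall>i\<le>n. (B n, F1T, vtx i n) \<cdot>\<^bsub>Alg C T\<^esub> h = w i) \<and> (\<forall>i<n. (B n, F2T, edg i n) \<cdot>\<^bsub>Alg C T\<^esub> h = g i)"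
  proof (rule ex1I[of _ "(Z, B n, h)"])
    show "(Z, B n, h) \<in> hom (Alg C T) Z (SOb (bar C T one) n) \<and>
      (\<forall>i\<le>n. (B n, F1T, vtx i n) \<cdot>\<^bsub>Alg C T\<^esub> (Z, B n, h) = w i) \<and> (\<forall>i<n. (B n, F2T, edg i n) \<cdot>\<^bsub>Alg C T\<^esub> (Z, B n, h) = g i)"
      using hA h w(1) g(1) by (simp add: Alg_hom bar_simps)
  next
    fix k assume k: "k \<in> hom (Alg C T) Z (SOb (bar C T one) n) \<and>
      (\<forall>i\<le>n. (B n, F1T, vtx i n) \<cdot>\<^bsub>Alg C T\<^esub> k = w i) \<and> (\<forall>i<n. (B n, F2T, edg i n) \<cdot>\<^bsub>Alg C T\<^esub> k = g i)"
    then have "k \<in> hom (Alg C T) Z (B n)"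
      by (simp add: bar_simps)
    then obtain k' where k': "k = (Z, B n, k')" "(Z, B n, k') \<in> Arr (Alg C T)"
      by (rule Alg_homE)
    have "k' = h"
      using k k' h w(1) g(1) by - (rule bar_ext[of _ _ n]; simp add: Alg_arr)
    then show "k = (Z, B n, h)" using k' by simp
  qed
next
  fix n j i assume "j \<le> Suc n" "i \<le> n"
  then show "(B n, F1T, vtx i n) \<cdot>\<^bsub>Alg C T\<^esub> Face (bar C T one) n j = (B (Suc n), F1T, vtx (if i < j then i else Suc i) (Suc n))"
    using vtx_face[of i n j] by (simp only: bar_simps Alg_simps)
next
  fix n j i assume j: "j \<le> Suc n" and i: "i < n"
  have "icomp (Alg C T) (calg_icat HT_alg) (B (Suc n), F2T, edg i (Suc n)) (B (Suc n), F2T, edg (Suc i) (Suc n))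
      = (B (Suc n), F2T, icomp C HT (edg i (Suc n)) (edg (Suc i) (Suc n)))"
    using calg_icomp[OF HT_calg, of "B (Suc n)" "edg (Suc i) (Suc n)" "edg i (Suc n)"] i
      edg_Alg[of "Suc i" "Suc n"] edg_Alg[of i "Suc n"] edg_ends[of i "Suc n"] edg_ends[of "Suc i" "Suc n"]
    by (simp add: HT_alg_def)
  then show "(B n, F2T, edg i n) \<cdot>\<^bsub>Alg C T\<^esub> Face (bar C T one) n j =
      (if Suc i < j then (B (Suc n), F2T, edg i (Suc n))
       else if Suc i = j then icomp (Alg C T) (calg_icat HT_alg) (B (Suc n), F2T, edg i (Suc n)) (B (Suc n), F2T, edg (Suc i) (Suc n))
       else (B (Suc n), F2T, edg (Suc i) (Suc n)))"
    using edg_face[OF i j] by (simp only: bar_simps Alg_simps split: if_split) simp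
next
  fix n j i assume "j \<le> n" "i \<le> Suc n"
  then show "(B (Suc n), F1T, vtx i (Suc n)) \<cdot>\<^bsub>Alg C T\<^esub> Degen (bar C T one) n j = (B n, F1T, vtx (if i \<le> j then i else i - 1) n)"
    using vtx_degen[of i n j] by (simp only: bar_simps Alg_simps)
next
  fix n j i assume "j \<le> n" "i < Suc n"
  then show "(B (Suc n), F2T, edg i (Suc n)) \<cdot>\<^bsub>Alg C T\<^esub> Degen (bar C T one) n j =
      (if i < j then (B n, F2T, edg i n) else if i = j then idn (calg_icat HT_alg) \<cdot>\<^bsub>Alg C T\<^esub> (B n, F1T, vtx j n)
       else (B n, F2T, edg (i - 1) n))"
    using edg_degen[of i n j] by (simp only: bar_simps Alg_simps HT_calg_icat split: if_split) simp
qed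

lemma bar_nerve: "is_nerve (Alg C T) (calg_icat HT_alg) (bar C T one)"
  unfolding Alg.is_nerve_iff using bar_simplicial bar_exhibits by blast

text \<open>Both sides are equivalent to \<open>H\<close> being isomorphic to \<open>H\<^sup>T\<close>: representing objects are unique up
  to isomorphism, and a nerve determines its internal category up to isomorphism.\<close>

theorem represents_iff_nerve:
  assumes "H \<in> Obj (CAlg C T)"
  shows "represents (CAlg C T) (IAlg C T one) H \<longleftrightarrow>
    (\<exists>N. is_nerve (Alg C T) (calg_icat H) N \<and> simplicial_isomorphic (Alg C T) N (bar C T one))"
proof -
  interpret CAlg: two_category "CAlg C T"
    unfolding CAlg_def by (rule ICat.Alg2_two_category)
  obtain A \<alpha> where H: "H = (A, \<alpha>)" "(A, \<alpha>) \<in> calgs"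
    using assms by (cases H) (simp add: Obj_CAlg)
  have pH: "Alg.is_precat (calg_icat H)" and pT: "Alg.is_precat (calg_icat HT_alg)"
    using calg_precat[OF H(2)] calg_precat[OF HT_calg] unfolding H(1) HT_alg_eq .
  show ?thesis
  proof
    assume "represents (CAlg C T) (IAlg C T one) H"
    then obtain u where "is_iso (CAlg C T) HT_alg H u"
      using CAlg.representing_objects_iso[OF HT_represents] by blast
    then have "is_iso (CAlg C T) (HT, snd HT_alg) (A, \<alpha>) u"
      by (simp only: H(1) HT_alg_eq)
    from CAlg_iso_precat_iso[OF HT_calg H(2) this]
    obtain f0 f1 where "Alg.precat_iso (calg_icat HT_alg) (calg_icat H) f0 f1"
      unfolding HT_alg_eq H(1) by blast
    then have "is_nerve (Alg C T) (calg_icat H) (bar C T one)"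
      by (rule Alg.nerve_transport_precat[OF pH pT _ bar_nerve])
    moreover have "simplicial_isomorphic (Alg C T) (bar C T one) (bar C T one)"
      by (rule Alg.simplicial_isomorphic_refl[OF bar_simplicial])
    ultimately show "\<exists>N. is_nerve (Alg C T) (calg_icat H) N \<and> simplicial_isomorphic (Alg C T) N (bar C T one)"
      by blast
  next
    assume "\<exists>N. is_nerve (Alg C T) (calg_icat H) N \<and> simplicial_isomorphic (Alg C T) N (bar C T one)"
    then have "is_nerve (Alg C T) (calg_icat H) (bar C T one)"
      using Alg.nerve_transport_simplicial[OF pH] by blast
    from Alg.nerve_determines_precat[OF pH this, of "calg_icat HT_alg"]
    obtain f0 f1 where "Alg.precat_iso (calg_icat HT_alg) (calg_icat H) f0 f1"
      by (auto simp: bar_simps HT_calg_icat face_simps degen_simps)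
    then have "Alg.precat_iso (calg_icat (HT, snd HT_alg)) (calg_icat (A, \<alpha>)) f0 f1"
      by (simp only: H(1) HT_alg_eq)
    from precat_iso_CAlg_iso[OF HT_calg H(2) this]
    obtain u where "is_iso (CAlg C T) HT_alg H u"
      unfolding HT_alg_eq H(1) by blast
    then show "represents (CAlg C T) (IAlg C T one) H"
      by (rule CAlg.represents_transport[OF HT_represents])
  qed
qed

text \<open>Iterating the free algebra functor on the terminal algebra gives \<open>T\<^sup>k(1)\<close> with the multiplication
  as structure map, except for \<open>k = 0\<close>, where the counit contributes the last face.\<close>

lemma cotriple_FO:
  "(FO (alg_cotriple T) ^^ Suc k) (one_alg C T one) = B k"
  by (induction k) (simp_all add: alg_cotriple_def one_alg_def)

lemma cotriple_FA:
  "(FA (alg_cotriple T) ^^ i) ((P (Suc k), Mu T (P k)), (P (Suc l), Mu T (P l)), f)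
   = ((P (Suc (i + k)), Mu T (P (i + k))), (P (Suc (i + l)), Mu T (P (i + l))), (FA T ^^ i) f)"
  by (induction i) (simp_all add: alg_cotriple_def)

lemma cotriple_FA_one:
  "(FA (alg_cotriple T) ^^ Suc i) ((T1, Mu T one), one_alg C T one, f) = (B (Suc i), B i, (FA T ^^ Suc i) f)"
  by (induction i) (simp_all add: alg_cotriple_def one_alg_def)

theorem bar_eq_cotriple_resolution:
  "simplicial_eq (bar C T one) (cotriple_resolution (alg_cotriple T) (one_alg C T one))"
proof -
  let ?G = "alg_cotriple T" and ?x = "one_alg C T one"
  have "(FA ?G ^^ i) (Counit ?G ((FO ?G ^^ (Suc n - i)) ?x)) = (B (Suc n), B n, face n i)" if i: "i \<le> Suc n" for n i
  proof (cases "i = Suc n")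
    case True
    have "Counit ?G ?x = ((T1, Mu T one), ?x, bng T1)"
      by (simp add: alg_cotriple_def one_alg_def)
    then show ?thesis
      using True cotriple_FA_one[of n "bng T1"] by (simp add: face_def del: funpow.simps)
  next
    case False
    then obtain m where m: "n = i + m"
      using i by (metis le_SucE le_iff_add)
    have "(FO ?G ^^ (Suc n - i)) ?x = B m"
      using cotriple_FO[of m] m by (simp add: Suc_diff_le del: funpow.simps)
    moreover have "Counit ?G (B m) = (B (Suc m), B m, Mu T (P m))"
      by (simp add: alg_cotriple_def)
    ultimately show ?thesis
      using cotriple_FA[of i "Suc m" m "Mu T (P m)"] m by (simp add: face_def del: funpow.simps)
  qed
  moreover have "(FA ?G ^^ i) (Comult ?G ((FO ?G ^^ (n - i)) ?x)) = (B n, B (Suc n), degen n i)" if i: "i \<le> n" for n i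
  proof -
    obtain m where m: "n = i + m" using i by (metis le_iff_add)
    have "Comult ?G ((FO ?G ^^ m) ?x) = (B m, B (Suc m), FA T (Eps T (P m)))"
    proof (cases m)
      case 0
      then show ?thesis by (simp add: alg_cotriple_def one_alg_def)
    next
      case (Suc l)
      then show ?thesis using cotriple_FO[of l] by (simp add: alg_cotriple_def del: funpow.simps) simp
    qed
    then show ?thesis
      using cotriple_FA[of i m "Suc m" "FA T (Eps T (P m))"] m
      by (simp add: degen_def funpow_swap1 del: funpow.simps) (simp add: funpow_swap1)
  qed
  moreover note cotriple_FO
  ultimately show ?thesis
    unfolding simplicial_eq_def bar_simps cotriple_resolution_def by simp
qed

end

theorem theorem7p2:
  fixes C :: "('o, 'a) cat" and T :: "('o, 'a) monad" and one :: 'o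
  assumes "category C"
    and "has_finite_limits C"
    and "is_cartesian_monad C T"
    and "is_terminal C one"
  shows "two_category (CAlg C T)
    \<and> is_two_functor_to_Cat (CAlg C T) (IAlg C T one)
    \<and> representable (CAlg C T) (IAlg C T one)
    \<and> (\<forall>H \<in> Obj (CAlg C T).
         represents (CAlg C T) (IAlg C T one) H \<longleftrightarrow>
         (\<exists>N. is_nerve (Alg C T) (calg_icat H) N
              \<and> simplicial_isomorphic (Alg C T) N (bar C T one)))
    \<and> simplicial_eq (bar C T one) (cotriple_resolution (alg_cotriple T) (one_alg C T one))"
proof -
  interpret category C by fact
  interpret cartesian_monad_terminal C T one
    by unfold_locales fact+
  show ?thesis
  proof (intro conjI ballI)
    show "two_category (CAlg C T)"
      unfolding CAlg_def by (rule ICat.Alg2_two_category)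
    show "is_two_functor_to_Cat (CAlg C T) (IAlg C T one)"
      unfolding CAlg_def IAlg_def by (rule ICat.lax_two_functor[OF one_calg])
    show "representable (CAlg C T) (IAlg C T one)"
      unfolding representable_def using HT_represents by blast
    show "represents (CAlg C T) (IAlg C T one) H \<longleftrightarrow>
        (\<exists>N. is_nerve (Alg C T) (calg_icat H) N \<and> simplicial_isomorphic (Alg C T) N (bar C T one))"
      if "H \<in> Obj (CAlg C T)" for H
      using that by (rule represents_iff_nerve)
    show "simplicial_eq (bar C T one) (cotriple_resolution (alg_cotriple T) (one_alg C T one))"
      by (rule bar_eq_cotriple_resolution)
  qed
qed

end
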